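(* Assume $\omega^2<\inf_{j\in Z,\,m\ge 1}\mu^+_m(j)$ and $\omega^2<\inf_{j\in Z,\,m\ge1}\mu^-_m(j)$. Let $u$ and $\tilde u$ be two solutions of the transmission problem with the same incoming wave $U_{\mathrm{inc}}$ (with wave vector $k$). For $l\in\mathbb{N}_0$ let $\nu^\pm_{l,\infty}$ be Bloch measures generated by the difference $v:=u-\tilde u$. Then, for both signs $\pm$, $$\nu^\pm_{l,\infty}=0\quad\text{for every } l\ge 1,$$ $$\operatorname{supp}(\nu^\pm_{0,\infty})\subset\{j\in Z : \mu_0^\pm(j)=\omega^2,\ j_2\in \mathbb{Z}/K\}\cap J^\pm_{=0,0}.$$
   Context: **Setting.** Fix $\varepsilon>0$, $K\in\mathbb{N}=\{1,2,\dots\}$, $h=\varepsilon K$, $\omega>0$, $\Omega=\mathbb{R}\times(0,h)\subset\mathbb{R}^2$. The coefficient $a=a^\varepsilon:\Omega\to\mathbb{R}$ satisfies $0<a_*\le a\le a^*<\infty$, $a\equiv1$ on $\{x_1<0\}$, and on $\{x_1>0\}$ it is $C^1$ and $\varepsilon$-periodic in $x_1$ and in $x_2$ (i.e. the restriction of an $\varepsilon$-periodic $C^1$ function on $\mathbb{R}^2$, also denoted $a^\varepsilon$). The Helmholtz equation is $-\nabla\cdot(a\nabla u)=\omega^2u$ in $\Omega$ (weakly), with periodic boundary conditions in $x_2$ (lower and upper boundary identified). The incoming wave is $U_{\mathrm{inc}}(x)=e^{2\pi i k\cdot x/\varepsilon}$, with $k\in\mathbb{R}^2$, $k_1>0$,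 $k_2h\in\varepsilon\mathbb{Z}$, $4\pi^2|k|^2/\varepsilon^2=\omega^2$. **Bloch waves.** $\mathbb{N}_0=\{0,1,2,\dots\}$, $Z=[0,1]^2$, $I=Z\times\mathbb{N}_0$, $Y_\varepsilon=(0,\varepsilon)^2$. For $R\in\mathbb{N}$: $W_R=(0,R\varepsilon)^2$, $Q_R=\{0,\frac1R,\dots,\frac{R-1}R\}$, $I_R=\{(j,m): j\in Q_R\times Q_R,\ m\in\mathbb{N}_0\}$, $\langle v,w\rangle_R=\frac1{|W_R|}\int_{W_R}v\bar w$. For $j\in Z$ let $\mathcal{L}_j^+=-(\nabla+2\pi ij/\varepsilon)\cdot(a^\varepsilon(\nabla+2\pi ij/\varepsilon))$ (periodic coefficient $a^\varepsilon$) and $\mathcal{L}_j^-=-(\nabla+2\pi ij/\varepsilon)\cdot(\nabla+2\pi ij/\varepsilon)$, acting on functions on $Y_\varepsilon$ with periodic boundary conditions. $(\Psi^\pm_{j,m})_{m\in\mathbb{N}_0}$ is a fixed complete family of eigenfunctions of $\mathcal{L}_j^\pm$, orthonormal for $\frac1{|Y_\varepsilon|}\int_{Y_\varepsilon}v\bar w$, with eigenvalues $\mu^\pm_0(j)\le\mu^\pm_1(j)\le\dots$ (with multiplicity); for the sign $-$ they are exponentials $e^{2\pi i\kappa\cdot x/\varepsilon}$, $\kappa\in\mathbb{Z}^2$. For $\lambda=(j,m)\in I$, $U^\pm_\lambda(x)=\Psi^\pm_{j,m}(x)e^{2\pi ij\cdot x/\varepsilon}$. For each $R$, $(U^\pm_\lambda)_{\lambda\in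 I_R}$ is an orthonormal basis of $(L^2(W_R;\mathbb{C}),\langle\cdot,\cdot\rangle_R)$, so each $w\in L^2(W_R;\mathbb{C})$ has the Bloch expansions $w=\sum_{\lambda\in I_R}\alpha^\pm_\lambda U^\pm_\lambda$, $\alpha^\pm_\lambda=\langle w,U^\pm_\lambda\rangle_R$. **Poynting numbers.** $P^+_\lambda=\mathrm{Im}\frac1{|Y_\varepsilon|}\int_{Y_\varepsilon}\bar U^+_\lambda\,e_1\cdot(a^\varepsilon\nabla U^+_\lambda)$, $P^-_\lambda=\mathrm{Im}\frac1{|Y_\varepsilon|}\int_{Y_\varepsilon}\bar U^-_\lambda\,e_1\cdot\nabla U^-_\lambda$. $J^\pm_{=0,m}=\{j\in Z: P^\pm_{(j,m)}=0\}$. For $w\in L^2(W_R;\mathbb{C})$ with Bloch expansions $w=\sum_{\lambda\in I_R}\alpha^\pm_\lambda U^\pm_\lambda$, $\alpha^\pm_\lambda=\langle w,U^\pm_\lambda\rangle_R$, set $\Pi^\pm_{<0}w=\sum_{\lambda\in I_R,\,P^\pm_\lambda<0}\alpha^\pm_\lambda U^\pm_\lambda$ and $\Pi^\pm_{>0}w=\sum_{\lambda\in I_R,\,P^\pm_\lambda>0}\alpha^\pm_\lambda U^\pm_\lambda$. **Outgoing wave condition.** For $u\in L^2_{\mathrm{loc}}(\mathbb{R}\times(0,h);\mathbb{C})$ let $\tilde u$ be its $h$-periodic extension in $x_2$, and for $R\in\mathbb{N}K$ (multiples of $K$) and $x\in W_R$ set $u_R^+(x)=\tilde u(R\varepsilon+x_1,x_2)$,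 $u_R^-(x)=\tilde u(-2R\varepsilon+x_1,x_2)$. $u$ satisfies the outgoing wave condition on the right if $\int_0^h\int_L^{L+1}|u|^2\,dx_1dx_2$ is bounded independently of $L\ge0$ and $\frac1{|W_R|}\int_{W_R}|\Pi^+_{<0}(u_R^+)|^2\to0$ as $\mathbb{N}K\ni R\to\infty$; on the left if $\int_0^h\int_{L-1}^{L}|u|^2\,dx_1dx_2$ is bounded independently of $L\le0$ and $\frac1{|W_R|}\int_{W_R}|\Pi^-_{>0}(u_R^-)|^2\to0$ as $\mathbb{N}K\ni R\to\infty$. **Transmission problem.** $u\in H^1_{\mathrm{loc}}(\Omega)$ is a solution if it solves the Helmholtz equation in $\Omega$ with periodic boundary conditions in $x_2$, $u$ satisfies the outgoing wave condition on the right, and $u-U_{\mathrm{inc}}$ satisfies the outgoing wave condition on the left. **Bloch measures.** Let $\eta=\eta_R\in C^\infty(W_R;\mathbb{R})$ be cut-off functions with $\eta_R=1$ on $W_{R-1}:=\varepsilon(1,R-1)^2$, $\|\nabla\eta_R\|_\infty,\|\nabla^2\eta_R\|_\infty\le C_0$ ($C_0$ independent of $R$), with compact support in $(0,R\varepsilon)\times(0,R\varepsilon)_\sharp$, where $(0,R\varepsilon)_\sharp$ is the interval with end points identified (so vertically periodic $\eta_R$ are allowed). For $u\in L^2_{\mathrm{loc}}$ expand $u_R^\pm\eta_R=\sum_{\lambda\in I_R}\alpha^\pm_{\lambda,R}U^\pm_\lambda$ and set $\nu^\pm_{l,R}=\sum_{\lambda=(j,l)\in I_R}|\alpha^\pm_{\lambda,R}|^2\delta_j$,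 a Radon measure on $Z$. A Radon measure $\nu^\pm_{l,\infty}$ on $Z$ is a Bloch measure generated by $u$ if $\nu^\pm_{l,R}\to\nu^\pm_{l,\infty}$ weakly-$*$ (tested against $C(Z)$) along a subsequence $\mathbb{N}K\ni R\to\infty$. *)

theory Defs
  imports "HOL-Analysis.Analysis"
begin

text \<open>
  The plane is \<open>real \<times> real\<close>. An element of an \<open>L\<^sup>2\<close> space over a planar domain is represented by
  a Borel function on the whole plane whose values outside the domain (and on null sets) are
  irrelevant. Square integrability is always required explicitly, because the Bochner integral of
  a non-integrable function is 0.
\<close>

type_synonym plane = "real \<times> real"

section \<open>Differentiability and Lebesgue spaces\<close>

primrec Ck :: "nat \<Rightarrow> (plane \<Rightarrow> 'b::real_normed_vector) \<Rightarrow> bool" where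
  "Ck 0 f \<longleftrightarrow> continuous_on UNIV f"
| "Ck (Suc n) f \<longleftrightarrow> (\<forall>x. f differentiable (at x)) \<and> (\<forall>v. Ck n (\<lambda>x. frechet_derivative f (at x) v))"

definition Cinf :: "(plane \<Rightarrow> 'b::real_normed_vector) \<Rightarrow> bool" where
  "Cinf f \<longleftrightarrow> (\<forall>n. Ck n f)"

text \<open>Classical gradient; \<open>grad (grad f)\<close> is the Hessian, with the Euclidean (Frobenius) norm.\<close>
definition grad :: "(plane \<Rightarrow> 'b::real_normed_vector) \<Rightarrow> plane \<Rightarrow> 'b \<times> 'b" where
  "grad f x = (frechet_derivative f (at x) (1, 0), frechet_derivative f (at x) (0, 1))"

definition L2_on :: "plane set \<Rightarrow> (plane \<Rightarrow> complex) \<Rightarrow> bool" where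
  "L2_on S u \<longleftrightarrow> u \<in> borel_measurable borel \<and> set_integrable lborel S (\<lambda>x. (norm (u x))\<^sup>2)"

definition mean_ip :: "plane set \<Rightarrow> (plane \<Rightarrow> complex) \<Rightarrow> (plane \<Rightarrow> complex) \<Rightarrow> complex" where
  "mean_ip S v w = (LINT x:S|lborel. v x * cnj (w x)) / complex_of_real (measure lborel S)"

definition mean_sq :: "plane set \<Rightarrow> (plane \<Rightarrow> complex) \<Rightarrow> real" where
  "mean_sq S v = (LINT x:S|lborel. (norm (v x))\<^sup>2) / measure lborel S"

text \<open>Unordered summation in \<open>L\<^sup>2(S)\<close>; the sum \<open>v\<close> is determined up to null sets.\<close>
definition L2_has_sum ::
    "plane set \<Rightarrow> ('i \<Rightarrow> plane \<Rightarrow> complex) \<Rightarrow> 'i set \<Rightarrow> (plane \<Rightarrow> complex) \<Rightarrow> bool" where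
  "L2_has_sum S f A v \<longleftrightarrow> L2_on S v \<and>
     ((\<lambda>F. LINT x:S|lborel. (norm (v x - (\<Sum>i\<in>F. f i x)))\<^sup>2) \<longlongrightarrow> 0) (finite_subsets_at_top A)"


section \<open>Weak gradients\<close>

text \<open>
  Boundary conditions are encoded by the class \<open>T\<close> of test functions: compactly supported ones give
  the interior weak gradient. Test functions that are periodic under an identification of boundary
  parts give the weak gradient on the quotient (cylinder or torus), so that the traces of \<open>u\<close> on
  identified boundary parts agree.
\<close>
definition has_weak_grad ::
    "plane set \<Rightarrow> (plane \<Rightarrow> complex) set \<Rightarrow> (plane \<Rightarrow> complex) \<Rightarrow> (plane \<Rightarrow> complex \<times> complex) \<Rightarrow> bool"
where
  "has_weak_grad S T u g \<longleftrightarrow> (\<forall>\<phi>\<in>T.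
     (LINT x:S|lborel. u x * fst (grad \<phi> x)) = - (LINT x:S|lborel. fst (g x) * \<phi> x) \<and>
     (LINT x:S|lborel. u x * snd (grad \<phi> x)) = - (LINT x:S|lborel. snd (g x) * \<phi> x))"

definition test_compact :: "plane set \<Rightarrow> (plane \<Rightarrow> complex) set" where
  "test_compact S = {\<phi>. Cinf \<phi> \<and> (\<exists>C. compact C \<and> C \<subseteq> S \<and> (\<forall>x. x \<notin> C \<longrightarrow> \<phi> x = 0))}"

definition test_cylinder :: "real \<Rightarrow> (plane \<Rightarrow> complex) set" where
  "test_cylinder h = {\<phi>. Cinf \<phi> \<and> (\<forall>x. \<phi> (x + (0, h)) = \<phi> x) \<and>
     (\<exists>M. \<forall>x. \<bar>fst x\<bar> > M \<longrightarrow> \<phi> x = 0)}"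

definition periodic2 :: "real \<Rightarrow> (plane \<Rightarrow> 'b) \<Rightarrow> bool" where
  "periodic2 \<epsilon> f \<longleftrightarrow> (\<forall>x. f (x + (\<epsilon>, 0)) = f x \<and> f (x + (0, \<epsilon>)) = f x)"

definition test_torus :: "real \<Rightarrow> (plane \<Rightarrow> complex) set" where
  "test_torus \<epsilon> = {\<phi>. Cinf \<phi> \<and> periodic2 \<epsilon> \<phi>}"

definition L2_pair_on :: "plane set \<Rightarrow> (plane \<Rightarrow> complex \<times> complex) \<Rightarrow> bool" where
  "L2_pair_on S g \<longleftrightarrow> L2_on S (\<lambda>x. fst (g x)) \<and> L2_on S (\<lambda>x. snd (g x))"

text \<open>The weak gradient in the open set \<open>S\<close> (unique up to null sets, if it exists).\<close>
definition weak_grad :: "plane set \<Rightarrow> (plane \<Rightarrow> complex) \<Rightarrow> plane \<Rightarrow> complex \<times> complex" where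
  "weak_grad S u = (SOME g. L2_pair_on S g \<and> has_weak_grad S (test_compact S) u g)"

definition cdot :: "complex \<times> complex \<Rightarrow> complex \<times> complex \<Rightarrow> complex" where
  "cdot z w = fst z * cnj (fst w) + snd z * cnj (snd w)"


section \<open>Helmholtz equation in the strip\<close>

definition strip :: "real \<Rightarrow> plane set" where
  "strip h = UNIV \<times> {0<..<h}"

text \<open>Homogeneous on the left, the periodic coefficient on the right; the line \<open>x\<^sub>1 = 0\<close> is a null set.\<close>
definition a_coeff :: "(plane \<Rightarrow> real) \<Rightarrow> plane \<Rightarrow> real" where
  "a_coeff a_per x = (if fst x < 0 then 1 else a_per x)"

definition L2_loc_strip :: "real \<Rightarrow> (plane \<Rightarrow> complex) \<Rightarrow> bool" where
  "L2_loc_strip h u \<longleftrightarrow> (\<forall>M. L2_on ({-M<..<M} \<times> {0<..<h}) u)"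

definition helmholtz_solution :: "real \<Rightarrow> real \<Rightarrow> (plane \<Rightarrow> real) \<Rightarrow> (plane \<Rightarrow> complex) \<Rightarrow> bool" where
  "helmholtz_solution h \<omega> a u \<longleftrightarrow> L2_loc_strip h u \<and>
     (\<exists>g. L2_loc_strip h (\<lambda>x. fst (g x)) \<and> L2_loc_strip h (\<lambda>x. snd (g x)) \<and>
        has_weak_grad (strip h) (test_cylinder h) u g \<and>
        (\<forall>\<phi>\<in>test_cylinder h.
          (LINT x:strip h|lborel. complex_of_real (a x) * cdot (g x) (grad \<phi> x)) =
          complex_of_real (\<omega>\<^sup>2) * (LINT x:strip h|lborel. u x * cnj (\<phi> x))))"

definition U_inc :: "real \<Rightarrow> plane \<Rightarrow> plane \<Rightarrow> complex" where
  "U_inc \<epsilon> k x = cis (2 * pi * (k \<bullet> x) / \<epsilon>)"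


section \<open>Bloch waves\<close>

definition Z_cell :: "plane set" where
  "Z_cell = {0..1} \<times> {0..1}"

definition Y_cell :: "real \<Rightarrow> plane set" where
  "Y_cell \<epsilon> = {0<..<\<epsilon>} \<times> {0<..<\<epsilon>}"

definition W_box :: "real \<Rightarrow> nat \<Rightarrow> plane set" where
  "W_box \<epsilon> R = {0<..<real R * \<epsilon>} \<times> {0<..<real R * \<epsilon>}"

definition Q_grid :: "nat \<Rightarrow> real set" where
  "Q_grid R = (\<lambda>i. real i / real R) ` {..<R}"

definition I_index :: "nat \<Rightarrow> (plane \<times> nat) set" where
  "I_index R = (Q_grid R \<times> Q_grid R) \<times> UNIV"

text \<open>\<open>bloch_grad \<epsilon> j u g x\<close> is \<open>(\<nabla> + 2\<pi>ij/\<epsilon>)u\<close> at \<open>x\<close>, where \<open>g\<close> is the gradient of \<open>u\<close>.\<close>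
definition bloch_grad ::
    "real \<Rightarrow> plane \<Rightarrow> (plane \<Rightarrow> complex) \<Rightarrow> (plane \<Rightarrow> complex \<times> complex) \<Rightarrow> plane \<Rightarrow> complex \<times> complex" where
  "bloch_grad \<epsilon> j u g x =
     (fst (g x) + \<i> * complex_of_real (2 * pi * fst j / \<epsilon>) * u x,
      snd (g x) + \<i> * complex_of_real (2 * pi * snd j / \<epsilon>) * u x)"

text \<open>
  Weak form of \<open>-(\<nabla> + 2\<pi>ij/\<epsilon>) \<cdot> (b (\<nabla> + 2\<pi>ij/\<epsilon>) \<psi>) = \<mu> \<psi>\<close> on the periodicity cell with periodic
  boundary conditions. The operator for the sign \<open>+\<close> has \<open>b\<close> equal to the periodic coefficient, the
  one for the sign \<open>-\<close> has \<open>b = 1\<close>.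
\<close>
definition bloch_weak_eq ::
    "real \<Rightarrow> (plane \<Rightarrow> real) \<Rightarrow> plane \<Rightarrow> real \<Rightarrow> (plane \<Rightarrow> complex) \<Rightarrow> bool" where
  "bloch_weak_eq \<epsilon> b j \<mu> \<psi> \<longleftrightarrow> L2_on (Y_cell \<epsilon>) \<psi> \<and>
     (\<exists>g. L2_pair_on (Y_cell \<epsilon>) g \<and> has_weak_grad (Y_cell \<epsilon>) (test_torus \<epsilon>) \<psi> g \<and>
        (\<forall>\<phi>\<in>test_torus \<epsilon>.
          (LINT x:Y_cell \<epsilon>|lborel. complex_of_real (b x) *
             cdot (bloch_grad \<epsilon> j \<psi> g x) (bloch_grad \<epsilon> j \<phi> (grad \<phi>) x)) =
          complex_of_real \<mu> * (LINT x:Y_cell \<epsilon>|lborel. \<psi> x * cnj (\<phi> x))))"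

text \<open>
  \<open>\<Psi> j\<close> is a complete orthonormal family of eigenfunctions for each \<open>j\<close> (periodically extended to
  the plane), with eigenvalues \<open>\<mu> j\<close> in nondecreasing order.
\<close>
definition bloch_family ::
    "real \<Rightarrow> (plane \<Rightarrow> real) \<Rightarrow> (plane \<Rightarrow> nat \<Rightarrow> plane \<Rightarrow> complex) \<Rightarrow> (plane \<Rightarrow> nat \<Rightarrow> real) \<Rightarrow> bool" where
  "bloch_family \<epsilon> b \<Psi> \<mu> \<longleftrightarrow> (\<forall>j\<in>Z_cell.
     (\<forall>m. periodic2 \<epsilon> (\<Psi> j m) \<and> bloch_weak_eq \<epsilon> b j (\<mu> j m) (\<Psi> j m)) \<and>
     (\<forall>m n. mean_ip (Y_cell \<epsilon>) (\<Psi> j m) (\<Psi> j n) = (if m = n then 1 else 0)) \<and>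
     (\<forall>w. L2_on (Y_cell \<epsilon>) w \<longrightarrow>
        L2_has_sum (Y_cell \<epsilon>) (\<lambda>m x. mean_ip (Y_cell \<epsilon>) w (\<Psi> j m) * \<Psi> j m x) UNIV w) \<and>
     mono (\<mu> j))"

definition bloch_wave ::
    "real \<Rightarrow> (plane \<Rightarrow> nat \<Rightarrow> plane \<Rightarrow> complex) \<Rightarrow> plane \<times> nat \<Rightarrow> plane \<Rightarrow> complex" where
  "bloch_wave \<epsilon> \<Psi> \<xi> x = \<Psi> (fst \<xi>) (snd \<xi>) x * cis (2 * pi * (fst \<xi> \<bullet> x) / \<epsilon>)"

text \<open>Again \<open>b\<close> is the periodic coefficient for the sign \<open>+\<close> and \<open>b = 1\<close> for the sign \<open>-\<close>.\<close>
definition poynting ::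
    "real \<Rightarrow> (plane \<Rightarrow> real) \<Rightarrow> (plane \<Rightarrow> nat \<Rightarrow> plane \<Rightarrow> complex) \<Rightarrow> plane \<times> nat \<Rightarrow> real" where
  "poynting \<epsilon> b \<Psi> \<xi> =
     Im ((LINT x:Y_cell \<epsilon>|lborel. cnj (bloch_wave \<epsilon> \<Psi> \<xi> x) *
            (complex_of_real (b x) * fst (weak_grad (Y_cell \<epsilon>) (bloch_wave \<epsilon> \<Psi> \<xi>) x)))
         / complex_of_real (measure lborel (Y_cell \<epsilon>)))"

definition J_zero ::
    "real \<Rightarrow> (plane \<Rightarrow> real) \<Rightarrow> (plane \<Rightarrow> nat \<Rightarrow> plane \<Rightarrow> complex) \<Rightarrow> nat \<Rightarrow> plane set" where
  "J_zero \<epsilon> b \<Psi> m = {j \<in> Z_cell. poynting \<epsilon> b \<Psi> (j, m) = 0}"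

text \<open>The partial Bloch expansion of \<open>w\<close> in \<open>L\<^sup>2(W\<^sub>R)\<close> over the indices in \<open>A\<close>.\<close>
definition bloch_proj ::
    "real \<Rightarrow> nat \<Rightarrow> (plane \<times> nat \<Rightarrow> plane \<Rightarrow> complex) \<Rightarrow> (plane \<times> nat) set \<Rightarrow> (plane \<Rightarrow> complex)
      \<Rightarrow> plane \<Rightarrow> complex" where
  "bloch_proj \<epsilon> R U A w = (SOME v.
     L2_has_sum (W_box \<epsilon> R) (\<lambda>\<xi> x. mean_ip (W_box \<epsilon> R) w (U \<xi>) * U \<xi> x) (I_index R \<inter> A) v)"

definition Pi_neg ::
    "real \<Rightarrow> (plane \<Rightarrow> real) \<Rightarrow> (plane \<Rightarrow> nat \<Rightarrow> plane \<Rightarrow> complex) \<Rightarrow> nat \<Rightarrow> (plane \<Rightarrow> complex)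
      \<Rightarrow> plane \<Rightarrow> complex" where
  "Pi_neg \<epsilon> b \<Psi> R w = bloch_proj \<epsilon> R (bloch_wave \<epsilon> \<Psi>) {\<xi>. poynting \<epsilon> b \<Psi> \<xi> < 0} w"

definition Pi_pos ::
    "real \<Rightarrow> (plane \<Rightarrow> real) \<Rightarrow> (plane \<Rightarrow> nat \<Rightarrow> plane \<Rightarrow> complex) \<Rightarrow> nat \<Rightarrow> (plane \<Rightarrow> complex)
      \<Rightarrow> plane \<Rightarrow> complex" where
  "Pi_pos \<epsilon> b \<Psi> R w = bloch_proj \<epsilon> R (bloch_wave \<epsilon> \<Psi>) {\<xi>. poynting \<epsilon> b \<Psi> \<xi> > 0} w"


section \<open>Outgoing wave condition and transmission problem\<close>

definition per_ext :: "real \<Rightarrow> (plane \<Rightarrow> complex) \<Rightarrow> plane \<Rightarrow> complex" where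
  "per_ext h u x = u (fst x, snd x - h * of_int \<lfloor>snd x / h\<rfloor>)"

definition u_right :: "real \<Rightarrow> real \<Rightarrow> (plane \<Rightarrow> complex) \<Rightarrow> nat \<Rightarrow> plane \<Rightarrow> complex" where
  "u_right \<epsilon> h u R x = per_ext h u (real R * \<epsilon> + fst x, snd x)"

definition u_left :: "real \<Rightarrow> real \<Rightarrow> (plane \<Rightarrow> complex) \<Rightarrow> nat \<Rightarrow> plane \<Rightarrow> complex" where
  "u_left \<epsilon> h u R x = per_ext h u (- 2 * real R * \<epsilon> + fst x, snd x)"

text \<open>The limit over multiples \<open>R\<close> of \<open>K\<close> is taken along \<open>R = n * K\<close>.\<close>
definition outgoing_right ::
    "real \<Rightarrow> nat \<Rightarrow> (plane \<Rightarrow> real) \<Rightarrow> (plane \<Rightarrow> nat \<Rightarrow> plane \<Rightarrow> complex) \<Rightarrow> (plane \<Rightarrow> complex) \<Rightarrow> bool" where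
  "outgoing_right \<epsilon> K b \<Psi> u \<longleftrightarrow> (let h = \<epsilon> * real K in
     L2_loc_strip h u \<and>
     (\<exists>C. \<forall>L\<ge>0. (LINT x:{L<..<L+1} \<times> {0<..<h}|lborel. (norm (u x))\<^sup>2) \<le> C) \<and>
     (\<lambda>n. mean_sq (W_box \<epsilon> (n * K)) (Pi_neg \<epsilon> b \<Psi> (n * K) (u_right \<epsilon> h u (n * K)))) \<longlonglongrightarrow> 0)"

definition outgoing_left ::
    "real \<Rightarrow> nat \<Rightarrow> (plane \<Rightarrow> real) \<Rightarrow> (plane \<Rightarrow> nat \<Rightarrow> plane \<Rightarrow> complex) \<Rightarrow> (plane \<Rightarrow> complex) \<Rightarrow> bool" where
  "outgoing_left \<epsilon> K b \<Psi> u \<longleftrightarrow> (let h = \<epsilon> * real K in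
     L2_loc_strip h u \<and>
     (\<exists>C. \<forall>L\<le>0. (LINT x:{L-1<..<L} \<times> {0<..<h}|lborel. (norm (u x))\<^sup>2) \<le> C) \<and>
     (\<lambda>n. mean_sq (W_box \<epsilon> (n * K)) (Pi_pos \<epsilon> b \<Psi> (n * K) (u_left \<epsilon> h u (n * K)))) \<longlonglongrightarrow> 0)"

definition transmission_solution ::
    "real \<Rightarrow> nat \<Rightarrow> real \<Rightarrow> (plane \<Rightarrow> real) \<Rightarrow> (plane \<Rightarrow> nat \<Rightarrow> plane \<Rightarrow> complex)
      \<Rightarrow> (plane \<Rightarrow> nat \<Rightarrow> plane \<Rightarrow> complex) \<Rightarrow> plane \<Rightarrow> (plane \<Rightarrow> complex) \<Rightarrow> bool" where
  "transmission_solution \<epsilon> K \<omega> a_per \<Psi>p \<Psi>m k u \<longleftrightarrow>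
     helmholtz_solution (\<epsilon> * real K) \<omega> (a_coeff a_per) u \<and>
     outgoing_right \<epsilon> K a_per \<Psi>p u \<and>
     outgoing_left \<epsilon> K (\<lambda>_. 1) \<Psi>m (\<lambda>x. u x - U_inc \<epsilon> k x)"


section \<open>Bloch measures\<close>

text \<open>
  A smooth function on \<open>W\<^sub>R\<close> with compact support in \<open>(0, R\<epsilon>) \<times> (0, R\<epsilon>)\<^sub>\<sharp>\<close> is identified with
  its extension to the plane: periodically in \<open>x\<^sub>2\<close>, by zero in \<open>x\<^sub>1\<close>.
\<close>
definition cutoff_family :: "real \<Rightarrow> nat \<Rightarrow> (nat \<Rightarrow> plane \<Rightarrow> real) \<Rightarrow> bool" where
  "cutoff_family \<epsilon> K \<eta> \<longleftrightarrow> (\<exists>C0. \<forall>R>0. K dvd R \<longrightarrow>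
     Cinf (\<eta> R) \<and>
     (\<forall>x. \<eta> R (x + (0, real R * \<epsilon>)) = \<eta> R x) \<and>
     (\<exists>\<delta>>0. \<forall>x. fst x < \<delta> \<or> fst x > real R * \<epsilon> - \<delta> \<longrightarrow> \<eta> R x = 0) \<and>
     (\<forall>x \<in> {\<epsilon><..<(real R - 1) * \<epsilon>} \<times> {\<epsilon><..<(real R - 1) * \<epsilon>}. \<eta> R x = 1) \<and>
     (\<forall>x. norm (grad (\<eta> R) x) \<le> C0 \<and> norm (grad (grad (\<eta> R)) x) \<le> C0))"

text \<open>
  The discrete measure \<open>\<Sum> |\<alpha>\<^bsub>(j,l)\<^esub>|\<^sup>2 \<delta>\<^sub>j\<close>, the sum being over the grid points \<open>j\<close>, as a Borel measure on
  \<open>Z_cell\<close>, where \<open>\<alpha>\<close> are the Bloch coefficients of \<open>w\<close> on \<open>W\<^sub>R\<close>.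
\<close>
definition nu_R ::
    "real \<Rightarrow> (plane \<Rightarrow> nat \<Rightarrow> plane \<Rightarrow> complex) \<Rightarrow> nat \<Rightarrow> nat \<Rightarrow> (plane \<Rightarrow> complex) \<Rightarrow> plane measure" where
  "nu_R \<epsilon> \<Psi> l R w =
     distr (point_measure (Q_grid R \<times> Q_grid R)
              (\<lambda>j. ennreal ((norm (mean_ip (W_box \<epsilon> R) w (bloch_wave \<epsilon> \<Psi> (j, l))))\<^sup>2)))
       (restrict_space borel Z_cell) (\<lambda>j. j)"

text \<open>
  \<open>uR\<close> assigns to \<open>R\<close> the shifted function on \<open>W\<^sub>R\<close>. On the compact set \<open>Z_cell\<close> the nonnegative Radon
  measures are the finite Borel measures; weak-* limits of nonnegative measures are nonnegative.
\<close>
definition bloch_measure_of ::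
    "real \<Rightarrow> nat \<Rightarrow> (nat \<Rightarrow> plane \<Rightarrow> real) \<Rightarrow> (plane \<Rightarrow> nat \<Rightarrow> plane \<Rightarrow> complex) \<Rightarrow> nat
      \<Rightarrow> (nat \<Rightarrow> plane \<Rightarrow> complex) \<Rightarrow> plane measure \<Rightarrow> bool" where
  "bloch_measure_of \<epsilon> K \<eta> \<Psi> l uR \<nu> \<longleftrightarrow>
     sets \<nu> = sets (restrict_space borel Z_cell) \<and> finite_measure \<nu> \<and>
     (\<exists>r::nat \<Rightarrow> nat. strict_mono r \<and>
       (\<forall>f::plane \<Rightarrow> real. continuous_on Z_cell f \<longrightarrow>
         (\<lambda>n. integral\<^sup>L (nu_R \<epsilon> \<Psi> l (r n * K)
                  (\<lambda>x. uR (r n * K) x * complex_of_real (\<eta> (r n * K) x))) f)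
         \<longlonglongrightarrow> integral\<^sup>L \<nu> f))"

definition bloch_measure_right ::
    "real \<Rightarrow> nat \<Rightarrow> (nat \<Rightarrow> plane \<Rightarrow> real) \<Rightarrow> (plane \<Rightarrow> nat \<Rightarrow> plane \<Rightarrow> complex) \<Rightarrow> nat
      \<Rightarrow> (plane \<Rightarrow> complex) \<Rightarrow> plane measure \<Rightarrow> bool" where
  "bloch_measure_right \<epsilon> K \<eta> \<Psi> l u \<nu> \<longleftrightarrow>
     bloch_measure_of \<epsilon> K \<eta> \<Psi> l (u_right \<epsilon> (\<epsilon> * real K) u) \<nu>"

definition bloch_measure_left ::
    "real \<Rightarrow> nat \<Rightarrow> (nat \<Rightarrow> plane \<Rightarrow> real) \<Rightarrow> (plane \<Rightarrow> nat \<Rightarrow> plane \<Rightarrow> complex) \<Rightarrow> nat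
      \<Rightarrow> (plane \<Rightarrow> complex) \<Rightarrow> plane measure \<Rightarrow> bool" where
  "bloch_measure_left \<epsilon> K \<eta> \<Psi> l u \<nu> \<longleftrightarrow>
     bloch_measure_of \<epsilon> K \<eta> \<Psi> l (u_left \<epsilon> (\<epsilon> * real K) u) \<nu>"

definition meas_supp :: "'a::topological_space measure \<Rightarrow> 'a set" where
  "meas_supp \<nu> = {x \<in> space \<nu>. \<forall>V. open V \<and> x \<in> V \<longrightarrow> emeasure \<nu> (V \<inter> space \<nu>) > 0}"

end

theory Submission
  imports Defs
begin

text \<open>
  Let \<open>v\<close> be the difference of the two solutions. It solves the homogeneous Helmholtz equation, satisfies
  the outgoing wave condition on both sides, since the incoming wave cancels, and is bounded in the mean.

  Energy is conserved: testing the equation with a cut-off times \<open>v\<close> shows that the flux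
  \<open>Im \<integral> a \<partial>\<^sub>1v \<close> (times the conjugate of \<open>v\<close>), averaged over a far cell on the right, equals the one
  averaged over a far cell on the left (\<open>flux_conservation\<close>). On each side the flux can be computed from
  the Bloch coefficients \<open>\<alpha>\<close>. A cut-off \<open>\<zeta>\<close> that depends on the first coordinate only turns \<open>v\<close> into
  a periodic function on a cell of length \<open>R\<epsilon>\<close>; it solves the Helmholtz equation with errors supported
  where \<open>\<zeta>\<close> varies, and these have mean square of order \<open>1/R\<close> by Caccioppoli's inequality
  (\<open>gradient_window\<close>). The discrete Bloch transform decouples the equation into perturbed eigenvalue
  equations on the periodicity cell (\<open>perturbed_equation_on_large_cell\<close>). Because \<open>\<omega>\<^sup>2\<close> lies below all
  eigenvalues except possibly the lowest one \<open>\<mu>\<close>, the coefficients of the higher modes tend to zero, so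
  does \<open>\<Sum>(\<mu> - \<omega>\<^sup>2)\<^sup>2|\<alpha>|\<^sup>2\<close>, and the flux equals \<open>\<Sum>P|\<alpha>|\<^sup>2\<close> up to a small error, with \<open>P\<close> the Poynting
  numbers of the lowest modes (\<open>side_estimate\<close>). Vertical periodicity with period \<open>\<epsilon>K\<close> leaves only the
  vertical wave numbers in \<open>\<int>/K\<close> (\<open>coefficient_W_box\<close>).

  By the outgoing wave condition the terms with \<open>P < 0\<close> on the right and those with \<open>P > 0\<close> on the left
  are negligible. So \<open>\<Sum>|P||\<alpha>|\<^sup>2\<close> is asymptotically the flux on the right and minus the flux on the left;
  the flux being the same, the sum of these two nonnegative quantities tends to zero
  (\<open>masses_vanish_both_sides\<close>). Finally, a Bloch measure cannot charge a neighbourhood in which a weight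
  whose mass tends to zero stays above a positive constant (\<open>bloch_measure_support\<close>). This is applied to
  the weights \<open>(\<mu> - \<omega>\<^sup>2)\<^sup>2\<close> and \<open>|P|\<close>, which are continuous at the points in question because the lowest
  eigenvalue is Lipschitz and, where it equals \<open>\<omega>\<^sup>2\<close>, simple, and to the indicator of the vertical wave
  numbers that are not multiples of \<open>1/K\<close> in \<open>[0, 1)\<close>, which is constant near every point outside \<open>\<int>/K\<close>.

  Fourier series and bump functions are contained in the data. The free Bloch functions for \<open>j = 0\<close> are
  exponentials and complete, which gives Fourier series on all rectangles and with them the density of
  smooth periodic functions; and the cut-offs \<open>\<eta>\<close> provide smooth bumps.
\<close>

section \<open>Mean inner products of square integrable functions\<close>

lemma L2_onD: "L2_on S f \<Longrightarrow> f \<in> borel_measurable borel"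
  "L2_on S f \<Longrightarrow> set_integrable lborel S (\<lambda>x. (norm (f x))\<^sup>2)"
  by (auto simp: L2_on_def)

lemma L2_on_bound:
  assumes "S \<in> sets borel" "f \<in> borel_measurable borel" "set_integrable lborel S g"
    and "\<And>x. x \<in> S \<Longrightarrow> (norm (f x))\<^sup>2 \<le> g x"
  shows "L2_on S f"
proof -
  have "set_integrable lborel S (\<lambda>x. (norm (f x))\<^sup>2)"
    unfolding set_integrable_def
  proof (rule Bochner_Integration.integrable_bound)
    show "integrable lborel (\<lambda>x. indicator S x *\<^sub>R g x)" using assms(3) by (simp add: set_integrable_def)
    show "(\<lambda>x. indicat_real S x *\<^sub>R (norm (f x))\<^sup>2) \<in> borel_measurable lborel"
      using assms(1,2) by measurable
    show "AE x in lborel. norm (indicat_real S x *\<^sub>R (norm (f x))\<^sup>2) \<le> norm (indicator S x *\<^sub>R g x)"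
      using assms(4) by (intro AE_I2) (force simp: indicator_def)
  qed
  then show ?thesis using assms(2) by (simp add: L2_on_def)
qed

lemma L2_on_zero [simp]: "L2_on S (\<lambda>x. 0)"
  by (simp add: L2_on_def set_integrable_def)

lemma L2_on_bounded_mult:
  assumes "S \<in> sets borel" "L2_on S f" "b \<in> borel_measurable borel"
    and "\<And>x. x \<in> S \<Longrightarrow> norm (b x) \<le> C"
  shows "L2_on S (\<lambda>x. b x * f x)"
proof (rule L2_on_bound[OF assms(1)])
  show "(\<lambda>x. b x * f x) \<in> borel_measurable borel"
    using assms(2,3) by (auto simp: L2_on_def)
  show "set_integrable lborel S (\<lambda>x. C\<^sup>2 * (norm (f x))\<^sup>2)"
    using L2_onD(2)[OF assms(2)] by simp
  show "(norm (b x * f x))\<^sup>2 \<le> C\<^sup>2 * (norm (f x))\<^sup>2" if "x \<in> S" for x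
    using assms(4)[OF that]
    by (simp add: norm_mult power_mult_distrib mult_right_mono power_mono)
qed

lemma L2_on_cmult: "S \<in> sets borel \<Longrightarrow> L2_on S f \<Longrightarrow> L2_on S (\<lambda>x. c * f x)"
  by (rule L2_on_bounded_mult[where C="norm c"]) auto

lemma L2_on_add:
  assumes "S \<in> sets borel" "L2_on S f" "L2_on S g"
  shows "L2_on S (\<lambda>x. f x + g x)"
proof (rule L2_on_bound[OF assms(1)])
  show "(\<lambda>x. f x + g x) \<in> borel_measurable borel"
    using assms(2,3) by (auto simp: L2_on_def)
  show "set_integrable lborel S (\<lambda>x. 2 * (norm (f x))\<^sup>2 + 2 * (norm (g x))\<^sup>2)"
    using L2_onD(2)[OF assms(2)] L2_onD(2)[OF assms(3)] by (intro set_integral_add) auto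
  show "(norm (f x + g x))\<^sup>2 \<le> 2 * (norm (f x))\<^sup>2 + 2 * (norm (g x))\<^sup>2" for x
  proof -
    have "(norm (f x + g x))\<^sup>2 \<le> (norm (f x) + norm (g x))\<^sup>2"
      by (intro power_mono norm_triangle_ineq) auto
    also have "\<dots> \<le> 2 * (norm (f x))\<^sup>2 + 2 * (norm (g x))\<^sup>2"
      using sum_squares_bound[of "norm (f x)" "norm (g x)"] by (simp add: power2_sum)
    finally show ?thesis .
  qed
qed

lemma L2_on_diff:
  assumes "S \<in> sets borel" "L2_on S f" "L2_on S g"
  shows "L2_on S (\<lambda>x. f x - g x)"
  using L2_on_add[OF assms(1,2) L2_on_cmult[OF assms(1,3), of "-1"]] by simp

lemma L2_on_sum:
  assumes "S \<in> sets borel" "\<And>i. i \<in> F \<Longrightarrow> L2_on S (f i)"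
  shows "L2_on S (\<lambda>x. \<Sum>i\<in>F. f i x)"
proof (cases "finite F")
  case True
  then show ?thesis using assms(2)
    by (induction F) (auto intro!: L2_on_add assms(1))
qed auto

lemma L2_on_subset:
  assumes "L2_on S f" "T \<subseteq> S" "T \<in> sets borel"
  shows "L2_on T f"
  using assms set_integrable_subset[of lborel S "\<lambda>x. (norm (f x))\<^sup>2" T] by (auto simp: L2_on_def)

lemma L2_on_cong:
  assumes "L2_on S f" "g \<in> borel_measurable borel" "\<And>x. x \<in> S \<Longrightarrow> g x = f x"
  shows "L2_on S g"
  using assms unfolding L2_on_def
  by (auto cong: set_integrable_cong)

lemma L2_on_cnj: "L2_on S f \<Longrightarrow> L2_on S (\<lambda>x. cnj (f x))"
  by (auto simp: L2_on_def intro!: borel_measurable_continuous_on[OF continuous_on_cnj[OF continuous_on_id], unfolded id_def])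

lemma L2_prod_integrable:
  assumes "S \<in> sets borel" "L2_on S f" "L2_on S g"
  shows "set_integrable lborel S (\<lambda>x. f x * cnj (g x))"
  unfolding set_integrable_def
proof (rule Bochner_Integration.integrable_bound)
  note m = L2_onD(1)[OF assms(2)] L2_onD(1)[OF assms(3)]
  show "integrable lborel (\<lambda>x. indicator S x *\<^sub>R ((norm (f x))\<^sup>2 + (norm (g x))\<^sup>2))"
    using set_integral_add(1)[OF L2_onD(2)[OF assms(2)] L2_onD(2)[OF assms(3)]]
    by (simp add: set_integrable_def)
  show "(\<lambda>x. indicat_real S x *\<^sub>R (f x * cnj (g x))) \<in> borel_measurable lborel"
    using assms(1) m L2_onD(1)[OF L2_on_cnj[OF assms(3)]] by measurable
  have "norm (f x * cnj (g x)) \<le> (norm (f x))\<^sup>2 + (norm (g x))\<^sup>2" for x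
  proof -
    have "0 \<le> norm (f x) * norm (g x)" by simp
    then show ?thesis
      using sum_squares_bound[of "norm (f x)" "norm (g x)"] unfolding norm_mult complex_mod_cnj by linarith
  qed
  then show "AE x in lborel. norm (indicat_real S x *\<^sub>R (f x * cnj (g x)))
      \<le> norm (indicator S x *\<^sub>R ((norm (f x))\<^sup>2 + (norm (g x))\<^sup>2))"
    by (intro AE_I2) (auto simp: indicator_def)
qed

lemma mean_ip_cong:
  assumes "\<And>x. x \<in> S \<Longrightarrow> f x = f' x" "\<And>x. x \<in> S \<Longrightarrow> g x = g' x"
  shows "mean_ip S f g = mean_ip S f' g'"
  unfolding mean_ip_def set_lebesgue_integral_def
  by (intro arg_cong2[where f="(/)"] Bochner_Integration.integral_cong) (auto simp: indicator_def assms)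

lemma mean_sq_cong:
  assumes "\<And>x. x \<in> S \<Longrightarrow> norm (f x) = norm (f' x)"
  shows "mean_sq S f = mean_sq S f'"
  unfolding mean_sq_def set_lebesgue_integral_def
  by (intro arg_cong2[where f="(/)"] Bochner_Integration.integral_cong) (auto simp: indicator_def assms)

lemma mean_ip_cnj: "mean_ip S g f = cnj (mean_ip S f g)"
proof -
  have "(LINT x:S|lborel. g x * cnj (f x)) = cnj (LINT x:S|lborel. f x * cnj (g x))"
    unfolding set_lebesgue_integral_def Bochner_Integration.integral_cnj[symmetric]
    by (intro Bochner_Integration.integral_cong) (auto simp: scaleR_conv_of_real)
  then show ?thesis by (simp add: mean_ip_def)
qed

lemma mean_ip_self: "mean_ip S f f = complex_of_real (mean_sq S f)"
proof -
  have "(LINT x:S|lborel. f x * cnj (f x)) = complex_of_real (LINT x:S|lborel. (norm (f x))\<^sup>2)"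
    unfolding set_lebesgue_integral_def Bochner_Integration.integral_complex_of_real[symmetric]
    by (intro Bochner_Integration.integral_cong)
      (auto simp: indicator_def complex_norm_square[symmetric] simp flip: of_real_power)
  then show ?thesis by (simp add: mean_ip_def mean_sq_def)
qed

lemma mean_sq_nonneg [simp]: "0 \<le> mean_sq S f"
  unfolding mean_sq_def set_lebesgue_integral_def
  by (intro divide_nonneg_nonneg Bochner_Integration.integral_nonneg) auto

lemma mean_sq_mono:
  assumes "S \<in> sets borel" "L2_on S g" "\<And>x. x \<in> S \<Longrightarrow> norm (f x) \<le> norm (g x)"
  shows "mean_sq S f \<le> mean_sq S g"
proof (cases "set_integrable lborel S (\<lambda>x. (norm (f x))\<^sup>2)")
  case True
  then show ?thesis unfolding mean_sq_def
    by (intro divide_right_mono set_integral_mono L2_onD(2)[OF assms(2)] power_mono assms(3)) auto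
next
  case False
  then have "mean_sq S f = 0"
    by (simp add: mean_sq_def set_lebesgue_integral_def set_integrable_def not_integrable_integral_eq)
  then show ?thesis by simp
qed

lemma mean_sq_cmult [simp]: "mean_sq S (\<lambda>x. c * f x) = (norm c)\<^sup>2 * mean_sq S f"
  by (simp add: mean_sq_def norm_mult power_mult_distrib)

lemma mean_sq_bounded_mult:
  assumes "S \<in> sets borel" "L2_on S f" "\<And>x. x \<in> S \<Longrightarrow> norm (b x) \<le> C"
  shows "mean_sq S (\<lambda>x. b x * f x) \<le> C\<^sup>2 * mean_sq S f"
proof -
  have "mean_sq S (\<lambda>x. b x * f x) \<le> mean_sq S (\<lambda>x. complex_of_real C * f x)"
  proof (intro mean_sq_mono assms(1) L2_on_cmult assms(2))
    fix x assume "x \<in> S"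
    then have "norm (b x) \<le> \<bar>C\<bar>" using assms(3) by (smt (verit))
    then show "norm (b x * f x) \<le> norm (complex_of_real C * f x)"
      by (simp add: norm_mult mult_right_mono)
  qed
  then show ?thesis by simp
qed

context
  fixes S :: "plane set"
  assumes S [measurable]: "S \<in> sets borel"
begin

lemma mean_ip_add_left:
  assumes "L2_on S f" "L2_on S g" "L2_on S w"
  shows "mean_ip S (\<lambda>x. f x + g x) w = mean_ip S f w + mean_ip S g w"
  using set_integral_add(2)[OF L2_prod_integrable[OF S assms(1,3)] L2_prod_integrable[OF S assms(2,3)]]
  by (simp add: mean_ip_def add_divide_distrib ring_distribs)

lemma mean_ip_diff_left:
  assumes "L2_on S f" "L2_on S g" "L2_on S w"
  shows "mean_ip S (\<lambda>x. f x - g x) w = mean_ip S f w - mean_ip S g w"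
  using set_integral_diff(2)[OF L2_prod_integrable[OF S assms(1,3)] L2_prod_integrable[OF S assms(2,3)]]
  by (simp add: mean_ip_def diff_divide_distrib ring_distribs)

lemma mean_ip_cmult_left [simp]: "mean_ip S (\<lambda>x. c * f x) w = c * mean_ip S f w"
  by (simp add: mean_ip_def mult.assoc)

lemma mean_ip_zero_left [simp]: "mean_ip S (\<lambda>x. 0) w = 0"
  by (simp add: mean_ip_def)

lemma mean_ip_sum_left:
  assumes "finite F" "\<And>i. i \<in> F \<Longrightarrow> L2_on S (f i)" "L2_on S w"
  shows "mean_ip S (\<lambda>x. \<Sum>i\<in>F. f i x) w = (\<Sum>i\<in>F. mean_ip S (f i) w)"
  using assms
proof (induction F)
  case (insert i F)
  then show ?case
    by (simp add: mean_ip_add_left L2_on_sum[OF S])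
qed auto

lemma mean_ip_add_right:
  assumes "L2_on S f" "L2_on S g" "L2_on S w"
  shows "mean_ip S w (\<lambda>x. f x + g x) = mean_ip S w f + mean_ip S w g"
  using mean_ip_add_left[OF assms] by (simp add: mean_ip_cnj[of S w])

lemma mean_ip_diff_right:
  assumes "L2_on S f" "L2_on S g" "L2_on S w"
  shows "mean_ip S w (\<lambda>x. f x - g x) = mean_ip S w f - mean_ip S w g"
  using mean_ip_diff_left[OF assms] by (simp add: mean_ip_cnj[of S w])

lemma mean_ip_cmult_right [simp]: "mean_ip S w (\<lambda>x. c * f x) = cnj c * mean_ip S w f"
  by (simp add: mean_ip_cnj[of S w])

lemma mean_ip_sum_right:
  assumes "finite F" "\<And>i. i \<in> F \<Longrightarrow> L2_on S (f i)" "L2_on S w"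
  shows "mean_ip S w (\<lambda>x. \<Sum>i\<in>F. f i x) = (\<Sum>i\<in>F. mean_ip S w (f i))"
  using mean_ip_sum_left[OF assms] by (simp add: mean_ip_cnj[of S w])

lemma mean_sq_diff_expand:
  assumes "L2_on S f" "L2_on S g"
  shows "mean_sq S (\<lambda>x. f x - g x) = mean_sq S f - 2 * Re (mean_ip S f g) + mean_sq S g"
proof -
  have "complex_of_real (mean_sq S (\<lambda>x. f x - g x)) =
      mean_ip S f f - mean_ip S f g - (cnj (mean_ip S f g) - mean_ip S g g)"
    using assms by (simp add: mean_ip_diff_left mean_ip_diff_right L2_on_diff[OF S]
        mean_ip_cnj[of S g f] flip: mean_ip_self)
  also have "\<dots> = complex_of_real (mean_sq S f - 2 * Re (mean_ip S f g) + mean_sq S g)"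
    by (simp add: mean_ip_self complex_eq_iff)
  finally show ?thesis using of_real_eq_iff by blast
qed

lemma mean_sq_add_expand:
  assumes "L2_on S f" "L2_on S g"
  shows "mean_sq S (\<lambda>x. f x + g x) = mean_sq S f + 2 * Re (mean_ip S f g) + mean_sq S g"
  using mean_sq_diff_expand[OF assms(1) L2_on_cmult[OF S assms(2), of "-1"]]
  by (simp add: mean_sq_cmult[of S "-1" g, simplified] mean_ip_cmult_right[of f "-1" g, simplified])

lemma mean_ip_Cauchy_Schwarz_sq:
  assumes f: "L2_on S f" and g: "L2_on S g"
  shows "(norm (mean_ip S f g))\<^sup>2 \<le> mean_sq S f * mean_sq S g"
proof -
  define z where "z = mean_ip S f g"
  have q: "0 \<le> mean_sq S f - 2 * t * (norm z)\<^sup>2 + t\<^sup>2 * (norm z)\<^sup>2 * mean_sq S g" for t :: real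
  proof -
    have "0 \<le> mean_sq S (\<lambda>x. f x - (of_real t * z) * g x)" by simp
    also have "\<dots> = mean_sq S f - 2 * Re (cnj (of_real t * z) * z) + (norm (of_real t * z))\<^sup>2 * mean_sq S g"
      using mean_sq_diff_expand[OF f L2_on_cmult[OF S g, of "of_real t * z"]]
      by (simp add: z_def)
    also have "Re (cnj (of_real t * z) * z) = t * (norm z)\<^sup>2"
      by (simp add: cmod_power2) (simp add: power2_eq_square algebra_simps)
    finally show ?thesis by (simp add: norm_mult power_mult_distrib)
  qed
  show ?thesis
  proof (cases "mean_sq S g = 0")
    case True
    have "(norm z)\<^sup>2 = 0"
    proof (rule ccontr)
      assume "(norm z)\<^sup>2 \<noteq> 0"
      then have p: "(norm z)\<^sup>2 > 0" by simp
      have "(mean_sq S f + 1) / (norm z)\<^sup>2 * (norm z)\<^sup>2 = mean_sq S f + 1" using p by simp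
      then show False using q[of "(mean_sq S f + 1) / (norm z)\<^sup>2"] mean_sq_nonneg[of S f]
        unfolding True mult.assoc by linarith
    qed
    then show ?thesis using True by (simp add: z_def)
  next
    case False
    then have p: "mean_sq S g > 0" using mean_sq_nonneg[of S g] by linarith
    have "0 \<le> mean_sq S f - (norm z)\<^sup>2 / mean_sq S g"
      using q[of "1 / mean_sq S g"] p by (simp add: power2_eq_square field_simps)
    then show ?thesis using p by (simp add: z_def field_simps)
  qed
qed

lemma mean_ip_Cauchy_Schwarz:
  assumes "L2_on S f" "L2_on S g"
  shows "norm (mean_ip S f g) \<le> sqrt (mean_sq S f) * sqrt (mean_sq S g)"
  using real_sqrt_le_mono[OF mean_ip_Cauchy_Schwarz_sq[OF assms]]
  by (simp add: real_sqrt_mult)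

lemma mean_sq_diff_le:
  assumes "L2_on S f" "L2_on S g"
  shows "mean_sq S (\<lambda>x. f x - g x) \<le> 2 * mean_sq S f + 2 * mean_sq S g"
proof -
  have "0 \<le> mean_sq S (\<lambda>x. f x + g x)" by simp
  then show ?thesis using mean_sq_add_expand[OF assms] mean_sq_diff_expand[OF assms] by simp
qed

lemma mean_ip_tendsto_right:
  assumes "\<And>n. L2_on S (\<phi> n)" "L2_on S f" "L2_on S w"
    and "(\<lambda>n. mean_sq S (\<lambda>x. f x - \<phi> n x)) \<longlonglongrightarrow> 0"
  shows "(\<lambda>n. mean_ip S w (\<phi> n)) \<longlonglongrightarrow> mean_ip S w f"
proof -
  have "(\<lambda>n. mean_ip S w f - mean_ip S w (\<phi> n)) \<longlonglongrightarrow> 0"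
  proof (rule Lim_null_comparison)
    show "\<forall>\<^sub>F n in sequentially. norm (mean_ip S w f - mean_ip S w (\<phi> n)) \<le>
        sqrt (mean_sq S w) * sqrt (mean_sq S (\<lambda>x. f x - \<phi> n x))"
      using mean_ip_Cauchy_Schwarz[OF assms(3) L2_on_diff[OF S assms(2) assms(1)]]
      by (intro always_eventually allI) (simp add: mean_ip_diff_right assms)
    show "(\<lambda>n. sqrt (mean_sq S w) * sqrt (mean_sq S (\<lambda>x. f x - \<phi> n x))) \<longlonglongrightarrow> 0"
      using tendsto_mult[OF tendsto_const tendsto_real_sqrt[OF assms(4)]] by simp
  qed
  then have "(\<lambda>n. mean_ip S w f - (mean_ip S w f - mean_ip S w (\<phi> n))) \<longlonglongrightarrow> mean_ip S w f - 0"
    by (intro tendsto_diff tendsto_const)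
  then show ?thesis by simp
qed

text \<open>Bessel's inequality in the form of an identity for the remainder.\<close>

lemma mean_sq_orthonormal_remainder:
  assumes "finite F" "L2_on S f" "\<And>i. i \<in> F \<Longrightarrow> L2_on S (e i)"
    and on: "\<And>i k. i \<in> F \<Longrightarrow> k \<in> F \<Longrightarrow> mean_ip S (e i) (e k) = (if i = k then 1 else 0)"
  shows "mean_sq S (\<lambda>x. f x - (\<Sum>i\<in>F. mean_ip S f (e i) * e i x)) =
         mean_sq S f - (\<Sum>i\<in>F. (norm (mean_ip S f (e i)))\<^sup>2)"
proof -
  define c where "c i = mean_ip S f (e i)" for i
  define s where "s = (\<lambda>x. \<Sum>i\<in>F. c i * e i x)"
  have Ls: "L2_on S s" unfolding s_def by (intro L2_on_sum L2_on_cmult S assms)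
  have cc: "cnj z * z = complex_of_real ((norm z)\<^sup>2)" for z
    by (metis complex_norm_square mult.commute of_real_power)
  have fs: "mean_ip S f s = of_real (\<Sum>i\<in>F. (norm (c i))\<^sup>2)"
    unfolding s_def using assms
    by (subst mean_ip_sum_right) (auto intro!: L2_on_cmult sum.cong simp: c_def[symmetric] cc)
  have se: "mean_ip S s (e k) = c k" if "k \<in> F" for k
  proof -
    have "mean_ip S s (e k) = (\<Sum>i\<in>F. c i * mean_ip S (e i) (e k))"
      unfolding s_def using assms that by (subst mean_ip_sum_left) (auto intro!: L2_on_cmult)
    also have "\<dots> = (\<Sum>i\<in>F. if i = k then c i else 0)"
      using that on by (intro sum.cong) auto
    finally show ?thesis using that assms(1) by simp
  qed
  have "mean_ip S s s = (\<Sum>i\<in>F. cnj (c i) * mean_ip S s (e i))"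
    by (subst (2) s_def) (use assms Ls in \<open>subst mean_ip_sum_right, auto intro!: L2_on_cmult\<close>)
  also have "\<dots> = of_real (\<Sum>i\<in>F. (norm (c i))\<^sup>2)"
    by (simp add: se cc)
  finally have ss: "mean_sq S s = (\<Sum>i\<in>F. (norm (c i))\<^sup>2)"
    by (simp only: mean_ip_self of_real_eq_iff)
  show ?thesis
    using mean_sq_diff_expand[OF assms(2) Ls] by (simp add: fs ss) (simp add: s_def c_def)
qed

lemma Bessel_inequality:
  assumes "finite F" "L2_on S f" "\<And>i. i \<in> F \<Longrightarrow> L2_on S (e i)"
    and "\<And>i k. i \<in> F \<Longrightarrow> k \<in> F \<Longrightarrow> mean_ip S (e i) (e k) = (if i = k then 1 else 0)"
  shows "(\<Sum>i\<in>F. (norm (mean_ip S f (e i)))\<^sup>2) \<le> mean_sq S f"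
  using mean_sq_orthonormal_remainder[OF assms] mean_sq_nonneg by (smt (verit))

end

section \<open>Smooth functions on the plane\<close>

lemma Ck_SucI:
  assumes "\<And>x. (f has_derivative f' x) (at x)" "\<And>v. Ck n (\<lambda>x. f' x v)"
  shows "Ck (Suc n) f"
proof -
  have "frechet_derivative f (at x) = f' x" for x
    using frechet_derivative_at[OF assms(1)] by simp
  then show ?thesis using assms(2) differentiableI[OF assms(1)] unfolding Ck.simps by simp
qed

lemma Ck_SucD:
  assumes "Ck (Suc n) f"
  shows "(f has_derivative frechet_derivative f (at x)) (at x)"
    and "Ck n (\<lambda>x. frechet_derivative f (at x) v)"
  using assms unfolding Ck.simps frechet_derivative_works by blast+

lemma Ck_Suc_imp: "Ck (Suc n) f \<Longrightarrow> Ck n f"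
proof (induction n arbitrary: f)
  case 0
  then show ?case
    by (auto intro!: differentiable_imp_continuous_on simp: differentiable_on_def differentiable_at_withinI)
qed auto

lemma Ck_const [simp]: "Ck n (\<lambda>x. c)"
proof (induction n arbitrary: c)
  case (Suc n)
  show ?case by (rule Ck_SucI[of _ "\<lambda>_ _. 0"]) (auto intro!: derivative_eq_intros Suc)
qed simp

lemma Ck_add: "Ck n f \<Longrightarrow> Ck n g \<Longrightarrow> Ck n (\<lambda>x. f x + g x)"
proof (induction n arbitrary: f g)
  case 0
  then show ?case by (auto intro: continuous_intros)
next
  case (Suc n)
  show ?case
    by (rule Ck_SucI[of _ "\<lambda>x v. frechet_derivative f (at x) v + frechet_derivative g (at x) v"])
      (auto intro!: derivative_eq_intros Ck_SucD(1)[OF Suc.prems(1)] Ck_SucD(1)[OF Suc.prems(2)]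
        Suc.IH Ck_SucD(2)[OF Suc.prems(1)] Ck_SucD(2)[OF Suc.prems(2)])
qed

lemma Ck_sum: "(\<And>i. i \<in> F \<Longrightarrow> Ck n (f i)) \<Longrightarrow> Ck n (\<lambda>x. \<Sum>i\<in>F. f i x)"
  by (induction F rule: infinite_finite_induct) (auto intro: Ck_add)

lemma Ck_bounded_linear:
  assumes "bounded_linear L" "Ck n f"
  shows "Ck n (\<lambda>x. L (f x))"
  using assms(2)
proof (induction n arbitrary: f)
  case 0
  then show ?case using assms(1) by (auto intro: bounded_linear.continuous_on)
next
  case (Suc n)
  show ?case
    by (rule Ck_SucI[of _ "\<lambda>x v. L (frechet_derivative f (at x) v)"])
      (auto intro!: bounded_linear.has_derivative[OF assms(1)] Ck_SucD(1)[OF Suc.prems]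
        Suc.IH Ck_SucD(2)[OF Suc.prems])
qed

lemma Ck_mult:
  fixes f g :: "plane \<Rightarrow> 'b::real_normed_algebra"
  assumes "Ck n f" "Ck n g"
  shows "Ck n (\<lambda>x. f x * g x)"
  using assms
proof (induction n arbitrary: f g)
  case 0
  then show ?case by (auto intro: continuous_intros)
next
  case (Suc n)
  show ?case
  proof (rule Ck_SucI[of _ "\<lambda>x v. f x * frechet_derivative g (at x) v + frechet_derivative f (at x) v * g x"])
    show "((\<lambda>x. f x * g x) has_derivative (\<lambda>v. f x * frechet_derivative g (at x) v + frechet_derivative f (at x) v * g x)) (at x)" for x
      by (rule has_derivative_mult[OF Ck_SucD(1)[OF Suc.prems(1)] Ck_SucD(1)[OF Suc.prems(2)]])
    show "Ck n (\<lambda>x. f x * frechet_derivative g (at x) v + frechet_derivative f (at x) v * g x)" for v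
      by (intro Ck_add Suc.IH[OF Ck_Suc_imp[OF Suc.prems(1)] Ck_SucD(2)[OF Suc.prems(2)]]
          Suc.IH[OF Ck_SucD(2)[OF Suc.prems(1)] Ck_Suc_imp[OF Suc.prems(2)]])
  qed
qed

lemma Ck_affine:
  assumes A: "bounded_linear A" and "Ck n f"
  shows "Ck n (\<lambda>x. f (A x + c))"
  using assms(2)
proof (induction n arbitrary: f)
  case 0
  have "continuous_on UNIV A" by (rule linear_continuous_on[OF A])
  then have "continuous_on UNIV (\<lambda>x. A x + c)" by (intro continuous_intros)
  with 0 show ?case
    using continuous_on_compose2[of UNIV f UNIV "\<lambda>x. A x + c"] by auto
next
  case (Suc n)
  show ?case
  proof (rule Ck_SucI[of _ "\<lambda>x v. frechet_derivative f (at (A x + c)) (A v)"])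
    fix x
    have "((\<lambda>x. A x + c) has_derivative A) (at x)"
      using has_derivative_add[OF bounded_linear_imp_has_derivative[OF A, of "at x"] has_derivative_const[of c "at x"]]
      by simp
    from has_derivative_compose[OF this Ck_SucD(1)[OF Suc.prems]]
    show "((\<lambda>x. f (A x + c)) has_derivative (\<lambda>v. frechet_derivative f (at (A x + c)) (A v))) (at x)" .
  next
    fix v show "Ck n (\<lambda>x. frechet_derivative f (at (A x + c)) (A v))"
      by (rule Suc.IH[OF Ck_SucD(2)[OF Suc.prems]])
  qed
qed

lemma has_derivative_cis_inner:
  fixes \<theta> :: plane
  shows "((\<lambda>x. cis (\<theta> \<bullet> x)) has_derivative (\<lambda>v. \<i> * of_real (\<theta> \<bullet> v) * cis (\<theta> \<bullet> x))) (at x)"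
proof -
  have "((\<lambda>x. \<i> * complex_of_real (\<theta> \<bullet> x)) has_derivative (\<lambda>v. \<i> * of_real (\<theta> \<bullet> v))) (at x)"
    by (intro has_derivative_mult_right has_derivative_of_real has_derivative_inner_right has_derivative_ident)
  from has_derivative_compose[OF this DERIV_exp[unfolded has_field_derivative_def]]
  show ?thesis by (simp add: cis_conv_exp mult_ac)
qed

lemma Ck_cis_inner: "Ck n (\<lambda>x. cis (\<theta> \<bullet> x))"
proof (induction n)
  case 0
  have "continuous_on UNIV (\<lambda>x::plane. cis (\<theta> \<bullet> x))"
    by (rule has_derivative_continuous_on[of _ _ "\<lambda>x v. \<i> * of_real (\<theta> \<bullet> v) * cis (\<theta> \<bullet> x)"])
      (rule has_derivative_at_withinI[OF has_derivative_cis_inner])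
  then show ?case by simp
next
  case (Suc n)
  show ?case by (rule Ck_SucI[OF has_derivative_cis_inner]) (intro Ck_mult Ck_const Suc)
qed

lemma Cinf_const [simp]: "Cinf (\<lambda>x. c)" by (simp add: Cinf_def)
lemma Cinf_cis_inner: "Cinf (\<lambda>x. cis (\<theta> \<bullet> x))" by (simp add: Cinf_def Ck_cis_inner)
lemma Cinf_add: "Cinf f \<Longrightarrow> Cinf g \<Longrightarrow> Cinf (\<lambda>x. f x + g x)" by (simp add: Cinf_def Ck_add)
lemma Cinf_sum: "(\<And>i. i \<in> F \<Longrightarrow> Cinf (f i)) \<Longrightarrow> Cinf (\<lambda>x. \<Sum>i\<in>F. f i x)" by (simp add: Cinf_def Ck_sum)
lemma Cinf_mult:
  fixes f g :: "plane \<Rightarrow> 'b::real_normed_algebra"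
  shows "Cinf f \<Longrightarrow> Cinf g \<Longrightarrow> Cinf (\<lambda>x. f x * g x)" by (simp add: Cinf_def Ck_mult)
lemma Cinf_bounded_linear: "bounded_linear L \<Longrightarrow> Cinf f \<Longrightarrow> Cinf (\<lambda>x. L (f x))"
  by (simp add: Cinf_def Ck_bounded_linear)
lemma Cinf_affine: "bounded_linear A \<Longrightarrow> Cinf f \<Longrightarrow> Cinf (\<lambda>x. f (A x + c))"
  by (simp add: Cinf_def Ck_affine)
lemma Cinf_shift: "Cinf f \<Longrightarrow> Cinf (\<lambda>x. f (x + c))"
  by (rule Cinf_affine[OF bounded_linear_ident])
lemma Cinf_cnj: "Cinf f \<Longrightarrow> Cinf (\<lambda>x. cnj (f x))"
  by (rule Cinf_bounded_linear[OF bounded_linear_cnj])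

lemma Cinf_has_derivative: "Cinf f \<Longrightarrow> (f has_derivative frechet_derivative f (at x)) (at x)"
  unfolding Cinf_def using Ck_SucD(1)[of 0 f x] by blast

lemma Cinf_frechet: "Cinf f \<Longrightarrow> Cinf (\<lambda>x. frechet_derivative f (at x) v)"
  unfolding Cinf_def using Ck_SucD(2)[of _ f v] by blast

lemma Cinf_continuous: "Cinf f \<Longrightarrow> continuous_on UNIV f"
  unfolding Cinf_def using Ck.simps(1) by blast

text \<open>This is for the test weight whose derivative is a prescribed difference of two bumps.\<close>

lemma Cinf_antiderivative:
  assumes "\<And>x. (f has_derivative f' x) (at x)" "\<And>v. Cinf (\<lambda>x. f' x v)"
  shows "Cinf f"
  unfolding Cinf_def
proof
  fix n
  have "Ck (Suc n) f" by (rule Ck_SucI[OF assms(1)]) (use assms(2) in \<open>simp add: Cinf_def\<close>)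
  then show "Ck n f" by (rule Ck_Suc_imp)
qed

lemma Cinf_grad: "Cinf f \<Longrightarrow> Cinf (\<lambda>x. fst (grad f x))" "Cinf f \<Longrightarrow> Cinf (\<lambda>x. snd (grad f x))"
  by (simp_all add: grad_def Cinf_frechet)

lemma grad_eqI: "(f has_derivative D) (at x) \<Longrightarrow> grad f x = (D (1, 0), D (0, 1))"
  by (simp add: grad_def frechet_derivative_at[symmetric])

lemma grad_mult:
  fixes f g :: "plane \<Rightarrow> complex"
  assumes "Cinf f" "Cinf g"
  shows "grad (\<lambda>x. f x * g x) x =
    (f x * fst (grad g x) + fst (grad f x) * g x, f x * snd (grad g x) + snd (grad f x) * g x)"
  using grad_eqI[OF has_derivative_mult[OF Cinf_has_derivative[OF assms(1), of x] Cinf_has_derivative[OF assms(2), of x]]]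
  by (simp add: grad_def)

lemma grad_cis_inner:
  "grad (\<lambda>x. cis (\<theta> \<bullet> x)) x = (\<i> * of_real (fst \<theta>) * cis (\<theta> \<bullet> x), \<i> * of_real (snd \<theta>) * cis (\<theta> \<bullet> x))"
  using grad_eqI[OF has_derivative_cis_inner, of \<theta> x] by (cases \<theta>) simp

lemma grad_cnj:
  assumes "Cinf f"
  shows "grad (\<lambda>x. cnj (f x)) x = (cnj (fst (grad f x)), cnj (snd (grad f x)))"
  using grad_eqI[OF bounded_linear.has_derivative[OF bounded_linear_cnj Cinf_has_derivative[OF assms, of x]]]
  by (simp add: grad_def)

lemma grad_sum_cmult:
  fixes f :: "'i \<Rightarrow> plane \<Rightarrow> complex"
  assumes "\<And>i. i \<in> F \<Longrightarrow> Cinf (f i)"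
  shows "grad (\<lambda>x. \<Sum>i\<in>F. c i * f i x) x = (\<Sum>i\<in>F. c i * fst (grad (f i) x), \<Sum>i\<in>F. c i * snd (grad (f i) x))"
proof -
  have "((\<lambda>x. \<Sum>i\<in>F. c i * f i x) has_derivative (\<lambda>v. \<Sum>i\<in>F. c i * frechet_derivative (f i) (at x) v)) (at x)"
    by (intro has_derivative_sum has_derivative_mult_right Cinf_has_derivative assms)
  from grad_eqI[OF this] show ?thesis by (simp add: grad_def)
qed

lemma grad_shift:
  assumes "Cinf f"
  shows "grad (\<lambda>x. f (x + c)) x = grad f (x + c)"
proof -
  have "((\<lambda>x. x + c) has_derivative (\<lambda>v. v)) (at x)" by (auto intro!: derivative_eq_intros)
  from has_derivative_compose[OF this Cinf_has_derivative[OF assms]]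
  have "((\<lambda>x. f (x + c)) has_derivative frechet_derivative f (at (x + c))) (at x)" .
  from grad_eqI[OF this] show ?thesis by (simp add: grad_def)
qed

text \<open>The factor 2 is the price of bounding both coordinate directions by the full norms.\<close>

lemma frechet_derivative_le_grad:
  assumes "Cinf f"
  shows "norm (frechet_derivative f (at x) v) \<le> 2 * norm (grad f x) * norm v"
proof -
  interpret linear "frechet_derivative f (at x)"
    using has_derivative_linear[OF Cinf_has_derivative[OF assms]] .
  have v: "v = fst v *\<^sub>R (1, 0) + snd v *\<^sub>R (0, 1)" by (cases v) simp
  have "frechet_derivative f (at x) v = fst v *\<^sub>R fst (grad f x) + snd v *\<^sub>R snd (grad f x)"
    by (subst v) (simp add: add scaleR grad_def del: scaleR_Pair add_Pair)
  also have "norm \<dots> \<le> \<bar>fst v\<bar> * norm (fst (grad f x)) + \<bar>snd v\<bar> * norm (snd (grad f x))"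
    using norm_triangle_ineq by (metis norm_scaleR)
  also have "\<dots> \<le> norm v * norm (grad f x) + norm v * norm (grad f x)"
    using norm_fst_le[of "fst v" "snd v"] norm_snd_le[of "snd v" "fst v"]
      norm_fst_le[of "fst (grad f x)" "snd (grad f x)"] norm_snd_le[of "snd (grad f x)" "fst (grad f x)"]
    by (intro add_mono mult_mono) (auto simp: real_norm_def)
  finally show ?thesis by (simp add: mult_ac)
qed

lemma Cinf_lipschitz:
  assumes "Cinf f" "\<And>x. norm (grad f x) \<le> C"
  shows "norm (f x - f y) \<le> 2 * C * norm (x - y)"
proof (rule differentiable_bound[of UNIV f "\<lambda>x. frechet_derivative f (at x)"])
  show "(f has_derivative frechet_derivative f (at x)) (at x within UNIV)" for x
    using Cinf_has_derivative[OF assms(1)] by simp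
  show "onorm (frechet_derivative f (at x)) \<le> 2 * C" for x
  proof (rule onorm_le)
    fix v :: plane
    have "2 * norm (grad f x) * norm v \<le> 2 * C * norm v"
      using assms(2)[of x] by (intro mult_right_mono) auto
    then show "norm (frechet_derivative f (at x) v) \<le> 2 * C * norm v"
      using frechet_derivative_le_grad[OF assms(1), of x v] by linarith
  qed
qed auto

lemma continuous_L2_on:
  fixes f :: "plane \<Rightarrow> complex"
  assumes "continuous_on UNIV f" "bounded S" "S \<in> sets borel"
  shows "L2_on S f"
proof -
  have m: "f \<in> borel_measurable borel" using assms(1) by (rule borel_measurable_continuous_onI)
  obtain a b where ab: "S \<subseteq> cbox a b" using assms(2) bounded_subset_cbox_symmetric by blast
  have "set_integrable lborel (cbox a b) (\<lambda>x. (norm (f x))\<^sup>2)"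
    unfolding set_integrable_def
    by (rule borel_integrable_compact)
       (auto intro!: continuous_intros continuous_on_subset[OF assms(1)])
  then have "L2_on (cbox a b) f" using m by (simp add: L2_on_def)
  then show ?thesis using ab assms(3) by (rule L2_on_subset)
qed

lemma Cinf_L2_on: "Cinf f \<Longrightarrow> bounded S \<Longrightarrow> S \<in> sets borel \<Longrightarrow> L2_on S f"
  for f :: "plane \<Rightarrow> complex"
  by (intro continuous_L2_on Cinf_continuous)

subsection \<open>Cut-off functions of the first coordinate\<close>

text \<open>Smoothness of a function of one real variable, expressed through the notion for the plane because
  such functions enter only as weights depending on the first coordinate.\<close>

definition smooth_line :: "(real \<Rightarrow> real) \<Rightarrow> bool" where
  "smooth_line z \<longleftrightarrow> Cinf (\<lambda>x::plane. z (fst x))"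

lemma smooth_line_has_derivative:
  assumes "smooth_line z"
  shows "(z has_real_derivative deriv z t) (at t)"
proof -
  have "((\<lambda>t::real. (t, 0::real)) has_derivative (\<lambda>s. (s, 0))) (at t)"
    by (auto intro!: derivative_eq_intros)
  from has_derivative_compose[OF this Cinf_has_derivative[OF assms[unfolded smooth_line_def]]]
  have "z differentiable (at t)" unfolding differentiable_def by auto
  then show ?thesis using real_differentiable_def DERIV_imp_deriv by blast
qed

lemma smooth_line_plane_derivative:
  assumes "smooth_line z"
  shows "((\<lambda>x::plane. z (fst x)) has_derivative (\<lambda>v. deriv z (fst x) * fst v)) (at x)"
proof -
  have "(fst has_derivative fst) (at x)" by (auto intro!: derivative_eq_intros)
  from has_derivative_compose[OF this smooth_line_has_derivative[OF assms, unfolded has_field_derivative_def]]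
  show ?thesis by simp
qed

lemma smooth_line_deriv: "smooth_line z \<Longrightarrow> smooth_line (deriv z)"
  using Cinf_frechet[of "\<lambda>x. z (fst x)" "(1, 0)"]
  by (simp add: smooth_line_def frechet_derivative_at[OF smooth_line_plane_derivative, symmetric])

lemma smooth_line_continuous: "smooth_line z \<Longrightarrow> continuous_on UNIV z"
  using smooth_line_has_derivative DERIV_continuous_on by blast

lemma smooth_line_mult: "smooth_line z \<Longrightarrow> smooth_line w \<Longrightarrow> smooth_line (\<lambda>t. z t * w t)"
  unfolding smooth_line_def by (rule Cinf_mult)

lemma smooth_line_shift: "smooth_line z \<Longrightarrow> smooth_line (\<lambda>t. z (t + c))"
  unfolding smooth_line_def using Cinf_shift[of "\<lambda>x. z (fst x)" "(c, 0)"] by simp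

lemma smooth_line_diff:
  assumes "smooth_line z" "smooth_line w"
  shows "smooth_line (\<lambda>t. z t - w t)"
  using Cinf_add[OF assms(1)[unfolded smooth_line_def] Cinf_bounded_linear[OF bounded_linear_minus[OF bounded_linear_ident] assms(2)[unfolded smooth_line_def]]]
  unfolding smooth_line_def by simp

lemma smooth_line_antiderivative:
  assumes "smooth_line w" "\<And>t. (z has_real_derivative w t) (at t)"
  shows "smooth_line z"
  unfolding smooth_line_def
proof (rule Cinf_antiderivative)
  fix x :: plane
  have "(fst has_derivative fst) (at x)" by (auto intro!: derivative_eq_intros)
  from has_derivative_compose[OF this assms(2)[unfolded has_field_derivative_def]]
  show "((\<lambda>x. z (fst x)) has_derivative (\<lambda>v. w (fst x) * fst v)) (at x)" by simp
next
  fix v :: plane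
  show "Cinf (\<lambda>x. w (fst x) * fst v)"
    using assms(1) by (intro Cinf_mult Cinf_const) (simp add: smooth_line_def)
qed

lemma smooth_line_complex:
  assumes "smooth_line z"
  shows "Cinf (\<lambda>x::plane. complex_of_real (z (fst x)))"
    and "grad (\<lambda>x::plane. complex_of_real (z (fst x))) x = (of_real (deriv z (fst x)), 0)"
proof -
  show "Cinf (\<lambda>x::plane. complex_of_real (z (fst x)))"
    using Cinf_bounded_linear[OF bounded_linear_of_real assms[unfolded smooth_line_def]] .
  show "grad (\<lambda>x::plane. complex_of_real (z (fst x))) x = (of_real (deriv z (fst x)), 0)"
    using grad_eqI[OF bounded_linear.has_derivative[OF bounded_linear_of_real smooth_line_plane_derivative[OF assms, of x]]]
    by simp
qed

lemma smooth_line_borel [measurable_dest]: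
  "smooth_line z \<Longrightarrow> z \<in> borel_measurable borel"
  using smooth_line_continuous by (rule borel_measurable_continuous_onI)

lemma deriv_zero_of_vanishing:
  fixes z :: "real \<Rightarrow> real"
  assumes "open U" "t \<in> U" "\<And>s. s \<in> U \<Longrightarrow> z s = c"
  shows "deriv z t = 0"
proof -
  have "(z has_field_derivative 0) (at t)"
    by (rule has_field_derivative_transform_within_open[OF _ assms(1,2), of "\<lambda>_. c"])
      (auto simp: assms(3))
  then show ?thesis by (rule DERIV_imp_deriv)
qed

text \<open>Points of the plane are handled as single variables, so quantifiers over them must not be split
  into quantifiers over the coordinates.\<close>

declare split_paired_All [simp del] split_paired_Ex [simp del]

section \<open>Rectangular cells\<close>

definition cell :: "real \<Rightarrow> real \<Rightarrow> plane set" where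
  "cell s1 s2 = {0<..<s1} \<times> {0<..<s2}"

lemma Y_cell_eq: "Y_cell \<epsilon> = cell \<epsilon> \<epsilon>" by (simp add: Y_cell_def cell_def)
lemma W_box_eq: "W_box \<epsilon> R = cell (real R * \<epsilon>) (real R * \<epsilon>)" by (simp add: W_box_def cell_def)

lemma cell_borel [measurable, simp]: "cell s1 s2 \<in> sets borel"
  by (auto simp: cell_def intro!: borel_open open_Times)

lemma cell_bounded [simp]: "bounded (cell s1 s2)"
  by (simp add: cell_def bounded_Times)

lemma mem_cell: "x \<in> cell s1 s2 \<longleftrightarrow> 0 < fst x \<and> fst x < s1 \<and> 0 < snd x \<and> snd x < s2"
  by (cases x) (auto simp: cell_def)

lemma measure_cell [simp]:
  assumes "0 \<le> s1" "0 \<le> s2"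
  shows "measure lborel (cell s1 s2) = s1 * s2"
proof -
  have "cell s1 s2 = box (0, 0) (s1, s2)" by (auto simp: cell_def box_def Basis_prod_def)
  then show ?thesis using assms by (simp add: measure_lborel_box_eq Basis_prod_def)
qed

lemma plane_integral_translate:
  fixes F :: "plane \<Rightarrow> 'b::{banach, second_countable_topology}"
  assumes [measurable]: "F \<in> borel_measurable borel"
  shows "integral\<^sup>L lborel (\<lambda>x. F (x + c)) = integral\<^sup>L lborel F"
    and "integrable lborel (\<lambda>x. F (x + c)) \<longleftrightarrow> integrable lborel F"
proof -
  have "integral\<^sup>L lborel F = integral\<^sup>L (distr lborel borel ((+) c)) F" by (simp add: lborel_distr_plus)
  also have "\<dots> = integral\<^sup>L lborel (\<lambda>x. F (c + x))" by (rule integral_distr) auto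
  finally show "integral\<^sup>L lborel (\<lambda>x. F (x + c)) = integral\<^sup>L lborel F" by (simp add: add.commute)
  have "integrable lborel F \<longleftrightarrow> integrable (distr lborel borel ((+) c)) F" by (simp add: lborel_distr_plus)
  also have "\<dots> \<longleftrightarrow> integrable lborel (\<lambda>x. F (c + x))" by (rule integrable_distr_eq) auto
  finally show "integrable lborel (\<lambda>x. F (x + c)) \<longleftrightarrow> integrable lborel F" by (simp add: add.commute)
qed

lemma plane_scaling_density:
  assumes "d1 > 0" "d2 > 0"
  shows "(lborel :: plane measure) =
    density (distr lborel borel (\<lambda>x. (d1 * fst x, d2 * snd x))) (\<lambda>_. ennreal (d1 * d2))"
proof -
  define c :: "plane \<Rightarrow> real" where "c j = (if j = (1, 0) then d1 else d2)" for j
  have T: "(0 :: plane) + (\<Sum>j\<in>Basis. (c j * (x \<bullet> j)) *\<^sub>R j) = (d1 * fst x, d2 * snd x)" for x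
    by (cases x) (simp add: Basis_prod_def sum.union_disjoint c_def)
  have P: "(\<Prod>j\<in>Basis. \<bar>c j\<bar>) = d1 * d2"
    using assms by (simp add: Basis_prod_def c_def mult.commute)
  have "c j \<noteq> 0" for j using assms by (simp add: c_def)
  from lborel_affine_euclidean[of c "0 :: plane", OF this] show ?thesis
    unfolding T P .
qed

lemma plane_integral_scale:
  fixes F :: "plane \<Rightarrow> 'b::{banach, second_countable_topology}"
  assumes [measurable]: "F \<in> borel_measurable borel" and d: "d1 > 0" "d2 > 0"
  shows "integral\<^sup>L lborel F = (d1 * d2) *\<^sub>R integral\<^sup>L lborel (\<lambda>x. F (d1 * fst x, d2 * snd x))"
    and "integrable lborel F \<longleftrightarrow> integrable lborel (\<lambda>x. F (d1 * fst x, d2 * snd x))"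
proof -
  have nz: "d1 * d2 > 0" using d by simp
  have [measurable]: "(\<lambda>x::plane. (d1 * fst x, d2 * snd x)) \<in> borel_measurable borel"
    by (intro borel_measurable_continuous_onI continuous_intros)
  show "integral\<^sup>L lborel F = (d1 * d2) *\<^sub>R integral\<^sup>L lborel (\<lambda>x. F (d1 * fst x, d2 * snd x))"
    by (subst plane_scaling_density[OF d]) (use nz in \<open>simp add: integral_density integral_distr\<close>)
  show "integrable lborel F \<longleftrightarrow> integrable lborel (\<lambda>x. F (d1 * fst x, d2 * snd x))"
  proof (subst plane_scaling_density[OF d])
    have "integrable (density (distr lborel borel (\<lambda>x::plane. (d1 * fst x, d2 * snd x))) (\<lambda>_. ennreal (d1 * d2))) F
        \<longleftrightarrow> integrable lborel (\<lambda>x. (d1 * d2) *\<^sub>R F (d1 * fst x, d2 * snd x))"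
      using nz by (simp add: integrable_density integrable_distr_eq)
    also have "\<dots> \<longleftrightarrow> integrable lborel (\<lambda>x. F (d1 * fst x, d2 * snd x))"
    proof -
      have "integrable lborel (\<lambda>x. c *\<^sub>R G x) \<longleftrightarrow> integrable lborel G" if "c > 0" for c :: real and G :: "plane \<Rightarrow> 'b"
        using that integrable_scaleR_right[of "inverse c" lborel "\<lambda>x. c *\<^sub>R G x"] by auto
      from this[OF nz] show ?thesis .
    qed
    finally show "integrable (density (distr lborel borel (\<lambda>x::plane. (d1 * fst x, d2 * snd x))) (\<lambda>_. ennreal (d1 * d2))) F
        \<longleftrightarrow> integrable lborel (\<lambda>x. F (d1 * fst x, d2 * snd x))" .
  qed
qed

text \<open>The factor of the change of variables cancels because inner products are normalised by the
  measure of the cell. This transports Fourier series from one rectangle to every other one.\<close>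

lemma mean_ip_cell_scale:
  assumes [measurable]: "f \<in> borel_measurable borel" "g \<in> borel_measurable borel"
    and s: "s1 > 0" "s2 > 0" "t1 > 0" "t2 > 0"
  shows "mean_ip (cell s1 s2) f g = mean_ip (cell t1 t2)
    (\<lambda>x. f (s1 / t1 * fst x, s2 / t2 * snd x)) (\<lambda>x. g (s1 / t1 * fst x, s2 / t2 * snd x))"
proof -
  have "(\<lambda>x. cnj (g x)) \<in> borel_measurable borel"
    by (rule borel_measurable_continuous_on[OF continuous_on_cnj[OF continuous_on_id] assms(2)])
  then have m: "(\<lambda>x. indicator (cell s1 s2) x *\<^sub>R (f x * cnj (g x))) \<in> borel_measurable borel" by measurable
  have i: "indicator (cell s1 s2) (s1 / t1 * fst x, s2 / t2 * snd x) = (indicator (cell t1 t2) x :: real)" for x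
    using s by (auto simp: indicator_def mem_cell field_simps zero_less_mult_iff)
  show ?thesis
    unfolding mean_ip_def set_lebesgue_integral_def
    by (subst plane_integral_scale(1)[OF m, of "s1 / t1" "s2 / t2"], unfold i)
      (use s in \<open>auto simp: scaleR_conv_of_real\<close>)
qed

lemma L2_on_cell_scale:
  assumes "L2_on (cell s1 s2) f" and s: "s1 > 0" "s2 > 0" "t1 > 0" "t2 > 0"
  shows "L2_on (cell t1 t2) (\<lambda>x. f (s1 / t1 * fst x, s2 / t2 * snd x))"
proof -
  have f [measurable]: "f \<in> borel_measurable borel" using assms(1) by (rule L2_onD)
  have m: "(\<lambda>x. indicator (cell s1 s2) x *\<^sub>R (norm (f x))\<^sup>2) \<in> borel_measurable borel" by measurable
  have "(\<lambda>x::plane. (s1 / t1 * fst x, s2 / t2 * snd x)) \<in> borel_measurable borel"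
    by (intro borel_measurable_continuous_onI continuous_intros)
  then have me: "(\<lambda>x. f (s1 / t1 * fst x, s2 / t2 * snd x)) \<in> borel_measurable borel"
    by (rule measurable_compose[OF _ f])
  have i: "indicator (cell s1 s2) (s1 / t1 * fst x, s2 / t2 * snd x) = (indicator (cell t1 t2) x :: real)" for x
    using s by (auto simp: indicator_def mem_cell field_simps zero_less_mult_iff)
  show ?thesis
    using plane_integral_scale(2)[OF m, of "s1 / t1" "s2 / t2"] L2_onD(2)[OF assms(1)] s me
    unfolding L2_on_def set_integrable_def i by simp
qed

subsection \<open>Tiling\<close>

lemma AE_plane_line: "AE x in lborel. fst (x::plane) \<noteq> c \<and> snd x \<noteq> c'"
proof -
  have "emeasure lborel ({c} \<times> (UNIV :: real set)) = 0"
    unfolding lborel_prod[symmetric] by (subst lborel.emeasure_pair_measure_Times) auto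
  moreover have "{c} \<times> (UNIV :: real set) \<in> sets lborel" by (auto intro!: borel_closed closed_Times)
  ultimately have 1: "{c} \<times> (UNIV :: real set) \<in> null_sets lborel" by (simp add: null_sets_def)
  have "emeasure lborel ((UNIV :: real set) \<times> {c'}) = 0"
    unfolding lborel_prod[symmetric] by (subst lborel.emeasure_pair_measure_Times) auto
  moreover have "(UNIV :: real set) \<times> {c'} \<in> sets lborel" by (auto intro!: borel_closed closed_Times)
  ultimately have 2: "(UNIV :: real set) \<times> {c'} \<in> null_sets lborel" by (simp add: null_sets_def)
  show ?thesis
    using AE_not_in[OF 1] AE_not_in[OF 2] by eventually_elim auto
qed

lemma tile_unique:
  fixes t s :: real
  assumes "s > 0"
  shows "(0 \<le> t \<and> t < real n * s) \<longleftrightarrow> (\<exists>i<n. real i * s \<le> t \<and> t < (real i + 1) * s)"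
    and "real i * s \<le> t \<Longrightarrow> t < (real i + 1) * s \<Longrightarrow> real k * s \<le> t \<Longrightarrow> t < (real k + 1) * s \<Longrightarrow> i = k"
proof -
  show "(0 \<le> t \<and> t < real n * s) \<longleftrightarrow> (\<exists>i<n. real i * s \<le> t \<and> t < (real i + 1) * s)"
  proof
    assume a: "0 \<le> t \<and> t < real n * s"
    define i where "i = nat \<lfloor>t / s\<rfloor>"
    have nn: "0 \<le> t / s" using a assms by simp
    then have i: "real i \<le> t / s" "t / s < real i + 1" unfolding i_def by linarith+
    have "t / s < real n" using a assms by (simp add: field_simps)
    then have "i < n" using i by linarith
    then show "\<exists>i<n. real i * s \<le> t \<and> t < (real i + 1) * s"
      using i assms by (auto simp: field_simps)
  next
    assume "\<exists>i<n. real i * s \<le> t \<and> t < (real i + 1) * s"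
    then obtain i where i: "i < n" "real i * s \<le> t" "t < (real i + 1) * s" by blast
    have "(real i + 1) * s \<le> real n * s" using i assms by (intro mult_right_mono) auto
    moreover have "0 \<le> real i * s" using assms by simp
    ultimately show "0 \<le> t \<and> t < real n * s" using i by linarith
  qed
  assume h: "real i * s \<le> t" "t < (real i + 1) * s" "real k * s \<le> t" "t < (real k + 1) * s"
  have "real i * s < (real k + 1) * s" "real k * s < (real i + 1) * s" using h by linarith+
  then have "real i < real k + 1" "real k < real i + 1" using assms by (simp_all add: mult_less_cancel_right_pos)
  then show "i = k" by linarith
qed

definition tile :: "real \<Rightarrow> real \<Rightarrow> nat \<times> nat \<Rightarrow> plane" where
  "tile s1 s2 c = (real (fst c) * s1, real (snd c) * s2)"

lemma cell_shift_subset: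
  assumes "x \<in> cell s1 s2" "fst c < n1" "snd c < n2"
  shows "x + tile s1 s2 c \<in> cell (real n1 * s1) (real n2 * s2)"
proof -
  have s: "s1 > 0" "s2 > 0" using assms(1) by (auto simp: mem_cell)
  have "(real (fst c) + 1) * s1 \<le> real n1 * s1" "(real (snd c) + 1) * s2 \<le> real n2 * s2"
    using assms s by (auto intro!: mult_right_mono)
  moreover have "0 \<le> real (fst c) * s1" "0 \<le> real (snd c) * s2" using s by simp_all
  ultimately show ?thesis using assms(1) unfolding mem_cell tile_def ring_distribs
    by (auto intro: add_pos_nonneg)
qed

text \<open>A large cell is, up to the null set of the grid lines, the disjoint union of translates of a small
  cell.\<close>

lemma set_integrable_tile:
  fixes F :: "plane \<Rightarrow> 'b::{banach, second_countable_topology}"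
  assumes F [measurable]: "F \<in> borel_measurable borel" and s: "s1 > 0" "s2 > 0"
  shows "set_integrable lborel (cell (real n1 * s1) (real n2 * s2)) F \<longleftrightarrow>
    (\<forall>c\<in>{..<n1} \<times> {..<n2}. set_integrable lborel (cell s1 s2) (\<lambda>x. F (x + tile s1 s2 c)))" (is ?A)
    and "set_integrable lborel (cell (real n1 * s1) (real n2 * s2)) F \<Longrightarrow>
     (LINT x:cell (real n1 * s1) (real n2 * s2)|lborel. F x) =
     (\<Sum>c\<in>{..<n1} \<times> {..<n2}. LINT x:cell s1 s2|lborel. F (x + tile s1 s2 c))" (is "_ \<Longrightarrow> ?B")
proof -
  define H where "H c = {x::plane. real (fst c) * s1 \<le> fst x \<and> fst x < (real (fst c) + 1) * s1 \<and>
      real (snd c) * s2 \<le> snd x \<and> snd x < (real (snd c) + 1) * s2}" for c :: "nat \<times> nat"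
  let ?I = "{..<n1} \<times> {..<n2}" and ?C = "cell (real n1 * s1) (real n2 * s2)"
  have H [measurable]: "H c \<in> sets borel" for c
  proof -
    have "H c = {real (fst c) * s1..<(real (fst c) + 1) * s1} \<times> {real (snd c) * s2..<(real (snd c) + 1) * s2}"
      by (auto simp: H_def)
    then show ?thesis by (simp flip: borel_prod)
  qed
  have UH: "(\<Union>c\<in>?I. H c) = {x. 0 \<le> fst x \<and> fst x < real n1 * s1 \<and> 0 \<le> snd x \<and> snd x < real n2 * s2}"
    using tile_unique(1)[OF s(1), of _ n1] tile_unique(1)[OF s(2), of _ n2]
    by (auto simp: H_def) blast+
  have dH: "disjoint_family_on H ?I"
    unfolding disjoint_family_on_def
  proof (intro ballI impI, rule ccontr)
    fix c d assume "c \<in> ?I" "d \<in> ?I" "c \<noteq> d" "H c \<inter> H d \<noteq> {}"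
    then obtain x where "x \<in> H c" "x \<in> H d" by blast
    then have "fst c = fst d" "snd c = snd d"
      using tile_unique(2)[OF s(1), of "fst c" "fst x" "fst d"] tile_unique(2)[OF s(2), of "snd c" "snd x" "snd d"]
      by (auto simp: H_def)
    with \<open>c \<noteq> d\<close> show False by (simp add: prod_eq_iff)
  qed
  have mC: "set_borel_measurable lborel A F" if "A \<in> sets borel" for A
    using that F unfolding set_borel_measurable_def by measurable
  have aeC: "AE x in lborel. x \<in> ?C \<longleftrightarrow> x \<in> (\<Union>c\<in>?I. H c)"
    using AE_plane_line[of 0 0] unfolding UH by eventually_elim (auto simp: mem_cell)
  have UHm: "(\<Union>c\<in>?I. H c) \<in> sets borel" by measurable
  have intC: "set_integrable lborel ?C F \<longleftrightarrow> set_integrable lborel (\<Union>c\<in>?I. H c) F"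
    unfolding set_integrable_def using aeC UHm
    by (intro integrable_cong_AE) (auto simp: indicator_def elim!: eventually_mono)
  have shift: "indicator (H c) (x + tile s1 s2 c) = (indicator (H (0, 0)) x :: real)" for c x
    by (auto simp: indicator_def H_def tile_def algebra_simps)
  have H0: "AE x in lborel. x \<in> cell s1 s2 \<longleftrightarrow> x \<in> H (0, 0)"
    using AE_plane_line[of 0 0] by eventually_elim (auto simp: mem_cell H_def)
  have mc [measurable]: "(\<lambda>x. F (x + tile s1 s2 c)) \<in> borel_measurable borel" for c by measurable
  have intH: "set_integrable lborel (H c) F \<longleftrightarrow> set_integrable lborel (cell s1 s2) (\<lambda>x. F (x + tile s1 s2 c))" for c
  proof -
    have "set_integrable lborel (H c) F \<longleftrightarrow> set_integrable lborel (H (0, 0)) (\<lambda>x. F (x + tile s1 s2 c))"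
      unfolding set_integrable_def
      by (subst plane_integral_translate(2)[where c="tile s1 s2 c", symmetric]) (auto simp: shift)
    also have "\<dots> \<longleftrightarrow> set_integrable lborel (cell s1 s2) (\<lambda>x. F (x + tile s1 s2 c))"
      unfolding set_integrable_def using H0
      by (intro integrable_cong_AE) (auto simp: indicator_def elim!: eventually_mono)
    finally show ?thesis .
  qed
  show ?A
  proof
    assume "set_integrable lborel ?C F"
    then have "set_integrable lborel (\<Union>c\<in>?I. H c) F" by (simp add: intC)
    then show "\<forall>c\<in>?I. set_integrable lborel (cell s1 s2) (\<lambda>x. F (x + tile s1 s2 c))"
      unfolding intH[symmetric] by (blast intro: set_integrable_subset[OF _ _ UN_upper] H[folded sets_lborel])
  next
    assume "\<forall>c\<in>?I. set_integrable lborel (cell s1 s2) (\<lambda>x. F (x + tile s1 s2 c))"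
    then show "set_integrable lborel ?C F"
      unfolding intH[symmetric] intC by (intro set_integrable_UN) auto
  qed
  assume "set_integrable lborel ?C F"
  then have i: "set_integrable lborel (H c) F" if "c \<in> ?I" for c
    using that \<open>?A\<close> by (auto simp: intH)
  have "(LINT x:?C|lborel. F x) = (LINT x:(\<Union>c\<in>?I. H c)|lborel. F x)"
    by (rule set_integral_cong_set) (use aeC UHm in \<open>auto intro!: mC\<close>)
  also have "\<dots> = (\<Sum>c\<in>?I. LINT x:H c|lborel. F x)"
    by (rule set_integral_finite_Union) (use dH i in auto)
  also have "\<dots> = (\<Sum>c\<in>?I. LINT x:cell s1 s2|lborel. F (x + tile s1 s2 c))"
  proof (rule sum.cong[OF refl])
    fix c
    have "(LINT x:H c|lborel. F x) = (LINT x:H (0, 0)|lborel. F (x + tile s1 s2 c))"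
      unfolding set_lebesgue_integral_def
      by (subst plane_integral_translate(1)[where c="tile s1 s2 c", symmetric]) (auto simp: shift)
    also have "\<dots> = (LINT x:cell s1 s2|lborel. F (x + tile s1 s2 c))"
      by (rule set_integral_cong_set) (use H0 in \<open>auto simp: set_borel_measurable_def\<close>)
    finally show "(LINT x:H c|lborel. F x) = (LINT x:cell s1 s2|lborel. F (x + tile s1 s2 c))" .
  qed
  finally show ?B .
qed

section \<open>Fourier series and density of trigonometric polynomials\<close>

text \<open>Smooth functions on the torus obtained by identifying opposite sides of a rectangle.\<close>

definition test_cell :: "real \<Rightarrow> real \<Rightarrow> (plane \<Rightarrow> complex) set" where
  "test_cell s1 s2 = {\<phi>. Cinf \<phi> \<and> (\<forall>x. \<phi> (x + (s1, 0)) = \<phi> x \<and> \<phi> (x + (0, s2)) = \<phi> x)}"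

lemma test_torus_eq: "test_torus \<epsilon> = test_cell \<epsilon> \<epsilon>"
  by (simp add: test_torus_def test_cell_def periodic2_def)

lemma test_cellD:
  assumes "\<phi> \<in> test_cell s1 s2"
  shows "Cinf \<phi>" "\<phi> (x + (s1, 0)) = \<phi> x" "\<phi> (x + (0, s2)) = \<phi> x"
  using assms by (auto simp: test_cell_def)

abbreviation tgrad :: "real \<Rightarrow> plane \<Rightarrow> (plane \<Rightarrow> complex) \<Rightarrow> plane \<Rightarrow> complex \<times> complex" where
  "tgrad \<epsilon> j \<phi> \<equiv> bloch_grad \<epsilon> j \<phi> (grad \<phi>)"

lemma Cinf_tgrad:
  assumes "Cinf \<phi>"
  shows "Cinf (\<lambda>x. fst (tgrad \<epsilon> j \<phi> x))" "Cinf (\<lambda>x. snd (tgrad \<epsilon> j \<phi> x))"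
  unfolding bloch_grad_def using Cinf_grad[OF assms] assms
  by (simp_all only: fst_conv snd_conv) (intro Cinf_add Cinf_mult Cinf_const; assumption)+

lemma test_L2_on:
  assumes "\<phi> \<in> test_cell s1 s2" "bounded S" "S \<in> sets borel"
  shows "L2_on S \<phi>" "L2_on S (\<lambda>x. fst (tgrad \<epsilon> j \<phi> x))" "L2_on S (\<lambda>x. snd (tgrad \<epsilon> j \<phi> x))"
  using Cinf_L2_on[OF test_cellD(1)[OF assms(1)] assms(2,3)]
    Cinf_L2_on[OF Cinf_tgrad(1)[OF test_cellD(1)[OF assms(1)]] assms(2,3)]
    Cinf_L2_on[OF Cinf_tgrad(2)[OF test_cellD(1)[OF assms(1)]] assms(2,3)] by blast+

definition trig :: "real \<Rightarrow> real \<Rightarrow> int \<times> int \<Rightarrow> plane \<Rightarrow> complex" where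
  "trig s1 s2 \<kappa> x = cis ((2 * pi * of_int (fst \<kappa>) / s1, 2 * pi * of_int (snd \<kappa>) / s2) \<bullet> x)"

lemma Cinf_trig: "Cinf (trig s1 s2 \<kappa>)"
  unfolding trig_def by (rule Cinf_cis_inner)

lemma cis_add_2pi_int: "cis (x + 2 * pi * of_int n) = cis x"
proof -
  have "cis (2 * pi * of_int n) = 1" by (simp add: cis_multiple_2pi)
  then show ?thesis by (simp flip: cis_mult)
qed

lemma trig_test:
  assumes "s1 \<noteq> 0" "s2 \<noteq> 0"
  shows "trig s1 s2 \<kappa> \<in> test_cell s1 s2"
proof -
  have "trig s1 s2 \<kappa> (x + (s1, 0)) = trig s1 s2 \<kappa> x" for x
    using assms cis_add_2pi_int[of "(2 * pi * of_int (fst \<kappa>) / s1, 2 * pi * of_int (snd \<kappa>) / s2) \<bullet> x" "fst \<kappa>"]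
    by (simp add: trig_def inner_add_right)
  moreover have "trig s1 s2 \<kappa> (x + (0, s2)) = trig s1 s2 \<kappa> x" for x
    using assms cis_add_2pi_int[of "(2 * pi * of_int (fst \<kappa>) / s1, 2 * pi * of_int (snd \<kappa>) / s2) \<bullet> x" "snd \<kappa>"]
    by (simp add: trig_def inner_add_right)
  ultimately show ?thesis by (simp add: test_cell_def Cinf_trig)
qed

text \<open>One enumeration of wave numbers has to serve for all rectangles at once.\<close>

definition fourier_complete :: "(nat \<Rightarrow> int \<times> int) \<Rightarrow> bool" where
  "fourier_complete \<kappa> \<longleftrightarrow> (\<forall>s1>0. \<forall>s2>0. \<forall>w. L2_on (cell s1 s2) w \<longrightarrow>
     (\<lambda>n. mean_sq (cell s1 s2) (\<lambda>x. w x - (\<Sum>m<n. mean_ip (cell s1 s2) w (trig s1 s2 (\<kappa> m)) * trig s1 s2 (\<kappa> m) x)))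
       \<longlonglongrightarrow> 0)"

lemma L2_has_sum_lessThan:
  assumes "L2_has_sum S f UNIV v"
  shows "(\<lambda>n. mean_sq S (\<lambda>x. v x - (\<Sum>i<n. f i x))) \<longlonglongrightarrow> 0"
proof -
  have "filterlim (\<lambda>n::nat. {..<n}) (finite_subsets_at_top UNIV) sequentially"
    unfolding filterlim_finite_subsets_at_top
  proof safe
    fix X :: "nat set" assume "finite X"
    then obtain N where "X \<subseteq> {..<N}" using finite_nat_iff_bounded by blast
    then show "\<forall>\<^sub>F n in sequentially. finite {..<n} \<and> X \<subseteq> {..<n} \<and> {..<n} \<subseteq> UNIV"
      by (intro eventually_sequentiallyI[of N]) auto
  qed
  from filterlim_compose[OF conjunct2[OF assms[unfolded L2_has_sum_def]] this]
  have "(\<lambda>n. LINT x:S|lborel. (norm (v x - (\<Sum>i<n. f i x)))\<^sup>2) \<longlonglongrightarrow> 0" .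
  then show ?thesis unfolding mean_sq_def by (rule tendsto_divide_zero)
qed

text \<open>For \<open>j = 0\<close> the free Bloch functions are exponentials that form a complete system on one cell, and
  scaling carries completeness to every rectangle. So the convergence of Fourier series on rectangles
  is contained in the data.\<close>

lemma fourier_complete_if_free_bloch_family:
  assumes \<epsilon>: "\<epsilon> > 0" and fam: "bloch_family \<epsilon> (\<lambda>_. 1) \<Psi> \<mu>"
    and ex: "\<forall>j\<in>Z_cell. \<forall>m. \<exists>\<kappa>1 \<kappa>2::int. \<forall>x. \<Psi> j m x = cis (2 * pi * ((of_int \<kappa>1, of_int \<kappa>2) \<bullet> x) / \<epsilon>)"
  obtains \<kappa> where "fourier_complete \<kappa>"
proof -
  have 0: "(0, 0) \<in> Z_cell" by (simp add: Z_cell_def)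
  have "\<forall>m. \<exists>\<kappa>. \<Psi> (0, 0) m = trig \<epsilon> \<epsilon> \<kappa>"
  proof
    fix m
    from ex 0 obtain \<kappa>1 \<kappa>2 :: int where
      "\<forall>x. \<Psi> (0, 0) m x = cis (2 * pi * ((of_int \<kappa>1, of_int \<kappa>2) \<bullet> x) / \<epsilon>)" by blast
    then have "\<Psi> (0, 0) m = trig \<epsilon> \<epsilon> (\<kappa>1, \<kappa>2)"
      by (intro ext) (simp add: trig_def inner_prod_def add_divide_distrib algebra_simps del: split_paired_All)
    then show "\<exists>\<kappa>. \<Psi> (0, 0) m = trig \<epsilon> \<epsilon> \<kappa>" by blast
  qed
  then obtain \<kappa> where \<kappa>: "\<Psi> (0, 0) m = trig \<epsilon> \<epsilon> (\<kappa> m)" for m by metis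
  have "fourier_complete \<kappa>"
    unfolding fourier_complete_def
  proof (intro allI impI)
    fix s1 s2 :: real and w assume s: "s1 > 0" "s2 > 0" and w: "L2_on (cell s1 s2) w"
    \<comment> \<open>The map \<open>D\<close> takes the square cell to the given rectangle and exponentials to exponentials.\<close>
    define D where "D x = (s1 / \<epsilon> * fst x, s2 / \<epsilon> * snd x)" for x :: plane
    have wD: "L2_on (cell \<epsilon> \<epsilon>) (\<lambda>x. w (D x))"
      unfolding D_def by (rule L2_on_cell_scale[OF w s \<epsilon> \<epsilon>])
    have tD: "trig s1 s2 k (D x) = trig \<epsilon> \<epsilon> k x" for k x
      using s \<epsilon> by (cases x) (simp add: trig_def D_def mult.assoc)
    have [measurable]: "w \<in> borel_measurable borel" by (rule L2_onD[OF w])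
    have [measurable]: "trig s1 s2 k \<in> borel_measurable borel" for k
      by (intro borel_measurable_continuous_onI Cinf_continuous Cinf_trig)
    have c: "mean_ip (cell s1 s2) w (trig s1 s2 k) = mean_ip (cell \<epsilon> \<epsilon>) (\<lambda>x. w (D x)) (trig \<epsilon> \<epsilon> k)" for k
      using mean_ip_cell_scale[of w "trig s1 s2 k" s1 s2 \<epsilon> \<epsilon>] s \<epsilon>
      unfolding D_def[symmetric] tD by simp
    have "mean_sq (cell s1 s2) f = mean_sq (cell \<epsilon> \<epsilon>) (\<lambda>x. f (D x))" if "f \<in> borel_measurable borel" for f
      using mean_ip_cell_scale[OF that that s \<epsilon> \<epsilon>] unfolding mean_ip_self D_def by (simp only: of_real_eq_iff)
    then have *: "mean_sq (cell s1 s2) (\<lambda>x. w x - (\<Sum>m<n. mean_ip (cell s1 s2) w (trig s1 s2 (\<kappa> m)) * trig s1 s2 (\<kappa> m) x))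
       = mean_sq (cell \<epsilon> \<epsilon>) (\<lambda>x. w (D x) - (\<Sum>m<n. mean_ip (cell \<epsilon> \<epsilon>) (\<lambda>x. w (D x)) (trig \<epsilon> \<epsilon> (\<kappa> m)) * trig \<epsilon> \<epsilon> (\<kappa> m) x))" for n
      by (simp add: c tD)
    have "L2_has_sum (Y_cell \<epsilon>) (\<lambda>m x. mean_ip (Y_cell \<epsilon>) (\<lambda>x. w (D x)) (\<Psi> (0, 0) m) * \<Psi> (0, 0) m x) UNIV (\<lambda>x. w (D x))"
      using fam 0 wD unfolding bloch_family_def Y_cell_eq by blast
    from L2_has_sum_lessThan[OF this]
    show "(\<lambda>n. mean_sq (cell s1 s2) (\<lambda>x. w x - (\<Sum>m<n. mean_ip (cell s1 s2) w (trig s1 s2 (\<kappa> m)) * trig s1 s2 (\<kappa> m) x))) \<longlonglongrightarrow> 0"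
      unfolding * by (simp add: \<kappa> Y_cell_eq)
  qed
  then show ?thesis by (rule that)
qed

text \<open>\<open>P\<close> is the weak shifted gradient \<open>(\<nabla> + 2\<pi>ij/\<epsilon>)\<rho>\<close> on the torus. The sign is that of an ordinary
  integration by parts because the shift is imaginary and the second slot is conjugated.\<close>

definition bloch_H1 ::
    "real \<Rightarrow> real \<Rightarrow> real \<Rightarrow> plane \<Rightarrow> (plane \<Rightarrow> complex) \<Rightarrow> (plane \<Rightarrow> complex \<times> complex) \<Rightarrow> bool" where
  "bloch_H1 s1 s2 \<epsilon> j \<rho> P \<longleftrightarrow> L2_on (cell s1 s2) \<rho> \<and> L2_pair_on (cell s1 s2) P \<and>
     (\<forall>\<phi>\<in>test_cell s1 s2.
        mean_ip (cell s1 s2) \<rho> (\<lambda>x. fst (tgrad \<epsilon> j \<phi> x)) = - mean_ip (cell s1 s2) (\<lambda>x. fst (P x)) \<phi> \<and>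
        mean_ip (cell s1 s2) \<rho> (\<lambda>x. snd (tgrad \<epsilon> j \<phi> x)) = - mean_ip (cell s1 s2) (\<lambda>x. snd (P x)) \<phi>)"

lemma bloch_H1D:
  assumes "bloch_H1 s1 s2 \<epsilon> j \<rho> P"
  shows "L2_on (cell s1 s2) \<rho>" "L2_on (cell s1 s2) (\<lambda>x. fst (P x))" "L2_on (cell s1 s2) (\<lambda>x. snd (P x))"
    "\<phi> \<in> test_cell s1 s2 \<Longrightarrow> mean_ip (cell s1 s2) \<rho> (\<lambda>x. fst (tgrad \<epsilon> j \<phi> x)) = - mean_ip (cell s1 s2) (\<lambda>x. fst (P x)) \<phi>"
    "\<phi> \<in> test_cell s1 s2 \<Longrightarrow> mean_ip (cell s1 s2) \<rho> (\<lambda>x. snd (tgrad \<epsilon> j \<phi> x)) = - mean_ip (cell s1 s2) (\<lambda>x. snd (P x)) \<phi>"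
  using assms by (auto simp: bloch_H1_def L2_pair_on_def)

lemma bloch_grad_sum_cmult:
  assumes "\<And>i. i \<in> F \<Longrightarrow> Cinf (f i)"
  shows "tgrad \<epsilon> j (\<lambda>x. \<Sum>i\<in>F. c i * f i x) x =
    (\<Sum>i\<in>F. c i * fst (tgrad \<epsilon> j (f i) x), \<Sum>i\<in>F. c i * snd (tgrad \<epsilon> j (f i) x))"
proof -
  have g: "grad (\<lambda>x. \<Sum>i\<in>F. c i * f i x) x = (\<Sum>i\<in>F. c i * fst (grad (f i) x), \<Sum>i\<in>F. c i * snd (grad (f i) x))"
    using assms by (rule grad_sum_cmult)
  have "c i * (a + \<i> * complex_of_real t * b) = c i * a + \<i> * complex_of_real t * (c i * b)" for i a b t
    by (simp add: algebra_simps)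
  then show ?thesis
    unfolding bloch_grad_def g by (simp only: fst_conv snd_conv sum.distrib sum_distrib_left)
qed

lemma test_cell_sum_cmult:
  assumes "\<And>i. i \<in> F \<Longrightarrow> f i \<in> test_cell s1 s2"
  shows "(\<lambda>x. \<Sum>i\<in>F. c i * f i x) \<in> test_cell s1 s2"
  using assms by (auto simp: test_cell_def intro!: Cinf_sum Cinf_mult)

lemma bloch_grad_trig:
  "tgrad \<epsilon> j (trig s1 s2 \<kappa>) x =
    (\<i> * of_real (2 * pi * of_int (fst \<kappa>) / s1 + 2 * pi * fst j / \<epsilon>) * trig s1 s2 \<kappa> x,
     \<i> * of_real (2 * pi * of_int (snd \<kappa>) / s2 + 2 * pi * snd j / \<epsilon>) * trig s1 s2 \<kappa> x)"
proof -
  have "trig s1 s2 \<kappa> = (\<lambda>x. cis ((2 * pi * of_int (fst \<kappa>) / s1, 2 * pi * of_int (snd \<kappa>) / s2) \<bullet> x))"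
    by (simp add: trig_def fun_eq_iff)
  then show ?thesis by (simp add: bloch_grad_def grad_cis_inner algebra_simps)
qed

text \<open>Testing with exponentials shows that the Fourier series of the weak gradient is the termwise
  gradient of the Fourier series of the function. Hence the partial sums converge together with
  their gradients.\<close>

lemma bloch_H1_approx:
  assumes fc: "fourier_complete \<kappa>" and s: "s1 > 0" "s2 > 0" and H: "bloch_H1 s1 s2 \<epsilon> j \<rho> P"
  obtains \<phi> where "\<And>n. \<phi> n \<in> test_cell s1 s2"
    "(\<lambda>n. mean_sq (cell s1 s2) (\<lambda>x. \<rho> x - \<phi> n x)) \<longlonglongrightarrow> 0"
    "(\<lambda>n. mean_sq (cell s1 s2) (\<lambda>x. fst (P x) - fst (tgrad \<epsilon> j (\<phi> n) x))) \<longlonglongrightarrow> 0"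
    "(\<lambda>n. mean_sq (cell s1 s2) (\<lambda>x. snd (P x) - snd (tgrad \<epsilon> j (\<phi> n) x))) \<longlonglongrightarrow> 0"
proof -
  let ?S = "cell s1 s2"
  define e where "e m = trig s1 s2 (\<kappa> m)" for m
  define \<phi> where "\<phi> n = (\<lambda>x. \<Sum>m<n. mean_ip ?S \<rho> (e m) * e m x)" for n :: nat
  have et: "e m \<in> test_cell s1 s2" for m using s by (simp add: e_def trig_test)
  have fe: "fst (tgrad \<epsilon> j (\<phi> n) x) = (\<Sum>m<n. mean_ip ?S (\<lambda>x. fst (P x)) (e m) * e m x)" for n x
  proof -
    have "mean_ip ?S \<rho> (e m) * fst (tgrad \<epsilon> j (e m) x) = mean_ip ?S (\<lambda>x. fst (P x)) (e m) * e m x" for m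
    proof -
      define q where "q = 2 * pi * of_int (fst (\<kappa> m)) / s1 + 2 * pi * fst j / \<epsilon>"
      have t: "fst (tgrad \<epsilon> j (e m) x) = \<i> * complex_of_real q * e m x" for x
        by (simp add: e_def bloch_grad_trig q_def)
      from bloch_H1D(4)[OF H et, of m] show ?thesis
        unfolding t by (simp add: mult_ac)
    qed
    then show ?thesis
      unfolding \<phi>_def by (subst bloch_grad_sum_cmult) (auto simp: test_cellD(1)[OF et])
  qed
  have se: "snd (tgrad \<epsilon> j (\<phi> n) x) = (\<Sum>m<n. mean_ip ?S (\<lambda>x. snd (P x)) (e m) * e m x)" for n x
  proof -
    have "mean_ip ?S \<rho> (e m) * snd (tgrad \<epsilon> j (e m) x) = mean_ip ?S (\<lambda>x. snd (P x)) (e m) * e m x" for m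
    proof -
      define q where "q = 2 * pi * of_int (snd (\<kappa> m)) / s2 + 2 * pi * snd j / \<epsilon>"
      have t: "snd (tgrad \<epsilon> j (e m) x) = \<i> * complex_of_real q * e m x" for x
        by (simp add: e_def bloch_grad_trig q_def)
      from bloch_H1D(5)[OF H et, of m] show ?thesis
        unfolding t by (simp add: mult_ac)
    qed
    then show ?thesis
      unfolding \<phi>_def by (subst bloch_grad_sum_cmult) (auto simp: test_cellD(1)[OF et])
  qed
  have lim: "(\<lambda>n. mean_sq ?S (\<lambda>x. w x - (\<Sum>m<n. mean_ip ?S w (e m) * e m x))) \<longlonglongrightarrow> 0" if "L2_on ?S w" for w
    using fc s that unfolding fourier_complete_def e_def by blast
  show ?thesis
  proof
    show "\<phi> n \<in> test_cell s1 s2" for n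
      unfolding \<phi>_def using et by (rule test_cell_sum_cmult)
    show "(\<lambda>n. mean_sq ?S (\<lambda>x. \<rho> x - \<phi> n x)) \<longlonglongrightarrow> 0"
      unfolding \<phi>_def by (rule lim[OF bloch_H1D(1)[OF H]])
    show "(\<lambda>n. mean_sq ?S (\<lambda>x. fst (P x) - fst (tgrad \<epsilon> j (\<phi> n) x))) \<longlonglongrightarrow> 0"
      unfolding fe by (rule lim[OF bloch_H1D(2)[OF H]])
    show "(\<lambda>n. mean_sq ?S (\<lambda>x. snd (P x) - snd (tgrad \<epsilon> j (\<phi> n) x))) \<longlonglongrightarrow> 0"
      unfolding se by (rule lim[OF bloch_H1D(3)[OF H]])
  qed
qed

text \<open>By the density of trigonometric polynomials a weak equation may be tested with every function that
  has a weak gradient, in particular with the solution itself.\<close>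

lemma weak_equation_extends:
  assumes fc: "fourier_complete \<kappa>" and s: "s1 > 0" "s2 > 0" and H: "bloch_H1 s1 s2 \<epsilon> j \<rho> P"
    and L: "L2_on (cell s1 s2) X1" "L2_on (cell s1 s2) X2" "L2_on (cell s1 s2) C"
    and eq: "\<And>\<phi>. \<phi> \<in> test_cell s1 s2 \<Longrightarrow>
      mean_ip (cell s1 s2) X1 (\<lambda>x. fst (tgrad \<epsilon> j \<phi> x)) + mean_ip (cell s1 s2) X2 (\<lambda>x. snd (tgrad \<epsilon> j \<phi> x))
      = mean_ip (cell s1 s2) C \<phi>"
  shows "mean_ip (cell s1 s2) X1 (\<lambda>x. fst (P x)) + mean_ip (cell s1 s2) X2 (\<lambda>x. snd (P x)) = mean_ip (cell s1 s2) C \<rho>"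
proof -
  let ?S = "cell s1 s2"
  obtain \<phi> where \<phi>: "\<And>n. \<phi> n \<in> test_cell s1 s2"
    "(\<lambda>n. mean_sq ?S (\<lambda>x. \<rho> x - \<phi> n x)) \<longlonglongrightarrow> 0"
    "(\<lambda>n. mean_sq ?S (\<lambda>x. fst (P x) - fst (tgrad \<epsilon> j (\<phi> n) x))) \<longlonglongrightarrow> 0"
    "(\<lambda>n. mean_sq ?S (\<lambda>x. snd (P x) - snd (tgrad \<epsilon> j (\<phi> n) x))) \<longlonglongrightarrow> 0"
    using bloch_H1_approx[OF fc s H] by blast
  note L2 = test_L2_on[OF \<phi>(1) cell_bounded cell_borel]
  have "(\<lambda>n. mean_ip ?S C (\<phi> n)) \<longlonglongrightarrow> mean_ip ?S C \<rho>"
    by (rule mean_ip_tendsto_right[OF cell_borel L2(1) bloch_H1D(1)[OF H] L(3) \<phi>(2)])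
  moreover have "(\<lambda>n. mean_ip ?S X1 (\<lambda>x. fst (tgrad \<epsilon> j (\<phi> n) x)) + mean_ip ?S X2 (\<lambda>x. snd (tgrad \<epsilon> j (\<phi> n) x)))
    \<longlonglongrightarrow> mean_ip ?S X1 (\<lambda>x. fst (P x)) + mean_ip ?S X2 (\<lambda>x. snd (P x))"
    by (intro tendsto_add mean_ip_tendsto_right[OF cell_borel L2(2) bloch_H1D(2)[OF H] L(1) \<phi>(3)]
        mean_ip_tendsto_right[OF cell_borel L2(3) bloch_H1D(3)[OF H] L(2) \<phi>(4)])
  ultimately show ?thesis unfolding eq[OF \<phi>(1)] using LIMSEQ_unique by blast
qed

section \<open>Spectral theory on the periodicity cell\<close>

lemma bloch_H1_sub_cmult:
  assumes \<rho>: "bloch_H1 s1 s2 \<epsilon> j \<rho> P" and \<sigma>: "bloch_H1 s1 s2 \<epsilon> j \<sigma> Q"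
  shows "bloch_H1 s1 s2 \<epsilon> j (\<lambda>x. \<rho> x - c * \<sigma> x) (\<lambda>x. (fst (P x) - c * fst (Q x), snd (P x) - c * snd (Q x)))"
proof -
  let ?S = "cell s1 s2"
  note R = bloch_H1D[OF \<rho>] and Q = bloch_H1D[OF \<sigma>]
  note m = L2_on_diff L2_on_cmult
  show ?thesis
    unfolding bloch_H1_def L2_pair_on_def
  proof (intro conjI ballI)
    fix \<phi> assume \<phi>: "\<phi> \<in> test_cell s1 s2"
    note T = test_L2_on[OF \<phi> cell_bounded cell_borel]
    show "mean_ip ?S (\<lambda>x. \<rho> x - c * \<sigma> x) (\<lambda>x. fst (tgrad \<epsilon> j \<phi> x)) =
       - mean_ip ?S (\<lambda>x. fst (fst (P x) - c * fst (Q x), snd (P x) - c * snd (Q x))) \<phi>"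
      using R(1-3) Q(1-3) T R(4)[OF \<phi>] Q(4)[OF \<phi>] by (simp add: mean_ip_diff_left m)
    show "mean_ip ?S (\<lambda>x. \<rho> x - c * \<sigma> x) (\<lambda>x. snd (tgrad \<epsilon> j \<phi> x)) =
       - mean_ip ?S (\<lambda>x. snd (fst (P x) - c * fst (Q x), snd (P x) - c * snd (Q x))) \<phi>"
      using R(1-3) Q(1-3) T R(5)[OF \<phi>] Q(5)[OF \<phi>] by (simp add: mean_ip_diff_left m)
  qed (use R(1-3) Q(1-3) in \<open>auto intro!: m\<close>)
qed

text \<open>The difference between the shifted gradients for the wave numbers \<open>j + d\<close> and \<open>j\<close>.\<close>

definition phase_shift :: "real \<Rightarrow> plane \<Rightarrow> (plane \<Rightarrow> complex) \<Rightarrow> plane \<Rightarrow> complex \<times> complex" where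
  "phase_shift \<epsilon> d \<rho> x = (\<i> * complex_of_real (2 * pi * fst d / \<epsilon>) * \<rho> x, \<i> * complex_of_real (2 * pi * snd d / \<epsilon>) * \<rho> x)"

lemma bloch_H1_change_phase:
  assumes \<rho>: "bloch_H1 s1 s2 \<epsilon> j \<rho> P"
  shows "bloch_H1 s1 s2 \<epsilon> j' \<rho>
    (\<lambda>x. (fst (P x) + fst (phase_shift \<epsilon> (j' - j) \<rho> x), snd (P x) + snd (phase_shift \<epsilon> (j' - j) \<rho> x)))"
proof -
  let ?S = "cell s1 s2"
  note R = bloch_H1D[OF \<rho>]
  define t1 where "t1 = 2 * pi * fst (j' - j) / \<epsilon>"
  define t2 where "t2 = 2 * pi * snd (j' - j) / \<epsilon>"
  have tg: "fst (tgrad \<epsilon> j' \<phi> x) = fst (tgrad \<epsilon> j \<phi> x) + \<i> * of_real t1 * \<phi> x"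
    "snd (tgrad \<epsilon> j' \<phi> x) = snd (tgrad \<epsilon> j \<phi> x) + \<i> * of_real t2 * \<phi> x" for \<phi> x
    unfolding bloch_grad_def t1_def t2_def by (simp_all add: algebra_simps diff_divide_distrib)
  show ?thesis
    unfolding bloch_H1_def L2_pair_on_def phase_shift_def fst_conv snd_conv t1_def[symmetric] t2_def[symmetric]
  proof (intro conjI ballI)
    fix \<phi> assume \<phi>: "\<phi> \<in> test_cell s1 s2"
    note T = test_L2_on[OF \<phi> cell_bounded cell_borel]
    show "mean_ip ?S \<rho> (\<lambda>x. fst (tgrad \<epsilon> j' \<phi> x)) = - mean_ip ?S (\<lambda>x. fst (P x) + \<i> * of_real t1 * \<rho> x) \<phi>"
      unfolding tg using R(1-3) T R(4)[OF \<phi>]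
      by (simp add: mean_ip_add_left mean_ip_add_right L2_on_cmult)
    show "mean_ip ?S \<rho> (\<lambda>x. snd (tgrad \<epsilon> j' \<phi> x)) = - mean_ip ?S (\<lambda>x. snd (P x) + \<i> * of_real t2 * \<rho> x) \<phi>"
      unfolding tg using R(1-3) T R(5)[OF \<phi>]
      by (simp add: mean_ip_add_left mean_ip_add_right L2_on_cmult)
  qed (use R(1-3) in \<open>auto intro!: L2_on_add L2_on_cmult\<close>)
qed

text \<open>One side of the interface: \<open>b\<close> is the periodic coefficient or the constant 1.\<close>

locale bloch_cell =
  fixes \<epsilon> :: real and b :: "plane \<Rightarrow> real" and \<Psi> :: "plane \<Rightarrow> nat \<Rightarrow> plane \<Rightarrow> complex"
    and \<mu> :: "plane \<Rightarrow> nat \<Rightarrow> real" and a_lo a_hi :: real and \<kappa> :: "nat \<Rightarrow> int \<times> int"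
  assumes \<epsilon>: "\<epsilon> > 0" and b_borel [measurable]: "b \<in> borel_measurable borel" and a_lo: "a_lo > 0"
    and b_bounds: "\<And>x. x \<in> cell \<epsilon> \<epsilon> \<Longrightarrow> a_lo \<le> b x \<and> b x \<le> a_hi"
    and fourier: "fourier_complete \<kappa>" and family: "bloch_family \<epsilon> b \<Psi> \<mu>"
begin

abbreviation "Y \<equiv> cell \<epsilon> \<epsilon>"

lemma a_hi: "a_lo \<le> a_hi" "a_hi > 0"
proof -
  have "(\<epsilon> / 2, \<epsilon> / 2) \<in> Y" using \<epsilon> by (simp add: mem_cell)
  then show "a_lo \<le> a_hi" using b_bounds by force
  then show "a_hi > 0" using a_lo by simp
qed

lemma L2_weight: "L2_on Y f \<Longrightarrow> L2_on Y (\<lambda>x. complex_of_real (b x) * f x)"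
  by (rule L2_on_bounded_mult[where C=a_hi]) (use b_bounds a_lo in \<open>force+\<close>)

lemma L2_sqrt_weight: "L2_on Y f \<Longrightarrow> L2_on Y (\<lambda>x. complex_of_real (sqrt (b x)) * f x)"
proof (rule L2_on_bounded_mult[where C="sqrt a_hi"])
  fix x assume "x \<in> Y"
  then show "norm (complex_of_real (sqrt (b x))) \<le> sqrt a_hi"
    using b_bounds[of x] a_lo by simp
qed auto

definition wip :: "(plane \<Rightarrow> complex) \<Rightarrow> (plane \<Rightarrow> complex) \<Rightarrow> complex" where
  "wip f g = mean_ip Y (\<lambda>x. complex_of_real (b x) * f x) g"

definition wsq :: "(plane \<Rightarrow> complex) \<Rightarrow> real" where
  "wsq f = mean_sq Y (\<lambda>x. complex_of_real (sqrt (b x)) * f x)"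

lemma wip_sqrt: "wip f g = mean_ip Y (\<lambda>x. complex_of_real (sqrt (b x)) * f x) (\<lambda>x. complex_of_real (sqrt (b x)) * g x)"
  unfolding wip_def mean_ip_def
proof (intro arg_cong2[where f="(/)"] set_lebesgue_integral_cong allI impI refl)
  fix x assume "x \<in> Y"
  then have "0 \<le> b x" using b_bounds[of x] a_lo by simp
  then have "complex_of_real (sqrt (b x)) * complex_of_real (sqrt (b x)) = complex_of_real (b x)"
    by (simp flip: of_real_mult)
  then show "complex_of_real (b x) * f x * cnj (g x) =
      complex_of_real (sqrt (b x)) * f x * cnj (complex_of_real (sqrt (b x)) * g x)"
    by (simp add: mult_ac)
qed simp

lemma wsq_bounds:
  assumes "L2_on Y f"
  shows "a_lo * mean_sq Y f \<le> wsq f" "wsq f \<le> a_hi * mean_sq Y f" "0 \<le> wsq f"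
proof -
  have "mean_sq Y (\<lambda>x. complex_of_real (sqrt a_lo) * f x) \<le> wsq f"
    unfolding wsq_def
  proof (rule mean_sq_mono)
    fix x assume "x \<in> Y"
    then show "norm (complex_of_real (sqrt a_lo) * f x) \<le> norm (complex_of_real (sqrt (b x)) * f x)"
      using b_bounds[of x] a_lo by (simp add: norm_mult mult_right_mono)
  qed (use L2_sqrt_weight assms in auto)
  then show "a_lo * mean_sq Y f \<le> wsq f" using a_lo by simp
  have "wsq f \<le> (sqrt a_hi)\<^sup>2 * mean_sq Y f"
    unfolding wsq_def
  proof (rule mean_sq_bounded_mult)
    fix x assume "x \<in> Y"
    then show "norm (complex_of_real (sqrt (b x))) \<le> sqrt a_hi"
      using b_bounds[of x] a_lo by simp
  qed (use assms in auto)
  then show "wsq f \<le> a_hi * mean_sq Y f" using a_hi by simp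
qed (simp add: wsq_def)

definition form :: "(plane \<Rightarrow> complex \<times> complex) \<Rightarrow> (plane \<Rightarrow> complex \<times> complex) \<Rightarrow> complex" where
  "form P Q = wip (\<lambda>x. fst (P x)) (\<lambda>x. fst (Q x)) + wip (\<lambda>x. snd (P x)) (\<lambda>x. snd (Q x))"

definition en :: "(plane \<Rightarrow> complex \<times> complex) \<Rightarrow> real" where
  "en P = wsq (\<lambda>x. fst (P x)) + wsq (\<lambda>x. snd (P x))"

lemma en_nonneg [simp]: "0 \<le> en P"
  by (simp add: en_def wsq_def)

lemma form_self: "form P P = complex_of_real (en P)"
  by (simp add: form_def en_def wip_sqrt wsq_def mean_ip_self)

lemma form_cnj: "form Q P = cnj (form P Q)"
  unfolding form_def wip_sqrt complex_cnj_add by (intro arg_cong2[where f="(+)"] mean_ip_cnj)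

lemma wip_diff_cmult_left:
  assumes "L2_on Y f" "L2_on Y g" "L2_on Y w"
  shows "wip (\<lambda>x. f x - c * g x) w = wip f w - c * wip g w"
proof -
  have "wip (\<lambda>x. f x - c * g x) w = mean_ip Y (\<lambda>x. complex_of_real (b x) * f x - c * (complex_of_real (b x) * g x)) w"
    unfolding wip_def by (intro arg_cong2[where f="mean_ip Y"]) (auto simp: algebra_simps)
  then show ?thesis
    using assms by (simp add: mean_ip_diff_left L2_weight L2_on_cmult) (simp add: wip_def)
qed

lemma form_diff_cmult_left:
  assumes "L2_pair_on Y P" "L2_pair_on Y Q" "L2_pair_on Y R"
  shows "form (\<lambda>x. (fst (P x) - c * fst (Q x), snd (P x) - c * snd (Q x))) R = form P R - c * form Q R"
  using assms by (simp add: form_def L2_pair_on_def wip_diff_cmult_left algebra_simps)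

lemma L2_pair_diff_cmult:
  assumes "L2_pair_on Y P" "L2_pair_on Y Q"
  shows "L2_pair_on Y (\<lambda>x. (fst (P x) - c * fst (Q x), snd (P x) - c * snd (Q x)))"
  using assms by (auto simp: L2_pair_on_def intro!: L2_on_diff L2_on_cmult)

lemma form_diff_cmult_right:
  assumes "L2_pair_on Y P" "L2_pair_on Y Q" "L2_pair_on Y R"
  shows "form R (\<lambda>x. (fst (P x) - c * fst (Q x), snd (P x) - c * snd (Q x))) = form R P - cnj c * form R Q"
  using form_diff_cmult_left[OF assms, of c] by (simp add: form_cnj[of R])

lemma en_diff_cmult:
  assumes P: "L2_pair_on Y P" and Q: "L2_pair_on Y Q"
  shows "en (\<lambda>x. (fst (P x) - c * fst (Q x), snd (P x) - c * snd (Q x))) =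
    en P - 2 * Re (cnj c * form P Q) + (norm c)\<^sup>2 * en Q"
proof -
  let ?D = "\<lambda>x. (fst (P x) - c * fst (Q x), snd (P x) - c * snd (Q x))"
  have "complex_of_real (en ?D) = form P P - cnj c * form P Q - c * (form Q P - cnj c * form Q Q)"
    unfolding form_self[symmetric]
    by (simp add: form_diff_cmult_left[OF P Q L2_pair_diff_cmult[OF P Q]]
        form_diff_cmult_right[OF P Q P] form_diff_cmult_right[OF P Q Q])
  also have "\<dots> = form P P - cnj c * form P Q - cnj (cnj c * form P Q) + (c * cnj c) * form Q Q"
    by (simp add: form_cnj[of Q P] algebra_simps)
  also have "\<dots> = complex_of_real (en P - 2 * Re (cnj c * form P Q) + (norm c)\<^sup>2 * en Q)"
    by (simp add: form_self complex_norm_square[symmetric] complex_eq_iff)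
  finally show ?thesis using of_real_eq_iff by blast
qed

lemma form_Cauchy_Schwarz:
  assumes P: "L2_pair_on Y P" and Q: "L2_pair_on Y Q"
  shows "norm (form P Q) \<le> sqrt (en P) * sqrt (en Q)"
proof -
  define p1 p2 q1 q2 where "p1 = sqrt (wsq (\<lambda>x. fst (P x)))" and "p2 = sqrt (wsq (\<lambda>x. snd (P x)))"
    and "q1 = sqrt (wsq (\<lambda>x. fst (Q x)))" and "q2 = sqrt (wsq (\<lambda>x. snd (Q x)))"
  have nn: "0 \<le> p1" "0 \<le> p2" "0 \<le> q1" "0 \<le> q2" by (simp_all add: p1_def p2_def q1_def q2_def wsq_def)
  have sq: "en P = p1\<^sup>2 + p2\<^sup>2" "en Q = q1\<^sup>2 + q2\<^sup>2"
    by (simp_all add: en_def p1_def p2_def q1_def q2_def wsq_def)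
  have "norm (form P Q) \<le> p1 * q1 + p2 * q2"
    unfolding form_def p1_def p2_def q1_def q2_def wip_sqrt wsq_def
    using P Q by (intro order_trans[OF norm_triangle_ineq] add_mono mean_ip_Cauchy_Schwarz L2_sqrt_weight)
       (auto simp: L2_pair_on_def)
  also have "\<dots> \<le> sqrt (en P) * sqrt (en Q)"
  proof -
    have "(p1 * q1 + p2 * q2)\<^sup>2 \<le> (p1\<^sup>2 + p2\<^sup>2) * (q1\<^sup>2 + q2\<^sup>2)"
      using zero_le_power2[of "p1 * q2 - p2 * q1"] by (simp add: power2_eq_square algebra_simps)
    then show ?thesis unfolding sq real_sqrt_mult[symmetric] by (rule real_le_rsqrt)
  qed
  finally show ?thesis .
qed

lemma sqrt_en_triangle:
  assumes P: "L2_pair_on Y P" and Q: "L2_pair_on Y Q"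
  shows "sqrt (en (\<lambda>x. (fst (P x) + fst (Q x), snd (P x) + snd (Q x)))) \<le> sqrt (en P) + sqrt (en Q)"
proof (rule real_le_lsqrt)
  have "Re (form P Q) \<le> sqrt (en P) * sqrt (en Q)"
    using complex_Re_le_cmod form_Cauchy_Schwarz[OF P Q] by (rule order_trans)
  then show "en (\<lambda>x. (fst (P x) + fst (Q x), snd (P x) + snd (Q x))) \<le> (sqrt (en P) + sqrt (en Q))\<^sup>2"
    using en_diff_cmult[OF P Q, of "-1"] by (simp add: power2_sum)
qed auto

lemma en_bounds:
  assumes "L2_pair_on Y P"
  shows "a_lo * (mean_sq Y (\<lambda>x. fst (P x)) + mean_sq Y (\<lambda>x. snd (P x))) \<le> en P"
    "en P \<le> a_hi * (mean_sq Y (\<lambda>x. fst (P x)) + mean_sq Y (\<lambda>x. snd (P x)))"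
    "mean_sq Y (\<lambda>x. fst (P x)) \<le> en P / a_lo"
proof -
  note w = wsq_bounds[of "\<lambda>x. fst (P x)"] wsq_bounds[of "\<lambda>x. snd (P x)"]
  show A: "a_lo * (mean_sq Y (\<lambda>x. fst (P x)) + mean_sq Y (\<lambda>x. snd (P x))) \<le> en P"
    using w assms by (simp add: en_def L2_pair_on_def ring_distribs)
  show "en P \<le> a_hi * (mean_sq Y (\<lambda>x. fst (P x)) + mean_sq Y (\<lambda>x. snd (P x)))"
    using w assms by (simp add: en_def L2_pair_on_def ring_distribs)
  have "a_lo * mean_sq Y (\<lambda>x. fst (P x)) \<le> en P"
    using A a_lo by (smt (verit, best) mean_sq_nonneg mult_left_mono)
  then show "mean_sq Y (\<lambda>x. fst (P x)) \<le> en P / a_lo"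
    using a_lo by (simp add: field_simps)
qed

subsection \<open>Eigenfunctions\<close>

abbreviation H1 :: "plane \<Rightarrow> (plane \<Rightarrow> complex) \<Rightarrow> (plane \<Rightarrow> complex \<times> complex) \<Rightarrow> bool" where
  "H1 \<equiv> bloch_H1 \<epsilon> \<epsilon> \<epsilon>"

lemma H1_pair: "H1 j \<rho> P \<Longrightarrow> L2_pair_on Y P"
  by (simp add: bloch_H1_def)

lemma Psi_periodic: "j \<in> Z_cell \<Longrightarrow> periodic2 \<epsilon> (\<Psi> j m)"
  using family by (auto simp: bloch_family_def)

lemma Psi_orthonormal: "j \<in> Z_cell \<Longrightarrow> mean_ip Y (\<Psi> j m) (\<Psi> j n) = (if m = n then 1 else 0)"
  using family by (auto simp: bloch_family_def Y_cell_eq)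

lemma mu_mono: "j \<in> Z_cell \<Longrightarrow> m \<le> n \<Longrightarrow> \<mu> j m \<le> \<mu> j n"
  using family by (auto simp: bloch_family_def mono_def)

text \<open>Besides the existence of the gradient this records the eigenvalue equation in the form in which all
  functions with a weak gradient are admissible test functions.\<close>

lemma ex_Gamma:
  assumes j: "j \<in> Z_cell"
  shows "\<exists>\<Gamma>. H1 j (\<Psi> j m) \<Gamma> \<and> (\<forall>\<rho> P. H1 j \<rho> P \<longrightarrow> form \<Gamma> P = complex_of_real (\<mu> j m) * mean_ip Y (\<Psi> j m) \<rho>)"
proof -
  let ?\<psi> = "\<Psi> j m"
  have "bloch_weak_eq \<epsilon> b j (\<mu> j m) ?\<psi>" using family j by (auto simp: bloch_family_def)
  then obtain g where \<psi>: "L2_on Y ?\<psi>" and g: "L2_pair_on Y g" and wg: "has_weak_grad Y (test_cell \<epsilon> \<epsilon>) ?\<psi> g"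
    and eq: "\<And>\<phi>. \<phi> \<in> test_cell \<epsilon> \<epsilon> \<Longrightarrow> (LINT x:Y|lborel. complex_of_real (b x) *
             cdot (bloch_grad \<epsilon> j ?\<psi> g x) (tgrad \<epsilon> j \<phi> x)) =
          complex_of_real (\<mu> j m) * (LINT x:Y|lborel. ?\<psi> x * cnj (\<phi> x))"
    by (auto simp: bloch_weak_eq_def Y_cell_eq test_torus_eq)
  define \<Gamma> where "\<Gamma> = bloch_grad \<epsilon> j ?\<psi> g"
  have \<Gamma>L: "L2_on Y (\<lambda>x. fst (\<Gamma> x))" "L2_on Y (\<lambda>x. snd (\<Gamma> x))"
    using g \<psi> unfolding \<Gamma>_def bloch_grad_def L2_pair_on_def fst_conv snd_conv
    by (auto intro!: L2_on_add L2_on_cmult simp del: of_real_mult of_real_divide times_divide_eq_left times_divide_eq_right)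
  have H: "H1 j ?\<psi> \<Gamma>"
    unfolding bloch_H1_def L2_pair_on_def
  proof (intro conjI ballI \<psi> \<Gamma>L)
    fix \<phi> assume \<phi>: "\<phi> \<in> test_cell \<epsilon> \<epsilon>"
    note T = test_L2_on[OF \<phi> cell_bounded cell_borel]
    note T0 = test_L2_on(2,3)[OF \<phi> cell_bounded cell_borel, where j="(0, 0)"]
    have T1: "L2_on Y (\<lambda>x. fst (grad \<phi> x))" "L2_on Y (\<lambda>x. snd (grad \<phi> x))"
      using T0 by (simp_all add: bloch_grad_def)
    have c: "(\<lambda>x. cnj (\<phi> x)) \<in> test_cell \<epsilon> \<epsilon>"
      using \<phi> by (auto simp: test_cell_def Cinf_cnj)
    from wg[unfolded has_weak_grad_def, rule_format, OF c]
    have 1: "mean_ip Y ?\<psi> (\<lambda>x. fst (grad \<phi> x)) = - mean_ip Y (\<lambda>x. fst (g x)) \<phi>"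
      and 2: "mean_ip Y ?\<psi> (\<lambda>x. snd (grad \<phi> x)) = - mean_ip Y (\<lambda>x. snd (g x)) \<phi>"
      by (simp_all add: mean_ip_def grad_cnj[OF test_cellD(1)[OF \<phi>]])
    show "mean_ip Y ?\<psi> (\<lambda>x. fst (tgrad \<epsilon> j \<phi> x)) = - mean_ip Y (\<lambda>x. fst (\<Gamma> x)) \<phi>"
      unfolding \<Gamma>_def bloch_grad_def fst_conv
      using \<psi> g T(1) T1 1 by (simp add: mean_ip_add_left mean_ip_add_right L2_on_cmult L2_pair_on_def del: of_real_divide of_real_mult)
    show "mean_ip Y ?\<psi> (\<lambda>x. snd (tgrad \<epsilon> j \<phi> x)) = - mean_ip Y (\<lambda>x. snd (\<Gamma> x)) \<phi>"
      unfolding \<Gamma>_def bloch_grad_def snd_conv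
      using \<psi> g T(1) T1 2 by (simp add: mean_ip_add_left mean_ip_add_right L2_on_cmult L2_pair_on_def del: of_real_divide of_real_mult)
  qed
  moreover have "form \<Gamma> P = complex_of_real (\<mu> j m) * mean_ip Y ?\<psi> \<rho>" if P: "H1 j \<rho> P" for \<rho> P
  proof -
    have "wip (\<lambda>x. fst (\<Gamma> x)) (\<lambda>x. fst (P x)) + wip (\<lambda>x. snd (\<Gamma> x)) (\<lambda>x. snd (P x))
        = mean_ip Y (\<lambda>x. complex_of_real (\<mu> j m) * ?\<psi> x) \<rho>"
      unfolding wip_def
    proof (rule weak_equation_extends[OF fourier \<epsilon> \<epsilon> P])
      fix \<phi> assume \<phi>: "\<phi> \<in> test_cell \<epsilon> \<epsilon>"
      note T = test_L2_on[OF \<phi> cell_bounded cell_borel]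
      have "mean_ip Y (\<lambda>x. complex_of_real (b x) * fst (\<Gamma> x)) (\<lambda>x. fst (tgrad \<epsilon> j \<phi> x)) +
        mean_ip Y (\<lambda>x. complex_of_real (b x) * snd (\<Gamma> x)) (\<lambda>x. snd (tgrad \<epsilon> j \<phi> x)) =
        (LINT x:Y|lborel. complex_of_real (b x) * cdot (\<Gamma> x) (tgrad \<epsilon> j \<phi> x)) / complex_of_real (measure lborel Y)"
        unfolding mean_ip_def add_divide_distrib[symmetric] cdot_def
        using L2_prod_integrable[OF cell_borel L2_weight[OF \<Gamma>L(1)] T(2)[where j=j and \<epsilon>=\<epsilon>]]
          L2_prod_integrable[OF cell_borel L2_weight[OF \<Gamma>L(2)] T(3)[where j=j and \<epsilon>=\<epsilon>]]
        by (subst set_integral_add(2)[symmetric]) (simp_all add: ring_distribs mult.assoc)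
      also have "\<dots> = mean_ip Y (\<lambda>x. complex_of_real (\<mu> j m) * ?\<psi> x) \<phi>"
        unfolding \<Gamma>_def eq[OF \<phi>] by (simp add: mean_ip_def mult.assoc)
      finally show "mean_ip Y (\<lambda>x. complex_of_real (b x) * fst (\<Gamma> x)) (\<lambda>x. fst (tgrad \<epsilon> j \<phi> x)) +
        mean_ip Y (\<lambda>x. complex_of_real (b x) * snd (\<Gamma> x)) (\<lambda>x. snd (tgrad \<epsilon> j \<phi> x)) =
        mean_ip Y (\<lambda>x. complex_of_real (\<mu> j m) * ?\<psi> x) \<phi>" .
    qed (auto intro!: L2_weight L2_on_cmult \<Gamma>L \<psi>)
    then show ?thesis by (simp add: form_def)
  qed
  ultimately show ?thesis by blast
qed

text \<open>The shifted gradient of the eigenfunction.\<close>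

definition \<Gamma> :: "plane \<Rightarrow> nat \<Rightarrow> plane \<Rightarrow> complex \<times> complex" where
  "\<Gamma> j m = (SOME \<Gamma>. H1 j (\<Psi> j m) \<Gamma> \<and>
     (\<forall>\<rho> P. H1 j \<rho> P \<longrightarrow> form \<Gamma> P = complex_of_real (\<mu> j m) * mean_ip Y (\<Psi> j m) \<rho>))"

lemma Gamma:
  assumes "j \<in> Z_cell"
  shows "H1 j (\<Psi> j m) (\<Gamma> j m)"
    and "H1 j \<rho> P \<Longrightarrow> form (\<Gamma> j m) P = complex_of_real (\<mu> j m) * mean_ip Y (\<Psi> j m) \<rho>"
  using someI_ex[OF ex_Gamma[OF assms, of m]] unfolding \<Gamma>_def by blast+

lemma Psi_L2: "j \<in> Z_cell \<Longrightarrow> L2_on Y (\<Psi> j m)"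
  using bloch_H1D(1)[OF Gamma(1)] .

lemma Psi_mean_sq: "j \<in> Z_cell \<Longrightarrow> mean_sq Y (\<Psi> j m) = 1"
  using Psi_orthonormal[of j m m] unfolding mean_ip_self by simp

lemma en_Gamma: "j \<in> Z_cell \<Longrightarrow> en (\<Gamma> j m) = \<mu> j m"
  using Gamma(2)[OF _ Gamma(1), of j m m] unfolding form_self by (simp add: Psi_orthonormal)

lemma mu_nonneg: "j \<in> Z_cell \<Longrightarrow> 0 \<le> \<mu> j m"
  using en_Gamma en_nonneg by metis

text \<open>Subtracting the component along one eigenfunction lowers the energy by its share.\<close>

lemma en_remove_component:
  fixes m :: nat
  assumes j: "j \<in> Z_cell" and \<rho>: "H1 j \<rho> P"
  defines "c \<equiv> mean_ip Y \<rho> (\<Psi> j m)"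
  shows "en (\<lambda>x. (fst (P x) - c * fst (\<Gamma> j m x), snd (P x) - c * snd (\<Gamma> j m x))) = en P - \<mu> j m * (norm c)\<^sup>2"
    and "n \<noteq> m \<Longrightarrow> mean_ip Y (\<lambda>x. \<rho> x - c * \<Psi> j m x) (\<Psi> j n) = mean_ip Y \<rho> (\<Psi> j n)"
    and "mean_ip Y (\<lambda>x. \<rho> x - c * \<Psi> j m x) (\<Psi> j m) = 0"
    and "mean_sq Y (\<lambda>x. \<rho> x - c * \<Psi> j m x) = mean_sq Y \<rho> - (norm c)\<^sup>2"
proof -
  note L = bloch_H1D(1)[OF \<rho>] L2_on_cmult[OF cell_borel Psi_L2[OF j]] Psi_L2[OF j]
  have cc: "cnj c * c = complex_of_real ((norm c)\<^sup>2)"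
    by (simp only: complex_norm_square mult.commute)
  have "form P (\<Gamma> j m) = cnj (form (\<Gamma> j m) P)" by (rule form_cnj)
  also have "\<dots> = \<mu> j m * c"
    unfolding Gamma(2)[OF j \<rho>] c_def mean_ip_cnj[of Y "\<Psi> j m" \<rho>] by simp
  finally have f: "cnj c * form P (\<Gamma> j m) = complex_of_real (\<mu> j m * (norm c)\<^sup>2)"
    using cc by (simp add: mult.left_commute)
  show "en (\<lambda>x. (fst (P x) - c * fst (\<Gamma> j m x), snd (P x) - c * snd (\<Gamma> j m x))) = en P - \<mu> j m * (norm c)\<^sup>2"
    unfolding en_diff_cmult[OF H1_pair[OF \<rho>] H1_pair[OF Gamma(1)[OF j]]] f en_Gamma[OF j] by simp
  show "n \<noteq> m \<Longrightarrow> mean_ip Y (\<lambda>x. \<rho> x - c * \<Psi> j m x) (\<Psi> j n) = mean_ip Y \<rho> (\<Psi> j n)"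
    using L by (simp add: mean_ip_diff_left Psi_orthonormal[OF j])
  show "mean_ip Y (\<lambda>x. \<rho> x - c * \<Psi> j m x) (\<Psi> j m) = 0"
    using L by (simp add: mean_ip_diff_left Psi_orthonormal[OF j] c_def)
  have "cnj c * mean_ip Y \<rho> (\<Psi> j m) = complex_of_real ((norm c)\<^sup>2)" using cc by (simp add: c_def)
  then show "mean_sq Y (\<lambda>x. \<rho> x - c * \<Psi> j m x) = mean_sq Y \<rho> - (norm c)\<^sup>2"
    using L by (simp add: mean_sq_diff_expand Psi_mean_sq[OF j])
qed

text \<open>Removing the components one after the other leaves a nonnegative energy.\<close>

lemma energy_Bessel:
  assumes j: "j \<in> Z_cell" and \<rho>: "H1 j \<rho> P"
  shows "(\<Sum>m<n. \<mu> j m * (norm (mean_ip Y \<rho> (\<Psi> j m)))\<^sup>2) \<le> en P"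
proof -
  have "\<exists>\<rho>' P'. H1 j \<rho>' P' \<and> (\<forall>m\<ge>n. mean_ip Y \<rho>' (\<Psi> j m) = mean_ip Y \<rho> (\<Psi> j m)) \<and>
      en P' = en P - (\<Sum>m<n. \<mu> j m * (norm (mean_ip Y \<rho> (\<Psi> j m)))\<^sup>2)"
  proof (induction n)
    case 0
    show ?case using \<rho> by (intro exI[of _ \<rho>] exI[of _ P]) simp
  next
    case (Suc n)
    then obtain \<rho>' P' where H: "H1 j \<rho>' P'" and c: "\<And>m. m \<ge> n \<Longrightarrow> mean_ip Y \<rho>' (\<Psi> j m) = mean_ip Y \<rho> (\<Psi> j m)"
      and e: "en P' = en P - (\<Sum>m<n. \<mu> j m * (norm (mean_ip Y \<rho> (\<Psi> j m)))\<^sup>2)" by blast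
    show ?case
      using bloch_H1_sub_cmult[OF H Gamma(1)[OF j, of n], of "mean_ip Y \<rho>' (\<Psi> j n)"]
        en_remove_component(1,2)[OF j H, where m=n] c e
      by (intro exI conjI allI impI) (assumption, auto)
  qed
  then obtain P' where "en P' = en P - (\<Sum>m<n. \<mu> j m * (norm (mean_ip Y \<rho> (\<Psi> j m)))\<^sup>2)" by blast
  then show ?thesis using en_nonneg[of P'] by linarith
qed

lemma Psi_Parseval:
  assumes j: "j \<in> Z_cell" and \<rho>: "L2_on Y \<rho>"
  shows "(\<lambda>n. \<Sum>m<n. (norm (mean_ip Y \<rho> (\<Psi> j m)))\<^sup>2) \<longlonglongrightarrow> mean_sq Y \<rho>"
proof -
  have "L2_has_sum Y (\<lambda>m x. mean_ip Y \<rho> (\<Psi> j m) * \<Psi> j m x) UNIV \<rho>"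
    using family j \<rho> by (auto simp: bloch_family_def Y_cell_eq)
  from L2_has_sum_lessThan[OF this]
  have "(\<lambda>n. mean_sq Y \<rho> - (\<Sum>m<n. (norm (mean_ip Y \<rho> (\<Psi> j m)))\<^sup>2)) \<longlonglongrightarrow> 0"
    by (subst (asm) mean_sq_orthonormal_remainder) (auto simp: \<rho> Psi_L2[OF j] Psi_orthonormal[OF j])
  from tendsto_diff[OF tendsto_const[of "mean_sq Y \<rho>"] this] show ?thesis by simp
qed

text \<open>The variational bound: with Parseval's identity for the function and Bessel's inequality for its
  energy, only the eigenvalues whose eigenfunctions are present matter.\<close>

lemma spectral_gap:
  assumes j: "j \<in> Z_cell" and \<rho>: "H1 j \<rho> P"
    and M: "\<And>m. mean_ip Y \<rho> (\<Psi> j m) \<noteq> 0 \<Longrightarrow> M \<le> \<mu> j m"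
  shows "M * mean_sq Y \<rho> \<le> en P"
proof (rule LIMSEQ_le_const2)
  show "(\<lambda>n. M * (\<Sum>m<n. (norm (mean_ip Y \<rho> (\<Psi> j m)))\<^sup>2)) \<longlonglongrightarrow> M * mean_sq Y \<rho>"
    by (intro tendsto_mult tendsto_const Psi_Parseval j bloch_H1D(1)[OF \<rho>])
  have "M * (\<Sum>m<n. (norm (mean_ip Y \<rho> (\<Psi> j m)))\<^sup>2) \<le> en P" for n
  proof -
    have "M * (\<Sum>m<n. (norm (mean_ip Y \<rho> (\<Psi> j m)))\<^sup>2) \<le> (\<Sum>m<n. \<mu> j m * (norm (mean_ip Y \<rho> (\<Psi> j m)))\<^sup>2)"
      unfolding sum_distrib_left
    proof (rule sum_mono)
      fix m show "M * (norm (mean_ip Y \<rho> (\<Psi> j m)))\<^sup>2 \<le> \<mu> j m * (norm (mean_ip Y \<rho> (\<Psi> j m)))\<^sup>2"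
        using M[of m] by (cases "mean_ip Y \<rho> (\<Psi> j m) = 0") (auto intro: mult_right_mono)
    qed
    then show ?thesis using energy_Bessel[OF j \<rho>, of n] by linarith
  qed
  then show "\<exists>N. \<forall>n\<ge>N. M * (\<Sum>m<n. (norm (mean_ip Y \<rho> (\<Psi> j m)))\<^sup>2) \<le> en P" by blast
qed

lemma ground_decomposition:
  assumes j: "j \<in> Z_cell" and \<rho>: "H1 j \<rho> P" and \<Lambda>: "\<And>m. m \<ge> 1 \<Longrightarrow> \<Lambda> \<le> \<mu> j m"
  defines "\<alpha> \<equiv> mean_ip Y \<rho> (\<Psi> j 0)"
  defines "r \<equiv> \<lambda>x. \<rho> x - \<alpha> * \<Psi> j 0 x"
  defines "Q \<equiv> \<lambda>x. (fst (P x) - \<alpha> * fst (\<Gamma> j 0 x), snd (P x) - \<alpha> * snd (\<Gamma> j 0 x))"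
  shows "H1 j r Q" "mean_sq Y \<rho> = (norm \<alpha>)\<^sup>2 + mean_sq Y r" "en P = \<mu> j 0 * (norm \<alpha>)\<^sup>2 + en Q"
    "\<Lambda> * mean_sq Y r \<le> en Q" "mean_ip Y (\<Psi> j 0) r = 0"
    "m \<ge> 1 \<Longrightarrow> mean_ip Y r (\<Psi> j m) = mean_ip Y \<rho> (\<Psi> j m)"
proof -
  show H: "H1 j r Q" unfolding r_def Q_def by (rule bloch_H1_sub_cmult[OF \<rho> Gamma(1)[OF j]])
  note e = en_remove_component[OF j \<rho>, of 0, folded \<alpha>_def, folded r_def Q_def]
  show "mean_sq Y \<rho> = (norm \<alpha>)\<^sup>2 + mean_sq Y r" "en P = \<mu> j 0 * (norm \<alpha>)\<^sup>2 + en Q"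
    using e(1,4) en_remove_component(2)[OF j \<rho>, where m=0] by auto
  show "mean_ip Y (\<Psi> j 0) r = 0" using e(3) by (subst mean_ip_cnj) simp
  show "m \<ge> 1 \<Longrightarrow> mean_ip Y r (\<Psi> j m) = mean_ip Y \<rho> (\<Psi> j m)"
    unfolding r_def \<alpha>_def using en_remove_component(2)[OF j \<rho>, of m 0] by simp
  show "\<Lambda> * mean_sq Y r \<le> en Q"
    using e(3) \<Lambda> by (intro spectral_gap[OF j H]) (metis One_nat_def Suc_leI not_gr_zero)
qed

lemma ground_energy_minimal: "j \<in> Z_cell \<Longrightarrow> H1 j \<rho> P \<Longrightarrow> \<mu> j 0 * mean_sq Y \<rho> \<le> en P"
  by (rule spectral_gap) (auto intro: mu_mono)

subsection \<open>Flux of a Bloch wave\<close>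

definition flux :: "(plane \<Rightarrow> complex) \<Rightarrow> (plane \<Rightarrow> complex \<times> complex) \<Rightarrow> real" where
  "flux \<rho> P = Im (wip (\<lambda>x. fst (P x)) \<rho>)"

lemma wip_le:
  assumes "L2_pair_on Y P" "L2_on Y \<rho>"
  shows "norm (wip (\<lambda>x. fst (P x)) \<rho>) \<le> sqrt (en P) * sqrt (a_hi * mean_sq Y \<rho>)"
proof -
  have "norm (wip (\<lambda>x. fst (P x)) \<rho>) \<le> sqrt (wsq (\<lambda>x. fst (P x))) * sqrt (wsq \<rho>)"
    unfolding wip_sqrt wsq_def using assms
    by (intro mean_ip_Cauchy_Schwarz L2_sqrt_weight) (auto simp: L2_pair_on_def)
  also have "\<dots> \<le> sqrt (en P) * sqrt (a_hi * mean_sq Y \<rho>)"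
    using wsq_bounds(2)[OF assms(2)] by (intro mult_mono real_sqrt_le_mono) (auto simp: en_def wsq_def)
  finally show ?thesis .
qed

text \<open>Replacing a function by its ground state component changes the flux by the cross terms, and these
  are controlled by the remainder and its gradient.\<close>

lemma flux_approx:
  assumes j: "j \<in> Z_cell" and \<rho>: "H1 j \<rho> P" and \<Lambda>: "\<And>m. m \<ge> 1 \<Longrightarrow> \<Lambda> \<le> \<mu> j m"
  defines "\<alpha> \<equiv> mean_ip Y \<rho> (\<Psi> j 0)"
  defines "r \<equiv> \<lambda>x. \<rho> x - \<alpha> * \<Psi> j 0 x"
  defines "Q \<equiv> \<lambda>x. (fst (P x) - \<alpha> * fst (\<Gamma> j 0 x), snd (P x) - \<alpha> * snd (\<Gamma> j 0 x))"
  shows "\<bar>flux \<rho> P - (norm \<alpha>)\<^sup>2 * flux (\<Psi> j 0) (\<Gamma> j 0)\<bar>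
    \<le> sqrt a_hi * (sqrt (\<mu> j 0) * sqrt (mean_sq Y r) + sqrt (en Q)) * sqrt (mean_sq Y \<rho>)"
proof -
  note d = ground_decomposition[OF j \<rho> \<Lambda>, folded \<alpha>_def, folded r_def Q_def]
  note L\<rho> = bloch_H1D[OF \<rho>] and LG = bloch_H1D[OF Gamma(1)[OF j, of 0]] and Lr = bloch_H1D[OF d(1)]
  let ?G = "\<lambda>x. fst (\<Gamma> j 0 x)"
  have 1: "wip (\<lambda>x. fst (Q x)) \<rho> = wip (\<lambda>x. fst (P x)) \<rho> - \<alpha> * wip ?G \<rho>"
    unfolding Q_def fst_conv by (rule wip_diff_cmult_left[OF L\<rho>(2) LG(2) L\<rho>(1)])
  have 2: "wip ?G r = wip ?G \<rho> - cnj \<alpha> * wip ?G (\<Psi> j 0)"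
    unfolding r_def wip_def
    using mean_ip_diff_right[OF cell_borel L\<rho>(1) L2_on_cmult[OF cell_borel LG(1)] L2_weight[OF LG(2)]] by simp
  have 3: "wip (\<lambda>x. fst (P x)) \<rho> = (\<alpha> * cnj \<alpha>) * wip ?G (\<Psi> j 0) + (\<alpha> * wip ?G r + wip (\<lambda>x. fst (Q x)) \<rho>)"
    unfolding 1 2 by (simp add: algebra_simps)
  have "flux \<rho> P - (norm \<alpha>)\<^sup>2 * flux (\<Psi> j 0) (\<Gamma> j 0) = Im (\<alpha> * wip ?G r + wip (\<lambda>x. fst (Q x)) \<rho>)"
    unfolding flux_def 3 complex_norm_square[symmetric] by simp
  also have "\<bar>\<dots>\<bar> \<le> norm (\<alpha> * wip ?G r + wip (\<lambda>x. fst (Q x)) \<rho>)" by (rule abs_Im_le_cmod)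
  also have "\<dots> \<le> norm \<alpha> * norm (wip ?G r) + norm (wip (\<lambda>x. fst (Q x)) \<rho>)"
    by (metis norm_mult norm_triangle_ineq)
  also have "\<dots> \<le> sqrt (mean_sq Y \<rho>) * (sqrt (\<mu> j 0) * sqrt (a_hi * mean_sq Y r)) + sqrt (en Q) * sqrt (a_hi * mean_sq Y \<rho>)"
  proof (intro add_mono mult_mono)
    show "norm \<alpha> \<le> sqrt (mean_sq Y \<rho>)" using d(2) by (simp add: real_le_rsqrt)
    show "norm (wip ?G r) \<le> sqrt (\<mu> j 0) * sqrt (a_hi * mean_sq Y r)"
      using wip_le[OF H1_pair[OF Gamma(1)[OF j, of 0]] Lr(1)] by (simp add: en_Gamma[OF j])
    show "norm (wip (\<lambda>x. fst (Q x)) \<rho>) \<le> sqrt (en Q) * sqrt (a_hi * mean_sq Y \<rho>)"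
      by (rule wip_le[OF H1_pair[OF d(1)] L\<rho>(1)])
  qed auto
  also have "\<dots> = sqrt a_hi * (sqrt (\<mu> j 0) * sqrt (mean_sq Y r) + sqrt (en Q)) * sqrt (mean_sq Y \<rho>)"
    by (simp add: real_sqrt_mult algebra_simps)
  finally show ?thesis .
qed

subsection \<open>Dependence on the wave number\<close>

lemma phase_shift_L2: "L2_on Y \<rho> \<Longrightarrow> L2_pair_on Y (phase_shift \<epsilon> d \<rho>)"
  by (auto simp: L2_pair_on_def phase_shift_def intro!: L2_on_cmult simp del: of_real_mult of_real_divide)

lemma en_phase_shift_le:
  assumes "L2_on Y \<rho>"
  shows "sqrt (en (phase_shift \<epsilon> d \<rho>)) \<le> sqrt a_hi * (2 * pi / \<epsilon>) * norm d * sqrt (mean_sq Y \<rho>)"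
proof -
  have "en (phase_shift \<epsilon> d \<rho>) \<le> a_hi * ((2 * pi * fst d / \<epsilon>)\<^sup>2 * mean_sq Y \<rho> + (2 * pi * snd d / \<epsilon>)\<^sup>2 * mean_sq Y \<rho>)"
    using en_bounds(2)[OF phase_shift_L2[OF assms, of d]]
    by (simp add: phase_shift_def norm_mult power_mult_distrib norm_divide power_divide del: of_real_mult of_real_divide)
  also have "\<dots> = a_hi * (2 * pi / \<epsilon>)\<^sup>2 * (norm d)\<^sup>2 * mean_sq Y \<rho>"
    by (cases d) (simp add: norm_Pair power_divide power_mult_distrib algebra_simps add_divide_distrib)
  finally have "sqrt (en (phase_shift \<epsilon> d \<rho>)) \<le> sqrt (a_hi * (2 * pi / \<epsilon>)\<^sup>2 * (norm d)\<^sup>2 * mean_sq Y \<rho>)"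
    by (rule real_sqrt_le_mono)
  then show ?thesis using \<epsilon> by (simp add: real_sqrt_mult real_sqrt_divide)
qed

definition lip :: real where "lip = sqrt a_hi * (2 * pi / \<epsilon>)"

lemma lip_pos: "lip > 0" using \<epsilon> a_hi by (simp add: lip_def)

definition Pshift :: "plane \<Rightarrow> plane \<Rightarrow> plane \<Rightarrow> complex \<times> complex" where
  "Pshift j j' x = (fst (\<Gamma> j 0 x) + fst (phase_shift \<epsilon> (j' - j) (\<Psi> j 0) x), snd (\<Gamma> j 0 x) + snd (phase_shift \<epsilon> (j' - j) (\<Psi> j 0) x))"

lemma Pshift:
  assumes "j \<in> Z_cell"
  shows "H1 j' (\<Psi> j 0) (Pshift j j')" "sqrt (en (Pshift j j')) \<le> sqrt (\<mu> j 0) + lip * norm (j' - j)"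
proof -
  show "H1 j' (\<Psi> j 0) (Pshift j j')"
    unfolding Pshift_def by (rule bloch_H1_change_phase[OF Gamma(1)[OF assms]])
  have "sqrt (en (Pshift j j')) \<le> sqrt (en (\<Gamma> j 0)) + sqrt (en (phase_shift \<epsilon> (j' - j) (\<Psi> j 0)))"
    unfolding Pshift_def by (rule sqrt_en_triangle[OF H1_pair[OF Gamma(1)[OF assms]] phase_shift_L2[OF Psi_L2[OF assms]]])
  then show "sqrt (en (Pshift j j')) \<le> sqrt (\<mu> j 0) + lip * norm (j' - j)"
    using en_phase_shift_le[OF Psi_L2[OF assms, of 0], of "j' - j"]
    by (simp add: en_Gamma[OF assms] Psi_mean_sq[OF assms] lip_def)
qed

text \<open>The ground state for \<open>j\<close> is a trial function for \<open>j'\<close>, and the triangle inequality for the energy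
  norm bounds the effect of the phase shift.\<close>

lemma sqrt_mu_Lipschitz:
  assumes "j \<in> Z_cell" "j' \<in> Z_cell"
  shows "\<bar>sqrt (\<mu> j' 0) - sqrt (\<mu> j 0)\<bar> \<le> lip * norm (j' - j)"
proof -
  have "sqrt (\<mu> j' 0) \<le> sqrt (\<mu> j 0) + lip * norm (j' - j)" if "j \<in> Z_cell" "j' \<in> Z_cell" for j j'
    using real_sqrt_le_mono[OF ground_energy_minimal[OF that(2) Pshift(1)[OF that(1)]]] Pshift(2)[OF that(1), of j']
    unfolding Psi_mean_sq[OF that(1)] mult_1_right by linarith
  from this[OF assms] this[OF assms(2,1)] show ?thesis by (simp add: norm_minus_commute abs_le_iff)
qed

text \<open>A common bound for the square roots of the lowest eigenvalues; 2 bounds the norm of the wave numbers.\<close>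

definition pmax :: real where "pmax = sqrt (\<mu> (0, 0) 0) + lip * 2"

lemma sqrt_mu_le: "j \<in> Z_cell \<Longrightarrow> sqrt (\<mu> j 0) \<le> pmax"
proof -
  assume j: "j \<in> Z_cell"
  have 0: "(0, 0) \<in> Z_cell" by (simp add: Z_cell_def)
  have "norm (fst j, snd j) \<le> norm (fst j) + norm (snd j)" by (rule norm_Pair_le)
  then have "norm j \<le> 2" using j by (auto simp: Z_cell_def)
  then have "lip * norm (j - (0, 0)) \<le> lip * 2"
    using lip_pos by (intro mult_left_mono) (auto simp: zero_prod_def[symmetric])
  then show ?thesis using sqrt_mu_Lipschitz[OF 0 j] unfolding pmax_def by linarith
qed

lemma mu_le: "j \<in> Z_cell \<Longrightarrow> \<mu> j 0 \<le> pmax\<^sup>2"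
  using sqrt_mu_le by (simp add: real_sqrt_le_iff sqrt_le_D)

lemma pmax_nonneg: "0 \<le> pmax"
  using lip_pos mu_nonneg[of "(0,0)" 0] by (simp add: pmax_def Z_cell_def)

lemma flux_le:
  assumes "j \<in> Z_cell"
  shows "\<bar>flux (\<Psi> j 0) (\<Gamma> j 0)\<bar> \<le> pmax * sqrt a_hi"
proof -
  have "\<bar>flux (\<Psi> j 0) (\<Gamma> j 0)\<bar> \<le> sqrt (\<mu> j 0) * sqrt a_hi"
    unfolding flux_def
    using abs_Im_le_cmod wip_le[OF H1_pair[OF Gamma(1)[OF assms]] Psi_L2[OF assms], of 0 0]
    by (auto simp: en_Gamma[OF assms] Psi_mean_sq[OF assms] intro: order_trans)
  also have "\<dots> \<le> pmax * sqrt a_hi"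
    using a_hi by (intro mult_right_mono sqrt_mu_le assms) auto
  finally show ?thesis .
qed

text \<open>The lowest eigenvalue is simple at \<open>j0\<close>, so the ground states for nearby \<open>j\<close> are close, up to a
  phase, to the one at \<open>j0\<close>: as trial functions at \<open>j0\<close> they have almost minimal energy, and the gap
  makes the remainder small. The flux does not see the phase.\<close>

lemma flux_continuous:
  assumes j0: "j0 \<in> Z_cell" and \<Lambda>: "\<And>m. m \<ge> 1 \<Longrightarrow> \<Lambda> \<le> \<mu> j0 m" and less: "\<mu> j0 0 < \<Lambda>"
  shows "((\<lambda>j. flux (\<Psi> j 0) (\<Gamma> j 0)) \<longlongrightarrow> flux (\<Psi> j0 0) (\<Gamma> j0 0)) (at j0 within Z_cell)"
proof -
  define m0 where "m0 = \<mu> j0 0"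
  have m0: "0 \<le> m0" "m0 < \<Lambda>" using mu_nonneg[OF j0] less by (simp_all add: m0_def)
  define F0 where "F0 = flux (\<Psi> j0 0) (\<Gamma> j0 0)"
  \<comment> \<open>\<open>q d\<close> bounds the energy of the remainder for \<open>|j - j0| = d\<close>; it vanishes for \<open>d = 0\<close>, and so does
    the bound \<open>G d\<close> for the difference of the fluxes.\<close>
  define q where "q d = \<Lambda> / (\<Lambda> - m0) * ((sqrt m0 + 2 * lip * d)\<^sup>2 - m0)" for d
  define G where "G d = sqrt a_hi * (sqrt m0 * sqrt (q d / \<Lambda>) + sqrt (q d)) + (q d / \<Lambda>) * \<bar>F0\<bar>
      + lip * d * sqrt a_hi" for d
  have bound: "\<bar>flux (\<Psi> j 0) (\<Gamma> j 0) - F0\<bar> \<le> G (norm (j0 - j))" if j: "j \<in> Z_cell" for j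
  proof -
    define d where "d = norm (j0 - j)"
    define P where "P = Pshift j j0"
    have P: "H1 j0 (\<Psi> j 0) P" unfolding P_def by (rule Pshift(1)[OF j])
    note Ppair = H1_pair[OF P]
    have "sqrt (en P) \<le> sqrt m0 + 2 * lip * d"
      using Pshift(2)[OF j, of j0] sqrt_mu_Lipschitz[OF j j0] unfolding P_def m0_def d_def by linarith
    then have e: "en P \<le> (sqrt m0 + 2 * lip * d)\<^sup>2"
      by (rule sqrt_le_D)
    define \<alpha> where "\<alpha> = mean_ip Y (\<Psi> j 0) (\<Psi> j0 0)"
    define r where "r = (\<lambda>x. \<Psi> j 0 x - \<alpha> * \<Psi> j0 0 x)"
    define Q where "Q = (\<lambda>x. (fst (P x) - \<alpha> * fst (\<Gamma> j0 0 x), snd (P x) - \<alpha> * snd (\<Gamma> j0 0 x)))"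
    note dec = ground_decomposition[OF j0 P \<Lambda>, folded \<alpha>_def, folded r_def Q_def]
    have a1: "(norm \<alpha>)\<^sup>2 = 1 - mean_sq Y r" using dec(2) by (simp add: Psi_mean_sq[OF j])
    have gap: "\<Lambda> * mean_sq Y r \<le> en Q" by (rule dec(4))
    have "en P = m0 * (1 - mean_sq Y r) + en Q" using dec(3) by (simp add: a1 m0_def)
    then have "en Q - m0 * mean_sq Y r \<le> (sqrt m0 + 2 * lip * d)\<^sup>2 - m0"
      using e by (simp add: algebra_simps)
    moreover have "m0 * mean_sq Y r \<le> m0 / \<Lambda> * en Q"
    proof -
      have "mean_sq Y r \<le> en Q / \<Lambda>" using gap m0 by (simp add: field_simps)
      from mult_left_mono[OF this m0(1)] show ?thesis by simp
    qed
    moreover have "(1 - m0 / \<Lambda>) * en Q = en Q - m0 / \<Lambda> * en Q" by (simp add: algebra_simps)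
    ultimately have "(1 - m0 / \<Lambda>) * en Q \<le> (sqrt m0 + 2 * lip * d)\<^sup>2 - m0" by linarith
    then have eQ: "en Q \<le> q d" unfolding q_def using m0 by (simp add: field_simps)
    then have rq: "mean_sq Y r \<le> q d / \<Lambda>" using gap m0 by (simp add: field_simps)
    have 1: "\<bar>flux (\<Psi> j 0) P - (norm \<alpha>)\<^sup>2 * F0\<bar> \<le> sqrt a_hi * (sqrt m0 * sqrt (q d / \<Lambda>) + sqrt (q d))"
    proof -
      have "\<bar>flux (\<Psi> j 0) P - (norm \<alpha>)\<^sup>2 * F0\<bar> \<le>
          sqrt a_hi * (sqrt m0 * sqrt (mean_sq Y r) + sqrt (en Q))"
        using flux_approx[OF j0 P \<Lambda>, folded \<alpha>_def, folded r_def Q_def]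
        by (simp add: Psi_mean_sq[OF j] F0_def m0_def)
      also have "\<dots> \<le> sqrt a_hi * (sqrt m0 * sqrt (q d / \<Lambda>) + sqrt (q d))"
        using eQ rq a_hi m0 by (intro mult_left_mono add_mono real_sqrt_le_mono) auto
      finally show ?thesis .
    qed
    have 2: "\<bar>(norm \<alpha>)\<^sup>2 * F0 - F0\<bar> \<le> (q d / \<Lambda>) * \<bar>F0\<bar>"
    proof -
      have "(norm \<alpha>)\<^sup>2 * F0 - F0 = - (mean_sq Y r * F0)" by (simp add: a1 algebra_simps)
      then have "\<bar>(norm \<alpha>)\<^sup>2 * F0 - F0\<bar> = mean_sq Y r * \<bar>F0\<bar>" by (simp add: abs_mult)
      also have "\<dots> \<le> (q d / \<Lambda>) * \<bar>F0\<bar>" by (rule mult_right_mono[OF rq]) simp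
      finally show ?thesis .
    qed
    have 3: "\<bar>flux (\<Psi> j 0) (\<Gamma> j 0) - flux (\<Psi> j 0) P\<bar> \<le> lip * d * sqrt a_hi"
    proof -
      let ?s = "phase_shift \<epsilon> (j0 - j) (\<Psi> j 0)"
      have "wip (\<lambda>x. fst (P x)) (\<Psi> j 0) = wip (\<lambda>x. fst (\<Gamma> j 0 x) - (-1) * fst (?s x)) (\<Psi> j 0)"
        by (simp add: P_def Pshift_def)
      also have "\<dots> = wip (\<lambda>x. fst (\<Gamma> j 0 x)) (\<Psi> j 0) + wip (\<lambda>x. fst (?s x)) (\<Psi> j 0)"
        using bloch_H1D[OF Gamma(1)[OF j, of 0]] phase_shift_L2[OF Psi_L2[OF j, of 0], of "j0 - j"]
        by (subst wip_diff_cmult_left) (auto simp: L2_pair_on_def)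
      finally have "\<bar>flux (\<Psi> j 0) (\<Gamma> j 0) - flux (\<Psi> j 0) P\<bar> = \<bar>Im (wip (\<lambda>x. fst (?s x)) (\<Psi> j 0))\<bar>"
        by (simp add: flux_def)
      also have "\<dots> \<le> sqrt (en ?s) * sqrt (a_hi * mean_sq Y (\<Psi> j 0))"
        by (rule order_trans[OF abs_Im_le_cmod wip_le[OF phase_shift_L2[OF Psi_L2[OF j]] Psi_L2[OF j]]])
      also have "\<dots> \<le> lip * d * sqrt a_hi"
        using en_phase_shift_le[OF Psi_L2[OF j, of 0], of "j0 - j"] a_hi
        unfolding Psi_mean_sq[OF j] lip_def[symmetric] d_def[symmetric]
        using lip_pos by (intro mult_mono) (auto simp: d_def)
      finally show ?thesis .
    qed
    show ?thesis using 1 2 3 unfolding G_def d_def[symmetric] by linarith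
  qed
  have "(G \<longlongrightarrow> G 0) (at 0)"
  proof -
    have "isCont q 0" unfolding q_def using m0 by (intro continuous_intros) auto
    then have "isCont G 0" unfolding G_def using m0 by (intro continuous_intros) auto
    then show ?thesis by (simp add: isCont_def)
  qed
  moreover have "G 0 = 0" using m0 by (simp add: G_def q_def)
  ultimately have G: "(G \<longlongrightarrow> 0) (at 0)" by simp
  have "((\<lambda>j. norm (j0 - j)) \<longlongrightarrow> norm (j0 - j0)) (at j0 within Z_cell)"
    by (intro tendsto_intros)
  then have n: "filterlim (\<lambda>j. norm (j0 - j)) (at 0) (at j0 within Z_cell)"
    by (auto simp: filterlim_at eventually_at_filter)
  have "((\<lambda>j. flux (\<Psi> j 0) (\<Gamma> j 0) - F0) \<longlongrightarrow> 0) (at j0 within Z_cell)"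
  proof (rule Lim_null_comparison)
    show "\<forall>\<^sub>F j in at j0 within Z_cell. norm (flux (\<Psi> j 0) (\<Gamma> j 0) - F0) \<le> G (norm (j0 - j))"
      using bound by (auto simp: eventually_at_filter)
    show "((\<lambda>j. G (norm (j0 - j))) \<longlongrightarrow> 0) (at j0 within Z_cell)"
      by (rule filterlim_compose[OF G n])
  qed
  then show ?thesis unfolding F0_def by (simp add: LIM_zero_iff)
qed

end

section \<open>The Poynting number as a flux\<close>

text \<open>The fundamental theorem of calculus along the coordinate lines.\<close>

lemma test_compact_integral_grad:
  assumes F: "Cinf F" and C: "compact C" "C \<subseteq> cell s1 s2" and out: "\<And>x. x \<notin> C \<Longrightarrow> F x = 0"
  shows "(LINT x:cell s1 s2|lborel. fst (grad F x)) = (0::complex)"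
    and "(LINT x:cell s1 s2|lborel. snd (grad F x)) = (0::complex)"
proof -
  have zero: "frechet_derivative F (at x) v = 0" if "x \<notin> C" for x v
  proof -
    have "open (- C)" using C(1) by (simp add: compact_imp_closed open_Compl)
    moreover have "x \<in> - C" using that by simp
    ultimately have "(F has_derivative (\<lambda>_. 0)) (at x)"
      by (rule has_derivative_transform_within_open[OF has_derivative_const[of 0]]) (use out in auto)
    then show ?thesis using frechet_derivative_at by metis
  qed
  have F0: "F x = 0" if "x \<notin> cell s1 s2" for x using that C(2) out by blast
  have cont: "continuous_on UNIV (\<lambda>x. frechet_derivative F (at x) v)" for v
    by (rule Cinf_continuous[OF Cinf_frechet[OF F]])
  have int: "integrable lborel (\<lambda>x. frechet_derivative F (at x) v)" for v
  proof -
    have "integrable lborel (\<lambda>x. indicator C x *\<^sub>R frechet_derivative F (at x) v)"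
      by (rule borel_integrable_compact[OF C(1) continuous_on_subset[OF cont]]) auto
    moreover have "(\<lambda>x. indicator C x *\<^sub>R frechet_derivative F (at x) v) = (\<lambda>x. frechet_derivative F (at x) v)"
      using zero by (auto simp: indicator_def fun_eq_iff)
    ultimately show ?thesis by simp
  qed
  have restrict: "(LINT x:cell s1 s2|lborel. frechet_derivative F (at x) v) = integral\<^sup>L lborel (\<lambda>x. frechet_derivative F (at x) v)" for v
    unfolding set_lebesgue_integral_def
  proof (intro Bochner_Integration.integral_cong refl)
    fix x show "indicat_real (cell s1 s2) x *\<^sub>R frechet_derivative F (at x) v = frechet_derivative F (at x) v"
      using zero[of x v] C(2) by (cases "x \<in> cell s1 s2") (simp, subst zero, auto)
  qed
  have line: "(\<lambda>t. indicator {0..s} t *\<^sub>R f t) = f" if "\<And>t. t \<notin> {0..s} \<Longrightarrow> f t = 0"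
    for s :: real and f :: "real \<Rightarrow> complex"
    using that by (auto simp: indicator_def fun_eq_iff)
  have C0: "(t, y) \<notin> C" if "t \<notin> {0..s1} \<or> y \<notin> {0..s2}" for t y
    using that C(2) by (force simp: mem_cell)
  have 1: "(LBINT t. frechet_derivative F (at (t, y)) (1, 0)) = 0" for y
  proof (cases "0 \<le> s1")
    case True
    have "((\<lambda>t. (t, y)) has_derivative (\<lambda>d. (d, 0))) (at t)" for t :: real
      by (auto intro!: derivative_eq_intros)
    from has_derivative_compose[OF this Cinf_has_derivative[OF F]]
    have d: "((\<lambda>t. F (t, y)) has_derivative (\<lambda>d. frechet_derivative F (at (t, y)) (d, 0))) (at t)" for t .
    have lin: "(\<lambda>d. frechet_derivative F (at (t, y)) (d, 0)) = (\<lambda>d. d *\<^sub>R frechet_derivative F (at (t, y)) (1, 0))" for t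
    proof
      fix d show "frechet_derivative F (at (t, y)) (d, 0) = d *\<^sub>R frechet_derivative F (at (t, y)) (1, 0)"
      using linear_scale[OF has_derivative_linear[OF Cinf_has_derivative[OF F, of "(t, y)"]], of d "(1, 0)"] by simp
    qed
    from d have d': "((\<lambda>t. F (t, y)) has_vector_derivative frechet_derivative F (at (t, y)) (1, 0)) (at t)" for t
      unfolding lin has_vector_derivative_def .
    have "(LBINT t. indicator {0..s1} t *\<^sub>R frechet_derivative F (at (t, y)) (1, 0)) = F (s1, y) - F (0, y)"
      by (rule integral_FTC_Icc[OF True has_vector_derivative_at_within[OF d']])
        (rule continuous_on_compose2[OF cont], auto intro!: continuous_intros)
    moreover have "F (s1, y) = 0" "F (0, y) = 0" by (auto intro!: F0 simp: mem_cell)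
    ultimately show ?thesis
      by (subst (asm) line) (auto intro!: zero C0)
  next
    case False
    then show ?thesis using C0 zero by simp
  qed
  have 2: "(LBINT t. frechet_derivative F (at (x, t)) (0, 1)) = 0" for x
  proof (cases "0 \<le> s2")
    case True
    have "((\<lambda>t. (x, t)) has_derivative (\<lambda>d. (0, d))) (at t)" for t :: real
      by (auto intro!: derivative_eq_intros)
    from has_derivative_compose[OF this Cinf_has_derivative[OF F]]
    have d: "((\<lambda>t. F (x, t)) has_derivative (\<lambda>d. frechet_derivative F (at (x, t)) (0, d))) (at t)" for t .
    have lin: "(\<lambda>d. frechet_derivative F (at (x, t)) (0, d)) = (\<lambda>d. d *\<^sub>R frechet_derivative F (at (x, t)) (0, 1))" for t
    proof
      fix d show "frechet_derivative F (at (x, t)) (0, d) = d *\<^sub>R frechet_derivative F (at (x, t)) (0, 1)"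
      using linear_scale[OF has_derivative_linear[OF Cinf_has_derivative[OF F, of "(x, t)"]], of d "(0, 1)"] by simp
    qed
    from d have d': "((\<lambda>t. F (x, t)) has_vector_derivative frechet_derivative F (at (x, t)) (0, 1)) (at t)" for t
      unfolding lin has_vector_derivative_def .
    have "(LBINT t. indicator {0..s2} t *\<^sub>R frechet_derivative F (at (x, t)) (0, 1)) = F (x, s2) - F (x, 0)"
      by (rule integral_FTC_Icc[OF True has_vector_derivative_at_within[OF d']])
        (rule continuous_on_compose2[OF cont], auto intro!: continuous_intros)
    moreover have "F (x, s2) = 0" "F (x, 0) = 0" by (auto intro!: F0 simp: mem_cell)
    ultimately show ?thesis
      by (subst (asm) line) (auto intro!: zero C0)
  next
    case False
    then show ?thesis using C0 zero by simp
  qed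
  have cp: "case_prod (\<lambda>x y. frechet_derivative F (at (x, y)) v) = (\<lambda>x. frechet_derivative F (at x) v)" for v
    by auto
  have "integral\<^sup>L lborel (\<lambda>x. frechet_derivative F (at x) (1, 0)) = (LBINT y. LBINT x. frechet_derivative F (at (x, y)) (1, 0))"
    using lborel_pair.integral_snd[of "\<lambda>x y. frechet_derivative F (at (x, y)) (1, 0)"] int[of "(1, 0)"]
    by (simp add: cp lborel_prod)
  then show "(LINT x:cell s1 s2|lborel. fst (grad F x)) = 0"
    by (simp add: grad_def restrict 1)
  have "integral\<^sup>L lborel (\<lambda>x. frechet_derivative F (at x) (0, 1)) = (LBINT x. LBINT y. frechet_derivative F (at (x, y)) (0, 1))"
    using lborel_pair.integral_fst[of "\<lambda>x y. frechet_derivative F (at (x, y)) (0, 1)"] int[of "(0, 1)"]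
    by (simp add: cp lborel_prod)
  then show "(LINT x:cell s1 s2|lborel. snd (grad F x)) = 0"
    by (simp add: grad_def restrict 2)
qed

text \<open>A supply of smooth cut-offs of the cell, to be read off from the given cut-off family.\<close>

definition smooth_bumps :: "real \<Rightarrow> bool" where
  "smooth_bumps \<epsilon> \<longleftrightarrow> (\<exists>z::nat \<Rightarrow> real \<Rightarrow> real. \<forall>n. smooth_line (z n) \<and>
     (\<exists>\<delta>>0. \<forall>t. t < \<delta> \<or> t > \<epsilon> - \<delta> \<longrightarrow> z n t = 0) \<and>
     (\<forall>t. 0 < t \<and> t < \<epsilon> \<longrightarrow> (\<forall>\<^sub>F n in sequentially. z n t = 1)))"

text \<open>The fundamental lemma of the calculus of variations. After multiplication with bumps all Fourier
  coefficients vanish, so the product is zero, and the bumps converge to 1 in the cell.\<close>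

lemma AE_zero_if_test_compact:
  assumes fc: "fourier_complete \<kappa>" and \<epsilon>: "\<epsilon> > 0" and bumps: "smooth_bumps \<epsilon>"
    and D: "L2_on (cell \<epsilon> \<epsilon>) D"
    and null: "\<And>\<phi>. \<phi> \<in> test_compact (cell \<epsilon> \<epsilon>) \<Longrightarrow> (LINT x:cell \<epsilon> \<epsilon>|lborel. D x * \<phi> x) = 0"
  shows "AE x in lborel. x \<in> cell \<epsilon> \<epsilon> \<longrightarrow> D x = 0"
proof -
  let ?Y = "cell \<epsilon> \<epsilon>"
  obtain z :: "nat \<Rightarrow> real \<Rightarrow> real" where z: "\<And>n. smooth_line (z n)"
    and supp: "\<And>n. \<exists>\<delta>>0. \<forall>t. t < \<delta> \<or> t > \<epsilon> - \<delta> \<longrightarrow> z n t = 0"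
    and one: "\<And>t. 0 < t \<Longrightarrow> t < \<epsilon> \<Longrightarrow> \<forall>\<^sub>F n in sequentially. z n t = 1"
    using bumps unfolding smooth_bumps_def by metis
  define \<beta> where "\<beta> n = (\<lambda>x::plane. complex_of_real (z n (fst x)) * complex_of_real (z n (snd x)))" for n
  have C\<beta>: "Cinf (\<beta> n)" for n
  proof -
    have "bounded_linear (\<lambda>x::plane. (snd x, fst x))"
      by (intro bounded_linear_Pair bounded_linear_snd bounded_linear_fst)
    from Cinf_affine[OF this smooth_line_complex(1)[OF z[of n]], where c="(0, 0)"]
    have "Cinf (\<lambda>x::plane. complex_of_real (z n (snd x)))" by (simp add: zero_prod_def[symmetric])
    from Cinf_mult[OF smooth_line_complex(1)[OF z, of n] this] show ?thesis by (simp add: \<beta>_def)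
  qed
  have L: "L2_on ?Y (\<lambda>x. \<beta> n x * D x)" for n
  proof -
    have "compact (closure ?Y)" by (simp add: compact_closure)
    then have "bounded (\<beta> n ` closure ?Y)"
      by (intro compact_imp_bounded compact_continuous_image continuous_on_subset[OF Cinf_continuous[OF C\<beta>]]) auto
    then obtain B where "\<And>x. x \<in> closure ?Y \<Longrightarrow> norm (\<beta> n x) \<le> B" by (force simp: bounded_iff)
    then show ?thesis
      by (intro L2_on_bounded_mult[OF _ D, where C=B] borel_measurable_continuous_onI Cinf_continuous C\<beta>)
        (use closure_subset in auto)
  qed
  have "mean_sq ?Y (\<lambda>x. \<beta> n x * D x) = 0" for n
  proof -
    have "mean_ip ?Y (\<lambda>x. \<beta> n x * D x) (trig \<epsilon> \<epsilon> k) = 0" for k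
    proof -
      obtain \<delta> where \<delta>: "\<delta> > 0" "\<And>t. t < \<delta> \<or> t > \<epsilon> - \<delta> \<Longrightarrow> z n t = 0" using supp by blast
      have "(\<lambda>x. \<beta> n x * cnj (trig \<epsilon> \<epsilon> k x)) \<in> test_compact ?Y"
        unfolding test_compact_def
      proof (intro CollectI conjI exI)
        show "Cinf (\<lambda>x. \<beta> n x * cnj (trig \<epsilon> \<epsilon> k x))" by (intro Cinf_mult C\<beta> Cinf_cnj Cinf_trig)
        show "compact ({\<delta>..\<epsilon> - \<delta>} \<times> {\<delta>..\<epsilon> - \<delta>})" by (intro compact_Times compact_Icc)
        show "{\<delta>..\<epsilon> - \<delta>} \<times> {\<delta>..\<epsilon> - \<delta>} \<subseteq> ?Y" using \<delta>(1) by (auto simp: mem_cell)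
        show "\<forall>x. x \<notin> {\<delta>..\<epsilon> - \<delta>} \<times> {\<delta>..\<epsilon> - \<delta>} \<longrightarrow> \<beta> n x * cnj (trig \<epsilon> \<epsilon> k x) = 0"
        proof (intro allI impI)
          fix x :: plane assume "x \<notin> {\<delta>..\<epsilon> - \<delta>} \<times> {\<delta>..\<epsilon> - \<delta>}"
          then have "z n (fst x) = 0 \<or> z n (snd x) = 0" using \<delta>(2) by (cases x) force
          then show "\<beta> n x * cnj (trig \<epsilon> \<epsilon> k x) = 0" by (auto simp: \<beta>_def)
        qed
      qed
      from null[OF this] show ?thesis by (simp add: mean_ip_def mult_ac)
    qed
    then have "(\<lambda>i::nat. mean_sq ?Y (\<lambda>x. \<beta> n x * D x)) \<longlonglongrightarrow> 0"
      using fc \<epsilon> L[of n] unfolding fourier_complete_def by fastforce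
    then show ?thesis by (simp add: LIMSEQ_const_iff)
  qed
  then have i0: "(LINT x:?Y|lborel. (norm (\<beta> n x * D x))\<^sup>2) = 0" for n
    using \<epsilon> by (simp add: mean_sq_def)
  have "AE x in lborel. indicator ?Y x *\<^sub>R (norm (\<beta> n x * D x))\<^sup>2 = 0" for n
    using i0[of n] L2_onD(2)[OF L[of n]] unfolding set_lebesgue_integral_def set_integrable_def
    by (subst (asm) integral_nonneg_eq_0_iff_AE) auto
  then have "AE x in lborel. \<forall>n. indicator ?Y x *\<^sub>R (norm (\<beta> n x * D x))\<^sup>2 = 0"
    by (subst AE_all_countable) blast
  then show ?thesis
  proof eventually_elim
    case (elim x)
    show ?case
    proof
      assume x: "x \<in> ?Y"
      then have "\<forall>\<^sub>F n in sequentially. z n (fst x) = 1 \<and> z n (snd x) = 1"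
        by (intro eventually_conj one) (auto simp: mem_cell)
      then obtain n where "z n (fst x) = 1" "z n (snd x) = 1" using eventually_happens by fastforce
      then show "D x = 0" using elim[rule_format, of n] x by (simp add: \<beta>_def)
    qed
  qed
qed

context bloch_cell
begin

text \<open>The phase factor turns the shifted gradient of the periodic part into the gradient of the Bloch wave.\<close>

lemma bloch_wave_weak_grad:
  assumes j: "j \<in> Z_cell"
  defines "e \<equiv> \<lambda>x. cis (2 * pi * (j \<bullet> x) / \<epsilon>)"
  shows "has_weak_grad Y (test_compact Y) (bloch_wave \<epsilon> \<Psi> (j, m)) (\<lambda>x. (fst (\<Gamma> j m x) * e x, snd (\<Gamma> j m x) * e x))"
  unfolding has_weak_grad_def
proof
  fix \<phi> assume "\<phi> \<in> test_compact Y"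
  then obtain C where \<phi>: "Cinf \<phi>" and C: "compact C" "C \<subseteq> Y" "\<And>x. x \<notin> C \<Longrightarrow> \<phi> x = 0"
    by (auto simp: test_compact_def)
  obtain p where p: "\<And>n. p n \<in> test_cell \<epsilon> \<epsilon>"
    "(\<lambda>n. mean_sq Y (\<lambda>x. \<Psi> j m x - p n x)) \<longlonglongrightarrow> 0"
    "(\<lambda>n. mean_sq Y (\<lambda>x. fst (\<Gamma> j m x) - fst (tgrad \<epsilon> j (p n) x))) \<longlonglongrightarrow> 0"
    "(\<lambda>n. mean_sq Y (\<lambda>x. snd (\<Gamma> j m x) - snd (tgrad \<epsilon> j (p n) x))) \<longlonglongrightarrow> 0"
    using bloch_H1_approx[OF fourier \<epsilon> \<epsilon> Gamma(1)[OF j]] by blast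
  define \<theta> where "\<theta> = (2 * pi * fst j / \<epsilon>, 2 * pi * snd j / \<epsilon>)"
  have e\<theta>: "e = (\<lambda>x. cis (\<theta> \<bullet> x))"
    by (simp add: e_def \<theta>_def inner_prod_def fun_eq_iff add_divide_distrib algebra_simps)
  have Ce: "Cinf e" unfolding e\<theta> by (rule Cinf_cis_inner)
  have ge: "grad e x = (\<i> * of_real (2 * pi * fst j / \<epsilon>) * e x, \<i> * of_real (2 * pi * snd j / \<epsilon>) * e x)" for x
    unfolding e\<theta> grad_cis_inner by (simp add: \<theta>_def)
  note L\<Gamma> = bloch_H1D[OF Gamma(1)[OF j, of m]]
  note T = test_L2_on[OF p(1) cell_bounded cell_borel]
  have Lc: "L2_on Y (\<lambda>x. cnj (e x * f x))" if "Cinf f" for f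
    by (intro Cinf_L2_on Cinf_cnj Cinf_mult Ce that) auto
  have tend: "(\<lambda>n. mean_ip Y (q n) w) \<longlonglongrightarrow> mean_ip Y f w"
    if "\<And>n. L2_on Y (q n)" "L2_on Y f" "L2_on Y w" "(\<lambda>n. mean_sq Y (\<lambda>x. f x - q n x)) \<longlonglongrightarrow> 0" for q f w
    using tendsto_cnj[OF mean_ip_tendsto_right[OF cell_borel that]] by (simp flip: mean_ip_cnj)
  have key: "mean_ip Y (p n) (\<lambda>x. cnj (e x * fst (grad \<phi> x))) = - mean_ip Y (\<lambda>x. fst (tgrad \<epsilon> j (p n) x)) (\<lambda>x. cnj (e x * \<phi> x))"
    "mean_ip Y (p n) (\<lambda>x. cnj (e x * snd (grad \<phi> x))) = - mean_ip Y (\<lambda>x. snd (tgrad \<epsilon> j (p n) x)) (\<lambda>x. cnj (e x * \<phi> x))" for n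
  proof -
    note Cp = test_cellD(1)[OF p(1), of n]
    let ?F = "\<lambda>x. (p n x * e x) * \<phi> x"
    have CF: "Cinf ?F" by (intro Cinf_mult Cp Ce \<phi>)
    have gF: "fst (grad ?F x) = p n x * cnj (cnj (e x * fst (grad \<phi> x))) + fst (tgrad \<epsilon> j (p n) x) * cnj (cnj (e x * \<phi> x))"
      "snd (grad ?F x) = p n x * cnj (cnj (e x * snd (grad \<phi> x))) + snd (tgrad \<epsilon> j (p n) x) * cnj (cnj (e x * \<phi> x))" for x
      unfolding grad_mult[OF Cinf_mult[OF Cp Ce] \<phi>] grad_mult[OF Cp Ce] ge bloch_grad_def
      by (simp_all add: algebra_simps)
    have i: "set_integrable lborel Y (\<lambda>x. p n x * cnj (cnj (e x * fst (grad \<phi> x))))"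
        "set_integrable lborel Y (\<lambda>x. p n x * cnj (cnj (e x * snd (grad \<phi> x))))"
        "set_integrable lborel Y (\<lambda>x. fst (tgrad \<epsilon> j (p n) x) * cnj (cnj (e x * \<phi> x)))"
        "set_integrable lborel Y (\<lambda>x. snd (tgrad \<epsilon> j (p n) x) * cnj (cnj (e x * \<phi> x)))"
      by (intro L2_prod_integrable cell_borel T Lc Cinf_grad \<phi>)+
    have "(LINT x:Y|lborel. fst (grad ?F x)) = 0" "(LINT x:Y|lborel. snd (grad ?F x)) = 0"
      using test_compact_integral_grad[OF CF C(1,2)] C(3) by auto
    then have s: "(LINT x:Y|lborel. p n x * cnj (cnj (e x * fst (grad \<phi> x)))) + (LINT x:Y|lborel. fst (tgrad \<epsilon> j (p n) x) * cnj (cnj (e x * \<phi> x))) = 0"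
      "(LINT x:Y|lborel. p n x * cnj (cnj (e x * snd (grad \<phi> x)))) + (LINT x:Y|lborel. snd (tgrad \<epsilon> j (p n) x) * cnj (cnj (e x * \<phi> x))) = 0"
      unfolding gF using i by (simp_all only: set_integral_add)
    have div: "x + y = 0 \<Longrightarrow> x / c = - (y / c)" for x y c :: complex
      by (simp add: eq_neg_iff_add_eq_0 flip: add_divide_distrib)
    show "mean_ip Y (p n) (\<lambda>x. cnj (e x * fst (grad \<phi> x))) = - mean_ip Y (\<lambda>x. fst (tgrad \<epsilon> j (p n) x)) (\<lambda>x. cnj (e x * \<phi> x))"
      "mean_ip Y (p n) (\<lambda>x. cnj (e x * snd (grad \<phi> x))) = - mean_ip Y (\<lambda>x. snd (tgrad \<epsilon> j (p n) x)) (\<lambda>x. cnj (e x * \<phi> x))"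
      unfolding mean_ip_def using div[OF s(1)] div[OF s(2)] by auto
  qed
  have 1: "mean_ip Y (\<Psi> j m) (\<lambda>x. cnj (e x * fst (grad \<phi> x))) = - mean_ip Y (\<lambda>x. fst (\<Gamma> j m x)) (\<lambda>x. cnj (e x * \<phi> x))"
    using tend[OF T(1) L\<Gamma>(1) Lc[OF Cinf_grad(1)[OF \<phi>]] p(2)]
      tendsto_minus[OF tend[OF T(2) L\<Gamma>(2) Lc[OF \<phi>] p(3)]]
    unfolding key by (rule LIMSEQ_unique)
  have 2: "mean_ip Y (\<Psi> j m) (\<lambda>x. cnj (e x * snd (grad \<phi> x))) = - mean_ip Y (\<lambda>x. snd (\<Gamma> j m x)) (\<lambda>x. cnj (e x * \<phi> x))"
    using tend[OF T(1) L\<Gamma>(1) Lc[OF Cinf_grad(2)[OF \<phi>]] p(2)]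
      tendsto_minus[OF tend[OF T(3) L\<Gamma>(3) Lc[OF \<phi>] p(4)]]
    unfolding key by (rule LIMSEQ_unique)
  have bw: "bloch_wave \<epsilon> \<Psi> (j, m) x = \<Psi> j m x * e x" for x by (simp add: bloch_wave_def e_def)
  have "complex_of_real (measure lborel Y) \<noteq> 0" using \<epsilon> by simp
  then show "(LINT x:Y|lborel. bloch_wave \<epsilon> \<Psi> (j, m) x * fst (grad \<phi> x)) =
      - (LINT x:Y|lborel. fst (fst (\<Gamma> j m x) * e x, snd (\<Gamma> j m x) * e x) * \<phi> x) \<and>
      (LINT x:Y|lborel. bloch_wave \<epsilon> \<Psi> (j, m) x * snd (grad \<phi> x)) =
      - (LINT x:Y|lborel. snd (fst (\<Gamma> j m x) * e x, snd (\<Gamma> j m x) * e x) * \<phi> x)"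
    using 1 2 unfolding mean_ip_def bw
    by (simp add: mult.assoc) (simp add: field_simps)
qed

text \<open>The gradient in the definition of the Poynting number is chosen without further specification; by
  uniqueness of weak gradients it agrees almost everywhere with the shifted gradient times the phase.\<close>

lemma poynting_eq_flux:
  assumes j: "j \<in> Z_cell" and bumps: "smooth_bumps \<epsilon>"
  shows "poynting \<epsilon> b \<Psi> (j, m) = flux (\<Psi> j m) (\<Gamma> j m)"
proof -
  define e where "e = (\<lambda>x. cis (2 * pi * (j \<bullet> x) / \<epsilon>))"
  define U where "U = bloch_wave \<epsilon> \<Psi> (j, m)"
  define G where "G = (\<lambda>x. (fst (\<Gamma> j m x) * e x, snd (\<Gamma> j m x) * e x))"
  note L\<Gamma> = bloch_H1D[OF Gamma(1)[OF j, of m]]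
  have em: "e \<in> borel_measurable borel"
    unfolding e_def using \<epsilon> by (intro borel_measurable_continuous_onI continuous_intros) auto
  have ne: "norm (e x) = 1" for x by (simp add: e_def)
  have LG: "L2_pair_on Y G"
    unfolding L2_pair_on_def G_def
    using L2_on_bounded_mult[OF cell_borel L\<Gamma>(2) em, of 1] L2_on_bounded_mult[OF cell_borel L\<Gamma>(3) em, of 1]
    by (simp add: ne mult.commute)
  have WG: "has_weak_grad Y (test_compact Y) U G"
    unfolding U_def G_def e_def by (rule bloch_wave_weak_grad[OF j])
  define g where "g = weak_grad Y U"
  have g: "L2_pair_on Y g" "has_weak_grad Y (test_compact Y) U g"
    unfolding g_def weak_grad_def using someI_ex[of "\<lambda>g. L2_pair_on Y g \<and> has_weak_grad Y (test_compact Y) U g"] LG WG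
    by blast+
  have Lg1: "L2_on Y (\<lambda>x. fst (g x))" and LG1: "L2_on Y (\<lambda>x. fst (G x))"
    using g(1) LG by (auto simp: L2_pair_on_def)
  have ae: "AE x in lborel. x \<in> Y \<longrightarrow> fst (g x) - fst (G x) = 0"
  proof (rule AE_zero_if_test_compact[OF fourier \<epsilon> bumps L2_on_diff[OF cell_borel Lg1 LG1]])
    fix \<phi> assume \<phi>: "\<phi> \<in> test_compact Y"
    then have "Cinf \<phi>" by (simp add: test_compact_def)
    then have L\<phi>: "L2_on Y (\<lambda>x. cnj (\<phi> x))" by (intro Cinf_L2_on Cinf_cnj) auto
    have "(LINT x:Y|lborel. fst (g x) * \<phi> x) = (LINT x:Y|lborel. fst (G x) * \<phi> x)"
      using g(2)[unfolded has_weak_grad_def, rule_format, OF \<phi>] WG[unfolded has_weak_grad_def, rule_format, OF \<phi>]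
      by simp
    then show "(LINT x:Y|lborel. (fst (g x) - fst (G x)) * \<phi> x) = 0"
      using L2_prod_integrable[OF cell_borel Lg1 L\<phi>] L2_prod_integrable[OF cell_borel LG1 L\<phi>]
      by (simp add: left_diff_distrib)
  qed
  have Um: "U \<in> borel_measurable borel"
    using L2_onD(1)[OF L\<Gamma>(1)] em unfolding U_def bloch_wave_def e_def by simp
  have cUm: "(\<lambda>x. cnj (U x)) \<in> borel_measurable borel"
    by (rule borel_measurable_continuous_on[OF continuous_on_cnj[OF continuous_on_id] Um])
  have c\<Psi>m: "(\<lambda>x. cnj (\<Psi> j m x)) \<in> borel_measurable borel"
    by (rule borel_measurable_continuous_on[OF continuous_on_cnj[OF continuous_on_id] L2_onD(1)[OF L\<Gamma>(1)]])
  note [measurable] = L2_onD(1)[OF Lg1] cUm L2_onD(1)[OF L\<Gamma>(2)] c\<Psi>m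
  have "(LINT x:Y|lborel. cnj (U x) * (complex_of_real (b x) * fst (g x))) =
      (LINT x:Y|lborel. complex_of_real (b x) * fst (\<Gamma> j m x) * cnj (\<Psi> j m x))"
  proof (rule set_lebesgue_integral_cong_AE)
    have ce: "cnj (e x) * e x = 1" for x
      using ne[of x] by (metis complex_norm_square mult.commute of_real_1 power_one)
    have pt: "cnj (U x) * (complex_of_real (b x) * fst (G x)) = complex_of_real (b x) * fst (\<Gamma> j m x) * cnj (\<Psi> j m x)" for x
    proof -
      have "cnj (U x) * (complex_of_real (b x) * fst (G x)) = (cnj (e x) * e x) * (complex_of_real (b x) * fst (\<Gamma> j m x) * cnj (\<Psi> j m x))"
        by (simp add: U_def bloch_wave_def G_def e_def mult_ac)
      then show ?thesis by (simp add: ce)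
    qed
    from ae show "AE x\<in>Y in lborel. cnj (U x) * (complex_of_real (b x) * fst (g x)) =
        complex_of_real (b x) * fst (\<Gamma> j m x) * cnj (\<Psi> j m x)"
    proof eventually_elim
      case (elim x)
      then show ?case using pt[of x] by (metis right_minus_eq)
    qed
  qed auto
  then show ?thesis
    unfolding poynting_def flux_def wip_def mean_ip_def Y_cell_eq U_def[symmetric] g_def[symmetric] by simp
qed

section \<open>The perturbed eigenvalue equation\<close>

text \<open>Stability of the eigenvalue equation. Testing with the remainder \<open>r\<close> orthogonal to the ground state
  gives a coercive left hand side because \<open>w\<close> lies below the gap; testing with the ground state gives
  the bound on its coefficient \<open>\<alpha>\<close>.\<close>

lemma perturbed_eigenvalue_equation:
  assumes j: "j \<in> Z_cell" and \<rho>: "H1 j \<rho> P" and A: "L2_on Y A" and C: "L2_on Y C"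
    and eq: "\<And>\<phi>. \<phi> \<in> test_cell \<epsilon> \<epsilon> \<Longrightarrow> form P (tgrad \<epsilon> j \<phi>) =
        complex_of_real w * mean_ip Y \<rho> \<phi> - mean_ip Y A \<phi> + mean_ip Y C (\<lambda>x. fst (tgrad \<epsilon> j \<phi> x))"
    and \<Lambda>: "\<And>m. m \<ge> 1 \<Longrightarrow> \<Lambda> \<le> \<mu> j m" and w: "0 \<le> w" "w < \<Lambda>"
  defines "\<alpha> \<equiv> mean_ip Y \<rho> (\<Psi> j 0)"
  defines "r \<equiv> \<lambda>x. \<rho> x - \<alpha> * \<Psi> j 0 x"
  defines "Q \<equiv> \<lambda>x. (fst (P x) - \<alpha> * fst (\<Gamma> j 0 x), snd (P x) - \<alpha> * snd (\<Gamma> j 0 x))"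
  shows "en Q \<le> 2 * (1 / \<Lambda> + 1 / a_lo) / (1 - w / \<Lambda>)\<^sup>2 * (mean_sq Y A + mean_sq Y C)"
    and "(\<mu> j 0 - w)\<^sup>2 * (norm \<alpha>)\<^sup>2 \<le> (2 + 2 * pmax\<^sup>2 / a_lo) * (mean_sq Y A + mean_sq Y C)"
proof -
  note L\<rho> = bloch_H1D[OF \<rho>]
  note d = ground_decomposition[OF j \<rho> \<Lambda>, folded \<alpha>_def, folded r_def Q_def]
  note Lr = bloch_H1D[OF d(1)] and L\<Gamma> = bloch_H1D[OF Gamma(1)[OF j, of 0]]
  have ext: "form P S = complex_of_real w * mean_ip Y \<rho> \<sigma> - mean_ip Y A \<sigma> + mean_ip Y C (\<lambda>x. fst (S x))"
    if S: "H1 j \<sigma> S" for \<sigma> S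
  proof -
    note LS = bloch_H1D[OF S]
    have LP: "L2_on Y (\<lambda>x. complex_of_real (b x) * fst (P x))" "L2_on Y (\<lambda>x. complex_of_real (b x) * snd (P x))"
      using L\<rho> by (auto intro: L2_weight)
    have Lw: "L2_on Y (\<lambda>x. complex_of_real w * \<rho> x)" using L\<rho>(1) by (rule L2_on_cmult[OF cell_borel])
    have "mean_ip Y (\<lambda>x. complex_of_real (b x) * fst (P x) - C x) (\<lambda>x. fst (S x)) +
       mean_ip Y (\<lambda>x. complex_of_real (b x) * snd (P x)) (\<lambda>x. snd (S x)) =
       mean_ip Y (\<lambda>x. complex_of_real w * \<rho> x - A x) \<sigma>"
    proof (rule weak_equation_extends[OF fourier \<epsilon> \<epsilon> S])
      fix \<phi> assume \<phi>: "\<phi> \<in> test_cell \<epsilon> \<epsilon>"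
      note T = test_L2_on[OF \<phi> cell_bounded cell_borel]
      show "mean_ip Y (\<lambda>x. complex_of_real (b x) * fst (P x) - C x) (\<lambda>x. fst (tgrad \<epsilon> j \<phi> x)) +
       mean_ip Y (\<lambda>x. complex_of_real (b x) * snd (P x)) (\<lambda>x. snd (tgrad \<epsilon> j \<phi> x)) =
       mean_ip Y (\<lambda>x. complex_of_real w * \<rho> x - A x) \<phi>"
        using eq[OF \<phi>] LP C T A Lw by (simp add: form_def wip_def mean_ip_diff_left algebra_simps)
    qed (use LP C A Lw in \<open>auto intro!: L2_on_diff\<close>)
    then show ?thesis
      using LP C LS A Lw by (simp add: form_def wip_def mean_ip_diff_left algebra_simps)
  qed
  define sA sC E where "sA = sqrt (mean_sq Y A)" and "sC = sqrt (mean_sq Y C)" and "E = sqrt (en Q)"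
  have nn: "0 \<le> sA" "0 \<le> sC" "0 \<le> E" by (simp_all add: sA_def sC_def E_def)
  have sq: "sA\<^sup>2 = mean_sq Y A" "sC\<^sup>2 = mean_sq Y C" "E\<^sup>2 = en Q" by (simp_all add: sA_def sC_def E_def)
  have \<Lambda>0: "\<Lambda> > 0" using w by linarith
  have "form Q Q = form P Q - \<alpha> * form (\<Gamma> j 0) Q"
    unfolding Q_def using form_diff_cmult_left[OF H1_pair[OF \<rho>] H1_pair[OF Gamma(1)[OF j]] H1_pair[OF d(1), unfolded Q_def]] .
  also have "form (\<Gamma> j 0) Q = 0" using Gamma(2)[OF j d(1), of 0] d(5) by simp
  finally have fQ: "complex_of_real (en Q) = form P Q" by (simp add: form_self)
  have "mean_ip Y r r = mean_ip Y \<rho> r - \<alpha> * mean_ip Y (\<Psi> j 0) r"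
    using L\<rho>(1) L\<Gamma>(1) Lr(1) mean_ip_diff_left[OF cell_borel L\<rho>(1) L2_on_cmult[OF cell_borel L\<Gamma>(1), of \<alpha>] Lr(1)]
    by (simp add: r_def[symmetric])
  then have \<rho>r: "mean_ip Y \<rho> r = complex_of_real (mean_sq Y r)" by (simp add: d(5) mean_ip_self)
  have "complex_of_real (en Q) = complex_of_real (w * mean_sq Y r) - mean_ip Y A r + mean_ip Y C (\<lambda>x. fst (Q x))"
    using fQ ext[OF d(1)] \<rho>r by simp
  then have "en Q = Re (complex_of_real (w * mean_sq Y r) - mean_ip Y A r + mean_ip Y C (\<lambda>x. fst (Q x)))"
    by (metis Re_complex_of_real)
  also have "\<dots> \<le> w * mean_sq Y r + norm (mean_ip Y A r) + norm (mean_ip Y C (\<lambda>x. fst (Q x)))"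
    using complex_Re_le_cmod[of "mean_ip Y C (\<lambda>x. fst (Q x))"] abs_Re_le_cmod[of "mean_ip Y A r"] by simp
  also have "\<dots> \<le> w * (en Q / \<Lambda>) + sA * (E / sqrt \<Lambda>) + sC * (E / sqrt a_lo)"
  proof (intro add_mono)
    have m: "mean_sq Y r \<le> en Q / \<Lambda>" using d(4) \<Lambda>0 by (simp add: field_simps)
    then show "w * mean_sq Y r \<le> w * (en Q / \<Lambda>)" using w by (intro mult_left_mono)
    have "sqrt (mean_sq Y r) \<le> E / sqrt \<Lambda>"
      unfolding E_def real_sqrt_divide[symmetric] using m by (rule real_sqrt_le_mono)
    then show "norm (mean_ip Y A r) \<le> sA * (E / sqrt \<Lambda>)"
      using mean_ip_Cauchy_Schwarz[OF cell_borel A Lr(1)] nn(1) mult_left_mono unfolding sA_def by (smt (verit))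
    have "sqrt (mean_sq Y (\<lambda>x. fst (Q x))) \<le> E / sqrt a_lo"
      unfolding E_def real_sqrt_divide[symmetric]
      by (rule real_sqrt_le_mono[OF en_bounds(3)[OF H1_pair[OF d(1)]]])
    then show "norm (mean_ip Y C (\<lambda>x. fst (Q x))) \<le> sC * (E / sqrt a_lo)"
      using mean_ip_Cauchy_Schwarz[OF cell_borel C Lr(2)] nn(2) mult_left_mono unfolding sC_def by (smt (verit))
  qed
  finally have ineq: "(1 - w / \<Lambda>) * E\<^sup>2 \<le> (sA / sqrt \<Lambda> + sC / sqrt a_lo) * E"
    unfolding sq by (simp add: algebra_simps)
  define \<gamma> where "\<gamma> = 1 - w / \<Lambda>"
  have \<gamma>: "\<gamma> > 0" unfolding \<gamma>_def using w \<Lambda>0 by (simp add: field_simps)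
  define B where "B = sA / sqrt \<Lambda> + sC / sqrt a_lo"
  have B0: "B \<ge> 0" unfolding B_def using nn \<Lambda>0 a_lo by simp
  have "\<gamma> * E \<le> B"
  proof (cases "E = 0")
    case False
    then have "E > 0" using nn by simp
    then show ?thesis using ineq unfolding \<gamma>_def[symmetric] B_def[symmetric]
      by (simp add: power2_eq_square mult.assoc[symmetric])
  qed (use B0 in simp)
  then have "E \<le> B / \<gamma>" using \<gamma> by (simp add: field_simps)
  then have "E\<^sup>2 \<le> (B / \<gamma>)\<^sup>2" using nn by (intro power_mono)
  also have "\<dots> = B\<^sup>2 / \<gamma>\<^sup>2" by (simp add: power_divide)
  also have "B\<^sup>2 \<le> 2 * ((sA / sqrt \<Lambda>)\<^sup>2 + (sC / sqrt a_lo)\<^sup>2)"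
    using sum_squares_bound[of "sA / sqrt \<Lambda>" "sC / sqrt a_lo"] unfolding B_def by (simp add: power2_sum)
  also have "\<dots> = 2 * (mean_sq Y A / \<Lambda> + mean_sq Y C / a_lo)"
    using \<Lambda>0 a_lo by (simp add: power_divide sq)
  also have "\<dots> \<le> 2 * ((1 / \<Lambda> + 1 / a_lo) * (mean_sq Y A + mean_sq Y C))"
  proof -
    have e: "(1 / \<Lambda> + 1 / a_lo) * (mean_sq Y A + mean_sq Y C) =
      mean_sq Y A / \<Lambda> + mean_sq Y C / a_lo + (mean_sq Y C / \<Lambda> + mean_sq Y A / a_lo)"
      by (simp add: algebra_simps)
    have "0 \<le> mean_sq Y C / \<Lambda> + mean_sq Y A / a_lo" using \<Lambda>0 a_lo by simp
    then show ?thesis unfolding e by (intro mult_left_mono) (simp_all only: le_add_same_cancel1 zero_le_numeral)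
  qed
  finally have "en Q \<le> 2 * ((1 / \<Lambda> + 1 / a_lo) * (mean_sq Y A + mean_sq Y C)) / \<gamma>\<^sup>2"
    using \<gamma> by (simp only: sq) (simp add: divide_right_mono)
  then show "en Q \<le> 2 * (1 / \<Lambda> + 1 / a_lo) / (1 - w / \<Lambda>)\<^sup>2 * (mean_sq Y A + mean_sq Y C)"
    unfolding \<gamma>_def by (simp only: times_divide_eq_left mult.assoc)
  have "form P (\<Gamma> j 0) = cnj (form (\<Gamma> j 0) P)" by (rule form_cnj)
  also have "\<dots> = complex_of_real (\<mu> j 0) * \<alpha>"
    unfolding Gamma(2)[OF j \<rho>] \<alpha>_def mean_ip_cnj[of Y "\<Psi> j 0" \<rho>] by simp
  finally have "complex_of_real (\<mu> j 0) * \<alpha> = complex_of_real w * \<alpha> - mean_ip Y A (\<Psi> j 0) + mean_ip Y C (\<lambda>x. fst (\<Gamma> j 0 x))"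
    using ext[OF Gamma(1)[OF j, of 0]] by (simp add: \<alpha>_def)
  then have "complex_of_real (\<mu> j 0 - w) * \<alpha> = mean_ip Y C (\<lambda>x. fst (\<Gamma> j 0 x)) - mean_ip Y A (\<Psi> j 0)"
    by (simp add: algebra_simps)
  then have "\<bar>\<mu> j 0 - w\<bar> * norm \<alpha> = norm (mean_ip Y C (\<lambda>x. fst (\<Gamma> j 0 x)) - mean_ip Y A (\<Psi> j 0))"
    by (metis norm_mult norm_of_real)
  also have "\<dots> \<le> norm (mean_ip Y C (\<lambda>x. fst (\<Gamma> j 0 x))) + norm (mean_ip Y A (\<Psi> j 0))"
    by (rule norm_triangle_ineq4)
  also have "\<dots> \<le> sC * (pmax / sqrt a_lo) + sA * 1"
  proof (intro add_mono)
    have "mean_sq Y (\<lambda>x. fst (\<Gamma> j 0 x)) \<le> \<mu> j 0 / a_lo"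
      using en_bounds(3)[OF H1_pair[OF Gamma(1)[OF j]], of 0] by (simp add: en_Gamma[OF j])
    then have "sqrt (mean_sq Y (\<lambda>x. fst (\<Gamma> j 0 x))) \<le> sqrt (\<mu> j 0) / sqrt a_lo"
      unfolding real_sqrt_divide[symmetric] by (rule real_sqrt_le_mono)
    also have "\<dots> \<le> pmax / sqrt a_lo" using sqrt_mu_le[OF j] a_lo by (intro divide_right_mono) auto
    finally show "norm (mean_ip Y C (\<lambda>x. fst (\<Gamma> j 0 x))) \<le> sC * (pmax / sqrt a_lo)"
      using mean_ip_Cauchy_Schwarz[OF cell_borel C L\<Gamma>(2)] nn(2) mult_left_mono unfolding sC_def by (smt (verit))
    show "norm (mean_ip Y A (\<Psi> j 0)) \<le> sA * 1"
      using mean_ip_Cauchy_Schwarz[OF cell_borel A L\<Gamma>(1)] by (simp add: sA_def Psi_mean_sq[OF j])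
  qed
  finally have "(\<bar>\<mu> j 0 - w\<bar> * norm \<alpha>)\<^sup>2 \<le> (sC * (pmax / sqrt a_lo) + sA)\<^sup>2"
    by (intro power_mono) auto
  also have "\<dots> \<le> 2 * (sC * (pmax / sqrt a_lo))\<^sup>2 + 2 * sA\<^sup>2"
    using sum_squares_bound[of "sC * (pmax / sqrt a_lo)" sA] by (simp add: power2_sum)
  also have "\<dots> = (2 * pmax\<^sup>2 / a_lo) * mean_sq Y C + 2 * mean_sq Y A"
    using a_lo by (simp add: power_mult_distrib power_divide sq)
  also have "\<dots> \<le> (2 + 2 * pmax\<^sup>2 / a_lo) * (mean_sq Y A + mean_sq Y C)"
  proof -
    have e: "(2 + 2 * pmax\<^sup>2 / a_lo) * (mean_sq Y A + mean_sq Y C) =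
      (2 * pmax\<^sup>2 / a_lo) * mean_sq Y C + 2 * mean_sq Y A + (2 * mean_sq Y C + (2 * pmax\<^sup>2 / a_lo) * mean_sq Y A)"
      by (simp add: algebra_simps add_divide_distrib)
    have "0 \<le> 2 * mean_sq Y C + (2 * pmax\<^sup>2 / a_lo) * mean_sq Y A" using a_lo by simp
    then show ?thesis unfolding e by linarith
  qed
  finally show "(\<mu> j 0 - w)\<^sup>2 * (norm \<alpha>)\<^sup>2 \<le> (2 + 2 * pmax\<^sup>2 / a_lo) * (mean_sq Y A + mean_sq Y C)"
    by (simp add: power_mult_distrib)
qed

end

section \<open>The discrete Bloch transform\<close>

lemma Q_grid_sum: "n > 0 \<Longrightarrow> (\<Sum>q\<in>Q_grid n. f q) = (\<Sum>i<n. f (real i / real n))"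
  unfolding Q_grid_def by (subst sum.reindex) (auto simp: inj_on_def)

lemma finite_Q_grid [simp]: "finite (Q_grid n)" by (simp add: Q_grid_def)

lemma Q_grid_Z: "p \<in> Q_grid n1 \<times> Q_grid n2 \<Longrightarrow> p \<in> Z_cell"
  by (auto simp: Q_grid_def Z_cell_def divide_le_eq_1)

lemma roots_of_unity_orthogonal:
  assumes "a < n" "b < n"
  shows "(\<Sum>i<n. cis (2 * pi * (real i / real n) * (real a - real b))) = (if a = b then of_nat n else 0)"
proof (cases "a = b")
  case False
  define t where "t = 2 * pi * (real a - real b) / real n"
  have n: "real n > 0" using assms by simp
  have c: "cis (2 * pi * (real i / real n) * (real a - real b)) = cis t ^ i" for i
  proof -
    have "2 * pi * (real i / real n) * (real a - real b) = real i * t" by (simp add: t_def)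
    then show ?thesis unfolding Complex.DeMoivre by simp
  qed
  have tn: "cis t ^ n = 1"
  proof -
    have nt: "real n * t = 2 * pi * of_int (int a - int b)"
      using n by (simp add: t_def)
    show ?thesis unfolding Complex.DeMoivre nt by (simp only: cis_multiple_2pi Ints_of_int)
  qed
  have "cis t \<noteq> 1"
  proof
    assume "cis t = 1"
    then have "sin t = 0" "cos t = 1" by (auto simp: complex_eq_iff)
    then obtain k :: int where "t = of_int k * (2 * pi)" by (auto simp: cos_one_2pi_int mult.assoc)
    then have "2 * pi * (real a - real b) = 2 * pi * (of_int k * real n)"
      using n unfolding t_def by (simp add: field_simps)
    then have "real a - real b = of_int k * real n" by simp
    then have e: "int a - int b = k * int n" by (metis of_int_diff of_int_eq_iff of_int_mult of_int_of_nat_eq)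
    have "\<bar>int a - int b\<bar> < int n" using assms by linarith
    then have "\<bar>k\<bar> * int n < 1 * int n" unfolding e by (simp add: abs_mult)
    then have "k = 0" by (simp only: mult_less_cancel_right) auto
    then show False using e False by simp
  qed
  then show ?thesis unfolding c using False by (simp add: geometric_sum tn lessThan_atLeast0[symmetric])
qed simp

definition bwave :: "real \<Rightarrow> plane \<Rightarrow> plane \<Rightarrow> complex" where
  "bwave \<epsilon> j x = cis (2 * pi * (j \<bullet> x) / \<epsilon>)"

lemma bwave_conv: "bwave \<epsilon> j = (\<lambda>x. cis ((2 * pi / \<epsilon>) *\<^sub>R j \<bullet> x))"
  by (simp add: bwave_def fun_eq_iff)

lemma bwave_borel [measurable]: "bwave \<epsilon> j \<in> borel_measurable borel"
  unfolding bwave_conv by (rule borel_measurable_continuous_onI[OF Cinf_continuous[OF Cinf_cis_inner]])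

lemma norm_bwave [simp]: "norm (bwave \<epsilon> j x) = 1" by (simp add: bwave_def)

lemma Cinf_bwave: "Cinf (bwave \<epsilon> j)"
  unfolding bwave_conv by (rule Cinf_cis_inner)

lemma grad_bwave: "grad (bwave \<epsilon> j) x =
    (\<i> * of_real (2 * pi * fst j / \<epsilon>) * bwave \<epsilon> j x, \<i> * of_real (2 * pi * snd j / \<epsilon>) * bwave \<epsilon> j x)"
  unfolding bwave_conv grad_cis_inner by simp

text \<open>The projection of a function on a large cell to the quasiperiodic functions with wave number \<open>j\<close>,
  with the phase removed so that the result is periodic. It lives on one periodicity cell.\<close>

definition bloch_transform :: "real \<Rightarrow> nat \<Rightarrow> nat \<Rightarrow> plane \<Rightarrow> (plane \<Rightarrow> complex) \<Rightarrow> plane \<Rightarrow> complex" where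
  "bloch_transform \<epsilon> n1 n2 j F x = (\<Sum>c\<in>{..<n1} \<times> {..<n2}.
      F (x + tile \<epsilon> \<epsilon> c) * cnj (bwave \<epsilon> j (x + tile \<epsilon> \<epsilon> c))) / of_nat (n1 * n2)"

lemma L2_on_tile:
  assumes "F \<in> borel_measurable borel" "s1 > 0" "s2 > 0"
  shows "L2_on (cell (real n1 * s1) (real n2 * s2)) F \<longleftrightarrow>
    (\<forall>c\<in>{..<n1} \<times> {..<n2}. L2_on (cell s1 s2) (\<lambda>x. F (x + tile s1 s2 c)))"
proof -
  have [measurable]: "F \<in> borel_measurable borel" by fact
  have "(\<lambda>x. (norm (F x))\<^sup>2) \<in> borel_measurable borel" by measurable
  from set_integrable_tile(1)[OF this assms(2,3), of n1 n2]
  show ?thesis by (auto simp: L2_on_def)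
qed

lemma bloch_transform_L2:
  assumes "\<epsilon> > 0" "L2_on (cell (real n1 * \<epsilon>) (real n2 * \<epsilon>)) F"
  shows "L2_on (cell \<epsilon> \<epsilon>) (bloch_transform \<epsilon> n1 n2 j F)"
proof -
  note [measurable] = L2_onD(1)[OF assms(2)]
  have "L2_on (cell \<epsilon> \<epsilon>) (\<lambda>x. cnj (bwave \<epsilon> j (x + tile \<epsilon> \<epsilon> c)) * F (x + tile \<epsilon> \<epsilon> c))" if "c \<in> {..<n1} \<times> {..<n2}" for c
  proof (rule L2_on_bounded_mult[where C=1])
    show "L2_on (cell \<epsilon> \<epsilon>) (\<lambda>x. F (x + tile \<epsilon> \<epsilon> c))"
      using L2_on_tile[OF L2_onD(1)[OF assms(2)] assms(1,1), of n1 n2] assms(2) that by blast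
    show "(\<lambda>x. cnj (bwave \<epsilon> j (x + tile \<epsilon> \<epsilon> c))) \<in> borel_measurable borel"
      by (intro borel_measurable_continuous_onI Cinf_continuous Cinf_cnj Cinf_shift Cinf_bwave)
  qed auto
  from L2_on_cmult[OF cell_borel L2_on_sum[OF cell_borel this, of "{..<n1} \<times> {..<n2}" "\<lambda>c. c"], where c="1 / of_nat (n1 * n2)"]
  have "L2_on (cell \<epsilon> \<epsilon>) (\<lambda>x. 1 / of_nat (n1 * n2) * (\<Sum>c\<in>{..<n1} \<times> {..<n2}. cnj (bwave \<epsilon> j (x + tile \<epsilon> \<epsilon> c)) * F (x + tile \<epsilon> \<epsilon> c)))"
    by blast
  moreover have "bloch_transform \<epsilon> n1 n2 j F = (\<lambda>x. 1 / of_nat (n1 * n2) * (\<Sum>c\<in>{..<n1} \<times> {..<n2}. cnj (bwave \<epsilon> j (x + tile \<epsilon> \<epsilon> c)) * F (x + tile \<epsilon> \<epsilon> c)))"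
    by (simp add: bloch_transform_def mult.commute fun_eq_iff)
  ultimately show ?thesis by simp
qed

lemma mean_ip_tile:
  assumes \<epsilon>: "\<epsilon> > 0" and n: "n1 > 0" "n2 > 0"
    and F: "L2_on (cell (real n1 * \<epsilon>) (real n2 * \<epsilon>)) F" and G: "L2_on (cell (real n1 * \<epsilon>) (real n2 * \<epsilon>)) G"
  shows "mean_ip (cell (real n1 * \<epsilon>) (real n2 * \<epsilon>)) F G =
    (\<Sum>c\<in>{..<n1} \<times> {..<n2}. mean_ip (cell \<epsilon> \<epsilon>) (\<lambda>x. F (x + tile \<epsilon> \<epsilon> c)) (\<lambda>x. G (x + tile \<epsilon> \<epsilon> c))) / of_nat (n1 * n2)"
proof -
  note [measurable] = L2_onD(1)[OF F] L2_onD(1)[OF L2_on_cnj[OF G]]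
  have "(\<lambda>x. F x * cnj (G x)) \<in> borel_measurable borel" by measurable
  from set_integrable_tile(2)[OF this \<epsilon> \<epsilon> L2_prod_integrable[OF cell_borel F G]]
  show ?thesis
    using \<epsilon> n by (simp add: mean_ip_def sum_divide_distrib[symmetric] divide_divide_eq_left mult_ac)
qed

lemma periodic2_tile:
  assumes "periodic2 \<epsilon> f"
  shows "f (x + tile \<epsilon> \<epsilon> c) = f x"
proof -
  have 1: "f (x + (real i * \<epsilon>, 0)) = f x" for i x
  proof (induction i)
    case 0 then show ?case by (simp add: zero_prod_def[symmetric])
  next
    case (Suc i)
    have "f (x + (real (Suc i) * \<epsilon>, 0)) = f (x + (real i * \<epsilon>, 0) + (\<epsilon>, 0))"
      by (simp add: algebra_simps)
    also have "\<dots> = f (x + (real i * \<epsilon>, 0))" using assms unfolding periodic2_def by blast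
    finally show ?case using Suc by simp
  qed
  have 2: "f (x + (0, real i * \<epsilon>)) = f x" for i x
  proof (induction i)
    case 0 then show ?case by (simp add: zero_prod_def[symmetric])
  next
    case (Suc i)
    have "f (x + (0, real (Suc i) * \<epsilon>)) = f (x + (0, real i * \<epsilon>) + (0, \<epsilon>))"
      by (simp add: algebra_simps)
    also have "\<dots> = f (x + (0, real i * \<epsilon>))" using assms unfolding periodic2_def by blast
    finally show ?case using Suc by simp
  qed
  have t: "x + tile \<epsilon> \<epsilon> c = x + (real (fst c) * \<epsilon>, 0) + (0, real (snd c) * \<epsilon>)"
    by (simp add: tile_def add.assoc)
  show ?thesis unfolding t 2 1 ..
qed

lemma test_cell_periodic2: "\<psi> \<in> test_cell \<epsilon> \<epsilon> \<Longrightarrow> periodic2 \<epsilon> \<psi>"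
  by (simp add: test_cell_def periodic2_def)

lemma periodic_bwave_L2:
  assumes \<epsilon>: "\<epsilon> > 0" and p: "periodic2 \<epsilon> \<psi>" and L: "L2_on (cell \<epsilon> \<epsilon>) \<psi>"
  shows "L2_on (cell (real n1 * \<epsilon>) (real n2 * \<epsilon>)) (\<lambda>x. \<psi> x * bwave \<epsilon> j x)"
proof -
  note [measurable] = L2_onD(1)[OF L]
  have "(\<lambda>x. \<psi> x * bwave \<epsilon> j x) \<in> borel_measurable borel" by measurable
  moreover have "L2_on (cell \<epsilon> \<epsilon>) (\<lambda>x. bwave \<epsilon> j (x + tile \<epsilon> \<epsilon> c) * \<psi> x)" for c
    by (rule L2_on_bounded_mult[where C=1])
      (auto intro!: L borel_measurable_continuous_onI Cinf_continuous Cinf_shift Cinf_bwave)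
  ultimately show ?thesis
    using L2_on_tile[of "\<lambda>x. \<psi> x * bwave \<epsilon> j x" \<epsilon> \<epsilon> n1 n2] \<epsilon>
    by (simp add: periodic2_tile[OF p] mult.commute)
qed

lemma bloch_transform_adjoint:
  assumes \<epsilon>: "\<epsilon> > 0" and n: "n1 > 0" "n2 > 0"
    and F: "L2_on (cell (real n1 * \<epsilon>) (real n2 * \<epsilon>)) F" and p: "periodic2 \<epsilon> \<psi>" and L: "L2_on (cell \<epsilon> \<epsilon>) \<psi>"
  shows "mean_ip (cell (real n1 * \<epsilon>) (real n2 * \<epsilon>)) F (\<lambda>x. \<psi> x * bwave \<epsilon> j x) =
    mean_ip (cell \<epsilon> \<epsilon>) (bloch_transform \<epsilon> n1 n2 j F) \<psi>"
proof -
  let ?Y = "cell \<epsilon> \<epsilon>"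
  have L1: "L2_on ?Y (\<lambda>x. F (x + tile \<epsilon> \<epsilon> c) * cnj (bwave \<epsilon> j (x + tile \<epsilon> \<epsilon> c)))" if c: "c \<in> {..<n1} \<times> {..<n2}" for c
  proof -
    have "L2_on ?Y (\<lambda>x. F (x + tile \<epsilon> \<epsilon> c))"
      using L2_on_tile[OF L2_onD(1)[OF F] \<epsilon> \<epsilon>, of n1 n2] F c by blast
    then have "L2_on ?Y (\<lambda>x. cnj (bwave \<epsilon> j (x + tile \<epsilon> \<epsilon> c)) * F (x + tile \<epsilon> \<epsilon> c))"
      by (rule L2_on_bounded_mult[where C=1, OF cell_borel])
        (auto intro!: borel_measurable_continuous_onI Cinf_continuous Cinf_cnj Cinf_shift Cinf_bwave)
    then show ?thesis by (simp add: mult.commute)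
  qed
  have "mean_ip (cell (real n1 * \<epsilon>) (real n2 * \<epsilon>)) F (\<lambda>x. \<psi> x * bwave \<epsilon> j x) =
    (\<Sum>c\<in>{..<n1} \<times> {..<n2}. mean_ip ?Y (\<lambda>x. F (x + tile \<epsilon> \<epsilon> c)) (\<lambda>x. \<psi> x * bwave \<epsilon> j (x + tile \<epsilon> \<epsilon> c))) / of_nat (n1 * n2)"
    by (subst mean_ip_tile[OF \<epsilon> n F periodic_bwave_L2[OF \<epsilon> p L]]) (simp add: periodic2_tile[OF p])
  also have "(\<Sum>c\<in>{..<n1} \<times> {..<n2}. mean_ip ?Y (\<lambda>x. F (x + tile \<epsilon> \<epsilon> c)) (\<lambda>x. \<psi> x * bwave \<epsilon> j (x + tile \<epsilon> \<epsilon> c))) =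
     (\<Sum>c\<in>{..<n1} \<times> {..<n2}. mean_ip ?Y (\<lambda>x. F (x + tile \<epsilon> \<epsilon> c) * cnj (bwave \<epsilon> j (x + tile \<epsilon> \<epsilon> c))) \<psi>)"
    by (intro sum.cong refl) (simp add: mean_ip_def mult_ac)
  also have "\<dots> = mean_ip ?Y (\<lambda>x. \<Sum>c\<in>{..<n1} \<times> {..<n2}. F (x + tile \<epsilon> \<epsilon> c) * cnj (bwave \<epsilon> j (x + tile \<epsilon> \<epsilon> c))) \<psi>"
    using L1 L by (subst mean_ip_sum_left) auto
  also have "\<dots> / of_nat (n1 * n2) = mean_ip ?Y (bloch_transform \<epsilon> n1 n2 j F) \<psi>"
    using mean_ip_cmult_left[OF cell_borel, of \<epsilon> \<epsilon> "1 / of_nat (n1 * n2)"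
        "\<lambda>x. \<Sum>c\<in>{..<n1} \<times> {..<n2}. F (x + tile \<epsilon> \<epsilon> c) * cnj (bwave \<epsilon> j (x + tile \<epsilon> \<epsilon> c))" \<psi>]
    unfolding bloch_transform_def by simp
  finally show ?thesis .
qed

lemma grid_orthogonal:
  assumes n: "n1 > 0" "n2 > 0" and "c \<in> {..<n1} \<times> {..<n2}" "d \<in> {..<n1} \<times> {..<n2}" and \<epsilon>: "\<epsilon> \<noteq> 0"
  shows "(\<Sum>j\<in>Q_grid n1 \<times> Q_grid n2. cnj (bwave \<epsilon> j (x + tile \<epsilon> \<epsilon> c)) * bwave \<epsilon> j (x + tile \<epsilon> \<epsilon> d)) =
    (if c = d then of_nat (n1 * n2) else 0)"
proof -
  have b: "cnj (bwave \<epsilon> (p, q) (x + tile \<epsilon> \<epsilon> c)) * bwave \<epsilon> (p, q) (x + tile \<epsilon> \<epsilon> d) =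
     cis (2 * pi * p * (real (fst d) - real (fst c))) * cis (2 * pi * q * (real (snd d) - real (snd c)))" for p q
  proof -
    have "2 * pi * ((p, q) \<bullet> (x + tile \<epsilon> \<epsilon> d)) / \<epsilon> - 2 * pi * ((p, q) \<bullet> (x + tile \<epsilon> \<epsilon> c)) / \<epsilon> =
      2 * pi * (((p, q) \<bullet> tile \<epsilon> \<epsilon> d) / \<epsilon> - ((p, q) \<bullet> tile \<epsilon> \<epsilon> c) / \<epsilon>)"
      by (simp add: inner_add_right algebra_simps add_divide_distrib)
    also have "\<dots> = 2 * pi * p * (real (fst d) - real (fst c)) + 2 * pi * q * (real (snd d) - real (snd c))"
      using \<epsilon> by (simp add: tile_def add_divide_distrib algebra_simps)
    finally show ?thesis by (simp add: bwave_def cis_cnj cis_mult)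
  qed
  have "(\<Sum>j\<in>Q_grid n1 \<times> Q_grid n2. cnj (bwave \<epsilon> j (x + tile \<epsilon> \<epsilon> c)) * bwave \<epsilon> j (x + tile \<epsilon> \<epsilon> d)) =
     (\<Sum>p\<in>Q_grid n1. \<Sum>q\<in>Q_grid n2. cis (2 * pi * p * (real (fst d) - real (fst c))) * cis (2 * pi * q * (real (snd d) - real (snd c))))"
    unfolding b[symmetric] sum.cartesian_product split_def prod.collapse ..
  also have "\<dots> = (\<Sum>p\<in>Q_grid n1. cis (2 * pi * p * (real (fst d) - real (fst c)))) * (\<Sum>q\<in>Q_grid n2. cis (2 * pi * q * (real (snd d) - real (snd c))))"
    by (simp add: sum_product)
  also have "\<dots> = (if fst d = fst c then of_nat n1 else 0) * (if snd d = snd c then of_nat n2 else 0)"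
    using assms(3,4) unfolding Q_grid_sum[OF n(1)] Q_grid_sum[OF n(2)]
    by (simp only: mem_Times_iff lessThan_iff roots_of_unity_orthogonal)
  finally show ?thesis by (auto simp: prod_eq_iff)
qed

text \<open>At a fixed point the transform is a finite Fourier transform over the translates of the point.\<close>

lemma bloch_transform_Parseval_pointwise:
  assumes n: "n1 > 0" "n2 > 0" and \<epsilon>: "\<epsilon> \<noteq> 0"
  shows "(\<Sum>j\<in>Q_grid n1 \<times> Q_grid n2. bloch_transform \<epsilon> n1 n2 j F x * cnj (bloch_transform \<epsilon> n1 n2 j G x)) =
     (\<Sum>c\<in>{..<n1} \<times> {..<n2}. F (x + tile \<epsilon> \<epsilon> c) * cnj (G (x + tile \<epsilon> \<epsilon> c))) / of_nat (n1 * n2)"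
proof -
  let ?I = "{..<n1} \<times> {..<n2}" and ?J = "Q_grid n1 \<times> Q_grid n2"
  define N :: complex where "N = of_nat (n1 * n2)"
  have N0: "N \<noteq> 0" "cnj N = N" using n by (simp_all add: N_def)
  let ?b = "\<lambda>j c. bwave \<epsilon> j (x + tile \<epsilon> \<epsilon> c)"
  have "(\<Sum>j\<in>?J. bloch_transform \<epsilon> n1 n2 j F x * cnj (bloch_transform \<epsilon> n1 n2 j G x)) =
     (\<Sum>j\<in>?J. \<Sum>c\<in>?I. \<Sum>d\<in>?I. F (x + tile \<epsilon> \<epsilon> c) * cnj (G (x + tile \<epsilon> \<epsilon> d)) * (cnj (?b j c) * ?b j d)) / (N * N)"
    unfolding bloch_transform_def N_def[symmetric] complex_cnj_divide N0(2) sum_divide_distrib[symmetric] times_divide_times_eq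
    by (intro arg_cong2[where f="(/)"] sum.cong refl) (simp add: sum_product mult_ac)
  also have "(\<Sum>j\<in>?J. \<Sum>c\<in>?I. \<Sum>d\<in>?I. F (x + tile \<epsilon> \<epsilon> c) * cnj (G (x + tile \<epsilon> \<epsilon> d)) * (cnj (?b j c) * ?b j d)) =
     (\<Sum>c\<in>?I. \<Sum>d\<in>?I. F (x + tile \<epsilon> \<epsilon> c) * cnj (G (x + tile \<epsilon> \<epsilon> d)) * (\<Sum>j\<in>?J. cnj (?b j c) * ?b j d))"
    unfolding sum_distrib_left by (subst sum.swap, intro sum.cong refl, rule sum.swap)
  also have "\<dots> = (\<Sum>c\<in>?I. \<Sum>d\<in>?I. F (x + tile \<epsilon> \<epsilon> c) * cnj (G (x + tile \<epsilon> \<epsilon> d)) * (if c = d then N else 0))"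
    unfolding N_def by (intro sum.cong refl arg_cong2[where f="(*)"] grid_orthogonal n \<epsilon>)
  also have "\<dots> = (\<Sum>c\<in>?I. F (x + tile \<epsilon> \<epsilon> c) * cnj (G (x + tile \<epsilon> \<epsilon> c)) * N)"
    by (intro sum.cong refl) (simp add: if_distrib[of "\<lambda>y. _ * y"] cong: if_cong)
  also have "\<dots> / (N * N) = (\<Sum>c\<in>?I. F (x + tile \<epsilon> \<epsilon> c) * cnj (G (x + tile \<epsilon> \<epsilon> c))) / N"
    using N0 by (simp add: sum_distrib_right[symmetric])
  finally show ?thesis unfolding N_def .
qed

lemma bloch_transform_Parseval:
  assumes \<epsilon>: "\<epsilon> > 0" and n: "n1 > 0" "n2 > 0"
    and F: "L2_on (cell (real n1 * \<epsilon>) (real n2 * \<epsilon>)) F" and G: "L2_on (cell (real n1 * \<epsilon>) (real n2 * \<epsilon>)) G"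
  shows "mean_ip (cell (real n1 * \<epsilon>) (real n2 * \<epsilon>)) F G =
    (\<Sum>j\<in>Q_grid n1 \<times> Q_grid n2. mean_ip (cell \<epsilon> \<epsilon>) (bloch_transform \<epsilon> n1 n2 j F) (bloch_transform \<epsilon> n1 n2 j G))"
proof -
  let ?Y = "cell \<epsilon> \<epsilon>"
  have LF: "L2_on ?Y (\<lambda>x. F (x + tile \<epsilon> \<epsilon> c))" if "c \<in> {..<n1} \<times> {..<n2}" for c
    using L2_on_tile[OF L2_onD(1)[OF F] \<epsilon> \<epsilon>, of n1 n2] F that by blast
  have LG: "L2_on ?Y (\<lambda>x. G (x + tile \<epsilon> \<epsilon> c))" if "c \<in> {..<n1} \<times> {..<n2}" for c
    using L2_on_tile[OF L2_onD(1)[OF G] \<epsilon> \<epsilon>, of n1 n2] G that by blast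
  have si: "(LINT x:?Y|lborel. (\<Sum>i\<in>A. f i x)) = (\<Sum>i\<in>A. LINT x:?Y|lborel. f i x)"
    if "\<And>i. i \<in> A \<Longrightarrow> set_integrable lborel ?Y (f i)" for A and f :: "'i \<Rightarrow> plane \<Rightarrow> complex"
    using that unfolding set_lebesgue_integral_def set_integrable_def
    by (simp add: scaleR_sum_right Bochner_Integration.integral_sum)
  have "(\<Sum>j\<in>Q_grid n1 \<times> Q_grid n2. mean_ip ?Y (bloch_transform \<epsilon> n1 n2 j F) (bloch_transform \<epsilon> n1 n2 j G)) =
     (LINT x:?Y|lborel. (\<Sum>j\<in>Q_grid n1 \<times> Q_grid n2. bloch_transform \<epsilon> n1 n2 j F x * cnj (bloch_transform \<epsilon> n1 n2 j G x))) / measure lborel ?Y"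
    unfolding mean_ip_def sum_divide_distrib[symmetric]
    by (subst si) (auto intro!: L2_prod_integrable bloch_transform_L2 \<epsilon> F G)
  also have "\<dots> = (LINT x:?Y|lborel. (\<Sum>c\<in>{..<n1} \<times> {..<n2}. F (x + tile \<epsilon> \<epsilon> c) * cnj (G (x + tile \<epsilon> \<epsilon> c)))) / of_nat (n1 * n2) / measure lborel ?Y"
    using \<epsilon> by (subst bloch_transform_Parseval_pointwise[OF n]) auto
  also have "\<dots> = (\<Sum>c\<in>{..<n1} \<times> {..<n2}. mean_ip ?Y (\<lambda>x. F (x + tile \<epsilon> \<epsilon> c)) (\<lambda>x. G (x + tile \<epsilon> \<epsilon> c))) / of_nat (n1 * n2)"
    unfolding mean_ip_def sum_divide_distrib[symmetric]
    by (subst si) (auto intro!: L2_prod_integrable LF LG)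
  also have "\<dots> = mean_ip (cell (real n1 * \<epsilon>) (real n2 * \<epsilon>)) F G"
    by (rule mean_ip_tile[OF \<epsilon> n F G, symmetric])
  finally show ?thesis by simp
qed

lemma bloch_transform_mean_sq:
  assumes \<epsilon>: "\<epsilon> > 0" and n: "n1 > 0" "n2 > 0"
    and F: "L2_on (cell (real n1 * \<epsilon>) (real n2 * \<epsilon>)) F"
  shows "mean_sq (cell (real n1 * \<epsilon>) (real n2 * \<epsilon>)) F =
    (\<Sum>j\<in>Q_grid n1 \<times> Q_grid n2. mean_sq (cell \<epsilon> \<epsilon>) (bloch_transform \<epsilon> n1 n2 j F))"
  using bloch_transform_Parseval[OF \<epsilon> n F F] unfolding mean_ip_self of_real_sum[symmetric]
  by (simp only: of_real_eq_iff)

lemma bloch_transform_periodic_mult: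
  assumes "periodic2 \<epsilon> f"
  shows "bloch_transform \<epsilon> n1 n2 j (\<lambda>x. f x * F x) x = f x * bloch_transform \<epsilon> n1 n2 j F x"
  by (simp add: bloch_transform_def periodic2_tile[OF assms] sum_distrib_left mult.assoc)

lemma bloch_transform_periodic_bwave:
  assumes n: "n1 > 0" "n2 > 0" and \<epsilon>: "\<epsilon> \<noteq> 0" and p: "periodic2 \<epsilon> \<psi>"
    and j: "j \<in> Q_grid n1 \<times> Q_grid n2" and k: "k \<in> Q_grid n1 \<times> Q_grid n2"
  shows "bloch_transform \<epsilon> n1 n2 k (\<lambda>x. \<psi> x * bwave \<epsilon> j x) x = (if j = k then \<psi> x else 0)"
proof -
  obtain i1 i2 l1 l2 where i: "i1 < n1" "i2 < n2" "l1 < n1" "l2 < n2"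
    and jk: "j = (real i1 / real n1, real i2 / real n2)" "k = (real l1 / real n1, real l2 / real n2)"
    using j k by (auto simp: Q_grid_def)
  have b: "bwave \<epsilon> j (x + tile \<epsilon> \<epsilon> (c, d)) * cnj (bwave \<epsilon> k (x + tile \<epsilon> \<epsilon> (c, d))) =
     bwave \<epsilon> (j - k) x * (cis (2 * pi * (real c / real n1) * (real i1 - real l1)) * cis (2 * pi * (real d / real n2) * (real i2 - real l2)))" for c d
  proof -
    have "2 * pi * (j \<bullet> (x + tile \<epsilon> \<epsilon> (c, d))) / \<epsilon> - 2 * pi * (k \<bullet> (x + tile \<epsilon> \<epsilon> (c, d))) / \<epsilon> =
      2 * pi * ((j - k) \<bullet> x) / \<epsilon> + 2 * pi * (((j - k) \<bullet> tile \<epsilon> \<epsilon> (c, d)) / \<epsilon>)"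
      by (simp add: inner_add_right inner_diff_left algebra_simps add_divide_distrib diff_divide_distrib)
    also have "((j - k) \<bullet> tile \<epsilon> \<epsilon> (c, d)) / \<epsilon> = (real c / real n1) * (real i1 - real l1) + (real d / real n2) * (real i2 - real l2)"
      using \<epsilon> by (simp add: jk tile_def add_divide_distrib) (simp add: diff_divide_distrib algebra_simps)
    finally show ?thesis by (simp add: bwave_def cis_cnj cis_mult distrib_left mult.assoc)
  qed
  have b': "\<psi> x * (bwave \<epsilon> j (x + tile \<epsilon> \<epsilon> (c, d)) * cnj (bwave \<epsilon> k (x + tile \<epsilon> \<epsilon> (c, d)))) =
     \<psi> x * bwave \<epsilon> (j - k) x * (cis (2 * pi * (real c / real n1) * (real i1 - real l1)) * cis (2 * pi * (real d / real n2) * (real i2 - real l2)))" for c d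
    by (simp only: b mult.assoc)
  have "bloch_transform \<epsilon> n1 n2 k (\<lambda>x. \<psi> x * bwave \<epsilon> j x) x =
    \<psi> x * bwave \<epsilon> (j - k) x * (\<Sum>c<n1. \<Sum>d<n2. cis (2 * pi * (real c / real n1) * (real i1 - real l1)) * cis (2 * pi * (real d / real n2) * (real i2 - real l2))) / of_nat (n1 * n2)"
    unfolding bloch_transform_def
    unfolding b'[symmetric] sum_distrib_left sum.cartesian_product split_def prod.collapse
    by (simp add: periodic2_tile[OF p] mult.assoc)
  also have "(\<Sum>c<n1. \<Sum>d<n2. cis (2 * pi * (real c / real n1) * (real i1 - real l1)) * cis (2 * pi * (real d / real n2) * (real i2 - real l2))) =
     (if i1 = l1 then of_nat n1 else 0) * (if i2 = l2 then of_nat n2 else 0)"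
    using i by (simp only: sum_product[symmetric] roots_of_unity_orthogonal)
  finally show ?thesis
    using n by (auto simp: jk bwave_def zero_prod_def[symmetric])
qed

section \<open>Riesz--Fischer theorem\<close>

lemma set_integral_norm_le_mean_sq:
  assumes S: "S \<in> sets borel" "bounded S" "measure lborel S > 0" and f: "L2_on S f"
  shows "set_integrable lborel S f" "(LINT x:S|lborel. norm (f x)) \<le> measure lborel S * sqrt (mean_sq S f)"
proof -
  have one: "L2_on S (\<lambda>x. 1)" by (rule continuous_L2_on) (use S in auto)
  show "set_integrable lborel S f" using L2_prod_integrable[OF S(1) f one] by simp
  have fm [measurable]: "f \<in> borel_measurable borel" by (rule L2_onD[OF f])
  have nf: "L2_on S (\<lambda>x. complex_of_real (norm (f x)))"
    using f by (simp add: L2_on_def)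
  have 1: "mean_sq S (\<lambda>x. 1) = 1"
  proof -
    have "emeasure lborel S < \<infinity>" by (rule emeasure_bounded_finite[OF S(2)])
    then have "(LINT x:S|lborel. (1::real)) = measure lborel S"
      using S by (simp add: set_lebesgue_integral_def)
    then show ?thesis using S(3) by (simp add: mean_sq_def)
  qed
  have "mean_ip S (\<lambda>x. complex_of_real (norm (f x))) (\<lambda>x. 1) = complex_of_real ((LINT x:S|lborel. norm (f x)) / measure lborel S)"
    by (simp add: mean_ip_def set_integral_complex_of_real)
  moreover have "norm (mean_ip S (\<lambda>x. complex_of_real (norm (f x))) (\<lambda>x. 1)) \<le> sqrt (mean_sq S f)"
    using mean_ip_Cauchy_Schwarz[OF S(1) nf one] mean_sq_cong[of S "\<lambda>x. complex_of_real (norm (f x))" f] by (simp add: 1)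
  ultimately have "\<bar>(LINT x:S|lborel. norm (f x)) / measure lborel S\<bar> \<le> sqrt (mean_sq S f)" by (metis norm_of_real)
  then have "(LINT x:S|lborel. norm (f x)) / measure lborel S \<le> sqrt (mean_sq S f)" by linarith
  then show "(LINT x:S|lborel. norm (f x)) \<le> measure lborel S * sqrt (mean_sq S f)"
    using S(3) by (simp add: field_simps)
qed

text \<open>The Cauchy property in the mean gives convergence in \<open>L\<^sup>1\<close>, hence almost everywhere along a
  subsequence, and Fatou's lemma identifies the limit.\<close>

lemma L2_complete:
  assumes S: "S \<in> sets borel" "bounded S" "measure lborel S > 0"
    and f: "\<And>k. L2_on S (f k)" and d: "d \<longlonglongrightarrow> 0"
    and cauchy: "\<And>k l. k \<le> l \<Longrightarrow> mean_sq S (\<lambda>x. f l x - f k x) \<le> d k"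
  obtains v where "L2_on S v" "\<And>k. mean_sq S (\<lambda>x. v x - f k x) \<le> d k"
proof -
  have d0: "0 \<le> d k" for k using cauchy[of k k] mean_sq_nonneg order_trans by blast
  have fm [measurable]: "f k \<in> borel_measurable borel" for k by (rule L2_onD[OF f])
  note [measurable] = S(1)
  define M where "M = measure lborel S"
  define s where "s k x = indicator S x *\<^sub>R f k x" for k x
  have sm [measurable]: "s k \<in> borel_measurable borel" for k unfolding s_def by measurable
  have si: "integrable lborel (s k)" for k
    using set_integral_norm_le_mean_sq(1)[OF S f, of k] unfolding s_def set_integrable_def .
  have sd: "(LINT x|lborel. norm (s i x - s l x)) \<le> M * sqrt (d (min i l))" for i l
  proof -
    have le: "(LINT x|lborel. norm (s i x - s l x)) \<le> M * sqrt (d l)" if "l \<le> i" for i l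
    proof -
      have "(LINT x|lborel. norm (s i x - s l x)) = (LINT x:S|lborel. norm (f i x - f l x))"
        unfolding set_lebesgue_integral_def s_def
        by (intro Bochner_Integration.integral_cong) (auto simp: indicator_def)
      also have "\<dots> \<le> M * sqrt (mean_sq S (\<lambda>x. f i x - f l x))"
        unfolding M_def by (rule set_integral_norm_le_mean_sq(2)[OF S L2_on_diff[OF S(1) f f]])
      also have "\<dots> \<le> M * sqrt (d l)"
        using cauchy[OF that] by (intro mult_left_mono) (auto simp: M_def)
      finally show ?thesis .
    qed
    show ?thesis
    proof (cases "l \<le> i")
      case True then show ?thesis using le[OF True] by (simp add: min_absorb2)
    next
      case False then show ?thesis using le[of i l] by (simp add: min_def norm_minus_commute)
    qed
  qed
  have CS: "\<exists>N. \<forall>i\<ge>N. \<forall>j\<ge>N. (LINT x|lborel. norm (s i x - s j x)) < e" if "e > 0" for e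
  proof -
    have "(\<lambda>k. M * sqrt (d k)) \<longlonglongrightarrow> 0"
      using tendsto_mult[OF tendsto_const tendsto_real_sqrt[OF d]] by simp
    from order_tendstoD(2)[OF this that] obtain N where N: "\<And>k. k \<ge> N \<Longrightarrow> M * sqrt (d k) < e"
      unfolding eventually_sequentially by blast
    have "(LINT x|lborel. norm (s i x - s j x)) < e" if "i \<ge> N" "j \<ge> N" for i j
      using sd[of i j] N[of "min i j"] that by simp
    then show ?thesis by blast
  qed
  obtain a where a: "strict_mono a" and ac: "AE x in lborel. Cauchy (\<lambda>i. s (a i) x)"
    by (rule cauchy_L1_AE_cauchy_subseq[of lborel s, OF si CS])
  define v where "v x = lim (\<lambda>i. s (a i) x)" for x
  have vm [measurable]: "v \<in> borel_measurable borel"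
    unfolding v_def by (rule borel_measurable_lim_metric) simp
  have conv: "AE x in lborel. (\<lambda>i. s (a i) x) \<longlonglongrightarrow> v x"
    using ac unfolding v_def by eventually_elim (simp add: Cauchy_convergent_iff convergent_LIMSEQ_iff)
  have bound: "(\<integral>\<^sup>+x. ennreal (indicator S x * (norm (v x - f k x))\<^sup>2) \<partial>lborel) \<le> ennreal (M * d k)" for k
  proof -
    have "(\<integral>\<^sup>+x. ennreal (indicator S x * (norm (v x - f k x))\<^sup>2) \<partial>lborel) \<le>
        (\<integral>\<^sup>+x. liminf (\<lambda>i. ennreal (indicator S x * (norm (f (a i) x - f k x))\<^sup>2)) \<partial>lborel)"
    proof (rule nn_integral_mono_AE)
      show "AE x in lborel. ennreal (indicator S x * (norm (v x - f k x))\<^sup>2) \<le>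
        liminf (\<lambda>i. ennreal (indicator S x * (norm (f (a i) x - f k x))\<^sup>2))"
        using conv
      proof eventually_elim
        case (elim x)
        show ?case
        proof (cases "x \<in> S")
          case True
          have "(\<lambda>i. ennreal (indicator S x * (norm (f (a i) x - f k x))\<^sup>2)) \<longlonglongrightarrow> ennreal (indicator S x * (norm (v x - f k x))\<^sup>2)"
            using elim True by (intro tendsto_intros) (simp add: s_def)
          from lim_imp_Liminf[OF sequentially_bot this] show ?thesis by (simp only: order_refl)
        qed simp
      qed
    qed
    also have "\<dots> \<le> liminf (\<lambda>i. \<integral>\<^sup>+x. ennreal (indicator S x * (norm (f (a i) x - f k x))\<^sup>2) \<partial>lborel)"
      by (rule nn_integral_liminf) measurable
    also have "\<dots> \<le> ennreal (M * d k)"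
    proof (rule Liminf_le)
      show "\<forall>\<^sub>F i in sequentially. (\<integral>\<^sup>+x. ennreal (indicator S x * (norm (f (a i) x - f k x))\<^sup>2) \<partial>lborel) \<le> ennreal (M * d k)"
      proof (rule eventually_sequentiallyI[of k])
        fix i assume "k \<le> i"
        then have ki: "k \<le> a i" using seq_suble[OF a, of i] by linarith
        have "set_integrable lborel S (\<lambda>x. (norm (f (a i) x - f k x))\<^sup>2)"
          by (rule L2_onD(2)[OF L2_on_diff[OF S(1) f f]])
        then have "(\<integral>\<^sup>+x. ennreal (indicator S x * (norm (f (a i) x - f k x))\<^sup>2) \<partial>lborel) =
            ennreal (LINT x:S|lborel. (norm (f (a i) x - f k x))\<^sup>2)"
          unfolding set_lebesgue_integral_def set_integrable_def by (simp add: nn_integral_eq_integral)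
        also have "(LINT x:S|lborel. (norm (f (a i) x - f k x))\<^sup>2) = M * mean_sq S (\<lambda>x. f (a i) x - f k x)"
          using S(3) by (simp add: mean_sq_def M_def)
        also have "ennreal \<dots> \<le> ennreal (M * d k)"
          using cauchy[OF ki] by (intro ennreal_leI mult_left_mono) (auto simp: M_def)
        finally show "(\<integral>\<^sup>+x. ennreal (indicator S x * (norm (f (a i) x - f k x))\<^sup>2) \<partial>lborel) \<le> ennreal (M * d k)" .
      qed
    qed simp
    finally show ?thesis .
  qed
  have L: "L2_on S (\<lambda>x. v x - f k x)" for k
    unfolding L2_on_def set_integrable_def
  proof
    show "integrable lborel (\<lambda>x. indicat_real S x *\<^sub>R (norm (v x - f k x))\<^sup>2)"
      using le_less_trans[OF bound[of k] ennreal_less_top]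
      by (intro integrableI_bounded) (simp_all add: abs_mult)
  qed measurable
  have "L2_on S (\<lambda>x. (v x - f 0 x) + f 0 x)" by (rule L2_on_add[OF S(1) L f])
  then have Lv: "L2_on S v" by simp
  have "mean_sq S (\<lambda>x. v x - f k x) \<le> d k" for k
  proof -
    have "ennreal (LINT x:S|lborel. (norm (v x - f k x))\<^sup>2) \<le> ennreal (M * d k)"
      using bound[of k] L2_onD(2)[OF L[of k]] unfolding set_lebesgue_integral_def set_integrable_def
      by (simp add: nn_integral_eq_integral)
    then have "(LINT x:S|lborel. (norm (v x - f k x))\<^sup>2) \<le> M * d k"
      using d0[of k] S(3) by (simp add: M_def)
    then show ?thesis using S(3) by (simp add: mean_sq_def M_def field_simps)
  qed
  with Lv show ?thesis by (rule that)
qed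

lemma mean_sq_orthonormal_sum:
  assumes S: "S \<in> sets borel" and "finite F" "\<And>i. i \<in> F \<Longrightarrow> L2_on S (e i)"
    and on: "\<And>i k. i \<in> F \<Longrightarrow> k \<in> F \<Longrightarrow> mean_ip S (e i) (e k) = (if i = k then 1 else 0)"
  shows "mean_sq S (\<lambda>x. \<Sum>i\<in>F. c i * e i x) = (\<Sum>i\<in>F. (norm (c i))\<^sup>2)"
    and "k \<in> F \<Longrightarrow> mean_ip S (\<lambda>x. \<Sum>i\<in>F. c i * e i x) (e k) = c k"
proof -
  let ?s = "\<lambda>x. \<Sum>i\<in>F. c i * e i x"
  have Ls: "L2_on S ?s" by (intro L2_on_sum L2_on_cmult S assms)
  have se: "mean_ip S ?s (e k) = c k" if "k \<in> F" for k
  proof -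
    have "mean_ip S ?s (e k) = (\<Sum>i\<in>F. c i * mean_ip S (e i) (e k))"
      using assms that by (subst mean_ip_sum_left) (auto intro!: L2_on_cmult)
    also have "\<dots> = (\<Sum>i\<in>F. if i = k then c i else 0)"
      using that on by (intro sum.cong) auto
    finally show ?thesis using that assms(2) by simp
  qed
  then show "k \<in> F \<Longrightarrow> mean_ip S ?s (e k) = c k" .
  have "mean_sq S (\<lambda>x. ?s x - (\<Sum>i\<in>F. mean_ip S ?s (e i) * e i x)) = mean_sq S ?s - (\<Sum>i\<in>F. (norm (mean_ip S ?s (e i)))\<^sup>2)"
    using assms Ls by (intro mean_sq_orthonormal_remainder) auto
  moreover have "mean_sq S (\<lambda>x. ?s x - (\<Sum>i\<in>F. mean_ip S ?s (e i) * e i x)) = 0"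
    by (simp add: se mean_sq_def)
  ultimately show "mean_sq S ?s = (\<Sum>i\<in>F. (norm (c i))\<^sup>2)" by (simp add: se)
qed

text \<open>Guarantees that partial Bloch expansions over infinite index sets exist.\<close>

lemma Riesz_Fischer:
  assumes S: "S \<in> sets borel" "bounded S" "measure lborel S > 0"
    and e: "\<And>i. i \<in> A \<Longrightarrow> L2_on S (e i)"
    and on: "\<And>i k. i \<in> A \<Longrightarrow> k \<in> A \<Longrightarrow> mean_ip S (e i) (e k) = (if i = k then 1 else 0)"
    and B: "\<And>F. finite F \<Longrightarrow> F \<subseteq> A \<Longrightarrow> (\<Sum>i\<in>F. (norm (c i))\<^sup>2) \<le> B"
  shows "\<exists>v. L2_has_sum S (\<lambda>i x. c i * e i x) A v"
proof -
  define q where "q F = (\<Sum>i\<in>F. (norm (c i))\<^sup>2)" for F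
  define \<F> where "\<F> = {F. finite F \<and> F \<subseteq> A}"
  define s where "s F = (\<lambda>x. \<Sum>i\<in>F. c i * e i x)" for F
  have bdd: "bdd_above (q ` \<F>)" using B by (auto simp: \<F>_def q_def bdd_above_def)
  have ne: "\<F> \<noteq> {}" by (auto simp: \<F>_def)
  have "\<exists>F\<in>\<F>. q F > Sup (q ` \<F>) - 1 / real (Suc k)" for k
    using less_cSup_iff[of "q ` \<F>" "Sup (q ` \<F>) - 1 / real (Suc k)"] bdd ne by auto
  then obtain H where H: "\<And>k. H k \<in> \<F>" "\<And>k. q (H k) > Sup (q ` \<F>) - 1 / real (Suc k)" by metis
  define G where "G k = (\<Union>i\<le>k. H i)" for k
  have G: "G k \<in> \<F>" for k using H(1) by (auto simp: G_def \<F>_def)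
  have Gmono: "k \<le> l \<Longrightarrow> G k \<subseteq> G l" for k l by (force simp: G_def)
  have qmono: "q F \<le> q F'" if "F \<subseteq> F'" "F' \<in> \<F>" for F F'
    using that unfolding q_def \<F>_def by (intro sum_mono2) auto
  have tail: "q F - q (G k) \<le> 1 / real (Suc k)" if "F \<in> \<F>" for F k
  proof -
    have "q F \<le> Sup (q ` \<F>)" using bdd that by (intro cSup_upper) auto
    moreover have "q (H k) \<le> q (G k)" by (rule qmono[OF _ G]) (auto simp: G_def)
    ultimately show ?thesis using H(2)[of k] by linarith
  qed
  have Ls: "L2_on S (s F)" if "F \<in> \<F>" for F
    using that e unfolding s_def \<F>_def by (intro L2_on_sum L2_on_cmult S(1)) auto
  have diff: "mean_sq S (\<lambda>x. s F x - s (G k) x) \<le> 1 / real (Suc k)" if "G k \<subseteq> F" "F \<in> \<F>" for F k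
  proof -
    have fin: "finite F" using that by (simp add: \<F>_def)
    have "s F x - s (G k) x = (\<Sum>i\<in>F - G k. c i * e i x)" for x
      unfolding s_def using that(1) fin by (simp add: sum_diff)
    then have "mean_sq S (\<lambda>x. s F x - s (G k) x) = mean_sq S (\<lambda>x. \<Sum>i\<in>F - G k. c i * e i x)" by simp
    also have "\<dots> = q (F - G k)"
      unfolding q_def
    proof (rule mean_sq_orthonormal_sum(1)[OF S(1)])
      have FA: "F - G k \<subseteq> A" using that by (auto simp: \<F>_def)
      show "L2_on S (e i)" if "i \<in> F - G k" for i using e FA that by blast
      show "mean_ip S (e i) (e l) = (if i = l then 1 else 0)" if "i \<in> F - G k" "l \<in> F - G k" for i l
        using on FA that by blast
    qed (use fin in simp)
    also have "\<dots> = q F - q (G k)" unfolding q_def using that(1) fin by (simp add: sum_diff)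
    finally show ?thesis using tail[OF that(2)] by simp
  qed
  have d: "(\<lambda>k. 1 / real (Suc k)) \<longlonglongrightarrow> 0" using LIMSEQ_inverse_real_of_nat by (simp add: inverse_eq_divide)
  obtain v where v: "L2_on S v" "\<And>k. mean_sq S (\<lambda>x. v x - s (G k) x) \<le> 1 / real (Suc k)"
    using L2_complete[OF S Ls[OF G] d diff[OF Gmono G]] by blast
  have "((\<lambda>F. mean_sq S (\<lambda>x. v x - s F x)) \<longlongrightarrow> 0) (finite_subsets_at_top A)"
  proof (rule tendstoI)
    fix \<epsilon> :: real assume "\<epsilon> > 0"
    have "(\<lambda>k. 4 * (1 / real (Suc k))) \<longlonglongrightarrow> 0" using tendsto_mult[OF tendsto_const d, of 4] by simp
    then obtain k where k: "4 * (1 / real (Suc k)) < \<epsilon>"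
      using \<open>\<epsilon> > 0\<close> eventually_happens[OF order_tendstoD(2)] by fastforce
    show "\<forall>\<^sub>F F in finite_subsets_at_top A. dist (mean_sq S (\<lambda>x. v x - s F x)) 0 < \<epsilon>"
      unfolding eventually_finite_subsets_at_top
    proof (intro exI conjI allI impI)
      show "finite (G k)" "G k \<subseteq> A" using G by (auto simp: \<F>_def)
      fix F assume F: "finite F \<and> G k \<subseteq> F \<and> F \<subseteq> A"
      then have F': "F \<in> \<F>" by (auto simp: \<F>_def)
      have "mean_sq S (\<lambda>x. v x - s F x) = mean_sq S (\<lambda>x. (v x - s (G k) x) - (s F x - s (G k) x))" by simp
      also have "\<dots> \<le> 2 * mean_sq S (\<lambda>x. v x - s (G k) x) + 2 * mean_sq S (\<lambda>x. s F x - s (G k) x)"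
        by (intro mean_sq_diff_le L2_on_diff S(1) v Ls G F')
      also have "\<dots> \<le> 4 * (1 / real (Suc k))"
        using v(2)[of k] diff[OF _ F', of k] F by linarith
      finally show "dist (mean_sq S (\<lambda>x. v x - s F x)) 0 < \<epsilon>" using k by (simp add: dist_real_def)
    qed
  qed
  then have "((\<lambda>F. measure lborel S * mean_sq S (\<lambda>x. v x - s F x)) \<longlongrightarrow> measure lborel S * 0) (finite_subsets_at_top A)"
    by (intro tendsto_mult tendsto_const)
  then have "L2_has_sum S (\<lambda>i x. c i * e i x) A v"
    using v(1) S(3) by (simp add: L2_has_sum_def s_def mean_sq_def)
  then show ?thesis by blast
qed

lemma L2_has_sum_Bessel:
  assumes S: "S \<in> sets borel" "measure lborel S > 0"
    and e: "\<And>i. i \<in> A \<Longrightarrow> L2_on S (e i)"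
    and on: "\<And>i k. i \<in> A \<Longrightarrow> k \<in> A \<Longrightarrow> mean_ip S (e i) (e k) = (if i = k then 1 else 0)"
    and sum: "L2_has_sum S (\<lambda>i x. c i * e i x) A v" and F: "finite F" "F \<subseteq> A"
  shows "(\<Sum>i\<in>F. (norm (c i))\<^sup>2) \<le> mean_sq S v"
proof -
  have v: "L2_on S v" using sum by (simp add: L2_has_sum_def)
  have lim: "((\<lambda>F. mean_sq S (\<lambda>x. v x - (\<Sum>i\<in>F. c i * e i x))) \<longlongrightarrow> 0) (finite_subsets_at_top A)"
    using tendsto_divide_zero[of _ _ "measure lborel S"] sum unfolding L2_has_sum_def mean_sq_def by blast
  have "mean_ip S v (e k) = c k" if k: "k \<in> A" for k
  proof -
    have "((\<lambda>F. mean_ip S v (e k) - c k) \<longlongrightarrow> 0) (finite_subsets_at_top A)"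
    proof (rule Lim_null_comparison)
      show "\<forall>\<^sub>F F in finite_subsets_at_top A. norm (mean_ip S v (e k) - c k) \<le>
          sqrt (mean_sq S (\<lambda>x. v x - (\<Sum>i\<in>F. c i * e i x))) * sqrt (mean_sq S (e k))"
        unfolding eventually_finite_subsets_at_top
      proof (intro exI[of _ "{k}"] conjI allI impI)
        fix F assume F: "finite F \<and> {k} \<subseteq> F \<and> F \<subseteq> A"
        have Ls: "L2_on S (\<lambda>x. \<Sum>i\<in>F. c i * e i x)" using F e by (intro L2_on_sum L2_on_cmult S(1)) auto
        have e': "L2_on S (e i)" if "i \<in> F" for i using e F that by blast
        have on': "mean_ip S (e i) (e l) = (if i = l then 1 else 0)" if "i \<in> F" "l \<in> F" for i l
          using on F that by blast
        have "mean_ip S (\<lambda>x. \<Sum>i\<in>F. c i * e i x) (e k) = c k"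
          using F by (intro mean_sq_orthonormal_sum(2)[OF S(1) _ e' on']) auto
        then have "mean_ip S v (e k) - c k = mean_ip S (\<lambda>x. v x - (\<Sum>i\<in>F. c i * e i x)) (e k)"
          using mean_ip_diff_left[OF S(1) v Ls e[OF k]] by simp
        then show "norm (mean_ip S v (e k) - c k) \<le> sqrt (mean_sq S (\<lambda>x. v x - (\<Sum>i\<in>F. c i * e i x))) * sqrt (mean_sq S (e k))"
          using mean_ip_Cauchy_Schwarz[OF S(1) L2_on_diff[OF S(1) v Ls] e[OF k]] by simp
      qed (use k in auto)
      show "((\<lambda>F. sqrt (mean_sq S (\<lambda>x. v x - (\<Sum>i\<in>F. c i * e i x))) * sqrt (mean_sq S (e k))) \<longlongrightarrow> 0) (finite_subsets_at_top A)"
        using tendsto_mult[OF tendsto_real_sqrt[OF lim] tendsto_const] by simp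
    qed
    then show ?thesis by (simp add: tendsto_const_iff)
  qed
  then have "(\<Sum>i\<in>F. (norm (c i))\<^sup>2) = (\<Sum>i\<in>F. (norm (mean_ip S v (e i)))\<^sup>2)"
    using F by (intro sum.cong refl) auto
  also have "\<dots> \<le> mean_sq S v"
  proof (rule Bessel_inequality[OF S(1) F(1) v])
    show "L2_on S (e i)" if "i \<in> F" for i using e F that by blast
    show "mean_ip S (e i) (e l) = (if i = l then 1 else 0)" if "i \<in> F" "l \<in> F" for i l
      using on F that by blast
  qed
  finally show ?thesis .
qed

section \<open>Bloch waves on large cells\<close>

lemma bloch_wave_eq: "bloch_wave \<epsilon> \<Psi> \<xi> = (\<lambda>x. \<Psi> (fst \<xi>) (snd \<xi>) x * bwave \<epsilon> (fst \<xi>) x)"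
  by (simp add: bloch_wave_def bwave_def fun_eq_iff)

lemma grad_periodic:
  assumes "Cinf \<phi>" "\<And>x. \<phi> (x + c) = \<phi> x"
  shows "grad \<phi> (x + c) = grad \<phi> x"
  using grad_shift[OF assms(1), of c x] assms(2) by simp

lemma tgrad_periodic2:
  assumes "\<psi> \<in> test_cell \<epsilon> \<epsilon>"
  shows "periodic2 \<epsilon> (\<lambda>x. fst (tgrad \<epsilon> j \<psi> x))" "periodic2 \<epsilon> (\<lambda>x. snd (tgrad \<epsilon> j \<psi> x))"
  using test_cellD[OF assms] grad_periodic[OF test_cellD(1)[OF assms], of "(\<epsilon>, 0)"]
    grad_periodic[OF test_cellD(1)[OF assms], of "(0, \<epsilon>)"]
  by (simp_all add: periodic2_def bloch_grad_def)

lemma test_cell_bwave: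
  assumes \<psi>: "\<psi> \<in> test_cell \<epsilon> \<epsilon>" and j: "j \<in> Q_grid n1 \<times> Q_grid n2" and n: "n1 > 0" "n2 > 0" and \<epsilon>: "\<epsilon> \<noteq> 0"
  shows "(\<lambda>x. \<psi> x * bwave \<epsilon> j x) \<in> test_cell (real n1 * \<epsilon>) (real n2 * \<epsilon>)"
    and "tgrad \<epsilon> (0, 0) (\<lambda>x. \<psi> x * bwave \<epsilon> j x) x = (fst (tgrad \<epsilon> j \<psi> x) * bwave \<epsilon> j x, snd (tgrad \<epsilon> j \<psi> x) * bwave \<epsilon> j x)"
proof -
  obtain i1 i2 where jd: "j = (real i1 / real n1, real i2 / real n2)" using j by (auto simp: Q_grid_def)
  have p: "\<psi> (x + (real n1 * \<epsilon>, 0)) = \<psi> x" "\<psi> (x + (0, real n2 * \<epsilon>)) = \<psi> x" for x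
    using periodic2_tile[OF test_cell_periodic2[OF \<psi>], of x "(n1, 0)"]
      periodic2_tile[OF test_cell_periodic2[OF \<psi>], of x "(0, n2)"] by (simp_all add: tile_def)
  have b1: "bwave \<epsilon> j (x + (real n1 * \<epsilon>, 0)) = bwave \<epsilon> j x" for x
  proof -
    have "2 * pi * (j \<bullet> (x + (real n1 * \<epsilon>, 0))) / \<epsilon> = 2 * pi * (j \<bullet> x) / \<epsilon> + 2 * pi * of_int (int i1)"
      using n \<epsilon> by (simp add: inner_add_right jd add_divide_distrib distrib_left)
    then show ?thesis unfolding bwave_def by (simp only: cis_add_2pi_int)
  qed
  have b2: "bwave \<epsilon> j (x + (0, real n2 * \<epsilon>)) = bwave \<epsilon> j x" for x
  proof -
    have "2 * pi * (j \<bullet> (x + (0, real n2 * \<epsilon>))) / \<epsilon> = 2 * pi * (j \<bullet> x) / \<epsilon> + 2 * pi * of_int (int i2)"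
      using n \<epsilon> by (simp add: inner_add_right jd add_divide_distrib distrib_left)
    then show ?thesis unfolding bwave_def by (simp only: cis_add_2pi_int)
  qed
  show "(\<lambda>x. \<psi> x * bwave \<epsilon> j x) \<in> test_cell (real n1 * \<epsilon>) (real n2 * \<epsilon>)"
    using test_cellD(1)[OF \<psi>] by (simp add: test_cell_def p b1 b2 Cinf_mult Cinf_bwave)
  show "tgrad \<epsilon> (0, 0) (\<lambda>x. \<psi> x * bwave \<epsilon> j x) x = (fst (tgrad \<epsilon> j \<psi> x) * bwave \<epsilon> j x, snd (tgrad \<epsilon> j \<psi> x) * bwave \<epsilon> j x)"
    by (simp add: bloch_grad_def grad_mult[OF test_cellD(1)[OF \<psi>] Cinf_bwave] grad_bwave algebra_simps)
qed

context bloch_cell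
begin

lemma bloch_wave_L2:
  assumes "fst \<xi> \<in> Z_cell"
  shows "L2_on (cell (real n1 * \<epsilon>) (real n2 * \<epsilon>)) (bloch_wave \<epsilon> \<Psi> \<xi>)"
  unfolding bloch_wave_eq using assms by (intro periodic_bwave_L2 \<epsilon> Psi_periodic Psi_L2)

lemma bloch_coefficient:
  assumes n: "n1 > 0" "n2 > 0" and F: "L2_on (cell (real n1 * \<epsilon>) (real n2 * \<epsilon>)) F" and j: "j \<in> Z_cell"
  shows "mean_ip (cell (real n1 * \<epsilon>) (real n2 * \<epsilon>)) F (bloch_wave \<epsilon> \<Psi> (j, m)) =
    mean_ip Y (bloch_transform \<epsilon> n1 n2 j F) (\<Psi> j m)"
  unfolding bloch_wave_eq fst_conv snd_conv by (rule bloch_transform_adjoint[OF \<epsilon> n F Psi_periodic[OF j] Psi_L2[OF j]])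

lemma bloch_wave_orthonormal:
  assumes n: "n1 > 0" "n2 > 0" and "fst \<xi> \<in> Q_grid n1 \<times> Q_grid n2" "fst \<zeta> \<in> Q_grid n1 \<times> Q_grid n2"
  shows "mean_ip (cell (real n1 * \<epsilon>) (real n2 * \<epsilon>)) (bloch_wave \<epsilon> \<Psi> \<xi>) (bloch_wave \<epsilon> \<Psi> \<zeta>) = (if \<xi> = \<zeta> then 1 else 0)"
proof -
  obtain j m k l where \<xi>\<zeta>: "\<xi> = (j, m)" "\<zeta> = (k, l)" by fastforce
  have jk: "j \<in> Q_grid n1 \<times> Q_grid n2" "k \<in> Q_grid n1 \<times> Q_grid n2" using assms \<xi>\<zeta> by auto
  note jZ = Q_grid_Z[OF jk(1)] and kZ = Q_grid_Z[OF jk(2)]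
  have "bloch_transform \<epsilon> n1 n2 k (bloch_wave \<epsilon> \<Psi> (j, m)) x = (if j = k then \<Psi> j m x else 0)" for x
    unfolding bloch_wave_eq fst_conv snd_conv
    using \<epsilon> by (intro bloch_transform_periodic_bwave n Psi_periodic jZ jk) auto
  then have t: "bloch_transform \<epsilon> n1 n2 k (bloch_wave \<epsilon> \<Psi> (j, m)) = (\<lambda>x. if j = k then \<Psi> j m x else 0)"
    by (rule ext)
  have "mean_ip (cell (real n1 * \<epsilon>) (real n2 * \<epsilon>)) (bloch_wave \<epsilon> \<Psi> \<xi>) (bloch_wave \<epsilon> \<Psi> \<zeta>) =
     mean_ip Y (\<lambda>x. if j = k then \<Psi> j m x else 0) (\<Psi> k l)"
    unfolding \<xi>\<zeta> t[symmetric] by (rule bloch_coefficient[OF n bloch_wave_L2 kZ]) (use jZ in simp)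
  then show ?thesis unfolding \<xi>\<zeta> by (cases "j = k") (simp_all add: Psi_orthonormal[OF kZ])
qed

lemma bloch_Bessel:
  assumes n: "n1 > 0" "n2 > 0" and F: "L2_on (cell (real n1 * \<epsilon>) (real n2 * \<epsilon>)) f"
    and X: "finite X" "fst ` X \<subseteq> Q_grid n1 \<times> Q_grid n2"
  shows "(\<Sum>\<xi>\<in>X. (norm (mean_ip (cell (real n1 * \<epsilon>) (real n2 * \<epsilon>)) f (bloch_wave \<epsilon> \<Psi> \<xi>)))\<^sup>2)
    \<le> mean_sq (cell (real n1 * \<epsilon>) (real n2 * \<epsilon>)) f"
proof (rule Bessel_inequality[OF cell_borel X(1) F])
  show "L2_on (cell (real n1 * \<epsilon>) (real n2 * \<epsilon>)) (bloch_wave \<epsilon> \<Psi> \<xi>)" if "\<xi> \<in> X" for \<xi>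
    using that X by (intro bloch_wave_L2 Q_grid_Z) blast
  show "mean_ip (cell (real n1 * \<epsilon>) (real n2 * \<epsilon>)) (bloch_wave \<epsilon> \<Psi> \<xi>) (bloch_wave \<epsilon> \<Psi> \<zeta>) = (if \<xi> = \<zeta> then 1 else 0)"
    if "\<xi> \<in> X" "\<zeta> \<in> X" for \<xi> \<zeta>
    using that X by (intro bloch_wave_orthonormal n) blast+
qed

text \<open>The partial expansion is determined only through its convergence property; this suffices for
  Bessel's inequality on its coefficients.\<close>

lemma bloch_proj_bound:
  assumes R: "R > 0" and w: "L2_on (W_box \<epsilon> R) w" and X: "finite X" "X \<subseteq> I_index R \<inter> A"
  shows "(\<Sum>\<xi>\<in>X. (norm (mean_ip (W_box \<epsilon> R) w (bloch_wave \<epsilon> \<Psi> \<xi>)))\<^sup>2)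
    \<le> mean_sq (W_box \<epsilon> R) (bloch_proj \<epsilon> R (bloch_wave \<epsilon> \<Psi>) A w)"
proof -
  let ?W = "W_box \<epsilon> R" and ?U = "bloch_wave \<epsilon> \<Psi>"
  have W: "?W \<in> sets borel" "bounded ?W" "measure lborel ?W > 0"
    using \<epsilon> R by (simp_all add: W_box_eq)
  have U: "L2_on ?W (?U \<xi>)" if "\<xi> \<in> I_index R \<inter> A" for \<xi>
    using that unfolding W_box_eq I_index_def by (intro bloch_wave_L2 Q_grid_Z) auto
  have on: "mean_ip ?W (?U \<xi>) (?U \<zeta>) = (if \<xi> = \<zeta> then 1 else 0)" if "\<xi> \<in> I_index R \<inter> A" "\<zeta> \<in> I_index R \<inter> A" for \<xi> \<zeta>
    using that unfolding W_box_eq I_index_def by (intro bloch_wave_orthonormal R) auto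
  have "\<exists>v. L2_has_sum ?W (\<lambda>\<xi> x. mean_ip ?W w (?U \<xi>) * ?U \<xi> x) (I_index R \<inter> A) v"
  proof (rule Riesz_Fischer[OF W U on])
    fix F assume F: "finite F" "F \<subseteq> I_index R \<inter> A"
    show "(\<Sum>\<xi>\<in>F. (norm (mean_ip ?W w (?U \<xi>)))\<^sup>2) \<le> mean_sq ?W w"
      using F w unfolding W_box_eq I_index_def by (intro bloch_Bessel R) auto
  qed
  then have "L2_has_sum ?W (\<lambda>\<xi> x. mean_ip ?W w (?U \<xi>) * ?U \<xi> x) (I_index R \<inter> A) (bloch_proj \<epsilon> R ?U A w)"
    unfolding bloch_proj_def by (rule someI_ex)
  from L2_has_sum_Bessel[OF W(1,3) U on this X] show ?thesis .
qed

text \<open>The Bloch transform turns a perturbed Helmholtz equation on a large cell into independent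
  perturbed eigenvalue equations on the periodicity cell.\<close>

lemma perturbed_equation_on_large_cell:
  assumes per: "periodic2 \<epsilon> b" and n: "n1 > 0" "n2 > 0"
  defines "D \<equiv> cell (real n1 * \<epsilon>) (real n2 * \<epsilon>)"
  assumes W: "bloch_H1 (real n1 * \<epsilon>) (real n2 * \<epsilon>) \<epsilon> (0, 0) W G" and A: "L2_on D A" and C: "L2_on D C"
    and eq: "\<And>\<phi>. \<phi> \<in> test_cell (real n1 * \<epsilon>) (real n2 * \<epsilon>) \<Longrightarrow>
        mean_ip D (\<lambda>x. complex_of_real (b x) * fst (G x)) (\<lambda>x. fst (tgrad \<epsilon> (0, 0) \<phi> x)) +
        mean_ip D (\<lambda>x. complex_of_real (b x) * snd (G x)) (\<lambda>x. snd (tgrad \<epsilon> (0, 0) \<phi> x)) =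
        complex_of_real w * mean_ip D W \<phi> - mean_ip D A \<phi> + mean_ip D C (\<lambda>x. fst (tgrad \<epsilon> (0, 0) \<phi> x))"
    and \<Lambda>: "\<And>j m. j \<in> Z_cell \<Longrightarrow> m \<ge> 1 \<Longrightarrow> \<Lambda> \<le> \<mu> j m" and w: "0 \<le> w" "w < \<Lambda>"
  defines "X \<equiv> mean_sq D A + mean_sq D C"
    and "K \<equiv> 2 * (1 / \<Lambda> + 1 / a_lo) / (1 - w / \<Lambda>)\<^sup>2"
    and "c \<equiv> \<lambda>j l. mean_ip D W (bloch_wave \<epsilon> \<Psi> (j, l))"
  shows "(\<Sum>j\<in>Q_grid n1 \<times> Q_grid n2. (\<mu> j 0 - w)\<^sup>2 * (norm (c j 0))\<^sup>2) \<le> (2 + 2 * pmax\<^sup>2 / a_lo) * X"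
    and "l \<ge> 1 \<Longrightarrow> (\<Sum>j\<in>Q_grid n1 \<times> Q_grid n2. (norm (c j l))\<^sup>2) \<le> K / \<Lambda> * X"
    and "\<bar>Im (mean_ip D (\<lambda>x. complex_of_real (b x) * fst (G x)) W) -
           (\<Sum>j\<in>Q_grid n1 \<times> Q_grid n2. (norm (c j 0))\<^sup>2 * flux (\<Psi> j 0) (\<Gamma> j 0))\<bar>
         \<le> sqrt a_hi * (pmax / sqrt \<Lambda> + 1) * sqrt (K * X) * sqrt (mean_sq D W)"
proof -
  let ?J = "Q_grid n1 \<times> Q_grid n2"
  define T where "T j = bloch_transform \<epsilon> n1 n2 j" for j
  define P where "P j = (\<lambda>x. (T j (\<lambda>x. fst (G x)) x, T j (\<lambda>x. snd (G x)) x))" for j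
  note LW = bloch_H1D[OF W, folded D_def]
  have \<Lambda>0: "\<Lambda> > 0" using w by linarith
  have Tb: "T j (\<lambda>x. complex_of_real (b x) * f x) = (\<lambda>x. complex_of_real (b x) * T j f x)" for j f
    unfolding T_def using per by (intro ext bloch_transform_periodic_mult) (simp add: periodic2_def)
  have b_big: "L2_on D (\<lambda>x. complex_of_real (b x) * f x)" if "L2_on D f" for f
  proof -
    have "L2_on Y (\<lambda>x. complex_of_real (b (x + tile \<epsilon> \<epsilon> c)) * f (x + tile \<epsilon> \<epsilon> c))" if c: "c \<in> {..<n1} \<times> {..<n2}" for c
    proof -
      have "L2_on Y (\<lambda>x. f (x + tile \<epsilon> \<epsilon> c))"
        using L2_on_tile[OF L2_onD(1)[OF \<open>L2_on D f\<close>] \<epsilon> \<epsilon>, of n1 n2] \<open>L2_on D f\<close> c unfolding D_def by blast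
      then show ?thesis by (simp add: periodic2_tile[OF per] L2_weight)
    qed
    then show ?thesis
      using L2_on_tile[of "\<lambda>x. complex_of_real (b x) * f x" \<epsilon> \<epsilon> n1 n2] \<epsilon> L2_onD(1)[OF that] by (simp add: D_def)
  qed
  have LT: "L2_on Y (T j f)" if "L2_on D f" for j f
    using that unfolding T_def D_def by (rule bloch_transform_L2[OF \<epsilon>])
  have adj: "mean_ip D f (\<lambda>x. \<psi> x * bwave \<epsilon> j x) = mean_ip Y (T j f) \<psi>"
    if "L2_on D f" "periodic2 \<epsilon> \<psi>" "L2_on Y \<psi>" for f \<psi> j
    unfolding T_def D_def using that by (intro bloch_transform_adjoint \<epsilon> n) (auto simp: D_def)
  have pars: "mean_ip D f g = (\<Sum>j\<in>?J. mean_ip Y (T j f) (T j g))" if "L2_on D f" "L2_on D g" for f g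
    unfolding T_def D_def using that by (intro bloch_transform_Parseval \<epsilon> n) (auto simp: D_def)
  have parsq: "mean_sq D f = (\<Sum>j\<in>?J. mean_sq Y (T j f))" if "L2_on D f" for f
    unfolding T_def D_def using that by (intro bloch_transform_mean_sq \<epsilon> n) (auto simp: D_def)
  have H: "H1 j (T j W) (P j)" if j: "j \<in> ?J" for j
    unfolding bloch_H1_def L2_pair_on_def
  proof (intro conjI ballI)
    fix \<psi> assume \<psi>: "\<psi> \<in> test_cell \<epsilon> \<epsilon>"
    note t = test_cell_bwave[OF \<psi> j n, of] and L = test_L2_on[OF \<psi> cell_bounded cell_borel]
    have \<epsilon>0: "\<epsilon> \<noteq> 0" using \<epsilon> by simp
    show "mean_ip Y (T j W) (\<lambda>x. fst (tgrad \<epsilon> j \<psi> x)) = - mean_ip Y (\<lambda>x. fst (P j x)) \<psi>"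
      using LW(4)[OF t(1)[OF \<epsilon>0]] adj[OF LW(1) tgrad_periodic2(1)[OF \<psi>] L(2)] adj[OF LW(2) test_cell_periodic2[OF \<psi>] L(1)]
      by (simp add: t(2)[OF \<epsilon>0] P_def)
    show "mean_ip Y (T j W) (\<lambda>x. snd (tgrad \<epsilon> j \<psi> x)) = - mean_ip Y (\<lambda>x. snd (P j x)) \<psi>"
      using LW(5)[OF t(1)[OF \<epsilon>0]] adj[OF LW(1) tgrad_periodic2(2)[OF \<psi>] L(3)] adj[OF LW(3) test_cell_periodic2[OF \<psi>] L(1)]
      by (simp add: t(2)[OF \<epsilon>0] P_def)
  qed (use LT LW in \<open>auto simp: P_def\<close>)
  have E: "form (P j) (tgrad \<epsilon> j \<psi>) = complex_of_real w * mean_ip Y (T j W) \<psi> - mean_ip Y (T j A) \<psi> + mean_ip Y (T j C) (\<lambda>x. fst (tgrad \<epsilon> j \<psi> x))"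
    if j: "j \<in> ?J" and \<psi>: "\<psi> \<in> test_cell \<epsilon> \<epsilon>" for j \<psi>
  proof -
    have \<epsilon>0: "\<epsilon> \<noteq> 0" using \<epsilon> by simp
    note t = test_cell_bwave[OF \<psi> j n \<epsilon>0] and L = test_L2_on[OF \<psi> cell_bounded cell_borel]
    have "form (P j) (tgrad \<epsilon> j \<psi>) =
      mean_ip D (\<lambda>x. complex_of_real (b x) * fst (G x)) (\<lambda>x. fst (tgrad \<epsilon> j \<psi> x) * bwave \<epsilon> j x) +
      mean_ip D (\<lambda>x. complex_of_real (b x) * snd (G x)) (\<lambda>x. snd (tgrad \<epsilon> j \<psi> x) * bwave \<epsilon> j x)"
      using adj[OF b_big[OF LW(2)] tgrad_periodic2(1)[OF \<psi>] L(2)] adj[OF b_big[OF LW(3)] tgrad_periodic2(2)[OF \<psi>] L(3)]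
      by (simp add: form_def wip_def P_def Tb)
    also have "\<dots> = complex_of_real w * mean_ip D W (\<lambda>x. \<psi> x * bwave \<epsilon> j x) - mean_ip D A (\<lambda>x. \<psi> x * bwave \<epsilon> j x)
       + mean_ip D C (\<lambda>x. fst (tgrad \<epsilon> j \<psi> x) * bwave \<epsilon> j x)"
      using eq[OF t(1)] by (simp add: t(2))
    finally show ?thesis
      using adj[OF LW(1) test_cell_periodic2[OF \<psi>] L(1)] adj[OF A test_cell_periodic2[OF \<psi>] L(1)]
        adj[OF C tgrad_periodic2(1)[OF \<psi>] L(2)] by simp
  qed
  have c: "c j l = mean_ip Y (T j W) (\<Psi> j l)" if "j \<in> ?J" for j l
    unfolding c_def T_def D_def by (rule bloch_coefficient[OF n LW(1)[unfolded D_def] Q_grid_Z[OF that]])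
  define r where "r j = (\<lambda>x. T j W x - c j 0 * \<Psi> j 0 x)" for j
  define Q where "Q j = (\<lambda>x. (fst (P j x) - c j 0 * fst (\<Gamma> j 0 x), snd (P j x) - c j 0 * snd (\<Gamma> j 0 x)))" for j
  define x where "x j = mean_sq Y (T j A) + mean_sq Y (T j C)" for j
  have X: "X = (\<Sum>j\<in>?J. x j)" unfolding X_def x_def using A C by (simp add: parsq sum.distrib)
  have est: "en (Q j) \<le> K * x j" "(\<mu> j 0 - w)\<^sup>2 * (norm (c j 0))\<^sup>2 \<le> (2 + 2 * pmax\<^sup>2 / a_lo) * x j" if j: "j \<in> ?J" for j
    using perturbed_eigenvalue_equation[OF Q_grid_Z[OF j] H[OF j] LT[OF A] LT[OF C] E[OF j] \<Lambda>[OF Q_grid_Z[OF j]] w, folded c[OF j]]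
    unfolding K_def x_def Q_def by auto
  have dec: "H1 j (r j) (Q j)" "\<Lambda> * mean_sq Y (r j) \<le> en (Q j)" "l \<ge> 1 \<Longrightarrow> mean_ip Y (r j) (\<Psi> j l) = c j l"
    if j: "j \<in> ?J" for j l
    using ground_decomposition[OF Q_grid_Z[OF j] H[OF j] \<Lambda>[OF Q_grid_Z[OF j]], folded c[OF j], folded r_def Q_def]
    by (auto simp: c[OF j])
  show "(\<Sum>j\<in>?J. (\<mu> j 0 - w)\<^sup>2 * (norm (c j 0))\<^sup>2) \<le> (2 + 2 * pmax\<^sup>2 / a_lo) * X"
    unfolding X sum_distrib_left by (rule sum_mono) (rule est(2))
  show "(\<Sum>j\<in>?J. (norm (c j l))\<^sup>2) \<le> K / \<Lambda> * X" if l: "l \<ge> 1"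
    unfolding X sum_distrib_left
  proof (rule sum_mono)
    fix j assume j: "j \<in> ?J"
    have "(norm (mean_ip Y (r j) (\<Psi> j l)))\<^sup>2 \<le> mean_sq Y (r j) * mean_sq Y (\<Psi> j l)"
      by (rule mean_ip_Cauchy_Schwarz_sq[OF cell_borel bloch_H1D(1)[OF dec(1)[OF j]] Psi_L2[OF Q_grid_Z[OF j]]])
    then have "(norm (c j l))\<^sup>2 \<le> mean_sq Y (r j)"
      using dec(3)[OF j l] by (simp add: Psi_mean_sq[OF Q_grid_Z[OF j]])
    also have "\<dots> \<le> K * x j / \<Lambda>" using dec(2)[OF j] est(1)[OF j] \<Lambda>0 by (simp add: field_simps)
    finally show "(norm (c j l))\<^sup>2 \<le> K / \<Lambda> * x j" by simp
  qed
  have "mean_ip D (\<lambda>x. complex_of_real (b x) * fst (G x)) W = (\<Sum>j\<in>?J. wip (\<lambda>x. fst (P j x)) (T j W))"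
    using pars[OF b_big[OF LW(2)] LW(1)] by (simp add: Tb wip_def P_def)
  then have "Im (mean_ip D (\<lambda>x. complex_of_real (b x) * fst (G x)) W) = (\<Sum>j\<in>?J. flux (T j W) (P j))"
    by (simp add: flux_def)
  then have "\<bar>Im (mean_ip D (\<lambda>x. complex_of_real (b x) * fst (G x)) W) -
           (\<Sum>j\<in>?J. (norm (c j 0))\<^sup>2 * flux (\<Psi> j 0) (\<Gamma> j 0))\<bar>
       \<le> (\<Sum>j\<in>?J. \<bar>flux (T j W) (P j) - (norm (c j 0))\<^sup>2 * flux (\<Psi> j 0) (\<Gamma> j 0)\<bar>)"
    by (simp add: sum_subtractf[symmetric] sum_abs)
  also have "\<dots> \<le> (\<Sum>j\<in>?J. sqrt a_hi * (pmax / sqrt \<Lambda> + 1) * (sqrt (K * x j) * sqrt (mean_sq Y (T j W))))"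
  proof (rule sum_mono)
    fix j assume j: "j \<in> ?J"
    have s1: "sqrt (en (Q j)) \<le> sqrt (K * x j)" using est(1)[OF j] by (rule real_sqrt_le_mono)
    have "mean_sq Y (r j) \<le> K * x j / \<Lambda>" using dec(2)[OF j] est(1)[OF j] \<Lambda>0 by (simp add: field_simps)
    then have s2: "sqrt (mean_sq Y (r j)) \<le> sqrt (K * x j) / sqrt \<Lambda>"
      unfolding real_sqrt_divide[symmetric] by (rule real_sqrt_le_mono)
    have "\<bar>flux (T j W) (P j) - (norm (c j 0))\<^sup>2 * flux (\<Psi> j 0) (\<Gamma> j 0)\<bar> \<le>
       sqrt a_hi * (sqrt (\<mu> j 0) * sqrt (mean_sq Y (r j)) + sqrt (en (Q j))) * sqrt (mean_sq Y (T j W))"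
      using flux_approx[OF Q_grid_Z[OF j] H[OF j] \<Lambda>[OF Q_grid_Z[OF j]], folded c[OF j], folded r_def Q_def] .
    also have "\<dots> \<le> sqrt a_hi * (pmax * (sqrt (K * x j) / sqrt \<Lambda>) + sqrt (K * x j)) * sqrt (mean_sq Y (T j W))"
      using s1 s2 sqrt_mu_le[OF Q_grid_Z[OF j]] a_hi pmax_nonneg
      by (intro mult_right_mono mult_left_mono add_mono mult_mono) auto
    also have "\<dots> = sqrt a_hi * (pmax / sqrt \<Lambda> + 1) * (sqrt (K * x j) * sqrt (mean_sq Y (T j W)))"
      by (simp add: algebra_simps)
    finally show "\<bar>flux (T j W) (P j) - (norm (c j 0))\<^sup>2 * flux (\<Psi> j 0) (\<Gamma> j 0)\<bar> \<le>
      sqrt a_hi * (pmax / sqrt \<Lambda> + 1) * (sqrt (K * x j) * sqrt (mean_sq Y (T j W)))" .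
  qed
  also have "\<dots> = sqrt a_hi * (pmax / sqrt \<Lambda> + 1) * (\<Sum>j\<in>?J. sqrt (K * x j) * sqrt (mean_sq Y (T j W)))"
    by (simp add: sum_distrib_left)
  also have "\<dots> \<le> sqrt a_hi * (pmax / sqrt \<Lambda> + 1) * (sqrt (K * X) * sqrt (mean_sq D W))"
  proof (rule mult_left_mono)
    have K0: "0 \<le> K" using \<Lambda>0 a_lo by (simp add: K_def)
    have "(\<Sum>j\<in>?J. sqrt (K * x j) * sqrt (mean_sq Y (T j W)))\<^sup>2 \<le>
       (\<Sum>j\<in>?J. (sqrt (K * x j))\<^sup>2) * (\<Sum>j\<in>?J. (sqrt (mean_sq Y (T j W)))\<^sup>2)"
      by (rule Cauchy_Schwarz_ineq_sum)
    also have "\<dots> = (K * X) * mean_sq D W"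
      using K0 by (simp add: X parsq[OF LW(1)] x_def sum_distrib_left)
    finally show "(\<Sum>j\<in>?J. sqrt (K * x j) * sqrt (mean_sq Y (T j W))) \<le> sqrt (K * X) * sqrt (mean_sq D W)"
      unfolding real_sqrt_mult[symmetric] by (rule real_le_rsqrt)
  qed (use a_hi pmax_nonneg \<Lambda>0 in simp)
  finally show "\<bar>Im (mean_ip D (\<lambda>x. complex_of_real (b x) * fst (G x)) W) -
           (\<Sum>j\<in>?J. (norm (c j 0))\<^sup>2 * flux (\<Psi> j 0) (\<Gamma> j 0))\<bar>
         \<le> sqrt a_hi * (pmax / sqrt \<Lambda> + 1) * sqrt (K * X) * sqrt (mean_sq D W)"
    by (simp add: mult.assoc)
qed

end

section \<open>The Helmholtz equation in the strip\<close>

lemma strip_borel [measurable, simp]: "strip h \<in> sets borel"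
  by (auto simp: strip_def intro!: borel_open open_Times)

lemma mem_strip: "x \<in> strip h \<longleftrightarrow> 0 < snd x \<and> snd x < h"
  by (cases x) (auto simp: strip_def)

text \<open>Cut-off functions reduce integrals over the infinite strip to integrals over cells.\<close>

lemma strip_integral_eq_cell:
  fixes F :: "plane \<Rightarrow> 'b::{banach, second_countable_topology}"
  assumes [measurable]: "F \<in> borel_measurable borel"
    and z: "\<And>x. fst x \<le> 0 \<or> fst x \<ge> s \<Longrightarrow> F (x + (t, 0)) = 0"
  shows "(LINT x:strip h|lborel. F x) = (LINT x:cell s h|lborel. F (x + (t, 0)))"
proof -
  have "(LINT x:strip h|lborel. F x) = (LBINT x. indicator (strip h) (x + (t, 0)) *\<^sub>R F (x + (t, 0)))"
    unfolding set_lebesgue_integral_def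
    by (rule plane_integral_translate(1)[symmetric]) measurable
  also have "\<dots> = (LINT x:cell s h|lborel. F (x + (t, 0)))"
    unfolding set_lebesgue_integral_def
  proof (intro Bochner_Integration.integral_cong refl)
    fix x :: plane
    show "indicat_real (strip h) (x + (t, 0)) *\<^sub>R F (x + (t, 0)) = indicat_real (cell s h) x *\<^sub>R F (x + (t, 0))"
      using z[of x] by (cases "fst x \<le> 0 \<or> fst x \<ge> s") (auto simp: indicator_def mem_cell mem_strip)
  qed
  finally show ?thesis .
qed

lemma L2_loc_strip_cell:
  assumes "L2_loc_strip h f"
  shows "L2_on (cell s h) (\<lambda>x. f (x + (t, 0)))"
proof -
  define M where "M = \<bar>t\<bar> + \<bar>s\<bar>"
  have L: "L2_on ({-M<..<M} \<times> {0<..<h}) f" using assms unfolding L2_loc_strip_def by blast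
  have [measurable]: "f \<in> borel_measurable borel" by (rule L2_onD[OF L])
  have B: "{-M<..<M} \<times> {0<..<h} \<in> sets borel" by (intro borel_open open_Times) auto
  then have m: "(\<lambda>x. indicator ({-M<..<M} \<times> {0<..<h}) x *\<^sub>R (norm (f x))\<^sup>2) \<in> borel_measurable borel" by measurable
  have "integrable lborel (\<lambda>x. indicator ({-M<..<M} \<times> {0<..<h}) (x + (t, 0)) *\<^sub>R (norm (f (x + (t, 0))))\<^sup>2)"
    using plane_integral_translate(2)[OF m, of "(t, 0)"] L2_onD(2)[OF L] by (simp add: set_integrable_def)
  then have "integrable lborel (\<lambda>x. indicator (cell s h) x *\<^sub>R (indicator ({-M<..<M} \<times> {0<..<h}) (x + (t, 0)) *\<^sub>R (norm (f (x + (t, 0))))\<^sup>2))"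
    by (intro integrable_mult_indicator) auto
  moreover have "indicator (cell s h) x *\<^sub>R (indicator ({-M<..<M} \<times> {0<..<h}) (x + (t, 0)) *\<^sub>R (norm (f (x + (t, 0))))\<^sup>2)
      = indicator (cell s h) x *\<^sub>R (norm (f (x + (t, 0))))\<^sup>2" for x
    by (cases x) (auto simp: indicator_def mem_cell M_def)
  ultimately show ?thesis unfolding L2_on_def set_integrable_def by (simp only:) measurable
qed

lemma L2_line_mult:
  assumes "continuous_on UNIV w" "L2_on (cell s h) f"
  shows "L2_on (cell s h) (\<lambda>x. complex_of_real (w (fst x)) * f x)"
proof -
  have "compact (w ` {0..s})" by (intro compact_continuous_image continuous_on_subset[OF assms(1)]) auto
  then have "bounded (w ` {0..s})" by (rule compact_imp_bounded)
  then obtain B where "\<forall>y\<in>w ` {0..s}. norm y \<le> B" unfolding bounded_iff by blast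
  then have B: "\<bar>w t\<bar> \<le> B" if "t \<in> {0..s}" for t using that by auto
  have "continuous_on UNIV (\<lambda>x::plane. complex_of_real (w (fst x)))"
    by (intro continuous_intros continuous_on_compose2[OF assms(1)]) auto
  then show ?thesis
    by (intro L2_on_bounded_mult[where C=B] assms(2) borel_measurable_continuous_onI)
      (auto simp: mem_cell intro!: B)
qed

definition supported_in :: "(real \<Rightarrow> real) \<Rightarrow> real \<Rightarrow> bool" where
  "supported_in z s \<longleftrightarrow> (\<exists>\<delta>>0. \<forall>r. r < \<delta> \<or> r > s - \<delta> \<longrightarrow> z r = 0)"

lemma supported_inD:
  assumes "supported_in z s" "r \<le> 0 \<or> r \<ge> s"
  shows "z r = 0" "deriv z r = 0"
proof -
  obtain \<delta> where \<delta>: "\<delta> > 0" "\<And>r. r < \<delta> \<or> r > s - \<delta> \<Longrightarrow> z r = 0"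
    using assms(1) unfolding supported_in_def by blast
  show "z r = 0" using \<delta> assms(2) by force
  show "deriv z r = 0"
    by (rule deriv_zero_of_vanishing[of "{..<\<delta>} \<union> {s - \<delta><..}" _ _ 0]) (use \<delta> assms(2) in auto)
qed

text \<open>Weak solutions in the form in which they are used: tested with a cut-off times a function that
  is periodic on a finite piece of the strip.\<close>

definition local_solution :: "real \<Rightarrow> real \<Rightarrow> (plane \<Rightarrow> real) \<Rightarrow> (plane \<Rightarrow> complex) \<Rightarrow> (plane \<Rightarrow> complex) \<Rightarrow> (plane \<Rightarrow> complex) \<Rightarrow> bool" where
  "local_solution h \<omega> a v g1 g2 \<longleftrightarrow> L2_loc_strip h v \<and> L2_loc_strip h g1 \<and> L2_loc_strip h g2 \<and>
    (\<forall>t s z \<phi>. s > 0 \<longrightarrow> smooth_line z \<longrightarrow> supported_in z s \<longrightarrow> \<phi> \<in> test_cell s h \<longrightarrow>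
      mean_ip (cell s h) (\<lambda>x. complex_of_real (z (fst x)) * v (x + (t, 0))) (\<lambda>x. fst (grad \<phi> x)) =
        - mean_ip (cell s h) (\<lambda>x. complex_of_real (z (fst x)) * g1 (x + (t, 0)) + complex_of_real (deriv z (fst x)) * v (x + (t, 0))) \<phi> \<and>
      mean_ip (cell s h) (\<lambda>x. complex_of_real (z (fst x)) * v (x + (t, 0))) (\<lambda>x. snd (grad \<phi> x)) =
        - mean_ip (cell s h) (\<lambda>x. complex_of_real (z (fst x)) * g2 (x + (t, 0))) \<phi> \<and>
      mean_ip (cell s h) (\<lambda>x. complex_of_real (a (x + (t, 0))) * (complex_of_real (z (fst x)) * g1 (x + (t, 0)))) (\<lambda>x. fst (grad \<phi> x)) +
      mean_ip (cell s h) (\<lambda>x. complex_of_real (a (x + (t, 0))) * (complex_of_real (z (fst x)) * g2 (x + (t, 0)))) (\<lambda>x. snd (grad \<phi> x)) =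
        complex_of_real (\<omega>\<^sup>2) * mean_ip (cell s h) (\<lambda>x. complex_of_real (z (fst x)) * v (x + (t, 0))) \<phi> -
        mean_ip (cell s h) (\<lambda>x. complex_of_real (a (x + (t, 0))) * (complex_of_real (deriv z (fst x)) * g1 (x + (t, 0)))) \<phi>)"

lemma borel_measurable_cnj:
  "f \<in> borel_measurable M \<Longrightarrow> (\<lambda>x. cnj (f x)) \<in> borel_measurable M"
  by (rule borel_measurable_continuous_on[OF continuous_on_cnj[OF continuous_on_id]])

lemma plane_fst_shift_measurable:
  assumes "continuous_on UNIV (w :: real \<Rightarrow> real)"
  shows "(\<lambda>x::plane. complex_of_real (w (fst x + c))) \<in> borel_measurable borel"
  by (intro borel_measurable_continuous_onI continuous_intros continuous_on_compose2[OF assms]) auto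

text \<open>A function that is periodic on a piece of the strip becomes an admissible test function after
  multiplication with the cut-off; the product rule moves the cut-off to the solution.\<close>

lemma helmholtz_local_solution:
  assumes sol: "helmholtz_solution h \<omega> a v" and am [measurable]: "a \<in> borel_measurable borel"
    and ab: "\<And>x. x \<in> strip h \<Longrightarrow> \<bar>a x\<bar> \<le> B"
  obtains g1 g2 where "local_solution h \<omega> a v g1 g2"
proof -
  obtain g where v: "L2_loc_strip h v" and g: "L2_loc_strip h (\<lambda>x. fst (g x))" "L2_loc_strip h (\<lambda>x. snd (g x))"
    and wg: "has_weak_grad (strip h) (test_cylinder h) v g"
    and eq: "\<And>\<phi>. \<phi> \<in> test_cylinder h \<Longrightarrow>
          (LINT x:strip h|lborel. complex_of_real (a x) * cdot (g x) (grad \<phi> x)) =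
          complex_of_real (\<omega>\<^sup>2) * (LINT x:strip h|lborel. v x * cnj (\<phi> x))"
    using sol unfolding helmholtz_solution_def by blast
  have [measurable]: "v \<in> borel_measurable borel" "(\<lambda>x. fst (g x)) \<in> borel_measurable borel" "(\<lambda>x. snd (g x)) \<in> borel_measurable borel"
    using v g by (auto simp: L2_loc_strip_def L2_on_def)
  have "local_solution h \<omega> a v (\<lambda>x. fst (g x)) (\<lambda>x. snd (g x))"
    unfolding local_solution_def
  proof (intro conjI v g allI impI)
    fix t s :: real and z \<phi> assume s: "s > 0" and z: "smooth_line z" and supp: "supported_in z s" and \<phi>: "\<phi> \<in> test_cell s h"
    let ?D = "cell s h"
    note C\<phi> = test_cellD(1)[OF \<phi>]
    note L\<phi> = Cinf_L2_on[OF C\<phi> cell_bounded cell_borel] Cinf_L2_on[OF Cinf_grad(1)[OF C\<phi>] cell_bounded cell_borel]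
      Cinf_L2_on[OF Cinf_grad(2)[OF C\<phi>] cell_bounded cell_borel]
    define Z where "Z x = complex_of_real (z (fst x))" for x :: plane
    define Z' where "Z' x = complex_of_real (deriv z (fst x))" for x :: plane
    define V where "V x = v (x + (t, 0))" for x
    define G1 where "G1 x = fst (g (x + (t, 0)))" for x
    define G2 where "G2 x = snd (g (x + (t, 0)))" for x
    define A where "A x = complex_of_real (a (x + (t, 0)))" for x
    have cz: "cnj (Z x) = Z x" "cnj (Z' x) = Z' x" for x by (simp_all add: Z_def Z'_def)
    have LV: "L2_on ?D V" and LG: "L2_on ?D G1" "L2_on ?D G2"
      unfolding V_def G1_def G2_def by (intro L2_loc_strip_cell v g)+
    have LZ: "L2_on ?D (\<lambda>x. Z x * f x)" "L2_on ?D (\<lambda>x. Z' x * f x)" if "L2_on ?D f" for f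
      unfolding Z_def Z'_def by (intro L2_line_mult smooth_line_continuous smooth_line_deriv z that)+
    have LA: "L2_on ?D (\<lambda>x. A x * f x)" if "L2_on ?D f" for f
    proof (rule L2_on_bounded_mult[where C=B])
      show "A \<in> borel_measurable borel" unfolding A_def by measurable
      show "norm (A x) \<le> B" if "x \<in> ?D" for x
        using ab[of "x + (t, 0)"] that by (simp add: A_def mem_cell mem_strip)
    qed (use that in auto)
    have Z0: "Z x = 0" "Z' x = 0" if "fst x \<le> 0 \<or> fst x \<ge> s" for x
      using supported_inD[OF supp that] by (simp_all add: Z_def Z'_def)
    define \<Phi> where "\<Phi> f x = Z (x - (t, 0)) * f (x - (t, 0))" for f x
    have \<Phi>t: "\<Phi> f (x + (t, 0)) = Z x * f x" for f x by (simp add: \<Phi>_def)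
    have grad\<Phi>: "grad (\<Phi> f) (x + (t, 0)) = (Z x * fst (grad f x) + Z' x * f x, Z x * snd (grad f x))"
      and C\<Phi>: "Cinf (\<Phi> f)" if "Cinf f" for f x
    proof -
      have sh: "x - (t, 0) = x + (- t, 0)" for x :: plane by (simp add: prod_eq_iff)
      have P: "\<Phi> f = (\<lambda>x. (\<lambda>x. Z x * f x) (x + (- t, 0)))" by (intro ext) (simp only: \<Phi>_def sh)
      have CZ: "Cinf Z" unfolding Z_def by (rule smooth_line_complex(1)[OF z])
      show "Cinf (\<Phi> f)" unfolding P by (intro Cinf_shift Cinf_mult CZ that)
      have "grad (\<Phi> f) (x + (t, 0)) = grad (\<lambda>x. Z x * f x) (x + (t, 0) + (- t, 0))"
        unfolding P by (rule grad_shift[OF Cinf_mult[OF CZ that]])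
      also have "x + (t, 0) + (- t, 0) = x" by (simp add: add.assoc zero_prod_def[symmetric])
      also have "grad (\<lambda>x. Z x * f x) x = (Z x * fst (grad f x) + Z' x * f x, Z x * snd (grad f x))"
      proof -
        have "Z = (\<lambda>x. complex_of_real (z (fst x)))" by (simp add: Z_def fun_eq_iff)
        then have "grad Z x = (Z' x, 0)" using smooth_line_complex(2)[OF z, of x] by (simp add: Z'_def)
        then show ?thesis unfolding grad_mult[OF CZ that] by simp
      qed
      finally show "grad (\<Phi> f) (x + (t, 0)) = (Z x * fst (grad f x) + Z' x * f x, Z x * snd (grad f x))" .
    qed
    have T\<Phi>: "\<Phi> f \<in> test_cylinder h" if f: "f \<in> test_cell s h" for f
      unfolding test_cylinder_def
    proof (intro CollectI conjI allI exI impI)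
      show "Cinf (\<Phi> f)" by (rule C\<Phi>[OF test_cellD(1)[OF f]])
      fix x :: plane
      have sh: "x + (0, h) - (t, 0) = x - (t, 0) + (0, h)" by (simp add: prod_eq_iff)
      show "\<Phi> f (x + (0, h)) = \<Phi> f x"
        using test_cellD(3)[OF f, of "x - (t, 0)"] unfolding \<Phi>_def sh by (simp add: Z_def)
      assume "\<bar>fst x\<bar> > \<bar>t\<bar> + s"
      then have "Z (x - (t, 0)) = 0" by (intro Z0) auto
      then show "\<Phi> f x = 0" by (simp add: \<Phi>_def)
    qed
    have Zm: "(\<lambda>x. Z (x - (t, 0))) \<in> borel_measurable borel" "(\<lambda>x. Z' (x - (t, 0))) \<in> borel_measurable borel"
      using plane_fst_shift_measurable[OF smooth_line_continuous[OF z], of "- t"]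
        plane_fst_shift_measurable[OF smooth_line_continuous[OF smooth_line_deriv[OF z]], of "- t"]
      by (simp_all add: Z_def Z'_def)
    have m\<Phi>: "\<Phi> f \<in> borel_measurable borel" "(\<lambda>x. fst (grad (\<Phi> f) x)) \<in> borel_measurable borel"
      "(\<lambda>x. snd (grad (\<Phi> f) x)) \<in> borel_measurable borel" if "Cinf f" for f
      using C\<Phi>[OF that] by (auto intro!: borel_measurable_continuous_onI Cinf_continuous Cinf_grad)
    have c: "(\<lambda>x. cnj (\<phi> x)) \<in> test_cell s h" using \<phi> by (auto simp: test_cell_def Cinf_cnj)
    note Cc = test_cellD(1)[OF c]
    have w: "(LINT x:strip h|lborel. v x * fst (grad (\<Phi> (\<lambda>x. cnj (\<phi> x))) x)) = - (LINT x:strip h|lborel. fst (g x) * \<Phi> (\<lambda>x. cnj (\<phi> x)) x)"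
      "(LINT x:strip h|lborel. v x * snd (grad (\<Phi> (\<lambda>x. cnj (\<phi> x))) x)) = - (LINT x:strip h|lborel. snd (g x) * \<Phi> (\<lambda>x. cnj (\<phi> x)) x)"
      using wg T\<Phi>[OF c] unfolding has_weak_grad_def by blast+
    note [measurable] = m\<Phi>[OF Cc] m\<Phi>[OF C\<phi>] borel_measurable_cnj[OF m\<Phi>(1)[OF C\<phi>]]
       borel_measurable_cnj[OF m\<Phi>(2)[OF C\<phi>]] borel_measurable_cnj[OF m\<Phi>(3)[OF C\<phi>]]
    have L1: "(LINT x:strip h|lborel. v x * fst (grad (\<Phi> (\<lambda>x. cnj (\<phi> x))) x)) =
        (LINT x:?D|lborel. V x * (Z x * cnj (fst (grad \<phi> x)) + Z' x * cnj (\<phi> x)))"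
      by (subst strip_integral_eq_cell[where s=s and t=t]) (auto simp: grad\<Phi>[OF Cc] grad_cnj[OF C\<phi>] Z0 V_def)
    have L2: "(LINT x:strip h|lborel. v x * snd (grad (\<Phi> (\<lambda>x. cnj (\<phi> x))) x)) =
        (LINT x:?D|lborel. V x * (Z x * cnj (snd (grad \<phi> x))))"
      by (subst strip_integral_eq_cell[where s=s and t=t]) (auto simp: grad\<Phi>[OF Cc] grad_cnj[OF C\<phi>] Z0 V_def)
    have R1: "(LINT x:strip h|lborel. fst (g x) * \<Phi> (\<lambda>x. cnj (\<phi> x)) x) = (LINT x:?D|lborel. G1 x * (Z x * cnj (\<phi> x)))"
      by (subst strip_integral_eq_cell[where s=s and t=t]) (auto simp: \<Phi>t Z0 G1_def)
    have R2: "(LINT x:strip h|lborel. snd (g x) * \<Phi> (\<lambda>x. cnj (\<phi> x)) x) = (LINT x:?D|lborel. G2 x * (Z x * cnj (\<phi> x)))"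
      by (subst strip_integral_eq_cell[where s=s and t=t]) (auto simp: \<Phi>t Z0 G2_def)
    have E1: "(LINT x:strip h|lborel. complex_of_real (a x) * cdot (g x) (grad (\<Phi> \<phi>) x)) =
        (LINT x:?D|lborel. A x * (G1 x * cnj (Z x * fst (grad \<phi> x) + Z' x * \<phi> x) + G2 x * cnj (Z x * snd (grad \<phi> x))))"
      unfolding cdot_def
      by (subst strip_integral_eq_cell[where s=s and t=t]) (auto simp: grad\<Phi>[OF C\<phi>] Z0 G1_def G2_def A_def)
    have E2: "(LINT x:strip h|lborel. v x * cnj (\<Phi> \<phi> x)) = (LINT x:?D|lborel. V x * cnj (Z x * \<phi> x))"
      by (subst strip_integral_eq_cell[where s=s and t=t]) (auto simp: \<Phi>t Z0 V_def)
    note E = eq[OF T\<Phi>[OF \<phi>], unfolded E1 E2]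
    let ?m = "complex_of_real (measure lborel ?D)"
    have mi: "mean_ip ?D f k = (LINT x:?D|lborel. f x * cnj (k x)) / ?m" for f k by (simp add: mean_ip_def)
    have "(LINT x:?D|lborel. V x * (Z x * cnj (fst (grad \<phi> x)) + Z' x * cnj (\<phi> x))) / ?m =
        mean_ip ?D (\<lambda>x. Z x * V x) (\<lambda>x. fst (grad \<phi> x)) + mean_ip ?D (\<lambda>x. Z' x * V x) \<phi>"
      using set_integral_add(2)[OF L2_prod_integrable[OF cell_borel LZ(1)[OF LV] L\<phi>(2)] L2_prod_integrable[OF cell_borel LZ(2)[OF LV] L\<phi>(1)]]
      by (simp add: mi add_divide_distrib[symmetric] algebra_simps)
    moreover have "(LINT x:?D|lborel. G1 x * (Z x * cnj (\<phi> x))) / ?m = mean_ip ?D (\<lambda>x. Z x * G1 x) \<phi>"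
      by (simp add: mi mult_ac)
    moreover have "mean_ip ?D (\<lambda>x. Z x * G1 x + Z' x * V x) \<phi> = mean_ip ?D (\<lambda>x. Z x * G1 x) \<phi> + mean_ip ?D (\<lambda>x. Z' x * V x) \<phi>"
      by (rule mean_ip_add_left[OF cell_borel LZ(1)[OF LG(1)] LZ(2)[OF LV] L\<phi>(1)])
    ultimately show "mean_ip ?D (\<lambda>x. complex_of_real (z (fst x)) * v (x + (t, 0))) (\<lambda>x. fst (grad \<phi> x)) =
        - mean_ip ?D (\<lambda>x. complex_of_real (z (fst x)) * fst (g (x + (t, 0))) + complex_of_real (deriv z (fst x)) * v (x + (t, 0))) \<phi>"
      using w(1)[unfolded L1 R1] unfolding Z_def[symmetric] Z'_def[symmetric] V_def[symmetric] G1_def[symmetric]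
      by (simp add: algebra_simps)
    have "(LINT x:?D|lborel. V x * (Z x * cnj (snd (grad \<phi> x)))) / ?m = mean_ip ?D (\<lambda>x. Z x * V x) (\<lambda>x. snd (grad \<phi> x))"
      "(LINT x:?D|lborel. G2 x * (Z x * cnj (\<phi> x))) / ?m = mean_ip ?D (\<lambda>x. Z x * G2 x) \<phi>"
      by (simp_all add: mi mult_ac)
    then show "mean_ip ?D (\<lambda>x. complex_of_real (z (fst x)) * v (x + (t, 0))) (\<lambda>x. snd (grad \<phi> x)) =
        - mean_ip ?D (\<lambda>x. complex_of_real (z (fst x)) * snd (g (x + (t, 0)))) \<phi>"
      using w(2)[unfolded L2 R2] unfolding Z_def[symmetric] V_def[symmetric] G2_def[symmetric]
      by (metis minus_divide_left)
    have i: "set_integrable lborel ?D (\<lambda>x. (A x * (Z x * G1 x)) * cnj (fst (grad \<phi> x)))"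
      "set_integrable lborel ?D (\<lambda>x. (A x * (Z' x * G1 x)) * cnj (\<phi> x))"
      "set_integrable lborel ?D (\<lambda>x. (A x * (Z x * G2 x)) * cnj (snd (grad \<phi> x)))"
      by (intro L2_prod_integrable cell_borel LA LZ LG L\<phi>)+
    have "A x * (G1 x * cnj (Z x * fst (grad \<phi> x) + Z' x * \<phi> x) + G2 x * cnj (Z x * snd (grad \<phi> x))) =
        (A x * (Z x * G1 x)) * cnj (fst (grad \<phi> x)) + (A x * (Z' x * G1 x)) * cnj (\<phi> x) + (A x * (Z x * G2 x)) * cnj (snd (grad \<phi> x))" for x
      by (simp add: cz algebra_simps)
    then have "(LINT x:?D|lborel. A x * (G1 x * cnj (Z x * fst (grad \<phi> x) + Z' x * \<phi> x) + G2 x * cnj (Z x * snd (grad \<phi> x)))) / ?m =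
       mean_ip ?D (\<lambda>x. A x * (Z x * G1 x)) (\<lambda>x. fst (grad \<phi> x)) + mean_ip ?D (\<lambda>x. A x * (Z' x * G1 x)) \<phi> + mean_ip ?D (\<lambda>x. A x * (Z x * G2 x)) (\<lambda>x. snd (grad \<phi> x))"
      unfolding mi by (simp add: set_integral_add(2)[OF set_integral_add(1)[OF i(1,2)] i(3)] set_integral_add(2)[OF i(1,2)] add_divide_distrib)
    moreover have "(LINT x:?D|lborel. V x * cnj (Z x * \<phi> x)) / ?m = mean_ip ?D (\<lambda>x. Z x * V x) \<phi>"
      by (simp add: mi cz mult_ac)
    ultimately show "mean_ip ?D (\<lambda>x. complex_of_real (a (x + (t, 0))) * (complex_of_real (z (fst x)) * fst (g (x + (t, 0))))) (\<lambda>x. fst (grad \<phi> x)) +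
      mean_ip ?D (\<lambda>x. complex_of_real (a (x + (t, 0))) * (complex_of_real (z (fst x)) * snd (g (x + (t, 0))))) (\<lambda>x. snd (grad \<phi> x)) =
        complex_of_real (\<omega>\<^sup>2) * mean_ip ?D (\<lambda>x. complex_of_real (z (fst x)) * v (x + (t, 0))) \<phi> -
        mean_ip ?D (\<lambda>x. complex_of_real (a (x + (t, 0))) * (complex_of_real (deriv z (fst x)) * fst (g (x + (t, 0))))) \<phi>"
      using E unfolding Z_def[symmetric] Z'_def[symmetric] V_def[symmetric] G1_def[symmetric] G2_def[symmetric] A_def[symmetric]
      by (simp add: algebra_simps) (metis (no_types, lifting) times_divide_eq_right add_divide_distrib)
  qed
  then show ?thesis by (rule that)
qed

lemma L2_loc_strip_diff:
  assumes "L2_loc_strip h f" "L2_loc_strip h k"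
  shows "L2_loc_strip h (\<lambda>x. f x - k x)"
  unfolding L2_loc_strip_def
proof
  fix M :: real
  have "{-M<..<M} \<times> {0<..<h} \<in> sets borel" by (intro borel_open open_Times) auto
  then show "L2_on ({-M<..<M} \<times> {0<..<h}) (\<lambda>x. f x - k x)"
    using assms unfolding L2_loc_strip_def by (intro L2_on_diff) auto
qed

lemma local_solution_diff:
  assumes u: "local_solution h \<omega> a u f1 f2" and v: "local_solution h \<omega> a v g1 g2"
    and [measurable]: "a \<in> borel_measurable borel" and ab: "\<And>x. x \<in> strip h \<Longrightarrow> \<bar>a x\<bar> \<le> B"
  shows "local_solution h \<omega> a (\<lambda>x. u x - v x) (\<lambda>x. f1 x - g1 x) (\<lambda>x. f2 x - g2 x)"
  unfolding local_solution_def
proof (intro conjI allI impI)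
  note Lu = u[unfolded local_solution_def, THEN conjunct1] u[unfolded local_solution_def, THEN conjunct2, THEN conjunct1]
    u[unfolded local_solution_def, THEN conjunct2, THEN conjunct2, THEN conjunct1]
  note Lv = v[unfolded local_solution_def, THEN conjunct1] v[unfolded local_solution_def, THEN conjunct2, THEN conjunct1]
    v[unfolded local_solution_def, THEN conjunct2, THEN conjunct2, THEN conjunct1]
  show "L2_loc_strip h (\<lambda>x. u x - v x)" "L2_loc_strip h (\<lambda>x. f1 x - g1 x)" "L2_loc_strip h (\<lambda>x. f2 x - g2 x)"
    by (intro L2_loc_strip_diff Lu Lv)+
  fix t s :: real and z \<phi> assume s: "s > 0" and z: "smooth_line z" and supp: "supported_in z s" and \<phi>: "\<phi> \<in> test_cell s h"
  let ?D = "cell s h"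
  define Z where "Z x = complex_of_real (z (fst x))" for x :: plane
  define Z' where "Z' x = complex_of_real (deriv z (fst x))" for x :: plane
  define A where "A x = complex_of_real (a (x + (t, 0)))" for x
  note Lc = Lu[THEN L2_loc_strip_cell, of s t] Lv[THEN L2_loc_strip_cell, of s t]
  have LZ: "L2_on ?D (\<lambda>x. Z x * f x)" "L2_on ?D (\<lambda>x. Z' x * f x)" if "L2_on ?D f" for f
    unfolding Z_def Z'_def by (intro L2_line_mult smooth_line_continuous smooth_line_deriv z that)+
  have LA: "L2_on ?D (\<lambda>x. A x * f x)" if "L2_on ?D f" for f
  proof (rule L2_on_bounded_mult[where C=B])
    show "A \<in> borel_measurable borel" unfolding A_def by measurable
    show "norm (A x) \<le> B" if "x \<in> ?D" for x
      using ab[of "x + (t, 0)"] that by (simp add: A_def mem_cell mem_strip)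
  qed (use that in auto)
  note C\<phi> = test_cellD(1)[OF \<phi>]
  note L\<phi> = Cinf_L2_on[OF C\<phi> cell_bounded cell_borel] Cinf_L2_on[OF Cinf_grad(1)[OF C\<phi>] cell_bounded cell_borel]
      Cinf_L2_on[OF Cinf_grad(2)[OF C\<phi>] cell_bounded cell_borel]
  note U = u[unfolded local_solution_def, THEN conjunct2, THEN conjunct2, THEN conjunct2, rule_format, OF s z supp \<phi>, of t,
      folded Z_def Z'_def A_def]
  note V = v[unfolded local_solution_def, THEN conjunct2, THEN conjunct2, THEN conjunct2, rule_format, OF s z supp \<phi>, of t,
      folded Z_def Z'_def A_def]
  note d = mean_ip_diff_left[OF cell_borel] mean_ip_add_left[OF cell_borel]
  have s1: "Z x * (p - q) = Z x * p - Z x * q" "Z' x * (p - q) = Z' x * p - Z' x * q" "A x * (p - q) = A x * p - A x * q" for x p q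
    by (simp_all add: right_diff_distrib)
  have i1: "mean_ip ?D (\<lambda>x. (Z x * f1 (x + (t, 0)) - Z x * g1 (x + (t, 0))) + (Z' x * u (x + (t, 0)) - Z' x * v (x + (t, 0)))) \<phi> =
     mean_ip ?D (\<lambda>x. Z x * f1 (x + (t, 0)) + Z' x * u (x + (t, 0))) \<phi> - mean_ip ?D (\<lambda>x. Z x * g1 (x + (t, 0)) + Z' x * v (x + (t, 0))) \<phi>"
    using Lc L\<phi> LZ by (simp add: d L2_on_diff)
  show "mean_ip ?D (\<lambda>x. complex_of_real (z (fst x)) * (u (x + (t, 0)) - v (x + (t, 0)))) (\<lambda>x. fst (grad \<phi> x)) =
        - mean_ip ?D (\<lambda>x. complex_of_real (z (fst x)) * (f1 (x + (t, 0)) - g1 (x + (t, 0))) + complex_of_real (deriv z (fst x)) * (u (x + (t, 0)) - v (x + (t, 0)))) \<phi>"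
    unfolding Z_def[symmetric] Z'_def[symmetric] s1 i1 using U V Lc L\<phi> LZ by (simp add: d)
  show "mean_ip ?D (\<lambda>x. complex_of_real (z (fst x)) * (u (x + (t, 0)) - v (x + (t, 0)))) (\<lambda>x. snd (grad \<phi> x)) =
        - mean_ip ?D (\<lambda>x. complex_of_real (z (fst x)) * (f2 (x + (t, 0)) - g2 (x + (t, 0)))) \<phi>"
    unfolding Z_def[symmetric] Z'_def[symmetric] s1 using U V Lc L\<phi> LZ by (simp add: d)
  show "mean_ip ?D (\<lambda>x. complex_of_real (a (x + (t, 0))) * (complex_of_real (z (fst x)) * (f1 (x + (t, 0)) - g1 (x + (t, 0))))) (\<lambda>x. fst (grad \<phi> x)) +
      mean_ip ?D (\<lambda>x. complex_of_real (a (x + (t, 0))) * (complex_of_real (z (fst x)) * (f2 (x + (t, 0)) - g2 (x + (t, 0))))) (\<lambda>x. snd (grad \<phi> x)) =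
        complex_of_real (\<omega>\<^sup>2) * mean_ip ?D (\<lambda>x. complex_of_real (z (fst x)) * (u (x + (t, 0)) - v (x + (t, 0)))) \<phi> -
        mean_ip ?D (\<lambda>x. complex_of_real (a (x + (t, 0))) * (complex_of_real (deriv z (fst x)) * (f1 (x + (t, 0)) - g1 (x + (t, 0))))) \<phi>"
  proof -
    have e: "mean_ip ?D (\<lambda>x. A x * (Z x * f1 (x + (t, 0))) - A x * (Z x * g1 (x + (t, 0)))) (\<lambda>x. fst (grad \<phi> x)) =
        mean_ip ?D (\<lambda>x. A x * (Z x * f1 (x + (t, 0)))) (\<lambda>x. fst (grad \<phi> x)) - mean_ip ?D (\<lambda>x. A x * (Z x * g1 (x + (t, 0)))) (\<lambda>x. fst (grad \<phi> x))"
      "mean_ip ?D (\<lambda>x. A x * (Z x * f2 (x + (t, 0))) - A x * (Z x * g2 (x + (t, 0)))) (\<lambda>x. snd (grad \<phi> x)) =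
        mean_ip ?D (\<lambda>x. A x * (Z x * f2 (x + (t, 0)))) (\<lambda>x. snd (grad \<phi> x)) - mean_ip ?D (\<lambda>x. A x * (Z x * g2 (x + (t, 0)))) (\<lambda>x. snd (grad \<phi> x))"
      "mean_ip ?D (\<lambda>x. A x * (Z' x * f1 (x + (t, 0))) - A x * (Z' x * g1 (x + (t, 0)))) \<phi> =
        mean_ip ?D (\<lambda>x. A x * (Z' x * f1 (x + (t, 0)))) \<phi> - mean_ip ?D (\<lambda>x. A x * (Z' x * g1 (x + (t, 0)))) \<phi>"
      "mean_ip ?D (\<lambda>x. Z x * u (x + (t, 0)) - Z x * v (x + (t, 0))) \<phi> =
        mean_ip ?D (\<lambda>x. Z x * u (x + (t, 0))) \<phi> - mean_ip ?D (\<lambda>x. Z x * v (x + (t, 0))) \<phi>"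
      by (intro d LA LZ Lc L\<phi>)+
    have lin: "(p1 - q1) + (p2 - q2) = c * (p - q) - (p3 - q3)"
      if "p1 + p2 = c * p - p3" "q1 + q2 = c * q - q3" for p1 p2 p3 q1 q2 q3 c p q :: complex
      using that by algebra
    show ?thesis
      unfolding Z_def[symmetric] Z'_def[symmetric] A_def[symmetric] s1 e
      by (rule lin[OF U[THEN conjunct2, THEN conjunct2] V[THEN conjunct2, THEN conjunct2]])
  qed
qed

section \<open>Energy identity and conservation of flux\<close>

text \<open>The coefficient \<open>a\<close> is the one on the whole strip, with its jump at the interface. All smooth functions
  of compact support will be derived from the cut-offs \<open>\<eta>\<close>.\<close>

locale strip_problem =
  fixes \<epsilon> \<omega> h a_lo a_hi C0 :: real and K :: nat and a :: "plane \<Rightarrow> real" and \<kappa> :: "nat \<Rightarrow> int \<times> int"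
    and \<eta> :: "nat \<Rightarrow> plane \<Rightarrow> real"
  assumes \<epsilon>: "\<epsilon> > 0" and K: "K \<ge> 1" and h: "h = \<epsilon> * real K"
    and a_borel [measurable]: "a \<in> borel_measurable borel" and a_lo: "a_lo > 0"
    and a_bounds: "\<And>x. x \<in> strip h \<Longrightarrow> a_lo \<le> a x \<and> a x \<le> a_hi"
    and fourier: "fourier_complete \<kappa>"
    and eta_smooth: "\<And>R. R > 0 \<Longrightarrow> K dvd R \<Longrightarrow> Cinf (\<eta> R)"
    and eta_supp: "\<And>R. R > 0 \<Longrightarrow> K dvd R \<Longrightarrow> \<exists>\<delta>>0. \<forall>x. fst x < \<delta> \<or> fst x > real R * \<epsilon> - \<delta> \<longrightarrow> \<eta> R x = 0"
    and eta_one: "\<And>R x. R > 0 \<Longrightarrow> K dvd R \<Longrightarrow>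
      x \<in> {\<epsilon><..<(real R - 1) * \<epsilon>} \<times> {\<epsilon><..<(real R - 1) * \<epsilon>} \<Longrightarrow> \<eta> R x = 1"
    and eta_grad: "\<And>R x. R > 0 \<Longrightarrow> K dvd R \<Longrightarrow> norm (grad (\<eta> R) x) \<le> C0"
begin

lemma h_pos: "h > 0" "\<epsilon> \<le> h"
  using \<epsilon> K h by simp_all

lemma C0_nonneg: "0 \<le> C0"
proof -
  have "norm (grad (\<eta> K) 0) \<le> C0" using K by (intro eta_grad) auto
  then show ?thesis using norm_ge_zero order_trans by blast
qed

lemma a_hi: "a_lo \<le> a_hi" "a_hi > 0"
proof -
  have "(0, h / 2) \<in> strip h" using h_pos by (simp add: mem_strip)
  then show "a_lo \<le> a_hi" using a_bounds by force
  then show "a_hi > 0" using a_lo by simp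
qed

lemma a_abs: "x \<in> strip h \<Longrightarrow> \<bar>a x\<bar> \<le> a_hi"
  using a_bounds[of x] a_lo by simp

text \<open>Restriction of the cut-off to a horizontal line in the middle of the large cell. It depends on the
  first coordinate only, so multiplication with it preserves vertical periodicity.\<close>

definition zeta :: "nat \<Rightarrow> real \<Rightarrow> real" where
  "zeta R r = \<eta> R (r, real R * \<epsilon> / 2)"

lemma zeta_smooth:
  assumes "R > 0" "K dvd R"
  shows "smooth_line (zeta R)"
proof -
  have "bounded_linear (\<lambda>x::plane. (fst x, 0::real))"
    by (intro bounded_linear_Pair bounded_linear_fst bounded_linear_zero)
  from Cinf_affine[OF this eta_smooth[OF assms], where c="(0, real R * \<epsilon> / 2)"]
  show ?thesis by (simp add: smooth_line_def zeta_def)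
qed

lemma zeta_supp: "R > 0 \<Longrightarrow> K dvd R \<Longrightarrow> supported_in (zeta R) (real R * \<epsilon>)"
  using eta_supp[of R] unfolding supported_in_def zeta_def by force

lemma zeta_one:
  assumes "R > 2" "K dvd R" "\<epsilon> < r" "r < (real R - 1) * \<epsilon>"
  shows "zeta R r = 1"
proof -
  have "2 * \<epsilon> < real R * \<epsilon>" using assms(1) \<epsilon> by simp
  then have "\<epsilon> < real R * \<epsilon> / 2" "real R * \<epsilon> / 2 < (real R - 1) * \<epsilon>"
    by (auto simp: algebra_simps)
  then show ?thesis using assms \<epsilon> unfolding zeta_def by (intro eta_one) auto
qed

lemma zeta_deriv_le:
  assumes "R > 0" "K dvd R"
  shows "\<bar>deriv (zeta R) r\<bar> \<le> C0"
proof -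
  let ?c = "real R * \<epsilon> / 2"
  have "((\<lambda>r. (r, ?c)) has_derivative (\<lambda>d. (d, 0))) (at r)" by (auto intro!: derivative_eq_intros)
  from has_derivative_compose[OF this Cinf_has_derivative[OF eta_smooth[OF assms]]]
  have d: "(zeta R has_derivative (\<lambda>d. frechet_derivative (\<eta> R) (at (r, ?c)) (d, 0))) (at r)"
    unfolding zeta_def .
  have "(\<lambda>d. frechet_derivative (\<eta> R) (at (r, ?c)) (d, 0)) = (*) (deriv (zeta R) r)"
    using has_derivative_unique[OF d smooth_line_has_derivative[OF zeta_smooth[OF assms], unfolded has_field_derivative_def]] .
  from fun_cong[OF this, of 1] have "deriv (zeta R) r = fst (grad (\<eta> R) (r, ?c))" by (simp add: grad_def)
  then show ?thesis
    using eta_grad[OF assms, of "(r, ?c)"] norm_fst_le[of "fst (grad (\<eta> R) (r, ?c))" "snd (grad (\<eta> R) (r, ?c))"]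
    by simp
qed

lemma zeta_deriv_zero:
  assumes "R > 2" "K dvd R" "\<epsilon> < r" "r < (real R - 1) * \<epsilon>"
  shows "deriv (zeta R) r = 0"
  by (rule deriv_zero_of_vanishing[of "{\<epsilon><..<(real R - 1) * \<epsilon>}" _ _ 1]) (use assms zeta_one in auto)

text \<open>A bound for the cut-offs: every point of the cell has distance at most \<open>4\<epsilon>\<close> from a point where the
  cut-off is 1, and \<open>2 * C0\<close> is a Lipschitz constant.\<close>

definition eta_max :: real where "eta_max = 1 + 8 * \<epsilon> * C0"

lemma eta_max_ge_1: "eta_max \<ge> 1" using \<epsilon> C0_nonneg by (simp add: eta_max_def)

lemma eta_bound:
  assumes R: "R > 5" "K dvd R" and x: "x \<in> W_box \<epsilon> R"
  shows "\<bar>\<eta> R x\<bar> \<le> eta_max"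
proof -
  \<comment> \<open>The nearest point of an interval inside the plateau.\<close>
  define p where "p r = max (2 * \<epsilon>) (min r ((real R - 2) * \<epsilon>))" for r
  have "5 * \<epsilon> < real R * \<epsilon>" using R \<epsilon> by simp
  moreover have "(real R - 2) * \<epsilon> = real R * \<epsilon> - 2 * \<epsilon>" by (simp add: algebra_simps)
  ultimately have o: "2 * \<epsilon> < (real R - 2) * \<epsilon>" using \<epsilon> by linarith
  have p: "\<epsilon> < p r" "p r < (real R - 1) * \<epsilon>" for r
  proof -
    show "\<epsilon> < p r" using \<epsilon> unfolding p_def by linarith
    have "p r \<le> (real R - 2) * \<epsilon>" using o by (simp add: p_def)
    also have "\<dots> < (real R - 1) * \<epsilon>" using \<epsilon> by (intro mult_strict_right_mono) auto
    finally show "p r < (real R - 1) * \<epsilon>" .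
  qed
  have d: "\<bar>r - p r\<bar> \<le> 2 * \<epsilon>" if "0 < r" "r < real R * \<epsilon>" for r
    using that o \<epsilon> by (auto simp: p_def algebra_simps max_def min_def)
  let ?y = "(p (fst x), p (snd x))"
  have y: "\<eta> R ?y = 1" using R p by (intro eta_one) auto
  have x12: "0 < fst x" "fst x < real R * \<epsilon>" "0 < snd x" "snd x < real R * \<epsilon>"
    using x by (auto simp: W_box_eq mem_cell)
  have "norm (x - ?y) \<le> norm (fst x - p (fst x)) + norm (snd x - p (snd x))"
    using norm_Pair_le[of "fst x - p (fst x)" "snd x - p (snd x)"] by (cases x) simp
  also have "\<dots> \<le> 4 * \<epsilon>" using d[OF x12(1,2)] d[OF x12(3,4)] by simp
  finally have n: "norm (x - ?y) \<le> 4 * \<epsilon>" .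
  have "norm (\<eta> R x - \<eta> R ?y) \<le> 2 * C0 * norm (x - ?y)"
    using R by (intro Cinf_lipschitz eta_smooth eta_grad) auto
  also have "\<dots> \<le> 2 * C0 * (4 * \<epsilon>)" using n C0_nonneg by (intro mult_left_mono) auto
  finally show ?thesis unfolding y eta_max_def by (simp add: algebra_simps)
qed

lemma zeta_bound:
  assumes R: "R > 5" "K dvd R" and r: "0 < r" "r < real R * \<epsilon>"
  shows "\<bar>zeta R r\<bar> \<le> eta_max"
  unfolding zeta_def by (rule eta_bound[OF R]) (use r R \<epsilon> in \<open>auto simp: W_box_eq mem_cell\<close>)

lemma L2_a:
  assumes "L2_on (cell s h) f"
  shows "L2_on (cell s h) (\<lambda>x. complex_of_real (a (x + (t, 0))) * f x)"
proof (rule L2_on_bounded_mult[where C=a_hi])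
  show "norm (complex_of_real (a (x + (t, 0)))) \<le> a_hi" if "x \<in> cell s h" for x
    using a_abs[of "x + (t, 0)"] that by (simp add: mem_cell mem_strip)
qed (use assms in auto)

end

lemma mean_ip_self_weight:
  "mean_ip S (\<lambda>x. complex_of_real (w x) * f x) f = complex_of_real ((LINT x:S|lborel. w x * (norm (f x))\<^sup>2) / measure lborel S)"
proof -
  have "(\<lambda>x. complex_of_real (w x) * f x * cnj (f x)) = (\<lambda>x. complex_of_real (w x * (norm (f x))\<^sup>2))"
    by (simp add: mult.assoc complex_norm_square[symmetric] flip: of_real_power)
  then show ?thesis unfolding mean_ip_def by (simp only: set_integral_complex_of_real of_real_divide)
qed

text \<open>The last assumption expresses that the solution is bounded in the mean over windows of unit length.\<close>

locale strip_solution = strip_problem +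
  fixes v g1 g2 :: "plane \<Rightarrow> complex" and Cv :: real
  assumes sol: "local_solution h \<omega> a v g1 g2"
    and v_window: "\<And>L. (LINT x:cell 1 h|lborel. (norm (v (x + (L, 0))))\<^sup>2) \<le> Cv"
begin

lemma loc: "L2_loc_strip h v" "L2_loc_strip h g1" "L2_loc_strip h g2"
  using sol by (auto simp: local_solution_def)

lemmas L2_shift = loc[THEN L2_loc_strip_cell]

lemma borel [measurable]: "v \<in> borel_measurable borel" "g1 \<in> borel_measurable borel" "g2 \<in> borel_measurable borel"
  using loc by (auto simp: L2_loc_strip_def L2_on_def)

lemma cut_off_H1:
  assumes "s > 0" "smooth_line z" "supported_in z s"
  shows "bloch_H1 s h \<epsilon> (0, 0) (\<lambda>x. complex_of_real (z (fst x)) * v (x + (t, 0)))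
     (\<lambda>x. (complex_of_real (z (fst x)) * g1 (x + (t, 0)) + complex_of_real (deriv z (fst x)) * v (x + (t, 0)),
           complex_of_real (z (fst x)) * g2 (x + (t, 0))))"
  using sol assms unfolding bloch_H1_def L2_pair_on_def local_solution_def
  by (auto simp: bloch_grad_def intro!: L2_on_add L2_line_mult smooth_line_continuous smooth_line_deriv L2_shift)

lemma cut_off_equation:
  assumes "s > 0" "smooth_line z" "supported_in z s" "\<phi> \<in> test_cell s h"
  shows "mean_ip (cell s h) (\<lambda>x. complex_of_real (a (x + (t, 0))) * (complex_of_real (z (fst x)) * g1 (x + (t, 0)))) (\<lambda>x. fst (tgrad \<epsilon> (0, 0) \<phi> x)) +
      mean_ip (cell s h) (\<lambda>x. complex_of_real (a (x + (t, 0))) * (complex_of_real (z (fst x)) * g2 (x + (t, 0)))) (\<lambda>x. snd (tgrad \<epsilon> (0, 0) \<phi> x)) =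
        complex_of_real (\<omega>\<^sup>2) * mean_ip (cell s h) (\<lambda>x. complex_of_real (z (fst x)) * v (x + (t, 0))) \<phi> -
        mean_ip (cell s h) (\<lambda>x. complex_of_real (a (x + (t, 0))) * (complex_of_real (deriv z (fst x)) * g1 (x + (t, 0)))) \<phi>"
  using sol assms unfolding local_solution_def by (simp add: bloch_grad_def)

text \<open>The equation is tested with \<open>\<theta>v\<close>. A cut-off that is 1 on the support of \<open>\<theta>\<close> places it on a finite
  cell.\<close>

lemma energy_identity:
  assumes M: "M > 2" "K dvd M" and \<theta>: "smooth_line \<theta>"
    and pq: "\<epsilon> < p" "q < (real M - 1) * \<epsilon>" "\<And>r. r < p \<or> r > q \<Longrightarrow> \<theta> r = 0"
  defines "D \<equiv> cell (real M * \<epsilon>) h"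
  shows "mean_ip D (\<lambda>x. complex_of_real (a (x + (t, 0)) * \<theta> (fst x)) * g1 (x + (t, 0))) (\<lambda>x. g1 (x + (t, 0))) +
     mean_ip D (\<lambda>x. complex_of_real (a (x + (t, 0)) * deriv \<theta> (fst x)) * g1 (x + (t, 0))) (\<lambda>x. v (x + (t, 0))) +
     mean_ip D (\<lambda>x. complex_of_real (a (x + (t, 0)) * \<theta> (fst x)) * g2 (x + (t, 0))) (\<lambda>x. g2 (x + (t, 0))) =
     complex_of_real (\<omega>\<^sup>2) * mean_ip D (\<lambda>x. complex_of_real (\<theta> (fst x)) * v (x + (t, 0))) (\<lambda>x. v (x + (t, 0)))"
proof -
  have M0: "M > 0" using M by simp
  let ?s = "real M * \<epsilon>" and ?z = "zeta M"
  have s: "?s > 0" using \<epsilon> M by simp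
  note z = zeta_smooth[OF M0 M(2)] zeta_supp[OF M0 M(2)]
  have \<theta>s: "supported_in \<theta> ?s"
    unfolding supported_in_def using pq \<epsilon> by (intro exI[of _ \<epsilon>]) (auto simp: algebra_simps)
  have \<theta>0: "\<theta> r = 0 \<and> deriv \<theta> r = 0" if "r \<le> \<epsilon> \<or> r \<ge> (real M - 1) * \<epsilon>" for r
  proof
    show "\<theta> r = 0" using pq that by force
    show "deriv \<theta> r = 0"
      by (rule deriv_zero_of_vanishing[of "{..<p} \<union> {q<..}" _ _ 0]) (use pq that in auto)
  qed
  have zt: "?z r * \<theta> r = \<theta> r" "?z r * deriv \<theta> r = deriv \<theta> r" "deriv ?z r * \<theta> r = 0" for r
    using \<theta>0[of r] zeta_one[OF M] zeta_deriv_zero[OF M] by (cases "r \<le> \<epsilon> \<or> r \<ge> (real M - 1) * \<epsilon>"; force)+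
  define Z where "Z x = complex_of_real (?z (fst x))" for x :: plane
  define Z' where "Z' x = complex_of_real (deriv ?z (fst x))" for x :: plane
  define T where "T x = complex_of_real (\<theta> (fst x))" for x :: plane
  define T' where "T' x = complex_of_real (deriv \<theta> (fst x))" for x :: plane
  define A where "A x = complex_of_real (a (x + (t, 0)))" for x
  define V where "V x = v (x + (t, 0))" for x
  define G1 where "G1 x = g1 (x + (t, 0))" for x
  define G2 where "G2 x = g2 (x + (t, 0))" for x
  have ZT: "Z x * T x = T x" "Z x * T' x = T' x" "Z' x * T x = 0" for x
    unfolding Z_def Z'_def T_def T'_def of_real_mult[symmetric] by (simp_all only: zt of_real_0)
  have cT: "cnj (T x) = T x" "cnj (T' x) = T' x" for x by (simp_all add: T_def T'_def)
  have LV: "L2_on D V" "L2_on D G1" "L2_on D G2"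
    unfolding D_def V_def G1_def G2_def by (rule L2_shift)+
  have LZ: "L2_on D (\<lambda>x. Z x * f x)" "L2_on D (\<lambda>x. Z' x * f x)" "L2_on D (\<lambda>x. T x * f x)" "L2_on D (\<lambda>x. T' x * f x)" if "L2_on D f" for f
    unfolding Z_def Z'_def T_def T'_def D_def using that unfolding D_def
    by (intro L2_line_mult smooth_line_continuous smooth_line_deriv z(1) \<theta>; assumption)+
  have LA: "L2_on D (\<lambda>x. A x * f x)" if "L2_on D f" for f
    using that unfolding A_def D_def by (rule L2_a)
  have DB: "D \<in> sets borel" by (simp add: D_def)
  note d = mean_ip_diff_left[OF DB] mean_ip_add_right[OF DB]
  have "mean_ip D (\<lambda>x. A x * (Z x * G1 x)) (\<lambda>x. T x * G1 x + T' x * V x) + mean_ip D (\<lambda>x. A x * (Z x * G2 x)) (\<lambda>x. T x * G2 x) =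
     mean_ip D (\<lambda>x. complex_of_real (\<omega>\<^sup>2) * (Z x * V x) - A x * (Z' x * G1 x)) (\<lambda>x. T x * V x)"
  proof -
    have H: "bloch_H1 ?s h \<epsilon> (0, 0) (\<lambda>x. T x * V x) (\<lambda>x. (T x * G1 x + T' x * V x, T x * G2 x))"
      using cut_off_H1[OF s \<theta> \<theta>s, of t] unfolding T_def T'_def V_def G1_def G2_def .
    have X: "L2_on D (\<lambda>x. A x * (Z x * G1 x))" "L2_on D (\<lambda>x. A x * (Z x * G2 x))"
      by (intro LA LZ LV)+
    have L: "L2_on D (\<lambda>x. complex_of_real (\<omega>\<^sup>2) * (Z x * V x))" "L2_on D (\<lambda>x. A x * (Z' x * G1 x))"
      by (intro LA LZ LV L2_on_cmult DB)+
    have eq: "mean_ip D (\<lambda>x. A x * (Z x * G1 x)) (\<lambda>x. fst (tgrad \<epsilon> (0, 0) \<phi> x)) +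
          mean_ip D (\<lambda>x. A x * (Z x * G2 x)) (\<lambda>x. snd (tgrad \<epsilon> (0, 0) \<phi> x)) =
          mean_ip D (\<lambda>x. complex_of_real (\<omega>\<^sup>2) * (Z x * V x) - A x * (Z' x * G1 x)) \<phi>"
      if \<phi>: "\<phi> \<in> test_cell ?s h" for \<phi>
    proof -
      have "L2_on D \<phi>" unfolding D_def by (rule test_L2_on(1)[OF \<phi>]) auto
      then show ?thesis
        using cut_off_equation[OF s z \<phi>, of t, folded D_def Z_def Z'_def A_def V_def G1_def G2_def]
          mean_ip_diff_left[OF DB L \<open>L2_on D \<phi>\<close>] mean_ip_cmult_left[OF DB, of "complex_of_real (\<omega>\<^sup>2)" "\<lambda>x. Z x * V x" \<phi>]
        by (simp only:)
    qed
    show ?thesis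
      using weak_equation_extends[OF fourier s h_pos(1) H X[unfolded D_def] L2_on_diff[OF DB L, unfolded D_def] eq[unfolded D_def]]
      unfolding D_def fst_conv snd_conv .
  qed
  also have "mean_ip D (\<lambda>x. complex_of_real (\<omega>\<^sup>2) * (Z x * V x) - A x * (Z' x * G1 x)) (\<lambda>x. T x * V x) =
     complex_of_real (\<omega>\<^sup>2) * mean_ip D (\<lambda>x. T x * V x) V"
  proof -
    have e: "(complex_of_real (\<omega>\<^sup>2) * (Z x * V x) - A x * (Z' x * G1 x)) * cnj (T x * V x) =
       complex_of_real (\<omega>\<^sup>2) * (T x * V x) * cnj (V x)" for x
    proof -
      have "(complex_of_real (\<omega>\<^sup>2) * (Z x * V x) - A x * (Z' x * G1 x)) * cnj (T x * V x) =
         complex_of_real (\<omega>\<^sup>2) * ((Z x * T x) * V x) * cnj (V x) - A x * G1 x * (Z' x * T x) * cnj (V x)"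
        by (simp add: cT algebra_simps)
      then show ?thesis by (simp only: ZT mult_zero_right mult_zero_left diff_zero)
    qed
    have "mean_ip D (\<lambda>x. complex_of_real (\<omega>\<^sup>2) * (Z x * V x) - A x * (Z' x * G1 x)) (\<lambda>x. T x * V x) =
        mean_ip D (\<lambda>x. complex_of_real (\<omega>\<^sup>2) * (T x * V x)) V"
      unfolding mean_ip_def e ..
    then show ?thesis using mean_ip_cmult_left[OF DB] by simp
  qed
  also have "mean_ip D (\<lambda>x. A x * (Z x * G1 x)) (\<lambda>x. T x * G1 x + T' x * V x) =
     mean_ip D (\<lambda>x. A x * T x * G1 x) G1 + mean_ip D (\<lambda>x. A x * T' x * G1 x) V"
  proof -
    have "mean_ip D (\<lambda>x. A x * (Z x * G1 x)) (\<lambda>x. T x * G1 x + T' x * V x) =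
       mean_ip D (\<lambda>x. A x * (Z x * G1 x)) (\<lambda>x. T x * G1 x) + mean_ip D (\<lambda>x. A x * (Z x * G1 x)) (\<lambda>x. T' x * V x)"
      by (intro d LA LZ LV)
    moreover have "A x * (Z x * G1 x) * cnj (T x * G1 x) = A x * (Z x * T x) * G1 x * cnj (G1 x)"
      "A x * (Z x * G1 x) * cnj (T' x * V x) = A x * (Z x * T' x) * G1 x * cnj (V x)" for x
      by (simp_all add: cT)
    ultimately show ?thesis by (simp add: mean_ip_def ZT del: complex_cnj_mult)
  qed
  also have "mean_ip D (\<lambda>x. A x * (Z x * G2 x)) (\<lambda>x. T x * G2 x) = mean_ip D (\<lambda>x. A x * T x * G2 x) G2"
  proof -
    have e: "A x * (Z x * G2 x) * cnj (T x * G2 x) = A x * T x * G2 x * cnj (G2 x)" for x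
    proof -
      have "A x * (Z x * G2 x) * cnj (T x * G2 x) = A x * (Z x * T x) * G2 x * cnj (G2 x)" by (simp add: cT)
      then show ?thesis by (simp only: ZT)
    qed
    show ?thesis unfolding mean_ip_def e ..
  qed
  finally show ?thesis
    unfolding A_def T_def T'_def V_def G1_def G2_def of_real_mult by (simp add: add.assoc)
qed

end

subsection \<open>Bounds on windows\<close>

lemma cell_window_integral:
  fixes F :: "plane \<Rightarrow> 'b::{banach, second_countable_topology}"
  assumes F: "F \<in> borel_measurable borel" and c: "0 \<le> c" "c + l \<le> s"
    and z: "\<And>x. fst x \<le> c \<or> fst x \<ge> c + l \<Longrightarrow> F x = 0"
  shows "(LINT x:cell s h|lborel. F x) = (LINT x:cell l h|lborel. F (x + (c, 0)))"
proof -
  have "(LINT x:strip h|lborel. F x) = (LINT x:cell s h|lborel. F (x + (0, 0)))"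
    by (rule strip_integral_eq_cell[OF F]) (use c z in auto)
  moreover have "(LINT x:strip h|lborel. F x) = (LINT x:cell l h|lborel. F (x + (c, 0)))"
    by (rule strip_integral_eq_cell[OF F]) (use z in auto)
  ultimately show ?thesis by (simp add: zero_prod_def[symmetric])
qed

lemma window_le:
  assumes f: "L2_loc_strip h f" and h: "h > 0" and l: "0 \<le> l"
    and C: "\<And>L. (LINT x:cell 1 h|lborel. (norm (f (x + (L, 0))))\<^sup>2) \<le> C"
  shows "(LINT x:cell l h|lborel. (norm (f (x + (L, 0))))\<^sup>2) \<le> C * (l + 1)"
proof -
  define n where "n = nat \<lceil>l\<rceil>"
  have n: "l \<le> real n" "real n \<le> l + 1" using l unfolding n_def by linarith+
  have [measurable]: "f \<in> borel_measurable borel" using f by (auto simp: L2_loc_strip_def L2_on_def)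
  have "0 \<le> (LINT x:cell 1 h|lborel. (norm (f (x + (0, 0))))\<^sup>2)"
    unfolding set_lebesgue_integral_def by (intro Bochner_Integration.integral_nonneg) auto
  then have C0: "0 \<le> C" using C[of 0] by simp
  let ?F = "\<lambda>x. (norm (f (x + (L, 0))))\<^sup>2"
  have Fm: "?F \<in> borel_measurable borel" by measurable
  have int: "set_integrable lborel (cell s h) ?F" for s using L2_onD(2)[OF L2_loc_strip_cell[OF f]] .
  have "(LINT x:cell l h|lborel. ?F x) \<le> (LINT x:cell (real n) h|lborel. ?F x)"
    unfolding set_lebesgue_integral_def
  proof (rule integral_mono)
    show "indicat_real (cell l h) x *\<^sub>R ?F x \<le> indicat_real (cell (real n) h) x *\<^sub>R ?F x" for x
      using n by (auto simp: indicator_def mem_cell)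
  qed (use int in \<open>auto simp: set_integrable_def\<close>)
  also have "\<dots> = (\<Sum>c\<in>{..<n} \<times> {..<1::nat}. LINT x:cell 1 h|lborel. ?F (x + tile 1 h c))"
    using set_integrable_tile(2)[OF Fm zero_less_one h, of n 1] int[of "real n"] by simp
  also have "\<dots> \<le> (\<Sum>c\<in>{..<n} \<times> {..<1::nat}. C)"
  proof (rule sum_mono)
    fix c assume "c \<in> {..<n} \<times> {..<1::nat}"
    then have "tile 1 h c = (real (fst c), 0)" by (auto simp: tile_def)
    then show "(LINT x:cell 1 h|lborel. ?F (x + tile 1 h c)) \<le> C"
      using C[of "real (fst c) + L"] by (simp add: add.assoc)
  qed
  also have "\<dots> = real n * C" by (simp add: card_cartesian_product)
  also have "\<dots> \<le> C * (l + 1)" using n C0 by (simp add: mult.commute mult_left_mono)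
  finally show ?thesis .
qed

text \<open>The weight \<open>W\<close> lives on the two boundary layers of width \<open>e\<close>, where cut-offs vary.\<close>

lemma layer_integral_le:
  assumes f: "L2_on (cell s h) f" and W [measurable]: "W \<in> borel_measurable borel"
    and e: "0 \<le> e" "e \<le> s" and B: "\<And>x. x \<in> cell s h \<Longrightarrow> norm (W x) \<le> B"
    and W0: "\<And>x. x \<in> cell s h \<Longrightarrow> e \<le> fst x \<Longrightarrow> fst x \<le> s - e \<Longrightarrow> W x = (0::complex)"
  shows "(LINT x:cell s h|lborel. (norm (W x * f x))\<^sup>2) \<le>
    B\<^sup>2 * ((LINT x:cell e h|lborel. (norm (f x))\<^sup>2) + (LINT x:cell e h|lborel. (norm (f (x + (s - e, 0))))\<^sup>2))"
proof -
  have [measurable]: "f \<in> borel_measurable borel" by (rule L2_onD[OF f])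
  define F0 where "F0 x = indicator ({0<..<e} \<times> UNIV) x * (norm (f x))\<^sup>2" for x :: plane
  define F1 where "F1 x = indicator ({s - e<..<s} \<times> UNIV) x * (norm (f x))\<^sup>2" for x :: plane
  have S: "{0<..<e} \<times> (UNIV :: real set) \<in> sets borel" "{s - e<..<s} \<times> (UNIV :: real set) \<in> sets borel"
    by (auto intro!: borel_open open_Times)
  then have m [measurable]: "F0 \<in> borel_measurable borel" "F1 \<in> borel_measurable borel"
    unfolding F0_def F1_def by measurable
  have ff: "set_integrable lborel (cell s h) (\<lambda>x. (norm (f x))\<^sup>2)" by (rule L2_onD(2)[OF f])
  have i: "set_integrable lborel (cell s h) F" if "F \<in> borel_measurable borel" "\<And>x. 0 \<le> F x \<and> F x \<le> (norm (f x))\<^sup>2" for F :: "plane \<Rightarrow> real"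
    unfolding set_integrable_def
    by (rule Bochner_Integration.integrable_bound[OF ff[unfolded set_integrable_def]])
      (use that in \<open>auto simp: indicator_def intro!: AE_I2\<close>)
  have i01: "set_integrable lborel (cell s h) F0" "set_integrable lborel (cell s h) F1"
    by (auto intro!: i simp: F0_def F1_def indicator_def)
  have "(LINT x:cell s h|lborel. (norm (W x * f x))\<^sup>2) \<le> (LINT x:cell s h|lborel. B\<^sup>2 * (F0 x + F1 x))"
  proof (rule set_integral_mono_AE)
    show "set_integrable lborel (cell s h) (\<lambda>x. (norm (W x * f x))\<^sup>2)"
      by (rule L2_onD(2)[OF L2_on_bounded_mult[OF cell_borel f W B]])
    show "set_integrable lborel (cell s h) (\<lambda>x. B\<^sup>2 * (F0 x + F1 x))"
      using i01 by (intro set_integrable_mult_right set_integral_add)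
    have "(norm (W x * f x))\<^sup>2 \<le> B\<^sup>2 * (F0 x + F1 x)" if x: "x \<in> cell s h" for x
    proof (cases "e \<le> fst x \<and> fst x \<le> s - e")
      case True
      then show ?thesis using W0[OF x] by (simp add: F0_def F1_def)
    next
      case False
      then have "(norm (f x))\<^sup>2 \<le> F0 x + F1 x"
        using x by (auto simp: F0_def F1_def indicator_def mem_cell mem_Times_iff)
      moreover have "(norm (W x))\<^sup>2 \<le> B\<^sup>2" using B[OF x] by (intro power_mono) auto
      ultimately show ?thesis by (simp add: norm_mult power_mult_distrib mult_mono)
    qed
    then show "AE x\<in>cell s h in lborel. (norm (W x * f x))\<^sup>2 \<le> B\<^sup>2 * (F0 x + F1 x)" by (auto intro!: AE_I2)
  qed
  also have "\<dots> = B\<^sup>2 * ((LINT x:cell s h|lborel. F0 x) + (LINT x:cell s h|lborel. F1 x))"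
    using i01 by simp
  also have "(LINT x:cell s h|lborel. F0 x) = (LINT x:cell e h|lborel. (norm (f x))\<^sup>2)"
  proof -
    have "(LINT x:cell s h|lborel. F0 x) = (LINT x:cell e h|lborel. F0 (x + (0, 0)))"
      by (rule cell_window_integral[OF m(1)]) (use e in \<open>auto simp: F0_def indicator_def mem_Times_iff\<close>)
    also have "\<dots> = (LINT x:cell e h|lborel. (norm (f x))\<^sup>2)"
      by (rule set_lebesgue_integral_cong) (auto simp: F0_def indicator_def mem_cell mem_Times_iff)
    finally show ?thesis .
  qed
  also have "(LINT x:cell s h|lborel. F1 x) = (LINT x:cell e h|lborel. (norm (f (x + (s - e, 0))))\<^sup>2)"
  proof -
    have "(LINT x:cell s h|lborel. F1 x) = (LINT x:cell e h|lborel. F1 (x + (s - e, 0)))"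
      by (rule cell_window_integral[OF m(2)]) (use e in \<open>auto simp: F1_def indicator_def mem_Times_iff\<close>)
    also have "\<dots> = (LINT x:cell e h|lborel. (norm (f (x + (s - e, 0))))\<^sup>2)"
      by (rule set_lebesgue_integral_cong) (auto simp: F1_def indicator_def mem_cell mem_Times_iff)
    finally show ?thesis .
  qed
  finally show ?thesis .
qed

context strip_solution
begin

lemma Cv_nonneg: "0 \<le> Cv"
proof -
  have "0 \<le> (LINT x:cell 1 h|lborel. (norm (v (x + (0, 0))))\<^sup>2)"
    unfolding set_lebesgue_integral_def by (intro Bochner_Integration.integral_nonneg) auto
  then show ?thesis using v_window[of 0] by simp
qed

text \<open>Caccioppoli's inequality: the energy identity with a squared cut-off bounds the gradient on a window
  by the function on a larger one.\<close>

lemma gradient_window: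
  obtains Cg where "\<And>L. (LINT x:cell 1 h|lborel. (norm (g1 (x + (L, 0))))\<^sup>2) \<le> Cg"
proof -
  \<comment> \<open>A cut-off of fixed length whose plateau contains an interval of length 1; the window \<open>(L, L + 1)\<close>
    is placed there.\<close>
  obtain m :: nat where m: "real m > 1 / \<epsilon> + 5" using reals_Archimedean2 by blast
  define N where "N = K * m"
  have "0 < 1 / \<epsilon>" using \<epsilon> by simp
  then have "m > 5" using m by linarith
  moreover have "m \<le> N" using K by (simp add: N_def)
  ultimately have "N > 5" "N > 0" by linarith+
  then have N: "N > 5" "K dvd N" "N > 0" by (simp_all add: N_def)
  have "real N > 1 / \<epsilon> + 5" using m \<open>m \<le> N\<close> by linarith
  then have N1: "\<epsilon> + 1 < (real N - 1) * \<epsilon>" using \<epsilon> by (simp add: field_simps)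
  define c where "c = real N * \<epsilon>"
  define \<zeta> where "\<zeta> r = zeta N (r + (- c))" for r
  have \<zeta>: "smooth_line \<zeta>" using smooth_line_shift[OF zeta_smooth[OF N(3,2)], of "- c"] unfolding \<zeta>_def .
  have d\<zeta>: "deriv \<zeta> r = deriv (zeta N) (r + (- c))" for r
    unfolding \<zeta>_def
    by (intro DERIV_imp_deriv DERIV_shift[THEN iffD1] smooth_line_has_derivative zeta_smooth N)
  define \<theta> where "\<theta> r = \<zeta> r * \<zeta> r" for r
  have \<theta>: "smooth_line \<theta>" unfolding \<theta>_def by (rule smooth_line_mult[OF \<zeta> \<zeta>])
  have d\<theta>: "deriv \<theta> r = 2 * (\<zeta> r * deriv \<zeta> r)" for r
  proof -
    have "(\<theta> has_real_derivative \<zeta> r * deriv \<zeta> r + deriv \<zeta> r * \<zeta> r) (at r)"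
      unfolding \<theta>_def
      using DERIV_mult[OF smooth_line_has_derivative[OF \<zeta>, of r] smooth_line_has_derivative[OF \<zeta>, of r]] by (simp add: mult.commute)
    then show ?thesis by (subst DERIV_imp_deriv) auto
  qed
  have zs: "zeta N r = 0" if "r \<le> 0 \<or> r \<ge> c" for r
    using supported_inD(1)[OF zeta_supp[OF N(3,2)], folded c_def] that .
  have \<zeta>0: "\<zeta> r = 0" if "r < c \<or> r > 2 * c" for r
    unfolding \<zeta>_def using that by (intro zs) auto
  have \<zeta>B: "\<bar>\<zeta> r\<bar> \<le> eta_max" for r
  proof (cases "c < r \<and> r < 2 * c")
    case True then show ?thesis using zeta_bound[OF N(1,2), of "r + (- c)", folded c_def] by (simp add: \<zeta>_def)
  next
    case False
    then have "\<zeta> r = 0" unfolding \<zeta>_def by (intro zs) auto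
    then show ?thesis using eta_max_ge_1 by simp
  qed
  have \<zeta>1: "\<zeta> r = 1" if "c + \<epsilon> < r" "r < c + \<epsilon> + 1" for r
    unfolding \<zeta>_def using that N1 N by (intro zeta_one) auto
  define M where "M = 3 * N"
  have M: "M > 2" "K dvd M" using N by (auto simp: M_def)
  have cM: "\<epsilon> < c" "2 * c < (real M - 1) * \<epsilon>"
    using N \<epsilon> by (auto simp: c_def M_def algebra_simps)
  define D where "D = cell (real M * \<epsilon>) h"
  have DB [measurable, simp]: "D \<in> sets borel" by (simp add: D_def)
  define mm where "mm = measure lborel D"
  have mm: "mm > 0" using \<epsilon> h_pos M by (simp add: mm_def D_def)
  define q where "q = 2 / a_lo * (\<omega>\<^sup>2 * eta_max\<^sup>2 + 2 * a_hi\<^sup>2 * C0\<^sup>2 / a_lo) * (Cv * (real M * \<epsilon> + 1))"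
  show ?thesis
  proof
    fix L :: real
    define t where "t = L - c - \<epsilon>"
    define V where "V x = v (x + (t, 0))" for x
    define G1 where "G1 x = g1 (x + (t, 0))" for x
    define G2 where "G2 x = g2 (x + (t, 0))" for x
    define A where "A x = a (x + (t, 0))" for x
    define z where "z x = \<zeta> (fst x)" for x :: plane
    have LV: "L2_on D V" "L2_on D G1" "L2_on D G2" unfolding V_def G1_def G2_def D_def by (rule L2_shift)+
    have Am [measurable]: "A \<in> borel_measurable borel" unfolding A_def by measurable
    have A: "a_lo \<le> A x" "A x \<le> a_hi" if "x \<in> D" for x
      using a_bounds[of "x + (t, 0)"] that by (auto simp: A_def D_def mem_cell mem_strip)
    have Lz: "L2_on D (\<lambda>x. complex_of_real (z x) * f x)" "L2_on D (\<lambda>x. complex_of_real (deriv \<zeta> (fst x)) * f x)" if "L2_on D f" for f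
      using that unfolding z_def D_def by (intro L2_line_mult smooth_line_continuous smooth_line_deriv \<zeta>; assumption)+
    have LA: "L2_on D (\<lambda>x. complex_of_real (sqrt (A x)) * f x)" "L2_on D (\<lambda>x. complex_of_real (A x) * f x)" if "L2_on D f" for f
    proof -
      have n: "norm (complex_of_real (sqrt (A x))) \<le> sqrt a_hi" "norm (complex_of_real (A x)) \<le> a_hi" if "x \<in> D" for x
        using A[OF that] a_lo by simp_all
      have m: "(\<lambda>x. complex_of_real (sqrt (A x))) \<in> borel_measurable borel" "(\<lambda>x. complex_of_real (A x)) \<in> borel_measurable borel"
        by measurable
      show "L2_on D (\<lambda>x. complex_of_real (sqrt (A x)) * f x)" by (rule L2_on_bounded_mult[OF DB that m(1) n(1)])
      show "L2_on D (\<lambda>x. complex_of_real (A x) * f x)" by (rule L2_on_bounded_mult[OF DB that m(2) n(2)])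
    qed
    define Q where "Q f = mean_sq D (\<lambda>x. complex_of_real (z x) * f x)" for f
    have low: "a_lo * Q f \<le> Re (mean_ip D (\<lambda>x. complex_of_real (A x * \<theta> (fst x)) * f x) f)" if Lf: "L2_on D f" for f
    proof -
      have "mean_ip D (\<lambda>x. complex_of_real (A x * \<theta> (fst x)) * f x) f =
        mean_ip D (\<lambda>x. complex_of_real (sqrt (A x)) * (complex_of_real (z x) * f x)) (\<lambda>x. complex_of_real (sqrt (A x)) * (complex_of_real (z x) * f x))"
        unfolding mean_ip_def
      proof (intro arg_cong2[where f="(/)"] set_lebesgue_integral_cong allI impI refl)
        fix x assume "x \<in> D"
        then have "0 \<le> A x" using A a_lo by (meson order.trans less_imp_le)
        then have "complex_of_real (A x) = complex_of_real (sqrt (A x)) * complex_of_real (sqrt (A x))"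
          by (simp flip: of_real_mult)
        then show "complex_of_real (A x * \<theta> (fst x)) * f x * cnj (f x) =
           complex_of_real (sqrt (A x)) * (complex_of_real (z x) * f x) * cnj (complex_of_real (sqrt (A x)) * (complex_of_real (z x) * f x))"
          by (simp add: \<theta>_def z_def)
      qed simp
      then have "Re (mean_ip D (\<lambda>x. complex_of_real (A x * \<theta> (fst x)) * f x) f) = mean_sq D (\<lambda>x. complex_of_real (sqrt (A x)) * (complex_of_real (z x) * f x))"
        by (simp add: mean_ip_self)
      moreover have "mean_sq D (\<lambda>x. complex_of_real (sqrt a_lo) * (complex_of_real (z x) * f x)) \<le> mean_sq D (\<lambda>x. complex_of_real (sqrt (A x)) * (complex_of_real (z x) * f x))"
      proof (rule mean_sq_mono[OF DB LA(1)[OF Lz(1)[OF Lf]]])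
        fix x assume "x \<in> D"
        then show "norm (complex_of_real (sqrt a_lo) * (complex_of_real (z x) * f x)) \<le> norm (complex_of_real (sqrt (A x)) * (complex_of_real (z x) * f x))"
          using A[of x] a_lo by (simp add: norm_mult mult_right_mono)
      qed
      ultimately show ?thesis using a_lo by (simp add: Q_def)
    qed
    note E = energy_identity[OF M \<theta> cM, of t, folded D_def A_def V_def G1_def G2_def]
    have E0: "r < c \<or> r > 2 * c \<Longrightarrow> \<theta> r = 0" for r using \<zeta>0 by (simp add: \<theta>_def)
    note E = E[OF E0]
    let ?X = "mean_ip D (\<lambda>x. complex_of_real (A x * deriv \<theta> (fst x)) * G1 x) V"
    have X: "norm ?X \<le> 2 * a_hi * C0 * sqrt (Q G1) * sqrt (mean_sq D V)"
    proof -
      have "?X = mean_ip D (\<lambda>x. complex_of_real (A x) * (complex_of_real (z x) * G1 x)) (\<lambda>x. 2 * (complex_of_real (deriv \<zeta> (fst x)) * V x))"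
        unfolding mean_ip_def by (simp add: d\<theta> z_def mult_ac)
      also have "norm \<dots> \<le> sqrt (mean_sq D (\<lambda>x. complex_of_real (A x) * (complex_of_real (z x) * G1 x))) *
          sqrt (mean_sq D (\<lambda>x. 2 * (complex_of_real (deriv \<zeta> (fst x)) * V x)))"
        by (intro mean_ip_Cauchy_Schwarz DB LA Lz LV L2_on_cmult)
      also have "\<dots> \<le> sqrt (a_hi\<^sup>2 * Q G1) * sqrt (4 * (C0\<^sup>2 * mean_sq D V))"
      proof (intro mult_mono real_sqrt_le_mono)
        show "mean_sq D (\<lambda>x. complex_of_real (A x) * (complex_of_real (z x) * G1 x)) \<le> a_hi\<^sup>2 * Q G1"
          unfolding Q_def using A a_lo by (intro mean_sq_bounded_mult DB Lz LV) force
        have "mean_sq D (\<lambda>x. complex_of_real (deriv \<zeta> (fst x)) * V x) \<le> C0\<^sup>2 * mean_sq D V"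
          using zeta_deriv_le[OF N(3,2)] by (intro mean_sq_bounded_mult DB LV) (simp add: d\<zeta>)
        then show "mean_sq D (\<lambda>x. 2 * (complex_of_real (deriv \<zeta> (fst x)) * V x)) \<le> 4 * (C0\<^sup>2 * mean_sq D V)"
          by simp
      qed (auto simp: Q_def)
      also have "\<dots> = 2 * a_hi * C0 * sqrt (Q G1) * sqrt (mean_sq D V)"
        using a_hi C0_nonneg by (simp add: real_sqrt_mult)
      finally show ?thesis .
    qed
    have Y: "Re (mean_ip D (\<lambda>x. complex_of_real (\<theta> (fst x)) * V x) V) \<le> eta_max\<^sup>2 * mean_sq D V"
    proof -
      have "mean_ip D (\<lambda>x. complex_of_real (\<theta> (fst x)) * V x) V = mean_ip D (\<lambda>x. complex_of_real (z x) * V x) (\<lambda>x. complex_of_real (z x) * V x)"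
        unfolding mean_ip_def by (simp add: \<theta>_def z_def mult_ac)
      then have "Re (mean_ip D (\<lambda>x. complex_of_real (\<theta> (fst x)) * V x) V) = mean_sq D (\<lambda>x. complex_of_real (z x) * V x)"
        by (simp add: mean_ip_self)
      also have "\<dots> \<le> eta_max\<^sup>2 * mean_sq D V"
        using \<zeta>B by (intro mean_sq_bounded_mult DB LV) (simp add: z_def)
      finally show ?thesis .
    qed
    define s1 where "s1 = sqrt (Q G1)"
    define sv where "sv = sqrt (mean_sq D V)"
    have sq: "s1\<^sup>2 = Q G1" "sv\<^sup>2 = mean_sq D V" by (simp_all add: s1_def sv_def Q_def)
    have "Re (mean_ip D (\<lambda>x. complex_of_real (A x * \<theta> (fst x)) * G1 x) G1) + Re ?X +
        Re (mean_ip D (\<lambda>x. complex_of_real (A x * \<theta> (fst x)) * G2 x) G2) = \<omega>\<^sup>2 * Re (mean_ip D (\<lambda>x. complex_of_real (\<theta> (fst x)) * V x) V)"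
      using arg_cong[OF E, of Re] by (simp flip: of_real_power)
    moreover have "- Re ?X \<le> 2 * a_hi * C0 * s1 * sv" using abs_Re_le_cmod[of ?X] X unfolding s1_def sv_def by linarith
    moreover have "0 \<le> a_lo * Q G2" using a_lo by (simp add: Q_def)
    moreover have "\<omega>\<^sup>2 * Re (mean_ip D (\<lambda>x. complex_of_real (\<theta> (fst x)) * V x) V) \<le> \<omega>\<^sup>2 * (eta_max\<^sup>2 * mean_sq D V)"
      using Y by (intro mult_left_mono) auto
    ultimately have "a_lo * s1\<^sup>2 \<le> \<omega>\<^sup>2 * (eta_max\<^sup>2 * sv\<^sup>2) + 2 * a_hi * C0 * s1 * sv"
      using low[OF LV(2)] low[OF LV(3)] unfolding sq by linarith
    moreover have "2 * a_hi * C0 * s1 * sv \<le> a_lo / 2 * s1\<^sup>2 + 2 * a_hi\<^sup>2 * C0\<^sup>2 / a_lo * sv\<^sup>2"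
    proof -
      \<comment> \<open>Young's inequality absorbs the gradient on the right into the left hand side.\<close>
      have "0 \<le> (a_lo * s1 - 2 * a_hi * C0 * sv)\<^sup>2 / (2 * a_lo)" using a_lo by simp
      also have "\<dots> = a_lo / 2 * s1\<^sup>2 + 2 * a_hi\<^sup>2 * C0\<^sup>2 / a_lo * sv\<^sup>2 - 2 * a_hi * C0 * s1 * sv"
        using a_lo by (simp add: power2_eq_square field_simps)
      finally show ?thesis by linarith
    qed
    ultimately have "a_lo / 2 * s1\<^sup>2 \<le> (\<omega>\<^sup>2 * eta_max\<^sup>2 + 2 * a_hi\<^sup>2 * C0\<^sup>2 / a_lo) * sv\<^sup>2"
      by (simp add: distrib_right mult.assoc)
    then have "Q G1 \<le> 2 / a_lo * ((\<omega>\<^sup>2 * eta_max\<^sup>2 + 2 * a_hi\<^sup>2 * C0\<^sup>2 / a_lo) * mean_sq D V)"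
      unfolding sq using a_lo by (simp add: field_simps)
    then have "mm * Q G1 \<le> mm * (2 / a_lo * ((\<omega>\<^sup>2 * eta_max\<^sup>2 + 2 * a_hi\<^sup>2 * C0\<^sup>2 / a_lo) * mean_sq D V))"
      using mm by (intro mult_left_mono) auto
    also have "\<dots> = 2 / a_lo * (\<omega>\<^sup>2 * eta_max\<^sup>2 + 2 * a_hi\<^sup>2 * C0\<^sup>2 / a_lo) * (mm * mean_sq D V)" by simp
    also have "\<dots> \<le> q"
      unfolding q_def
    proof (rule mult_left_mono)
      have "mm * mean_sq D V = (LINT x:cell (real M * \<epsilon>) h|lborel. (norm (v (x + (t, 0))))\<^sup>2)"
        using mm by (simp add: mean_sq_def mm_def D_def V_def)
      also have "\<dots> \<le> Cv * (real M * \<epsilon> + 1)"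
        by (rule window_le[OF loc(1) h_pos(1) _ v_window]) (use \<epsilon> in simp)
      finally show "mm * mean_sq D V \<le> Cv * (real M * \<epsilon> + 1)" .
    qed (use a_lo in simp)
    finally have fin: "mm * Q G1 \<le> q" .
    define F where "F x = indicator ({c + \<epsilon><..<c + \<epsilon> + 1} \<times> UNIV) x * (norm (G1 x))\<^sup>2" for x :: plane
    have "{c + \<epsilon><..<c + \<epsilon> + 1} \<times> (UNIV :: real set) \<in> sets borel" by (intro borel_open open_Times) auto
    then have Fm: "F \<in> borel_measurable borel" using L2_onD(1)[OF LV(2)] unfolding F_def by measurable
    have "(LINT x:cell 1 h|lborel. (norm (g1 (x + (L, 0))))\<^sup>2) = (LINT x:cell 1 h|lborel. F (x + (c + \<epsilon>, 0)))"
      by (rule set_lebesgue_integral_cong) (auto simp: F_def indicator_def mem_cell mem_Times_iff G1_def t_def add.assoc)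
    also have "\<dots> = (LINT x:D|lborel. F x)"
      unfolding D_def
      by (rule cell_window_integral[OF Fm, symmetric])
        (use \<epsilon> N1 N in \<open>auto simp: F_def indicator_def mem_Times_iff c_def M_def algebra_simps\<close>)
    also have "\<dots> \<le> (LINT x:D|lborel. (norm (complex_of_real (z x) * G1 x))\<^sup>2)"
    proof -
      have le: "0 \<le> F x \<and> F x \<le> (norm (complex_of_real (z x) * G1 x))\<^sup>2" for x
        using \<zeta>1[of "fst x"] by (auto simp: F_def indicator_def z_def mem_Times_iff)
      note i = L2_onD(2)[OF Lz(1)[OF LV(2)]]
      have "set_integrable lborel D F"
        unfolding set_integrable_def
        by (rule Bochner_Integration.integrable_bound[OF i[unfolded set_integrable_def]])
          (use le Fm in \<open>auto simp: indicator_def intro!: AE_I2\<close>)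
      then show ?thesis using i le by (intro set_integral_mono) auto
    qed
    also have "\<dots> = mm * Q G1" using mm by (simp add: Q_def mean_sq_def mm_def)
    finally show "(LINT x:cell 1 h|lborel. (norm (g1 (x + (L, 0))))\<^sup>2) \<le> q" using fin by linarith
  qed
qed

text \<open>The energy flux through the cell of length \<open>R\<epsilon>\<close> starting at \<open>t\<close>, averaged with the weight
  \<open>\<zeta>\<^sup>2\<close>. The square allows to distribute the weight evenly between the solution and its gradient.\<close>

definition flux_cell :: "nat \<Rightarrow> real \<Rightarrow> real" where
  "flux_cell R t = Im (mean_ip (cell (real R * \<epsilon>) h)
     (\<lambda>x. complex_of_real (a (x + (t, 0)) * (zeta R (fst x))\<^sup>2) * g1 (x + (t, 0))) (\<lambda>x. v (x + (t, 0))))"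

text \<open>All terms of the energy identity are real except the one with the derivative of the weight; with a
  weight that rises across the left cell and falls across the right one, that term is the difference of
  the two fluxes.\<close>

lemma flux_conservation:
  assumes R: "R > 5" "K dvd R"
  shows "flux_cell R (real R * \<epsilon>) = flux_cell R (- 2 * real R * \<epsilon>)"
proof -
  have R0: "R > 0" using R by simp
  define c where "c = real R * \<epsilon>"
  have c: "c > 5 * \<epsilon>" "c > 0" using R \<epsilon> by (simp_all add: c_def)
  define \<rho> where "\<rho> r = zeta R r * zeta R r" for r
  have \<rho>: "smooth_line \<rho>" unfolding \<rho>_def by (intro smooth_line_mult zeta_smooth R0 R)
  have \<rho>c: "continuous_on UNIV \<rho>" by (rule smooth_line_continuous[OF \<rho>])
  obtain \<delta> where \<delta>: "\<delta> > 0" "\<And>r. r < \<delta> \<or> r > c - \<delta> \<Longrightarrow> zeta R r = 0"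
    using zeta_supp[OF R0 R(2)] unfolding supported_in_def c_def by blast
  have \<rho>0: "\<rho> r = 0" if "r < \<delta> \<or> r > c - \<delta>" for r using \<delta>(2)[OF that] by (simp add: \<rho>_def)
  define F where "F r = integral {0..r} \<rho>" for r
  have Fneg: "F r = 0" if "r < \<delta>" for r
  proof -
    have "F r = integral {0..r} (\<lambda>_. 0)" unfolding F_def
      using \<rho>0 that by (intro Henstock_Kurzweil_Integration.integral_cong) auto
    then show ?thesis by simp
  qed
  have io: "\<rho> integrable_on {p..q}" for p q
    by (rule integrable_continuous_interval[OF continuous_on_subset[OF \<rho>c]]) simp
  have Fpos: "F r = F c" if "r \<ge> c" for r
  proof -
    have "F r = integral {0..c} \<rho> + integral {c..r} \<rho>"
      unfolding F_def using that c by (intro Henstock_Kurzweil_Integration.integral_combine[symmetric] io) auto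
    also have "integral {c..r} \<rho> = integral {c..r} (\<lambda>_. 0)"
      using \<rho>0 \<delta> by (intro Henstock_Kurzweil_Integration.integral_cong) auto
    finally show ?thesis by (simp add: F_def)
  qed
  have Fd: "(F has_real_derivative \<rho> r) (at r)" for r
  proof (cases "r < \<delta>")
    case True
    have "(F has_field_derivative 0) (at r)"
      by (rule has_field_derivative_transform_within_open[of "\<lambda>_. 0" 0 r "{..<\<delta>}"]) (use True Fneg in auto)
    then show ?thesis using \<rho>0 True by simp
  next
    case False
    then have r: "0 < r" using \<delta> by simp
    have "(F has_real_derivative \<rho> r) (at r within {0..r + 1})"
      unfolding F_def using r by (intro integral_has_real_derivative continuous_on_subset[OF \<rho>c]) auto
    moreover have "at r within {0..r + 1} = at r" using r by (intro at_within_interior) auto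
    ultimately show ?thesis by simp
  qed
  \<comment> \<open>In coordinates shifted by \<open>3c\<close> with \<open>c = R\<epsilon>\<close>, the left cell is \<open>(c, 2c)\<close> and the right one
    \<open>(4c, 5c)\<close>. The weight \<open>\<theta>\<close> has compact support and derivative \<open>\<zeta>\<^sup>2\<close> on the left and
    \<open>-\<zeta>\<^sup>2\<close> on the right cell; all other terms of the energy identity are real.\<close>
  define \<theta> where "\<theta> r = F (r + (- c)) - F (r + (- (4 * c)))" for r
  have \<theta>d: "(\<theta> has_real_derivative (\<rho> (r + (- c)) - \<rho> (r + (- (4 * c))))) (at r)" for r
    unfolding \<theta>_def using Fd[of "r + (- c)"] Fd[of "r + (- (4 * c))"] by (intro DERIV_diff) (simp_all only: DERIV_shift)
  have \<theta>: "smooth_line \<theta>"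
    by (rule smooth_line_antiderivative[OF smooth_line_diff[OF smooth_line_shift[OF \<rho>] smooth_line_shift[OF \<rho>]] \<theta>d])
  have d\<theta>: "deriv \<theta> r = \<rho> (r + (- c)) - \<rho> (r + (- (4 * c)))" for r by (rule DERIV_imp_deriv[OF \<theta>d])
  define M where "M = 6 * R"
  have M: "M > 2" "K dvd M" using R by (auto simp: M_def)
  have pq: "\<epsilon> < c" "5 * c < (real M - 1) * \<epsilon>" using c by (auto simp: M_def c_def algebra_simps)
  have \<theta>0: "\<theta> r = 0" if "r < c \<or> r > 5 * c" for r
    using that
  proof
    assume "r < c" then show ?thesis using Fneg[of "r - c"] Fneg[of "r - 4 * c"] \<delta> c by (simp add: \<theta>_def)
  next
    assume "r > 5 * c" then show ?thesis using Fpos[of "r - c"] Fpos[of "r - 4 * c"] c by (simp add: \<theta>_def)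
  qed
  define t where "t = - (3 * c)"
  define D where "D = cell (real M * \<epsilon>) h"
  note E = energy_identity[OF M \<theta> pq \<theta>0, of t, folded D_def]
  have Im0: "Im (mean_ip D (\<lambda>x. complex_of_real (a (x + (t, 0)) * deriv \<theta> (fst x)) * g1 (x + (t, 0))) (\<lambda>x. v (x + (t, 0)))) = 0"
    using arg_cong[OF E, of Im] unfolding mean_ip_self_weight by (simp flip: of_real_power)
  define f where "f c' x = complex_of_real (a (x + (t, 0)) * \<rho> (fst x + (- c'))) * g1 (x + (t, 0)) * cnj (v (x + (t, 0)))" for c' x
  have fm: "f c' \<in> borel_measurable borel" for c'
  proof -
    have "continuous_on UNIV (\<lambda>x::plane. \<rho> (fst x + (- c')))"
      by (intro continuous_intros continuous_on_compose2[OF \<rho>c]) auto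
    then have [measurable]: "(\<lambda>x::plane. \<rho> (fst x + (- c'))) \<in> borel_measurable borel"
      by (rule borel_measurable_continuous_onI)
    have [measurable]: "(\<lambda>x. cnj (v (x + (t, 0)))) \<in> borel_measurable borel"
      by (intro borel_measurable_cnj) measurable
    show ?thesis unfolding f_def by measurable
  qed
  have fi: "set_integrable lborel D (f c')" for c'
  proof -
    have "L2_on D (\<lambda>x. complex_of_real (a (x + (t, 0))) * (complex_of_real (\<rho> (fst x + (- c'))) * g1 (x + (t, 0))))"
      unfolding D_def using smooth_line_continuous[OF smooth_line_shift[OF \<rho>, of "- c'"]]
      by (intro L2_a L2_line_mult[of "\<lambda>r. \<rho> (r + (- c'))"] L2_shift)
    from L2_prod_integrable[OF _ this L2_shift(1)[of "real M * \<epsilon>" t, folded D_def]]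
    show ?thesis unfolding f_def by (simp add: D_def mult.assoc)
  qed
  have win: "(LINT x:D|lborel. f c' x) = (LINT x:cell c h|lborel. f c' (x + (c', 0)))" if "0 \<le> c'" "c' + c \<le> 6 * c" for c'
    unfolding D_def
  proof (rule cell_window_integral[OF fm])
    show "c' + c \<le> real M * \<epsilon>" using that by (simp add: M_def c_def)
    fix x :: plane assume "fst x \<le> c' \<or> c' + c \<le> fst x"
    then have "\<rho> (fst x + (- c')) = 0" using \<delta> by (intro \<rho>0) auto
    then show "f c' x = 0" by (simp add: f_def)
  qed (use that in auto)
  have cell: "(LINT x:cell c h|lborel. f c' (x + (c', 0))) / measure lborel (cell c h) =
      mean_ip (cell (real R * \<epsilon>) h) (\<lambda>x. complex_of_real (a (x + (t + c', 0)) * (zeta R (fst x))\<^sup>2) * g1 (x + (t + c', 0))) (\<lambda>x. v (x + (t + c', 0)))" for c'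
    unfolding mean_ip_def c_def[symmetric] f_def \<rho>_def by (simp add: add.assoc add.commute[of c'] power2_eq_square)
  have "(LINT x:D|lborel. f c x - f (4 * c) x) = (LINT x:D|lborel. f c x) - (LINT x:D|lborel. f (4 * c) x)"
    by (rule set_integral_diff(2)[OF fi fi])
  moreover have "mean_ip D (\<lambda>x. complex_of_real (a (x + (t, 0)) * deriv \<theta> (fst x)) * g1 (x + (t, 0))) (\<lambda>x. v (x + (t, 0)))
     = (LINT x:D|lborel. f c x - f (4 * c) x) / measure lborel D"
    unfolding mean_ip_def f_def d\<theta> by (simp add: algebra_simps)
  ultimately have "Im (((LINT x:D|lborel. f c x) - (LINT x:D|lborel. f (4 * c) x)) / measure lborel D) = 0"
    using Im0 by simp
  moreover have "measure lborel D > 0" using \<epsilon> h_pos M by (simp add: D_def)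
  ultimately have "Im (LINT x:D|lborel. f c x) = Im (LINT x:D|lborel. f (4 * c) x)" by simp
  then have "Im (LINT x:cell c h|lborel. f c (x + (c, 0))) = Im (LINT x:cell c h|lborel. f (4 * c) (x + (4 * c, 0)))"
    using win[of c] win[of "4 * c"] c by simp
  then have "Im ((LINT x:cell c h|lborel. f c (x + (c, 0))) / measure lborel (cell c h)) = Im ((LINT x:cell c h|lborel. f (4 * c) (x + (4 * c, 0))) / measure lborel (cell c h))"
    by simp
  then show ?thesis unfolding cell flux_cell_def by (simp add: t_def c_def algebra_simps)
qed

end

section \<open>Asymptotics on one side of the interface\<close>

context strip_problem
begin

text \<open>Cut-offs for larger and larger cells, scaled back to the periodicity cell.\<close>

lemma smooth_bumps: "smooth_bumps \<epsilon>"
proof -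
  define z where "z = (\<lambda>n t. zeta (K * (n + 6)) (real (K * (n + 6)) * t))"
  have 12: "smooth_line (z n) \<and> (\<exists>\<delta>>0. \<forall>t. t < \<delta> \<or> t > \<epsilon> - \<delta> \<longrightarrow> z n t = 0)" for n
  proof
  define R where "R = K * (n + 6)"
  have R: "R > 0" "K dvd R" using K by (simp_all add: R_def)
  have zn: "z n = (\<lambda>t. zeta R (real R * t))" by (simp add: z_def R_def)
  have "bounded_linear (\<lambda>x::plane. (real R * fst x, snd x))"
    by (intro bounded_linear_Pair bounded_linear_const_mult bounded_linear_fst bounded_linear_snd)
  from Cinf_affine[OF this zeta_smooth[OF R, unfolded smooth_line_def], where c="(0, 0)"]
  show "smooth_line (z n)"
    unfolding zn by (simp add: smooth_line_def zero_prod_def[symmetric])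
  obtain \<delta> where \<delta>: "\<delta> > 0" "\<And>r. r < \<delta> \<or> r > real R * \<epsilon> - \<delta> \<Longrightarrow> zeta R r = 0"
    using zeta_supp[OF R] unfolding supported_in_def by blast
  have "zeta R (real R * t) = 0" if "t < \<delta> / real R \<or> t > \<epsilon> - \<delta> / real R" for t
    using that R by (intro \<delta>(2)) (auto simp: field_simps)
  then show "\<exists>\<delta>>0. \<forall>t. t < \<delta> \<or> t > \<epsilon> - \<delta> \<longrightarrow> z n t = 0"
    unfolding zn using \<delta>(1) R by (intro exI[of _ "\<delta> / real R"]) simp
  qed
  have 3: "\<forall>\<^sub>F n in sequentially. z n t = 1" if t: "0 < t \<and> t < \<epsilon>" for t
  proof -
  obtain N :: nat where N: "real N > \<epsilon> / t" "real N > \<epsilon> / (\<epsilon> - t)"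
    using reals_Archimedean2[of "max (\<epsilon> / t) (\<epsilon> / (\<epsilon> - t))"] by auto
  show ?thesis
  proof (rule eventually_sequentiallyI[of N])
    fix n assume n: "N \<le> n"
    define R where "R = K * (n + 6)"
    have "1 * (n + 6) \<le> K * (n + 6)" using K by (intro mult_right_mono) auto
    then have nR: "n + 6 \<le> R" by (simp add: R_def)
    then have "real N \<le> real R" using n by simp
    then have R: "R > 2" "K dvd R" "real R > \<epsilon> / t" "real R > \<epsilon> / (\<epsilon> - t)"
      using N nR by (linarith, simp add: R_def, linarith, linarith)
    have "\<epsilon> < real R * t" "\<epsilon> < real R * (\<epsilon> - t)" using R(3,4) t by (simp_all add: field_simps)
    then have "zeta R (real R * t) = 1" using R by (intro zeta_one) (auto simp: algebra_simps)
    then show "z n t = 1" by (simp add: z_def R_def)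
  qed
  qed
  show ?thesis unfolding smooth_bumps_def using 12 3 by blast
qed

lemma zeta_layer:
  assumes R: "R > 5" "K dvd R" and r: "2 * \<epsilon> \<le> r" "r \<le> real R * \<epsilon> - 2 * \<epsilon>"
  shows "zeta R r = 1" "deriv (zeta R) r = 0"
proof -
  have "\<epsilon> < r" "r < (real R - 1) * \<epsilon>" using r \<epsilon> by (auto simp: algebra_simps)
  then show "zeta R r = 1" "deriv (zeta R) r = 0" using R by (auto intro!: zeta_one zeta_deriv_zero)
qed

lemma eta_layer:
  assumes R: "R > 5" "K dvd R" and x: "2 * \<epsilon> \<le> fst x" "fst x \<le> real R * \<epsilon> - 2 * \<epsilon>"
    "2 * \<epsilon> \<le> snd x" "snd x \<le> real R * \<epsilon> - 2 * \<epsilon>"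
  shows "\<eta> R x = 1"
proof (rule eta_one)
  show "x \<in> {\<epsilon><..<(real R - 1) * \<epsilon>} \<times> {\<epsilon><..<(real R - 1) * \<epsilon>}"
    using x \<epsilon> by (auto simp: mem_Times_iff algebra_simps)
qed (use R in auto)

end

lemma roots_of_unity_sum:
  assumes n: "n > 0"
  shows "(\<Sum>c<n. cis (2 * pi * (real i / real n) * real c)) = (if n dvd i then of_nat n else 0)"
proof -
  have "cis (2 * pi * (real i / real n) * real c) = cis (2 * pi * (real c / real n) * (real (i mod n) - real 0))" for c
  proof -
    have "real i = real (i mod n) + real (i div n) * real n"
      by (metis mod_mult_div_eq mult.commute of_nat_add of_nat_mult)
    then have "2 * pi * (real i / real n) * real c = 2 * pi * (real c / real n) * (real (i mod n) - real 0) + 2 * pi * of_int (int (i div n * c))"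
      using n by (simp add: field_simps)
    then show ?thesis by (simp only: cis_add_2pi_int)
  qed
  then show ?thesis
    using roots_of_unity_orthogonal[of "i mod n" n 0] n by (simp add: mod_eq_0_iff_dvd)
qed

context strip_problem
begin

text \<open>The vertically periodic extension, shifted by \<open>t\<close>; both sides of the interface are instances.\<close>

definition vper :: "(plane \<Rightarrow> complex) \<Rightarrow> real \<Rightarrow> plane \<Rightarrow> complex" where
  "vper f t x = per_ext h f (t + fst x, snd x)"

lemma vper_tile:
  assumes "x \<in> cell s h"
  shows "vper f t (x + (0, real c * h)) = f (x + (t, 0))"
proof -
  have "\<lfloor>(snd x + real c * h) / h\<rfloor> = int c"
    using assms h_pos by (intro floor_unique) (auto simp: mem_cell field_simps)
  then show ?thesis
    by (cases x) (simp add: vper_def per_ext_def add.commute mult.commute)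
qed

lemma vper_borel:
  assumes "L2_loc_strip h f"
  shows "vper f t \<in> borel_measurable borel"
proof -
  have f: "f \<in> borel_measurable borel" using assms by (auto simp: L2_loc_strip_def L2_on_def)
  have m: "(\<lambda>x::plane. (t + fst x, snd x - h * of_int \<lfloor>snd x / h\<rfloor>)) \<in> borel_measurable borel"
    unfolding borel_prod[symmetric] by measurable
  show ?thesis
    unfolding vper_def per_ext_def using measurable_compose[OF m f] by simp
qed

lemma W_box_tile:
  assumes R: "R = n * K"
  shows "W_box \<epsilon> R = cell (real 1 * (real R * \<epsilon>)) (real n * h)"
  by (simp add: W_box_eq R h mult_ac)

lemma tile_vertical: "c \<in> {..<1} \<times> {..<n} \<Longrightarrow> tile s h c = (0, real (snd c) * h)"
  by (auto simp: tile_def)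

lemma vper_L2:
  assumes f: "L2_loc_strip h f" and R: "R = n * K" "R > 0"
  shows "L2_on (W_box \<epsilon> R) (vper f t)"
proof -
  note [measurable] = vper_borel[OF f]
  have "L2_on (cell (real R * \<epsilon>) h) (\<lambda>x. vper f t (x + tile (real R * \<epsilon>) h c))" if c: "c \<in> {..<1} \<times> {..<n}" for c
    unfolding tile_vertical[OF c]
    by (rule L2_on_cong[OF L2_loc_strip_cell[OF f, of _ t]]) (auto intro!: vper_tile)
  then show ?thesis
    unfolding W_box_tile[OF R(1)] using R \<epsilon> h_pos by (subst L2_on_tile) auto
qed

end

context strip_solution
begin

lemmas vper_v_borel [measurable] = vper_borel[OF loc(1)]

lemma layer_v:
  assumes R: "R > 5" and W: "W \<in> borel_measurable borel" and B: "\<And>x. x \<in> cell (real R * \<epsilon>) h \<Longrightarrow> norm (W x) \<le> B"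
    and W0: "\<And>x. x \<in> cell (real R * \<epsilon>) h \<Longrightarrow> 2 * \<epsilon> \<le> fst x \<Longrightarrow> fst x \<le> real R * \<epsilon> - 2 * \<epsilon> \<Longrightarrow> W x = 0"
    and f: "L2_loc_strip h f" and C: "\<And>L. (LINT x:cell 1 h|lborel. (norm (f (x + (L, 0))))\<^sup>2) \<le> C"
  shows "(LINT x:cell (real R * \<epsilon>) h|lborel. (norm (W x * f (x + (t, 0))))\<^sup>2) \<le> B\<^sup>2 * (2 * C * (2 * \<epsilon> + 1))"
proof -
  have s: "2 * \<epsilon> \<le> real R * \<epsilon>" using R \<epsilon> by simp
  have "(LINT x:cell (real R * \<epsilon>) h|lborel. (norm (W x * f (x + (t, 0))))\<^sup>2) \<le>
    B\<^sup>2 * ((LINT x:cell (2 * \<epsilon>) h|lborel. (norm (f (x + (t, 0))))\<^sup>2) + (LINT x:cell (2 * \<epsilon>) h|lborel. (norm (f (x + (real R * \<epsilon> - 2 * \<epsilon>, 0) + (t, 0))))\<^sup>2))"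
    using \<epsilon> s by (intro layer_integral_le L2_loc_strip_cell[OF f] W B W0) auto
  also have "\<dots> \<le> B\<^sup>2 * (C * (2 * \<epsilon> + 1) + C * (2 * \<epsilon> + 1))"
    using window_le[OF f h_pos(1) _ C, of "2 * \<epsilon>" t] window_le[OF f h_pos(1) _ C, of "2 * \<epsilon>" "real R * \<epsilon> - 2 * \<epsilon> + t"] \<epsilon>
    by (intro mult_left_mono add_mono) (auto simp: add.assoc)
  also have "\<dots> = B\<^sup>2 * (2 * C * (2 * \<epsilon> + 1))" by simp
  finally show ?thesis .
qed

text \<open>A weight supported near the boundary of the large cell sees a fraction of order \<open>1/R\<close> of it: a
  layer at both ends of each of the \<open>n\<close> copies of a piece of the strip, and at most two full copies at
  the bottom and two at the top.\<close>

lemma layer_W: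
  assumes R: "R = n * K" "R > 5" and W [measurable]: "W \<in> borel_measurable borel" and B: "\<And>x. x \<in> W_box \<epsilon> R \<Longrightarrow> norm (W x) \<le> B"
    and W0: "\<And>x. 2 * \<epsilon> \<le> fst x \<Longrightarrow> fst x \<le> real R * \<epsilon> - 2 * \<epsilon> \<Longrightarrow> 2 * \<epsilon> \<le> snd x \<Longrightarrow> snd x \<le> real R * \<epsilon> - 2 * \<epsilon> \<Longrightarrow> W x = 0"
  shows "L2_on (W_box \<epsilon> R) (\<lambda>x. W x * vper v t x)"
    and "mean_sq (W_box \<epsilon> R) (\<lambda>x. W x * vper v t x) \<le> B\<^sup>2 * (Cv * (2 * (2 * \<epsilon> + 1) + 4 * (\<epsilon> + 1)) / \<epsilon>\<^sup>2) / real R"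
proof -
  have Wb: "W_box \<epsilon> R \<in> sets borel" by (simp add: W_box_eq)
  show L: "L2_on (W_box \<epsilon> R) (\<lambda>x. W x * vper v t x)"
    by (rule L2_on_bounded_mult[OF Wb vper_L2[OF loc(1) R(1)] W B]) (use R(2) in auto)
  define s where "s = real R * \<epsilon>"
  define F where "F x = (norm (W x * vper v t x))\<^sup>2" for x
  have Fm: "F \<in> borel_measurable borel" unfolding F_def by measurable
  have Fi: "set_integrable lborel (W_box \<epsilon> R) F" unfolding F_def by (rule L2_onD(2)[OF L])
  have nh: "real n * h = s" by (simp add: s_def R h)
  have s0: "s > 0" unfolding s_def using R(2) \<epsilon> by (intro mult_pos_pos) auto
  have WB: "W_box \<epsilon> R = cell (real 1 * s) (real n * h)" unfolding s_def by (rule W_box_tile[OF R(1)])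
  have "(LINT x:W_box \<epsilon> R|lborel. F x) = (\<Sum>c\<in>{..<1::nat} \<times> {..<n}. LINT x:cell s h|lborel. F (x + tile s h c))"
    unfolding WB by (rule set_integrable_tile(2)[OF Fm s0 h_pos(1)]) (use Fi WB in simp)
  also have "\<dots> \<le> (\<Sum>c\<in>{..<1::nat} \<times> {..<n}. B\<^sup>2 * (2 * Cv * (2 * \<epsilon> + 1)) + (if snd c \<in> {0, 1, n - 2, n - 1} then B\<^sup>2 * (Cv * (s + 1)) else 0))"
  proof (rule sum_mono)
    fix c assume c: "c \<in> {..<1::nat} \<times> {..<n}"
    define k where "k = snd c"
    have k: "k < n" using c by (auto simp: k_def)
    have t: "tile s h c = (0, real k * h)" using tile_vertical[OF c] by (simp add: k_def)
    define W' where "W' x = W (x + (0, real k * h))" for x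
    have W'm [measurable]: "W' \<in> borel_measurable borel" unfolding W'_def by measurable
    have eq: "(LINT x:cell s h|lborel. F (x + tile s h c)) = (LINT x:cell s h|lborel. (norm (W' x * v (x + (t, 0))))\<^sup>2)"
      unfolding \<open>tile s h c = (0, real k * h)\<close>
      by (rule set_lebesgue_integral_cong) (auto simp: F_def W'_def vper_tile)
    have B': "norm (W' x) \<le> B" if "x \<in> cell s h" for x
    proof -
      have "x + tile s h c \<in> cell (real 1 * s) (real n * h)"
        by (rule cell_shift_subset[OF that]) (use c in auto)
      then show ?thesis unfolding W'_def \<open>tile s h c = (0, real k * h)\<close> using B WB by simp
    qed
    have full: "(LINT x:cell s h|lborel. (norm (W' x * v (x + (t, 0))))\<^sup>2) \<le> B\<^sup>2 * (Cv * (s + 1))"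
    proof -
      have "(LINT x:cell s h|lborel. (norm (W' x * v (x + (t, 0))))\<^sup>2) \<le> (LINT x:cell s h|lborel. B\<^sup>2 * (norm (v (x + (t, 0))))\<^sup>2)"
      proof (rule set_integral_mono)
        show "set_integrable lborel (cell s h) (\<lambda>x. (norm (W' x * v (x + (t, 0))))\<^sup>2)"
          by (rule L2_onD(2)[OF L2_on_bounded_mult[OF cell_borel L2_shift(1) W'm B']])
        show "set_integrable lborel (cell s h) (\<lambda>x. B\<^sup>2 * (norm (v (x + (t, 0))))\<^sup>2)"
          using L2_onD(2)[OF L2_shift(1)] by (intro set_integrable_mult_right)
        show "(norm (W' x * v (x + (t, 0))))\<^sup>2 \<le> B\<^sup>2 * (norm (v (x + (t, 0))))\<^sup>2" if "x \<in> cell s h" for x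
          using B'[OF that] by (simp add: norm_mult power_mult_distrib mult_right_mono power_mono)
      qed
      also have "\<dots> = B\<^sup>2 * (LINT x:cell s h|lborel. (norm (v (x + (t, 0))))\<^sup>2)" by simp
      also have "\<dots> \<le> B\<^sup>2 * (Cv * (s + 1))"
        using window_le[OF loc(1) h_pos(1) _ v_window, of s t] s0 by (intro mult_left_mono) auto
      finally show ?thesis .
    qed
    have nn: "0 \<le> B\<^sup>2 * (2 * Cv * (2 * \<epsilon> + 1))" using Cv_nonneg \<epsilon> by simp
    show "(LINT x:cell s h|lborel. F (x + tile s h c)) \<le> B\<^sup>2 * (2 * Cv * (2 * \<epsilon> + 1)) + (if snd c \<in> {0, 1, n - 2, n - 1} then B\<^sup>2 * (Cv * (s + 1)) else 0)"
    proof (cases "k \<in> {0, 1, n - 2, n - 1}")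
      case True
      then show ?thesis unfolding eq k_def[symmetric] using add_mono[OF nn full] by (simp only: if_True add_0)
    next
      case False
      then have kk: "2 \<le> k" "k + 3 \<le> n" using k by auto
      have "(LINT x:cell s h|lborel. (norm (W' x * v (x + (t, 0))))\<^sup>2) \<le> B\<^sup>2 * (2 * Cv * (2 * \<epsilon> + 1))"
        unfolding s_def
      proof (rule layer_v[OF R(2) W'm _ _ loc(1) v_window], fold s_def)
        show "norm (W' x) \<le> B" if "x \<in> cell s h" for x by (rule B'[OF that])
        fix x assume x: "x \<in> cell s h" "2 * \<epsilon> \<le> fst x" "fst x \<le> s - 2 * \<epsilon>"
        have "2 * h \<le> real k * h" using kk h_pos by (intro mult_right_mono) auto
        moreover have "real k * h + 3 * h \<le> s"
        proof -
          have "(real k + 3) * h \<le> real n * h" using kk h_pos by (intro mult_right_mono) auto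
          then show ?thesis by (simp only: distrib_right nh)
        qed
        moreover have "0 < snd x" "snd x < h" using x(1) by (simp_all add: mem_cell)
        moreover have "fst (x + (0, real k * h)) = fst x" "snd (x + (0, real k * h)) = snd x + real k * h" by simp_all
        ultimately show "W' x = 0"
          unfolding W'_def using x(2,3) h_pos by - (rule W0; (unfold s_def[symmetric])?; linarith)
      qed
      then show ?thesis using False unfolding eq k_def[symmetric] by simp
    qed
  qed
  also have "\<dots> = real n * (B\<^sup>2 * (2 * Cv * (2 * \<epsilon> + 1))) + (\<Sum>c\<in>{..<1::nat} \<times> {..<n}. if snd c \<in> {0, 1, n - 2, n - 1} then B\<^sup>2 * (Cv * (s + 1)) else 0)"
    by (simp add: sum.distrib card_cartesian_product)
  also have "(\<Sum>c\<in>{..<1::nat} \<times> {..<n}. if snd c \<in> {0, 1, n - 2, n - 1} then B\<^sup>2 * (Cv * (s + 1)) else 0) \<le> 4 * (B\<^sup>2 * (Cv * (s + 1)))"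
  proof -
    let ?S = "{c \<in> {..<1::nat} \<times> {..<n}. snd c \<in> {0, 1, n - 2, n - 1}}"
    have "(\<Sum>c\<in>{..<1::nat} \<times> {..<n}. if snd c \<in> {0, 1, n - 2, n - 1} then B\<^sup>2 * (Cv * (s + 1)) else 0) = real (card ?S) * (B\<^sup>2 * (Cv * (s + 1)))"
      by (subst sum.inter_filter[symmetric]) auto
    also have "card ?S \<le> card ({0::nat} \<times> {0, 1, n - 2, n - 1})"
      by (intro card_mono) auto
    then have "real (card ?S) * (B\<^sup>2 * (Cv * (s + 1))) \<le> 4 * (B\<^sup>2 * (Cv * (s + 1)))"
    proof (intro mult_right_mono)
      have "card {0, 1, n - 2, n - 1} \<le> 4" using card_length[of "[0, 1, n - 2, n - 1]"] by simp
      then show "card ?S \<le> card ({0::nat} \<times> {0, 1, n - 2, n - 1}) \<Longrightarrow> real (card ?S) \<le> 4"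
        by (simp only: card_cartesian_product card.empty card.insert) auto
    qed (use Cv_nonneg s0 in auto)
    finally show ?thesis .
  qed
  finally have I: "(LINT x:W_box \<epsilon> R|lborel. F x) \<le> real n * (B\<^sup>2 * (2 * Cv * (2 * \<epsilon> + 1))) + 4 * (B\<^sup>2 * (Cv * (s + 1)))"
    by simp
  have nR: "real n \<le> real R" using mult_left_mono[of 1 "real K" "real n"] K by (simp add: R(1))
  have R1: "real R \<ge> 1" using R(2) by linarith
  have "(LINT x:W_box \<epsilon> R|lborel. F x) \<le> real R * (B\<^sup>2 * (2 * Cv * (2 * \<epsilon> + 1))) + 4 * (B\<^sup>2 * (Cv * (real R * (\<epsilon> + 1))))"
  proof (rule order_trans[OF I], intro add_mono mult_left_mono mult_right_mono)
    show "s + 1 \<le> real R * (\<epsilon> + 1)" unfolding s_def using R1 by (simp add: algebra_simps)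
  qed (use nR Cv_nonneg \<epsilon> in auto)
  also have "\<dots> = real R * (B\<^sup>2 * (Cv * (2 * (2 * \<epsilon> + 1) + 4 * (\<epsilon> + 1))))" by (simp add: algebra_simps)
  finally have "(LINT x:W_box \<epsilon> R|lborel. F x) / (s * s) \<le> real R * (B\<^sup>2 * (Cv * (2 * (2 * \<epsilon> + 1) + 4 * (\<epsilon> + 1)))) / (s * s)"
    using s0 by (intro divide_right_mono) auto
  also have "\<dots> = B\<^sup>2 * (Cv * (2 * (2 * \<epsilon> + 1) + 4 * (\<epsilon> + 1)) / \<epsilon>\<^sup>2) / real R"
    using R1 \<epsilon> by (simp add: s_def power2_eq_square field_simps)
  also have "(LINT x:W_box \<epsilon> R|lborel. F x) / (s * s) = mean_sq (W_box \<epsilon> R) (\<lambda>x. W x * vper v t x)"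
    using s0 by (simp add: mean_sq_def F_def W_box_eq s_def[symmetric])
  finally show "mean_sq (W_box \<epsilon> R) (\<lambda>x. W x * vper v t x) \<le> B\<^sup>2 * (Cv * (2 * (2 * \<epsilon> + 1) + 4 * (\<epsilon> + 1)) / \<epsilon>\<^sup>2) / real R" .
qed

text \<open>Each of the \<open>n\<close> vertical copies of the strip contributes the same integral times a root of unity, and
  the roots add up to zero unless the vertical wave number is a multiple of \<open>1/K\<close>.\<close>

lemma coefficient_W_box:
  assumes R: "R = n * K" "R > 0" and \<Psi>: "periodic2 \<epsilon> (\<Psi> j l)" "L2_on (cell \<epsilon> \<epsilon>) (\<Psi> j l)"
    and z: "continuous_on UNIV z" and j: "j \<in> Q_grid R \<times> Q_grid R"
  shows "mean_ip (W_box \<epsilon> R) (\<lambda>x. complex_of_real (z (fst x)) * vper v t x) (bloch_wave \<epsilon> \<Psi> (j, l)) =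
    (if snd j \<in> Q_grid K
     then mean_ip (cell (real R * \<epsilon>) h) (\<lambda>x. complex_of_real (z (fst x)) * v (x + (t, 0))) (bloch_wave \<epsilon> \<Psi> (j, l)) else 0)"
proof -
  define s where "s = real R * \<epsilon>"
  have n0: "n > 0" using R by (cases n) auto
  have s0: "s > 0" unfolding s_def using R(2) \<epsilon> by (intro mult_pos_pos) auto
  have nh: "real n * h = s" by (simp add: s_def R h)
  have WB: "W_box \<epsilon> R = cell (real 1 * s) (real n * h)" unfolding s_def by (rule W_box_tile[OF R(1)])
  let ?U = "bloch_wave \<epsilon> \<Psi> (j, l)"
  obtain i where i: "snd j = real i / real R" "i < R" using j by (auto simp: Q_grid_def mem_Times_iff)
  define \<tau> where "\<tau> c = cis (2 * pi * (real i / real n) * real c)" for c :: nat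
  have LU: "L2_on (W_box \<epsilon> R) ?U"
    unfolding bloch_wave_eq W_box_eq by (rule periodic_bwave_L2[OF \<epsilon>]) (use \<Psi> in auto)
  have LF: "L2_on (W_box \<epsilon> R) (\<lambda>x. complex_of_real (z (fst x)) * vper v t x)"
    unfolding W_box_eq by (rule L2_line_mult[OF z vper_L2[OF loc(1) R, unfolded W_box_eq]])
  have Us: "?U (x + (0, real c * h)) = ?U x * \<tau> c" for x c
  proof -
    have "\<Psi> j l (x + (0, real c * h)) = \<Psi> j l x"
      using periodic2_tile[OF \<Psi>(1), of x "(0, c * K)"] by (simp add: tile_def h mult_ac)
    moreover have "bwave \<epsilon> j (x + (0, real c * h)) = bwave \<epsilon> j x * \<tau> c"
    proof -
      have "2 * pi * (j \<bullet> (x + (0, real c * h))) / \<epsilon> = 2 * pi * (j \<bullet> x) / \<epsilon> + 2 * pi * (real i / real n) * real c"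
        using \<epsilon> R n0 by (cases j) (use i in \<open>simp add: inner_add_right h R add_divide_distrib distrib_left\<close>)
      then show ?thesis by (simp only: bwave_def \<tau>_def cis_mult)
    qed
    ultimately show ?thesis by (simp add: bloch_wave_eq mult.assoc)
  qed
  have zm: "(\<lambda>x::plane. complex_of_real (z (fst x))) \<in> borel_measurable borel"
    using plane_fst_shift_measurable[OF z, of 0] by simp
  define F where "F x = complex_of_real (z (fst x)) * vper v t x * cnj (?U x)" for x
  have Fm: "F \<in> borel_measurable borel"
    using zm L2_onD(1)[OF L2_on_cnj[OF LU]] unfolding F_def by measurable
  have Fi: "set_integrable lborel (W_box \<epsilon> R) F"
    unfolding F_def by (rule L2_prod_integrable[OF _ LF LU]) (simp add: W_box_eq)
  define I where "I = (LINT x:cell s h|lborel. complex_of_real (z (fst x)) * v (x + (t, 0)) * cnj (?U x))"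
  have "(LINT x:W_box \<epsilon> R|lborel. F x) = (\<Sum>c\<in>{..<1::nat} \<times> {..<n}. LINT x:cell s h|lborel. F (x + tile s h c))"
    unfolding WB by (rule set_integrable_tile(2)[OF Fm s0 h_pos(1)]) (use Fi WB in simp)
  also have "\<dots> = (\<Sum>c\<in>{..<1::nat} \<times> {..<n}. cnj (\<tau> (snd c)) * I)"
  proof (rule sum.cong[OF refl])
    fix c assume c: "c \<in> {..<1::nat} \<times> {..<n}"
    have "(LINT x:cell s h|lborel. F (x + tile s h c)) =
       (LINT x:cell s h|lborel. cnj (\<tau> (snd c)) * (complex_of_real (z (fst x)) * v (x + (t, 0)) * cnj (?U x)))"
      unfolding tile_vertical[OF c]
    proof (rule set_lebesgue_integral_cong, simp, intro allI impI)
      fix x assume x: "x \<in> cell s h"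
      have "fst (x + (0, real (snd c) * h)) = fst x" by simp
      then show "F (x + (0, real (snd c) * h)) = cnj (\<tau> (snd c)) * (complex_of_real (z (fst x)) * v (x + (t, 0)) * cnj (?U x))"
        unfolding F_def vper_tile[OF x] Us by (simp only: complex_cnj_mult mult_ac)
    qed
    also have "\<dots> = cnj (\<tau> (snd c)) * I" unfolding I_def by (rule set_integral_mult_right)
    finally show "(LINT x:cell s h|lborel. F (x + tile s h c)) = cnj (\<tau> (snd c)) * I" .
  qed
  also have "\<dots> = (\<Sum>c<n. cnj (\<tau> c)) * I"
  proof -
    have "(\<Sum>c\<in>{..<1::nat} \<times> {..<n}. cnj (\<tau> (snd c)) * I) = (\<Sum>x<1::nat. \<Sum>c<n. cnj (\<tau> c) * I)"
      by (simp only: sum.cartesian_product case_prod_beta' snd_conv)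
    then show ?thesis by (simp add: sum_distrib_right)
  qed
  also have "(\<Sum>c<n. cnj (\<tau> c)) = cnj (if n dvd i then of_nat n else 0)"
    unfolding cnj_sum[symmetric] \<tau>_def roots_of_unity_sum[OF n0] ..
  finally have J: "(LINT x:W_box \<epsilon> R|lborel. F x) = (if n dvd i then of_nat n else 0) * I" by simp
  have m: "measure lborel (W_box \<epsilon> R) = real n * measure lborel (cell s h)"
    unfolding WB using s0 h_pos by simp
  have "n dvd i \<longleftrightarrow> snd j \<in> Q_grid K"
  proof
    assume "n dvd i"
    then obtain k where k: "i = n * k" by blast
    then have "k < K" using i(2) R n0 by simp
    moreover have "snd j = real k / real K" using i(1) k R n0 by simp
    ultimately show "snd j \<in> Q_grid K" by (auto simp: Q_grid_def)
  next
    assume "snd j \<in> Q_grid K"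
    then obtain k where "real i / real R = real k / real K" using i(1) by (auto simp: Q_grid_def)
    then have "real i = real (n * k)" using R K n0 by (simp add: field_simps)
    then have "i = n * k" by (simp only: of_nat_eq_iff)
    then show "n dvd i" by simp
  qed
  moreover have "mean_ip (W_box \<epsilon> R) (\<lambda>x. complex_of_real (z (fst x)) * vper v t x) ?U = (LINT x:W_box \<epsilon> R|lborel. F x) / measure lborel (W_box \<epsilon> R)"
    by (simp add: mean_ip_def F_def)
  moreover have "mean_ip (cell s h) (\<lambda>x. complex_of_real (z (fst x)) * v (x + (t, 0))) ?U = I / measure lborel (cell s h)"
    by (simp add: mean_ip_def I_def)
  ultimately show ?thesis unfolding J m s_def[symmetric] using n0 by simp
qed

lemma Q_grid_subset: "n > 0 \<Longrightarrow> Q_grid K \<subseteq> Q_grid (n * K)"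
proof
  fix q assume n: "n > 0" and "q \<in> Q_grid K"
  then obtain k where "k < K" "q = real k / real K" by (auto simp: Q_grid_def)
  then have "q = real (n * k) / real (n * K)" "n * k < n * K" using n by simp_all
  then show "q \<in> Q_grid (n * K)" unfolding Q_grid_def by blast
qed

text \<open>The cut-off solution satisfies the Helmholtz equation up to terms containing \<open>\<zeta>'\<close>, whose mean
  square is of order \<open>1/R\<close>. The stability estimate for each Bloch component makes all coefficients
  small except those of ground states with \<open>\<mu> \<approx> \<omega>\<^sup>2\<close>, and the flux is the sum of the fluxes carried
  by the ground states up to an error of order \<open>1/\<surd>R\<close>.\<close>

lemma side_estimate:
  fixes b :: "plane \<Rightarrow> real"
  assumes bc: "bloch_cell \<epsilon> b \<Psi> \<mu> a_lo a_hi \<kappa>" and per: "periodic2 \<epsilon> b"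
    and \<Lambda>: "\<And>j m. j \<in> Z_cell \<Longrightarrow> m \<ge> 1 \<Longrightarrow> \<Lambda> \<le> \<mu> j m" and w: "\<omega>\<^sup>2 < \<Lambda>"
  obtains C where "C \<ge> 0" and
    "\<And>R n t c J. R = n * K \<Longrightarrow> R > 5 \<Longrightarrow> (\<And>x. x \<in> cell (real R * \<epsilon>) h \<Longrightarrow> a (x + (t, 0)) = b x) \<Longrightarrow>
      c = (\<lambda>j l. mean_ip (cell (real R * \<epsilon>) h) (\<lambda>x. complex_of_real (zeta R (fst x)) * v (x + (t, 0))) (bloch_wave \<epsilon> \<Psi> (j, l))) \<Longrightarrow>
      J = Q_grid R \<times> Q_grid K \<Longrightarrow>
      (\<Sum>j\<in>J. (\<mu> j 0 - \<omega>\<^sup>2)\<^sup>2 * (norm (c j 0))\<^sup>2) \<le> C / real R \<and>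
      (\<forall>l\<ge>1. (\<Sum>j\<in>J. (norm (c j l))\<^sup>2) \<le> C / real R) \<and>
      \<bar>flux_cell R t - (\<Sum>j\<in>J. (norm (c j 0))\<^sup>2 * poynting \<epsilon> b \<Psi> (j, 0))\<bar> \<le> C / sqrt (real R)"
proof -
  interpret bc: bloch_cell \<epsilon> b \<Psi> \<mu> a_lo a_hi \<kappa> by (rule bc)
  obtain Cg where Cg: "\<And>L. (LINT x:cell 1 h|lborel. (norm (g1 (x + (L, 0))))\<^sup>2) \<le> Cg"
    using gradient_window by blast
  have Cg0: "0 \<le> Cg"
  proof -
    have "0 \<le> (LINT x:cell 1 h|lborel. (norm (g1 (x + (0, 0))))\<^sup>2)"
      unfolding set_lebesgue_integral_def by (intro Bochner_Integration.integral_nonneg) auto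
    then show ?thesis using Cg[of 0] by simp
  qed
  define w where "w = \<omega>\<^sup>2"
  have w0: "0 \<le> w" "w < \<Lambda>" "0 < \<Lambda>" using w zero_le_power2[of \<omega>] unfolding w_def by linarith+
  define X where "X = (a_hi * C0)\<^sup>2 * (2 * (Cv + Cg) * (2 * \<epsilon> + 1)) / (\<epsilon> * h)"
  have X0: "0 \<le> X" unfolding X_def using Cv_nonneg Cg0 \<epsilon> h_pos by simp
  \<comment> \<open>\<open>X / R\<close> bounds the mean square of the perturbation and \<open>N\<close> that of the cut-off solution.\<close>
  define N where "N = eta_max\<^sup>2 * (Cv * (\<epsilon> + 1) / (\<epsilon> * h))"
  have N0: "0 \<le> N" unfolding N_def using Cv_nonneg \<epsilon> h_pos by simp
  define K1 where "K1 = 2 * (1 / \<Lambda> + 1 / a_lo) / (1 - w / \<Lambda>)\<^sup>2"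
  have K10: "0 \<le> K1" unfolding K1_def using w0 a_lo by simp
  define K2 where "K2 = 2 + 2 * bc.pmax\<^sup>2 / a_lo"
  have K20: "0 \<le> K2" unfolding K2_def using a_lo by simp
  define K3 where "K3 = sqrt a_hi * (bc.pmax / sqrt \<Lambda> + 1) * (sqrt (K1 * X) * sqrt N)"
  have K30: "0 \<le> K3" unfolding K3_def using a_hi bc.pmax_nonneg w0 K10 X0 N0 by simp
  define C where "C = K2 * X + K1 / \<Lambda> * X + K3"
  have C1: "K2 * X \<le> C" "K1 / \<Lambda> * X \<le> C" "K3 \<le> C" "0 \<le> C"
    unfolding C_def using K10 K20 K30 X0 w0 by simp_all
  show ?thesis
  proof (rule that[OF C1(4)])
    fix R n :: nat and t :: real and c J
    assume R: "R = n * K" "R > 5" and ab: "\<And>x. x \<in> cell (real R * \<epsilon>) h \<Longrightarrow> a (x + (t, 0)) = b x"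
      and c: "c = (\<lambda>j l. mean_ip (cell (real R * \<epsilon>) h) (\<lambda>x. complex_of_real (zeta R (fst x)) * v (x + (t, 0))) (bloch_wave \<epsilon> \<Psi> (j, l)))"
      and J: "J = Q_grid R \<times> Q_grid K"
    have RK: "K dvd R" "R > 0" using R(2) by (simp add: R(1), linarith)
    have R1: "real R \<ge> 1" using R(2) by linarith
    define s where "s = real R * \<epsilon>"
    have s0: "s > 0" unfolding s_def using RK(2) \<epsilon> by (intro mult_pos_pos) auto
    define D where "D = cell s h"
    have DB [simp]: "D \<in> sets borel" by (simp add: D_def)
    have hK: "h = real K * \<epsilon>" by (simp add: h)
    have Dm: "measure lborel D = real R * (\<epsilon> * h)" using s0 h_pos by (simp add: D_def s_def)
    have eh: "\<epsilon> * h > 0" using \<epsilon> h_pos by simp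
    define Z where "Z x = complex_of_real (zeta R (fst x))" for x :: plane
    define Z' where "Z' x = complex_of_real (deriv (zeta R) (fst x))" for x :: plane
    define V where "V x = v (x + (t, 0))" for x
    define G1 where "G1 x = g1 (x + (t, 0))" for x
    define G2 where "G2 x = g2 (x + (t, 0))" for x
    note z = zeta_smooth[OF RK(2,1)] zeta_supp[OF RK(2,1), folded s_def]
    have LV: "L2_on D V" "L2_on D G1" "L2_on D G2" unfolding V_def G1_def G2_def D_def by (rule L2_shift)+
    have LZ: "L2_on D (\<lambda>x. Z x * f x)" "L2_on D (\<lambda>x. Z' x * f x)" if "L2_on D f" for f
      using that unfolding Z_def Z'_def D_def by (intro L2_line_mult smooth_line_continuous smooth_line_deriv z(1); assumption)+
    have bD: "\<bar>b x\<bar> \<le> a_hi" if "x \<in> D" for x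
      using ab[of x] a_abs[of "x + (t, 0)"] that by (simp add: D_def s_def mem_cell mem_strip)
    have Lb: "L2_on D (\<lambda>x. complex_of_real (b x) * f x)" if "L2_on D f" for f
      by (rule L2_on_bounded_mult[OF DB that, where C=a_hi]) (use bD in auto)
    define W where "W x = Z x * V x" for x
    define G where "G x = (Z x * G1 x + Z' x * V x, Z x * G2 x)" for x
    define A where "A x = complex_of_real (b x) * (Z' x * G1 x)" for x
    define B where "B x = complex_of_real (b x) * (Z' x * V x)" for x
    have Be: "B = (\<lambda>x. complex_of_real (b x) * (Z' x * V x))" by (simp add: B_def fun_eq_iff)
    have LA: "L2_on D A" "L2_on D B" unfolding A_def B_def by (intro Lb LZ LV)+
    have H: "bloch_H1 s h \<epsilon> (0, 0) W G"
      using cut_off_H1[OF s0 z, of t] unfolding W_def G_def Z_def Z'_def V_def G1_def G2_def .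
    have eq: "mean_ip D (\<lambda>x. complex_of_real (b x) * fst (G x)) (\<lambda>x. fst (tgrad \<epsilon> (0, 0) \<phi> x)) +
        mean_ip D (\<lambda>x. complex_of_real (b x) * snd (G x)) (\<lambda>x. snd (tgrad \<epsilon> (0, 0) \<phi> x)) =
        complex_of_real w * mean_ip D W \<phi> - mean_ip D A \<phi> + mean_ip D B (\<lambda>x. fst (tgrad \<epsilon> (0, 0) \<phi> x))"
      if \<phi>: "\<phi> \<in> test_cell s h" for \<phi>
    proof -
      note T = test_L2_on[OF \<phi> cell_bounded cell_borel, of s h, folded D_def]
      have rw: "mean_ip D (\<lambda>x. complex_of_real (a (x + (t, 0))) * f x) k = mean_ip D (\<lambda>x. complex_of_real (b x) * f x) k" for f k
        by (rule mean_ip_cong) (auto simp: ab D_def s_def)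
      have sp: "mean_ip D (\<lambda>x. complex_of_real (b x) * (Z x * G1 x + Z' x * V x)) k =
          mean_ip D (\<lambda>x. complex_of_real (b x) * (Z x * G1 x)) k + mean_ip D B k" if "L2_on D k" for k
        using mean_ip_add_left[OF DB Lb[OF LZ(1)[OF LV(2)]] Lb[OF LZ(2)[OF LV(1)]] that] by (simp add: distrib_left Be)
      show ?thesis
        using cut_off_equation[OF s0 z \<phi>, of t, folded D_def Z_def Z'_def V_def G1_def G2_def, unfolded rw] sp[OF T(2)]
        unfolding G_def fst_conv snd_conv W_def w_def A_def by simp
    qed
    note main = bc.perturbed_equation_on_large_cell[OF per RK(2) _ H[unfolded s_def hK] LA[unfolded D_def s_def hK] eq[unfolded D_def s_def hK] \<Lambda> w0(1,2),
        folded hK, folded s_def, folded D_def, folded K1_def K2_def]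
    have Kpos: "K > 0" using K by simp
    have cj: "mean_ip D W (bloch_wave \<epsilon> \<Psi> (j, l)) = c j l" for j l
      unfolding c W_def Z_def V_def D_def s_def ..
    define Y where "Y = mean_sq D A + mean_sq D B"
    have Yle: "Y \<le> X / real R"
    proof -
      have layer: "mean_sq D (\<lambda>x. complex_of_real (b x) * (Z' x * f (x + (t, 0)))) \<le> (a_hi * C0)\<^sup>2 * (2 * Cf * (2 * \<epsilon> + 1)) / (real R * (\<epsilon> * h))"
        if f: "L2_loc_strip h f" "\<And>L. (LINT x:cell 1 h|lborel. (norm (f (x + (L, 0))))\<^sup>2) \<le> Cf" for f Cf
      proof -
        have Z'm: "Z' \<in> borel_measurable borel"
          using plane_fst_shift_measurable[OF smooth_line_continuous[OF smooth_line_deriv[OF z(1)]], of 0] by (simp add: Z'_def[abs_def])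
        have "(LINT x:D|lborel. (norm ((complex_of_real (b x) * Z' x) * f (x + (t, 0))))\<^sup>2) \<le> (a_hi * C0)\<^sup>2 * (2 * Cf * (2 * \<epsilon> + 1))"
          unfolding D_def s_def
        proof (rule layer_v[OF R(2) _ _ _ f])
          show "(\<lambda>x. complex_of_real (b x) * Z' x) \<in> borel_measurable borel" using Z'm by measurable
          fix x assume x: "x \<in> cell (real R * \<epsilon>) h"
          have "\<bar>b x\<bar> * \<bar>deriv (zeta R) (fst x)\<bar> \<le> a_hi * C0"
            using bD[of x] x zeta_deriv_le[OF RK(2,1)] a_hi by (intro mult_mono) (auto simp: D_def s_def)
          then show "norm (complex_of_real (b x) * Z' x) \<le> a_hi * C0" by (simp add: Z'_def norm_mult)
          assume "2 * \<epsilon> \<le> fst x" "fst x \<le> real R * \<epsilon> - 2 * \<epsilon>"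
          then show "complex_of_real (b x) * Z' x = 0" using zeta_layer(2)[OF R(2) RK(1)] by (simp add: Z'_def)
        qed
        then show ?thesis
          using eh R1 unfolding mean_sq_def Dm by (simp add: mult.assoc divide_right_mono)
      qed
      have "Y \<le> (a_hi * C0)\<^sup>2 * (2 * Cg * (2 * \<epsilon> + 1)) / (real R * (\<epsilon> * h)) + (a_hi * C0)\<^sup>2 * (2 * Cv * (2 * \<epsilon> + 1)) / (real R * (\<epsilon> * h))"
        unfolding Y_def A_def B_def G1_def V_def by (intro add_mono layer loc Cg v_window)
      also have "\<dots> = ((a_hi * C0)\<^sup>2 * (2 * Cg * (2 * \<epsilon> + 1)) + (a_hi * C0)\<^sup>2 * (2 * Cv * (2 * \<epsilon> + 1))) / (\<epsilon> * h) / real R"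
        by (simp add: add_divide_distrib mult.commute)
      also have "(a_hi * C0)\<^sup>2 * (2 * Cg * (2 * \<epsilon> + 1)) + (a_hi * C0)\<^sup>2 * (2 * Cv * (2 * \<epsilon> + 1)) = (a_hi * C0)\<^sup>2 * (2 * (Cv + Cg) * (2 * \<epsilon> + 1))"
        by (simp add: algebra_simps)
      finally show ?thesis unfolding X_def .
    qed
    have Wle: "mean_sq D W \<le> N"
    proof -
      have "mean_sq D W \<le> eta_max\<^sup>2 * mean_sq D V"
        unfolding W_def
      proof (rule mean_sq_bounded_mult[OF DB LV(1)])
        fix x assume "x \<in> D"
        then show "norm (Z x) \<le> eta_max" using zeta_bound[OF R(2) RK(1), of "fst x"] by (simp add: Z_def D_def s_def mem_cell)
      qed
      also have "mean_sq D V \<le> Cv * (\<epsilon> + 1) / (\<epsilon> * h)"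
      proof -
        have "(LINT x:D|lborel. (norm (V x))\<^sup>2) \<le> Cv * (s + 1)"
          unfolding D_def V_def using s0 by (intro window_le loc h_pos v_window) auto
        also have "\<dots> \<le> Cv * (real R * (\<epsilon> + 1))"
          using R1 Cv_nonneg by (intro mult_left_mono) (simp_all add: s_def distrib_left)
        finally have "(LINT x:D|lborel. (norm (V x))\<^sup>2) / (real R * (\<epsilon> * h)) \<le> Cv * (real R * (\<epsilon> + 1)) / (real R * (\<epsilon> * h))"
          using eh by (intro divide_right_mono) auto
        then show ?thesis unfolding mean_sq_def Dm using R1 by simp
      qed
      then have "eta_max\<^sup>2 * mean_sq D V \<le> N" unfolding N_def by (intro mult_left_mono) auto
      finally show ?thesis .
    qed
    have p: "poynting \<epsilon> b \<Psi> (j, 0) = bc.flux (\<Psi> j 0) (bc.\<Gamma> j 0)" if "j \<in> J" for j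
      using that Q_grid_Z[of j R K] unfolding J by (intro bc.poynting_eq_flux smooth_bumps) auto
    have fx: "Im (mean_ip D (\<lambda>x. complex_of_real (b x) * fst (G x)) W) = flux_cell R t"
    proof -
      have e1: "mean_ip D (\<lambda>x. complex_of_real (b x) * fst (G x)) W =
         mean_ip D (\<lambda>x. complex_of_real (b x) * (Z x * G1 x)) W + mean_ip D (\<lambda>x. complex_of_real (b x) * (Z' x * V x)) W"
        using mean_ip_add_left[OF DB Lb[OF LZ(1)[OF LV(2)]] Lb[OF LZ(2)[OF LV(1)]] LZ(1)[OF LV(1)], folded W_def] by (simp add: distrib_left G_def)
      have e2: "mean_ip D (\<lambda>x. complex_of_real (b x) * (Z' x * V x)) W = mean_ip D (\<lambda>x. complex_of_real (b x * deriv (zeta R) (fst x) * zeta R (fst x)) * V x) V"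
        unfolding mean_ip_def W_def Z_def Z'_def by (simp add: mult_ac)
      have e3: "mean_ip D (\<lambda>x. complex_of_real (b x) * (Z x * G1 x)) W =
          mean_ip D (\<lambda>x. complex_of_real (a (x + (t, 0)) * (zeta R (fst x))\<^sup>2) * G1 x) V"
        unfolding mean_ip_def
        by (intro arg_cong2[where f="(/)"] set_lebesgue_integral_cong allI impI refl)
          (auto simp: W_def Z_def ab D_def s_def power2_eq_square)
      \<comment> \<open>The term with the derivative of the cut-off has a real weight times \<open>|V|\<^sup>2\<close>.\<close>
      have "Im (mean_ip D (\<lambda>x. complex_of_real (b x) * (Z' x * V x)) W) = 0"
        unfolding e2 mean_ip_self_weight by simp
      then have "Im (mean_ip D (\<lambda>x. complex_of_real (b x) * fst (G x)) W) =
          Im (mean_ip D (\<lambda>x. complex_of_real (a (x + (t, 0)) * (zeta R (fst x))\<^sup>2) * G1 x) V)"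
        by (simp only: e1 e3 plus_complex.simps add_0_right)
      then show ?thesis unfolding flux_cell_def D_def s_def G1_def[abs_def] V_def[abs_def] .
    qed
    note m = main[OF Kpos, folded Y_def, unfolded cj fx, folded J]
    have m1: "(\<Sum>j\<in>J. (\<mu> j 0 - w)\<^sup>2 * (norm (c j 0))\<^sup>2) \<le> K2 * Y" by (rule m(1))
    have m2: "(\<Sum>j\<in>J. (norm (c j l))\<^sup>2) \<le> K1 / \<Lambda> * Y" if "l \<ge> 1" for l by (rule m(2)) (use that in auto)
    have m3: "\<bar>flux_cell R t - (\<Sum>j\<in>J. (norm (c j 0))\<^sup>2 * bc.flux (\<Psi> j 0) (bc.\<Gamma> j 0))\<bar> \<le>
        sqrt a_hi * (bc.pmax / sqrt \<Lambda> + 1) * sqrt (K1 * Y) * sqrt (mean_sq D W)" by (rule m(3))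
    have "(\<Sum>j\<in>J. (\<mu> j 0 - \<omega>\<^sup>2)\<^sup>2 * (norm (c j 0))\<^sup>2) \<le> C / real R"
    proof -
      have "(\<Sum>j\<in>J. (\<mu> j 0 - \<omega>\<^sup>2)\<^sup>2 * (norm (c j 0))\<^sup>2) \<le> K2 * (X / real R)"
        using m1 mult_left_mono[OF Yle K20] unfolding w_def by linarith
      also have "\<dots> \<le> C / real R" using C1(1) R1 by (simp add: divide_right_mono)
      finally show ?thesis .
    qed
    moreover have "(\<Sum>j\<in>J. (norm (c j l))\<^sup>2) \<le> C / real R" if "l \<ge> 1" for l
    proof -
      have "0 \<le> K1 / \<Lambda>" using K10 w0 by simp
      then have "(\<Sum>j\<in>J. (norm (c j l))\<^sup>2) \<le> K1 / \<Lambda> * (X / real R)"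
        using m2[OF that] mult_left_mono[OF Yle, of "K1 / \<Lambda>"] by linarith
      also have "\<dots> = (K1 / \<Lambda> * X) / real R" by simp
      also have "\<dots> \<le> C / real R" using C1(2) R1 by (intro divide_right_mono) auto
      finally show ?thesis .
    qed
    moreover have "\<bar>flux_cell R t - (\<Sum>j\<in>J. (norm (c j 0))\<^sup>2 * poynting \<epsilon> b \<Psi> (j, 0))\<bar> \<le> C / sqrt (real R)"
    proof -
      have "\<bar>flux_cell R t - (\<Sum>j\<in>J. (norm (c j 0))\<^sup>2 * poynting \<epsilon> b \<Psi> (j, 0))\<bar> \<le>
          sqrt a_hi * (bc.pmax / sqrt \<Lambda> + 1) * sqrt (K1 * Y) * sqrt (mean_sq D W)"
        using m3 p by (simp cong: sum.cong)
      also have "\<dots> = sqrt a_hi * (bc.pmax / sqrt \<Lambda> + 1) * (sqrt (K1 * Y) * sqrt (mean_sq D W))" by simp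
      also have "\<dots> \<le> sqrt a_hi * (bc.pmax / sqrt \<Lambda> + 1) * (sqrt (K1 * (X / real R)) * sqrt N)"
        using Yle Wle K10 X0 R1 a_hi bc.pmax_nonneg w0
        by (intro mult_left_mono mult_mono real_sqrt_le_mono) (auto simp: Y_def)
      also have "\<dots> = K3 / sqrt (real R)" unfolding K3_def by (simp add: real_sqrt_divide real_sqrt_mult)
      also have "\<dots> \<le> C / sqrt (real R)" using C1(3) by (intro divide_right_mono) auto
      finally show ?thesis .
    qed
    ultimately show "(\<Sum>j\<in>J. (\<mu> j 0 - \<omega>\<^sup>2)\<^sup>2 * (norm (c j 0))\<^sup>2) \<le> C / real R \<and>
      (\<forall>l\<ge>1. (\<Sum>j\<in>J. (norm (c j l))\<^sup>2) \<le> C / real R) \<and>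
      \<bar>flux_cell R t - (\<Sum>j\<in>J. (norm (c j 0))\<^sup>2 * poynting \<epsilon> b \<Psi> (j, 0))\<bar> \<le> C / sqrt (real R)" by blast
  qed
qed

end

lemma norm_add_sq_le: "(norm (x + y))\<^sup>2 \<le> 2 * (norm x)\<^sup>2 + 2 * (norm y)\<^sup>2" for x y :: complex
proof -
  have "(norm (x + y))\<^sup>2 \<le> (norm x + norm y)\<^sup>2" by (intro power_mono norm_triangle_ineq) auto
  also have "\<dots> \<le> 2 * (norm x)\<^sup>2 + 2 * (norm y)\<^sup>2" using sum_squares_bound[of "norm x" "norm y"] by (simp add: power2_sum)
  finally show ?thesis .
qed

context strip_solution
begin

text \<open>The previous estimates in terms of the coefficients \<open>\<alpha>\<close> on the square cell with the given cut-offs,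
  which differ from those with \<open>\<zeta>\<close> by boundary layer terms. In the last part the coefficients \<open>\<beta>\<close>
  without cut-off are those of the outgoing wave condition: \<open>|P|\<close> is \<open>\<sigma>P\<close>, which sums to the flux in
  direction \<open>\<sigma>\<close>, plus twice the absolute value for the waves going the other way.\<close>

lemma side_bounds:
  fixes b :: "plane \<Rightarrow> real"
  assumes bc: "bloch_cell \<epsilon> b \<Psi> \<mu> a_lo a_hi \<kappa>" and per: "periodic2 \<epsilon> b"
    and \<Lambda>: "\<And>j m. j \<in> Z_cell \<Longrightarrow> m \<ge> 1 \<Longrightarrow> \<Lambda> \<le> \<mu> j m" and w: "\<omega>\<^sup>2 < \<Lambda>"
  obtains C where "C \<ge> 0" and
    "\<And>R n t \<alpha> \<beta> J. R = n * K \<Longrightarrow> R > 5 \<Longrightarrow> (\<And>x. x \<in> cell (real R * \<epsilon>) h \<Longrightarrow> a (x + (t, 0)) = b x) \<Longrightarrow>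
      \<alpha> = (\<lambda>j l. mean_ip (W_box \<epsilon> R) (\<lambda>x. vper v t x * complex_of_real (\<eta> R x)) (bloch_wave \<epsilon> \<Psi> (j, l))) \<Longrightarrow>
      \<beta> = (\<lambda>j. mean_ip (W_box \<epsilon> R) (vper v t) (bloch_wave \<epsilon> \<Psi> (j, 0))) \<Longrightarrow> J = Q_grid R \<times> Q_grid R \<Longrightarrow>
      (\<forall>l\<ge>1. (\<Sum>j\<in>J. (norm (\<alpha> j l))\<^sup>2) \<le> C / real R) \<and>
      (\<Sum>j\<in>J. (\<mu> j 0 - \<omega>\<^sup>2)\<^sup>2 * (norm (\<alpha> j 0))\<^sup>2) \<le> C / real R \<and>
      (\<Sum>j\<in>J. (if snd j \<in> Q_grid K then 0 else 1) * (norm (\<alpha> j 0))\<^sup>2) \<le> C / real R \<and>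
      (\<forall>\<sigma>\<in>{1, -1}. (\<Sum>j\<in>J. \<bar>poynting \<epsilon> b \<Psi> (j, 0)\<bar> * (norm (\<alpha> j 0))\<^sup>2) \<le>
         2 * \<sigma> * flux_cell R t + C / sqrt (real R) +
         C * (\<Sum>j\<in>{j\<in>J. \<sigma> * poynting \<epsilon> b \<Psi> (j, 0) < 0}. (norm (\<beta> j))\<^sup>2))"
proof -
  interpret bc: bloch_cell \<epsilon> b \<Psi> \<mu> a_lo a_hi \<kappa> by (rule bc)
  obtain C1 where C1: "C1 \<ge> 0" and side: "\<And>R n t c J. R = n * K \<Longrightarrow> R > 5 \<Longrightarrow> (\<And>x. x \<in> cell (real R * \<epsilon>) h \<Longrightarrow> a (x + (t, 0)) = b x) \<Longrightarrow>
      c = (\<lambda>j l. mean_ip (cell (real R * \<epsilon>) h) (\<lambda>x. complex_of_real (zeta R (fst x)) * v (x + (t, 0))) (bloch_wave \<epsilon> \<Psi> (j, l))) \<Longrightarrow>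
      J = Q_grid R \<times> Q_grid K \<Longrightarrow>
      (\<Sum>j\<in>J. (\<mu> j 0 - \<omega>\<^sup>2)\<^sup>2 * (norm (c j 0))\<^sup>2) \<le> C1 / real R \<and>
      (\<forall>l\<ge>1. (\<Sum>j\<in>J. (norm (c j l))\<^sup>2) \<le> C1 / real R) \<and>
      \<bar>flux_cell R t - (\<Sum>j\<in>J. (norm (c j 0))\<^sup>2 * poynting \<epsilon> b \<Psi> (j, 0))\<bar> \<le> C1 / sqrt (real R)"
    using side_estimate[OF bc per \<Lambda> w] by blast
  define N where "N = (2 * eta_max)\<^sup>2 * (Cv * (2 * (2 * \<epsilon> + 1) + 4 * (\<epsilon> + 1)) / \<epsilon>\<^sup>2)"
  have N0: "0 \<le> N" unfolding N_def using Cv_nonneg \<epsilon> by simp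
  define p where "p = bc.pmax * sqrt a_hi"
  have p0: "0 \<le> p" unfolding p_def using bc.pmax_nonneg a_hi by simp
  define q where "q = (bc.pmax\<^sup>2 + \<omega>\<^sup>2)\<^sup>2"
  have q0: "0 \<le> q" unfolding q_def by simp
  define C where "C = 2 * C1 + 2 * N + 2 * q * N + 10 * p * N + 8 * p"
  have nn: "0 \<le> q * N" "0 \<le> p * N" using q0 p0 N0 by simp_all
  have CC: "0 \<le> C" "2 * C1 + 2 * N \<le> C" "2 * C1 + 2 * q * N \<le> C" "2 * N \<le> C" "2 * C1 + 10 * p * N \<le> C" "8 * p \<le> C"
    unfolding C_def using C1 N0 p0 nn by (simp_all add: mult.assoc)
  show ?thesis
  proof (rule that[OF CC(1)])
    fix R n :: nat and t :: real and \<alpha> \<beta> J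
    assume R: "R = n * K" "R > 5" and ab: "\<And>x. x \<in> cell (real R * \<epsilon>) h \<Longrightarrow> a (x + (t, 0)) = b x"
      and \<alpha>: "\<alpha> = (\<lambda>j l. mean_ip (W_box \<epsilon> R) (\<lambda>x. vper v t x * complex_of_real (\<eta> R x)) (bloch_wave \<epsilon> \<Psi> (j, l)))"
      and \<beta>: "\<beta> = (\<lambda>j. mean_ip (W_box \<epsilon> R) (vper v t) (bloch_wave \<epsilon> \<Psi> (j, 0)))" and J: "J = Q_grid R \<times> Q_grid R"
    have R0: "R > 0" "real R \<ge> 1" using R(2) by linarith+
    have KR: "K dvd R" unfolding R(1) by simp
    have n0: "n > 0" using R by (cases n) auto
    define D where "D = W_box \<epsilon> R"
    have DB [simp]: "D \<in> sets borel" by (simp add: D_def W_box_eq)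
    have finJ [simp]: "finite J" by (simp add: J)
    have JZ: "j \<in> Z_cell" if "j \<in> J" for j using that Q_grid_Z unfolding J by blast
    have LU: "L2_on D (bloch_wave \<epsilon> \<Psi> (j, l))" if "j \<in> J" for j l
      unfolding D_def W_box_eq using JZ[OF that] by (intro bc.bloch_wave_L2) simp
    define \<gamma> where "\<gamma> j l = mean_ip D (\<lambda>x. complex_of_real (zeta R (fst x)) * vper v t x) (bloch_wave \<epsilon> \<Psi> (j, l))" for j l
    have zs: "continuous_on UNIV (zeta R)" by (rule smooth_line_continuous[OF zeta_smooth[OF R0(1) KR]])
    have zm: "(\<lambda>x::plane. complex_of_real (zeta R (fst x))) \<in> borel_measurable borel"
      using plane_fst_shift_measurable[OF zs, of 0] by simp
    have em: "(\<lambda>x. complex_of_real (\<eta> R x)) \<in> borel_measurable borel"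
      using borel_measurable_continuous_onI[OF Cinf_continuous[OF eta_smooth[OF R0(1) KR]]] by simp
    have x2: "0 < fst x" "fst x < real R * \<epsilon>" if "x \<in> D" for x
      using that by (simp_all add: D_def W_box_eq mem_cell)
    have ez: "norm (complex_of_real (zeta R (fst x))) \<le> eta_max" "norm (complex_of_real (\<eta> R x)) \<le> eta_max" if "x \<in> D" for x
      using zeta_bound[OF R(2) KR x2[OF that]] eta_bound[OF R(2) KR that[unfolded D_def]] by simp_all
    have Lz: "L2_on D (\<lambda>x. complex_of_real (zeta R (fst x)) * vper v t x)" "L2_on D (\<lambda>x. complex_of_real (\<eta> R x) * vper v t x)"
      using vper_L2[OF loc(1) R(1) R0(1), of t, folded D_def] by (auto intro!: L2_on_bounded_mult zm em ez)
    have Lv: "L2_on D (vper v t)" unfolding D_def by (rule vper_L2[OF loc(1) R(1) R0(1)])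
    have bes: "(\<Sum>j\<in>J. (norm (mean_ip D (\<lambda>x. W x * vper v t x) (bloch_wave \<epsilon> \<Psi> (j, l))))\<^sup>2) \<le> N / real R"
      if W: "W \<in> borel_measurable borel" and B: "\<And>x. x \<in> D \<Longrightarrow> norm (W x) \<le> 2 * eta_max"
        and W0: "\<And>x. 2 * \<epsilon> \<le> fst x \<Longrightarrow> fst x \<le> real R * \<epsilon> - 2 * \<epsilon> \<Longrightarrow> 2 * \<epsilon> \<le> snd x \<Longrightarrow> snd x \<le> real R * \<epsilon> - 2 * \<epsilon> \<Longrightarrow> W x = 0" for W l
    proof -
      note LW = layer_W[OF R W B[unfolded D_def] W0, of t, folded N_def]
      have "(\<Sum>j\<in>J. (norm (mean_ip D (\<lambda>x. W x * vper v t x) (bloch_wave \<epsilon> \<Psi> (j, l))))\<^sup>2) =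
          (\<Sum>\<xi>\<in>J \<times> {l}. (norm (mean_ip D (\<lambda>x. W x * vper v t x) (bloch_wave \<epsilon> \<Psi> \<xi>)))\<^sup>2)"
        by (rule sum.reindex_bij_witness[where i=fst and j="\<lambda>j. (j, l)"]) auto
      also have "\<dots> \<le> mean_sq D (\<lambda>x. W x * vper v t x)"
        unfolding D_def W_box_eq
        by (rule bc.bloch_Bessel[OF R0(1) R0(1) LW(1)[unfolded W_box_eq]]) (auto simp: J)
      also have "\<dots> \<le> N / real R" unfolding D_def by (rule LW(2))
      finally show ?thesis .
    qed
    have \<delta>: "(\<Sum>j\<in>J. (norm (\<alpha> j l - \<gamma> j l))\<^sup>2) \<le> N / real R" for l
    proof -
      have "\<alpha> j l - \<gamma> j l = mean_ip D (\<lambda>x. (complex_of_real (\<eta> R x) - complex_of_real (zeta R (fst x))) * vper v t x) (bloch_wave \<epsilon> \<Psi> (j, l))" if "j \<in> J" for j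
        unfolding \<alpha> \<gamma>_def D_def[symmetric] left_diff_distrib mean_ip_diff_left[OF DB Lz(2,1) LU[OF that]] by (simp add: mult.commute)
      then have "(\<Sum>j\<in>J. (norm (\<alpha> j l - \<gamma> j l))\<^sup>2) =
          (\<Sum>j\<in>J. (norm (mean_ip D (\<lambda>x. (complex_of_real (\<eta> R x) - complex_of_real (zeta R (fst x))) * vper v t x) (bloch_wave \<epsilon> \<Psi> (j, l))))\<^sup>2)"
        by (intro sum.cong) auto
      also have "\<dots> \<le> N / real R"
      proof (rule bes)
        fix x assume "x \<in> D"
        then show "norm (complex_of_real (\<eta> R x) - complex_of_real (zeta R (fst x))) \<le> 2 * eta_max"
          using norm_triangle_ineq4[of "complex_of_real (\<eta> R x)" "complex_of_real (zeta R (fst x))"] ez[of x] by linarith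
      next
        fix x :: plane assume "2 * \<epsilon> \<le> fst x" "fst x \<le> real R * \<epsilon> - 2 * \<epsilon>" "2 * \<epsilon> \<le> snd x" "snd x \<le> real R * \<epsilon> - 2 * \<epsilon>"
        then show "complex_of_real (\<eta> R x) - complex_of_real (zeta R (fst x)) = 0"
          using eta_layer[OF R(2) KR] zeta_layer(1)[OF R(2) KR] by simp
      qed (use zm em in measurable)
      finally show ?thesis .
    qed
    have \<delta>': "(\<Sum>j\<in>J. (norm (\<beta> j - \<gamma> j 0))\<^sup>2) \<le> N / real R"
    proof -
      have "\<beta> j - \<gamma> j 0 = mean_ip D (\<lambda>x. (1 - complex_of_real (zeta R (fst x))) * vper v t x) (bloch_wave \<epsilon> \<Psi> (j, 0))" if "j \<in> J" for j
        using mean_ip_diff_left[OF DB Lv Lz(1) LU[OF that]] by (simp add: \<beta> \<gamma>_def D_def[symmetric] left_diff_distrib)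
      then have "(\<Sum>j\<in>J. (norm (\<beta> j - \<gamma> j 0))\<^sup>2) =
          (\<Sum>j\<in>J. (norm (mean_ip D (\<lambda>x. (1 - complex_of_real (zeta R (fst x))) * vper v t x) (bloch_wave \<epsilon> \<Psi> (j, 0))))\<^sup>2)"
        by (intro sum.cong) auto
      also have "\<dots> \<le> N / real R"
      proof (rule bes)
        fix x assume "x \<in> D"
        then show "norm (1 - complex_of_real (zeta R (fst x))) \<le> 2 * eta_max"
          using norm_triangle_ineq4[of 1 "complex_of_real (zeta R (fst x))"] ez[of x] eta_max_ge_1 by simp
      next
        fix x :: plane assume "2 * \<epsilon> \<le> fst x" "fst x \<le> real R * \<epsilon> - 2 * \<epsilon>"
        then show "1 - complex_of_real (zeta R (fst x)) = 0"
          using zeta_layer(1)[OF R(2) KR] by simp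
      qed (use zm in measurable)
      finally show ?thesis .
    qed
    define c where "c = (\<lambda>j l. mean_ip (cell (real R * \<epsilon>) h) (\<lambda>x. complex_of_real (zeta R (fst x)) * v (x + (t, 0))) (bloch_wave \<epsilon> \<Psi> (j, l)))"
    note S = side[OF R ab c_def refl]
    have \<gamma>c: "\<gamma> j l = (if snd j \<in> Q_grid K then c j l else 0)" if j: "j \<in> J" for j l
      unfolding \<gamma>_def D_def c_def
      using bc.family JZ[OF j] j unfolding bloch_family_def bloch_weak_eq_def J
      by (intro coefficient_W_box[OF R(1) R0(1)] zs) (auto simp: Y_cell_eq)
    have sumJ: "(\<Sum>j\<in>J. f j (\<gamma> j l)) = (\<Sum>j\<in>Q_grid R \<times> Q_grid K. f j (c j l))" if f0: "\<And>j. f j 0 = 0" for f :: "plane \<Rightarrow> complex \<Rightarrow> real" and l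
    proof -
      have s: "Q_grid R \<times> Q_grid K \<subseteq> J" using Q_grid_subset[OF n0] unfolding J R(1) by auto
      have "(\<Sum>j\<in>J. f j (\<gamma> j l)) = (\<Sum>j\<in>Q_grid R \<times> Q_grid K. f j (\<gamma> j l))"
        by (rule sum.mono_neutral_right[OF finJ s]) (auto simp: \<gamma>c f0 J)
      also have "\<dots> = (\<Sum>j\<in>Q_grid R \<times> Q_grid K. f j (c j l))"
      proof (rule sum.cong[OF refl])
        fix j assume "j \<in> Q_grid R \<times> Q_grid K"
        then show "f j (\<gamma> j l) = f j (c j l)" using \<gamma>c[of j l] s by auto
      qed
      finally show ?thesis .
    qed
    have transfer: "(\<Sum>j\<in>J. f j * (norm (\<alpha> j l))\<^sup>2) \<le> 2 * (\<Sum>j\<in>J. f j * (norm (\<gamma> j l))\<^sup>2) + 2 * B * (N / real R)"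
      if f: "\<And>j. j \<in> J \<Longrightarrow> 0 \<le> f j \<and> f j \<le> B" and B: "0 \<le> B" for f B l
    proof -
      have "(\<Sum>j\<in>J. f j * (norm (\<alpha> j l))\<^sup>2) \<le> (\<Sum>j\<in>J. 2 * (f j * (norm (\<gamma> j l))\<^sup>2) + 2 * B * (norm (\<alpha> j l - \<gamma> j l))\<^sup>2)"
      proof (rule sum_mono)
        fix j assume j: "j \<in> J"
        have "f j * (norm (\<alpha> j l))\<^sup>2 \<le> f j * (2 * (norm (\<gamma> j l))\<^sup>2 + 2 * (norm (\<alpha> j l - \<gamma> j l))\<^sup>2)"
          using norm_add_sq_le[of "\<gamma> j l" "\<alpha> j l - \<gamma> j l"] f[OF j] by (intro mult_left_mono) auto
        moreover have "f j * (norm (\<alpha> j l - \<gamma> j l))\<^sup>2 \<le> B * (norm (\<alpha> j l - \<gamma> j l))\<^sup>2"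
          using f[OF j] by (intro mult_right_mono) auto
        ultimately show "f j * (norm (\<alpha> j l))\<^sup>2 \<le> 2 * (f j * (norm (\<gamma> j l))\<^sup>2) + 2 * B * (norm (\<alpha> j l - \<gamma> j l))\<^sup>2"
          by (simp add: distrib_left)
      qed
      also have "\<dots> = 2 * (\<Sum>j\<in>J. f j * (norm (\<gamma> j l))\<^sup>2) + 2 * B * (\<Sum>j\<in>J. (norm (\<alpha> j l - \<gamma> j l))\<^sup>2)"
        by (simp add: sum.distrib sum_distrib_left)
      also have "\<dots> \<le> 2 * (\<Sum>j\<in>J. f j * (norm (\<gamma> j l))\<^sup>2) + 2 * B * (N / real R)"
        using \<delta>[of l] B by (intro add_left_mono mult_left_mono) auto
      finally show ?thesis .
    qed
    have S2: "(\<Sum>j\<in>J. (norm (\<gamma> j l))\<^sup>2) \<le> C1 / real R" if "l \<ge> 1" for l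
      using conjunct1[OF conjunct2[OF S]] that sumJ[of "\<lambda>_ z. (norm z)\<^sup>2" l] by simp
    have S1: "(\<Sum>j\<in>J. (\<mu> j 0 - \<omega>\<^sup>2)\<^sup>2 * (norm (\<gamma> j 0))\<^sup>2) \<le> C1 / real R"
      using conjunct1[OF S] sumJ[of "\<lambda>j z. (\<mu> j 0 - \<omega>\<^sup>2)\<^sup>2 * (norm z)\<^sup>2" 0] by simp
    have S3: "\<bar>flux_cell R t - (\<Sum>j\<in>J. (norm (\<gamma> j 0))\<^sup>2 * poynting \<epsilon> b \<Psi> (j, 0))\<bar> \<le> C1 / sqrt (real R)"
      using conjunct2[OF conjunct2[OF S]] sumJ[of "\<lambda>j z. (norm z)\<^sup>2 * poynting \<epsilon> b \<Psi> (j, 0)" 0] by simp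
    have CR: "x / real R \<le> C / real R" if "x \<le> C" for x using that R0 by (simp add: divide_right_mono)
    have "(\<Sum>j\<in>J. (norm (\<alpha> j l))\<^sup>2) \<le> C / real R" if l: "l \<ge> 1" for l
    proof -
      have "(\<Sum>j\<in>J. (norm (\<alpha> j l))\<^sup>2) \<le> 2 * (\<Sum>j\<in>J. (norm (\<gamma> j l))\<^sup>2) + 2 * (N / real R)"
        using transfer[of "\<lambda>_. 1" 1 l] by simp
      also have "\<dots> \<le> 2 * (C1 / real R) + 2 * (N / real R)"
        using S2[OF l] by linarith
      also have "\<dots> = (2 * C1 + 2 * N) / real R" by (simp add: add_divide_distrib)
      finally show ?thesis using CR[OF CC(2)] by linarith
    qed
    moreover have "(\<Sum>j\<in>J. (\<mu> j 0 - \<omega>\<^sup>2)\<^sup>2 * (norm (\<alpha> j 0))\<^sup>2) \<le> C / real R"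
    proof -
      have "(\<mu> j 0 - \<omega>\<^sup>2)\<^sup>2 \<le> q" if "j \<in> J" for j
      proof -
        have "\<bar>\<mu> j 0 - \<omega>\<^sup>2\<bar> \<le> bc.pmax\<^sup>2 + \<omega>\<^sup>2"
          using bc.mu_le[OF JZ[OF that]] bc.mu_nonneg[OF JZ[OF that], of 0] zero_le_power2[of \<omega>] zero_le_power2[of bc.pmax]
          unfolding abs_le_iff by linarith
        then show ?thesis unfolding q_def by (metis abs_ge_zero power2_abs power_mono)
      qed
      then have "(\<Sum>j\<in>J. (\<mu> j 0 - \<omega>\<^sup>2)\<^sup>2 * (norm (\<alpha> j 0))\<^sup>2) \<le> 2 * (\<Sum>j\<in>J. (\<mu> j 0 - \<omega>\<^sup>2)\<^sup>2 * (norm (\<gamma> j 0))\<^sup>2) + 2 * q * (N / real R)"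
        by (intro transfer q0) auto
      also have "\<dots> \<le> 2 * (C1 / real R) + 2 * q * (N / real R)"
        using S1 by linarith
      also have "\<dots> = (2 * C1 + 2 * q * N) / real R" by (simp add: add_divide_distrib)
      finally show ?thesis using CR[OF CC(3)] by linarith
    qed
    moreover have "(\<Sum>j\<in>J. (if snd j \<in> Q_grid K then 0 else 1) * (norm (\<alpha> j 0))\<^sup>2) \<le> C / real R"
    proof -
      have "(\<Sum>j\<in>J. (if snd j \<in> Q_grid K then 0 else 1) * (norm (\<alpha> j 0))\<^sup>2) \<le>
          2 * (\<Sum>j\<in>J. (if snd j \<in> Q_grid K then 0 else 1) * (norm (\<gamma> j 0))\<^sup>2) + 2 * 1 * (N / real R)"
        by (rule transfer) auto
      also have "(\<Sum>j\<in>J. (if snd j \<in> Q_grid K then 0 else 1) * (norm (\<gamma> j 0))\<^sup>2) = 0"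
        by (rule sum.neutral) (auto simp: \<gamma>c)
      finally show ?thesis using CR[OF CC(4)] by simp
    qed
    moreover have "(\<Sum>j\<in>J. \<bar>P j\<bar> * (norm (\<alpha> j 0))\<^sup>2) \<le>
         2 * \<sigma> * flux_cell R t + C / sqrt (real R) + C * (\<Sum>j\<in>{j\<in>J. \<sigma> * P j < 0}. (norm (\<beta> j))\<^sup>2)"
      if \<sigma>: "\<sigma> \<in> {1, -1}" and P: "P = (\<lambda>j. poynting \<epsilon> b \<Psi> (j, 0))" for \<sigma> P
    proof -
      have Pp: "\<bar>P j\<bar> \<le> p" if "j \<in> J" for j
        using bc.flux_le[OF JZ[OF that]] unfolding P p_def bc.poynting_eq_flux[OF JZ[OF that] smooth_bumps] .
      let ?N = "{j\<in>J. \<sigma> * P j < 0}"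
      have "(\<Sum>j\<in>J. \<bar>P j\<bar> * (norm (\<gamma> j 0))\<^sup>2) = (\<Sum>j\<in>J. \<sigma> * ((norm (\<gamma> j 0))\<^sup>2 * P j) + (if \<sigma> * P j < 0 then 2 * (\<bar>P j\<bar> * (norm (\<gamma> j 0))\<^sup>2) else 0))"
        by (rule sum.cong) (use \<sigma> in auto)
      also have "\<dots> = \<sigma> * (\<Sum>j\<in>J. (norm (\<gamma> j 0))\<^sup>2 * P j) + (\<Sum>j\<in>?N. 2 * (\<bar>P j\<bar> * (norm (\<gamma> j 0))\<^sup>2))"
        by (simp add: sum.distrib sum_distrib_left sum.inter_filter)
      also have "\<sigma> * (\<Sum>j\<in>J. (norm (\<gamma> j 0))\<^sup>2 * P j) \<le> \<sigma> * flux_cell R t + C1 / sqrt (real R)"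
        using S3[folded fun_cong[OF P]] \<sigma> by auto
      also have "(\<Sum>j\<in>?N. 2 * (\<bar>P j\<bar> * (norm (\<gamma> j 0))\<^sup>2)) \<le> (\<Sum>j\<in>?N. 4 * p * (norm (\<beta> j))\<^sup>2 + 4 * p * (norm (\<beta> j - \<gamma> j 0))\<^sup>2)"
      proof (rule sum_mono)
        fix j assume "j \<in> ?N"
        then have "\<bar>P j\<bar> * (norm (\<gamma> j 0))\<^sup>2 \<le> p * (2 * (norm (\<beta> j))\<^sup>2 + 2 * (norm (\<beta> j - \<gamma> j 0))\<^sup>2)"
          using Pp[of j] norm_add_sq_le[of "\<beta> j" "\<gamma> j 0 - \<beta> j"] p0 by (intro mult_mono) (auto simp: norm_minus_commute)
        then show "2 * (\<bar>P j\<bar> * (norm (\<gamma> j 0))\<^sup>2) \<le> 4 * p * (norm (\<beta> j))\<^sup>2 + 4 * p * (norm (\<beta> j - \<gamma> j 0))\<^sup>2"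
          by (simp add: algebra_simps)
      qed
      also have "\<dots> = 4 * p * (\<Sum>j\<in>?N. (norm (\<beta> j))\<^sup>2) + 4 * p * (\<Sum>j\<in>?N. (norm (\<beta> j - \<gamma> j 0))\<^sup>2)"
        by (simp add: sum.distrib sum_distrib_left)
      also have "(\<Sum>j\<in>?N. (norm (\<beta> j - \<gamma> j 0))\<^sup>2) \<le> N / real R"
        by (rule order_trans[OF sum_mono2 \<delta>']) auto
      finally have G: "(\<Sum>j\<in>J. \<bar>P j\<bar> * (norm (\<gamma> j 0))\<^sup>2) \<le>
          \<sigma> * flux_cell R t + C1 / sqrt (real R) + (4 * p * (\<Sum>j\<in>?N. (norm (\<beta> j))\<^sup>2) + 4 * p * (N / real R))"
        using p0 by (simp add: mult_left_mono)
      have "(\<Sum>j\<in>J. \<bar>P j\<bar> * (norm (\<alpha> j 0))\<^sup>2) \<le> 2 * (\<Sum>j\<in>J. \<bar>P j\<bar> * (norm (\<gamma> j 0))\<^sup>2) + 2 * p * (N / real R)"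
        by (rule transfer) (use Pp p0 in auto)
      also have "\<dots> \<le> 2 * \<sigma> * flux_cell R t + (2 * (C1 / sqrt (real R)) + 10 * p * N / real R) + 8 * p * (\<Sum>j\<in>?N. (norm (\<beta> j))\<^sup>2)"
      proof -
        have "4 * p * x = 4 * (p * x)" "2 * p * x = 2 * (p * x)" "10 * p * N / real R = 10 * (p * (N / real R))"
          "8 * p * x = 8 * (p * x)" "2 * \<sigma> * x = 2 * (\<sigma> * x)" for x by simp_all
        then show ?thesis using G by (simp only:)
      qed
      also have "10 * p * N / real R \<le> 10 * p * N / sqrt (real R)"
      proof (rule divide_left_mono)
        have "sqrt (real R) * 1 \<le> sqrt (real R) * sqrt (real R)" using R0 by (intro mult_left_mono) auto
        then show "sqrt (real R) \<le> real R" by simp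
      qed (use p0 N0 R0 in auto)
      also have "2 * (C1 / sqrt (real R)) + 10 * p * N / sqrt (real R) = (2 * C1 + 10 * p * N) / sqrt (real R)"
        by (simp add: add_divide_distrib)
      also have "\<dots> \<le> C / sqrt (real R)" using CC(5) by (intro divide_right_mono) auto
      also have "8 * p * (\<Sum>j\<in>?N. (norm (\<beta> j))\<^sup>2) \<le> C * (\<Sum>j\<in>?N. (norm (\<beta> j))\<^sup>2)"
        using CC(6) by (intro mult_right_mono sum_nonneg) auto
      finally show ?thesis by simp
    qed
    ultimately show "(\<forall>l\<ge>1. (\<Sum>j\<in>J. (norm (\<alpha> j l))\<^sup>2) \<le> C / real R) \<and>
      (\<Sum>j\<in>J. (\<mu> j 0 - \<omega>\<^sup>2)\<^sup>2 * (norm (\<alpha> j 0))\<^sup>2) \<le> C / real R \<and>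
      (\<Sum>j\<in>J. (if snd j \<in> Q_grid K then 0 else 1) * (norm (\<alpha> j 0))\<^sup>2) \<le> C / real R \<and>
      (\<forall>\<sigma>\<in>{1, -1}. (\<Sum>j\<in>J. \<bar>poynting \<epsilon> b \<Psi> (j, 0)\<bar> * (norm (\<alpha> j 0))\<^sup>2) \<le>
         2 * \<sigma> * flux_cell R t + C / sqrt (real R) +
         C * (\<Sum>j\<in>{j\<in>J. \<sigma> * poynting \<epsilon> b \<Psi> (j, 0) < 0}. (norm (\<beta> j))\<^sup>2))"
      by blast
  qed
qed

end

section \<open>Bloch measures\<close>

text \<open>The integral of \<open>q\<close> against the discrete measure of the Bloch coefficients, also for weights \<open>q\<close>
  that are not continuous.\<close>

definition bloch_mass :: "real \<Rightarrow> (plane \<Rightarrow> nat \<Rightarrow> plane \<Rightarrow> complex) \<Rightarrow> nat \<Rightarrow> nat \<Rightarrow> (plane \<Rightarrow> complex)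
    \<Rightarrow> (plane \<Rightarrow> real) \<Rightarrow> real" where
  "bloch_mass \<epsilon> \<Psi> l R w q =
     (\<Sum>j\<in>Q_grid R \<times> Q_grid R. q j * (norm (mean_ip (W_box \<epsilon> R) w (bloch_wave \<epsilon> \<Psi> (j, l))))\<^sup>2)"

lemma bloch_mass_mono:
  assumes "\<And>j. j \<in> Z_cell \<Longrightarrow> f j \<le> q j"
  shows "bloch_mass \<epsilon> \<Psi> l R w f \<le> bloch_mass \<epsilon> \<Psi> l R w q"
  unfolding bloch_mass_def using assms Q_grid_Z by (intro sum_mono mult_right_mono) auto

lemma bloch_mass_nonneg:
  assumes "\<And>j. j \<in> Z_cell \<Longrightarrow> 0 \<le> q j"
  shows "0 \<le> bloch_mass \<epsilon> \<Psi> l R w q"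
  unfolding bloch_mass_def using assms Q_grid_Z by (intro sum_nonneg mult_nonneg_nonneg) auto

lemma integral_nu_R:
  assumes f: "continuous_on Z_cell f"
  shows "integral\<^sup>L (nu_R \<epsilon> \<Psi> l R w) f = bloch_mass \<epsilon> \<Psi> l R w f"
proof -
  have m: "f \<in> borel_measurable (restrict_space borel Z_cell)" by (rule borel_measurable_continuous_on_restrict[OF f])
  have i: "(\<lambda>j. j) \<in> measurable (point_measure (Q_grid R \<times> Q_grid R) g) (restrict_space borel Z_cell)" for g
    using Q_grid_Z by (auto simp: space_restrict_space)
  show ?thesis
    unfolding nu_R_def bloch_mass_def integral_distr[OF i m]
    by (subst lebesgue_integral_point_measure_finite) (auto simp: mult.commute)
qed

lemma bloch_measure_integral_zero:
  assumes \<nu>: "bloch_measure_of \<epsilon> K \<eta> \<Psi> l uR \<nu>"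
    and lim: "(\<lambda>n. bloch_mass \<epsilon> \<Psi> l (n * K) (\<lambda>x. uR (n * K) x * complex_of_real (\<eta> (n * K) x)) q) \<longlonglongrightarrow> 0"
    and f: "continuous_on Z_cell f" "\<And>j. j \<in> Z_cell \<Longrightarrow> 0 \<le> f j" "\<And>j. j \<in> Z_cell \<Longrightarrow> f j \<le> q j"
  shows "integral\<^sup>L \<nu> f = 0"
proof -
  let ?w = "\<lambda>n x. uR (n * K) x * complex_of_real (\<eta> (n * K) x)"
  obtain r :: "nat \<Rightarrow> nat" where r: "strict_mono r"
    and "(\<lambda>n. integral\<^sup>L (nu_R \<epsilon> \<Psi> l (r n * K) (?w (r n))) f) \<longlonglongrightarrow> integral\<^sup>L \<nu> f"
    using \<nu> f(1) unfolding bloch_measure_of_def by blast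
  then have l: "(\<lambda>n. bloch_mass \<epsilon> \<Psi> l (r n * K) (?w (r n)) f) \<longlonglongrightarrow> integral\<^sup>L \<nu> f"
    by (simp only: integral_nu_R[OF f(1)])
  have "(\<lambda>n. bloch_mass \<epsilon> \<Psi> l (r n * K) (?w (r n)) f) \<longlonglongrightarrow> 0"
  proof (rule tendsto_sandwich[OF _ _ tendsto_const])
    show "(\<lambda>n. bloch_mass \<epsilon> \<Psi> l (r n * K) (?w (r n)) q) \<longlonglongrightarrow> 0"
      using LIMSEQ_subseq_LIMSEQ[OF lim r] by (simp add: o_def)
    show "\<forall>\<^sub>F n in sequentially. 0 \<le> bloch_mass \<epsilon> \<Psi> l (r n * K) (?w (r n)) f"
      by (intro always_eventually allI bloch_mass_nonneg f(2))
    show "\<forall>\<^sub>F n in sequentially. bloch_mass \<epsilon> \<Psi> l (r n * K) (?w (r n)) f \<le> bloch_mass \<epsilon> \<Psi> l (r n * K) (?w (r n)) q"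
      by (intro always_eventually allI bloch_mass_mono f(3))
  qed
  with l show ?thesis by (rule LIMSEQ_unique)
qed

lemma bloch_measure_space:
  assumes "bloch_measure_of \<epsilon> K \<eta> \<Psi> l uR \<nu>"
  shows "space \<nu> = Z_cell" "sets \<nu> = sets (restrict_space borel Z_cell)" "finite_measure \<nu>"
  using assms sets_eq_imp_space_eq[of \<nu> "restrict_space borel Z_cell"]
  by (auto simp: bloch_measure_of_def space_restrict_space)

lemma bloch_measure_zero:
  assumes \<nu>: "bloch_measure_of \<epsilon> K \<eta> \<Psi> l uR \<nu>"
    and lim: "(\<lambda>n. bloch_mass \<epsilon> \<Psi> l (n * K) (\<lambda>x. uR (n * K) x * complex_of_real (\<eta> (n * K) x)) (\<lambda>_. 1)) \<longlonglongrightarrow> 0"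
  shows "\<nu> = null_measure (restrict_space borel Z_cell)"
proof (rule measure_eqI)
  interpret finite_measure \<nu> by (rule bloch_measure_space[OF \<nu>])
  have "integral\<^sup>L \<nu> (\<lambda>_. 1 :: real) = 0" by (rule bloch_measure_integral_zero[OF \<nu> lim]) auto
  then have "emeasure \<nu> (space \<nu>) = 0" by (simp add: emeasure_eq_measure)
  then show "emeasure \<nu> A = emeasure (null_measure (restrict_space borel Z_cell)) A" for A
    using emeasure_space[of \<nu> A] by simp
qed (use bloch_measure_space[OF \<nu>] in simp)

text \<open>A tent function at \<open>j0\<close> below \<open>q\<close> has integral zero if \<open>q j0 > 0\<close>.\<close>

lemma bloch_measure_support:
  assumes \<nu>: "bloch_measure_of \<epsilon> K \<eta> \<Psi> l uR \<nu>"
    and lim: "(\<lambda>n. bloch_mass \<epsilon> \<Psi> l (n * K) (\<lambda>x. uR (n * K) x * complex_of_real (\<eta> (n * K) x)) q) \<longlonglongrightarrow> 0"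
    and q: "\<And>j. j \<in> Z_cell \<Longrightarrow> 0 \<le> q j" and cont: "(q \<longlongrightarrow> q j0) (at j0 within Z_cell)" and j0: "j0 \<in> meas_supp \<nu>"
  shows "q j0 = 0"
proof (rule ccontr)
  assume "q j0 \<noteq> 0"
  note sp = bloch_measure_space[OF \<nu>]
  have j0Z: "j0 \<in> Z_cell" using j0 sp by (simp add: meas_supp_def)
  have pos: "q j0 > 0" using q[OF j0Z] \<open>q j0 \<noteq> 0\<close> by simp
  have "\<forall>\<^sub>F j in at j0 within Z_cell. q j0 / 2 < q j" using order_tendstoD(1)[OF cont, of "q j0 / 2"] pos by simp
  then obtain d where d: "d > 0" "\<And>j. j \<in> Z_cell \<Longrightarrow> j \<noteq> j0 \<Longrightarrow> dist j j0 < d \<Longrightarrow> q j0 / 2 < q j"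
    unfolding eventually_at by auto
  \<comment> \<open>The tent: continuous, at most \<open>q j0 / 2\<close>, and nonzero exactly on the ball of radius \<open>d\<close>.\<close>
  define f where "f j = q j0 / 2 * max 0 (1 - dist j j0 / d)" for j
  have f0: "0 \<le> f j" for j using pos by (simp add: f_def)
  have fle: "f j \<le> q j0 / 2" for j
  proof -
    have "max 0 (1 - dist j j0 / d) \<le> 1" using d(1) by simp
    then show ?thesis using pos mult_left_mono[of _ 1 "q j0 / 2"] by (simp add: f_def)
  qed
  have fpos: "f j \<noteq> 0 \<longleftrightarrow> dist j j0 < d" for j using pos d(1) by (auto simp: f_def max_def field_simps)
  have fq: "f j \<le> q j" if "j \<in> Z_cell" for j
  proof (cases "dist j j0 < d")
    case True
    then have "q j0 / 2 \<le> q j" using d(2)[OF that] pos by (cases "j = j0") force+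
    then show ?thesis using fle[of j] by simp
  next
    case False
    then show ?thesis using fpos[of j] q[OF that] by simp
  qed
  have fc: "continuous_on Z_cell f" unfolding f_def using d(1) by (intro continuous_intros) auto
  interpret finite_measure \<nu> by (rule sp)
  have fm: "f \<in> borel_measurable \<nu>"
    using borel_measurable_continuous_on_restrict[OF fc] measurable_cong_sets[OF sp(2) refl] by blast
  have "integrable \<nu> f"
    by (rule integrable_const_bound[where B="q j0 / 2"]) (use f0 fle fm in auto)
  moreover have "integral\<^sup>L \<nu> f = 0" by (rule bloch_measure_integral_zero[OF \<nu> lim fc f0 fq])
  ultimately have AE: "AE j in \<nu>. f j = 0" using integral_nonneg_eq_0_iff_AE[of \<nu> f] f0 by simp
  have N: "{j \<in> space \<nu>. \<not> f j = 0} = ball j0 d \<inter> space \<nu>" using fpos by (auto simp: dist_commute)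
  have "{j \<in> space \<nu>. \<not> f j = 0} \<in> sets \<nu>" using fm by measurable
  then have "emeasure \<nu> (ball j0 d \<inter> space \<nu>) = 0"
    using AE_iff_measurable[of "ball j0 d \<inter> space \<nu>" \<nu> "\<lambda>j. f j = 0"] AE N by simp
  moreover have "emeasure \<nu> (ball j0 d \<inter> space \<nu>) > 0" using j0 d(1) by (simp add: meas_supp_def)
  ultimately show False by simp
qed

text \<open>The four weights single out the higher modes, the energies different from \<open>\<omega>\<^sup>2\<close>, the vertical wave
  numbers that are not multiples of \<open>1/K\<close> in \<open>[0, 1)\<close>, and the waves that transport energy.\<close>

definition masses_vanish :: "real \<Rightarrow> nat \<Rightarrow> real \<Rightarrow> (plane \<Rightarrow> real) \<Rightarrow> (plane \<Rightarrow> nat \<Rightarrow> plane \<Rightarrow> complex)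
    \<Rightarrow> (plane \<Rightarrow> nat \<Rightarrow> real) \<Rightarrow> (nat \<Rightarrow> plane \<Rightarrow> complex) \<Rightarrow> bool" where
  "masses_vanish \<epsilon> K \<omega> b \<Psi> \<mu> w \<longleftrightarrow>
     (\<forall>l\<ge>1. (\<lambda>n. bloch_mass \<epsilon> \<Psi> l (n * K) (w (n * K)) (\<lambda>_. 1)) \<longlonglongrightarrow> 0) \<and>
     (\<lambda>n. bloch_mass \<epsilon> \<Psi> 0 (n * K) (w (n * K)) (\<lambda>j. (\<mu> j 0 - \<omega>\<^sup>2)\<^sup>2)) \<longlonglongrightarrow> 0 \<and>
     (\<lambda>n. bloch_mass \<epsilon> \<Psi> 0 (n * K) (w (n * K)) (\<lambda>j. if snd j \<in> Q_grid K then 0 else 1)) \<longlonglongrightarrow> 0 \<and>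
     (\<lambda>n. bloch_mass \<epsilon> \<Psi> 0 (n * K) (w (n * K)) (\<lambda>j. \<bar>poynting \<epsilon> b \<Psi> (j, 0)\<bar>)) \<longlonglongrightarrow> 0"

lemma (in bloch_cell) bloch_measures_supported:
  assumes bumps: "smooth_bumps \<epsilon>" and K: "K \<ge> 1"
    and \<Lambda>: "\<And>j m. j \<in> Z_cell \<Longrightarrow> m \<ge> 1 \<Longrightarrow> \<Lambda> \<le> \<mu> j m" and w: "\<omega>\<^sup>2 < \<Lambda>"
    and van: "masses_vanish \<epsilon> K \<omega> b \<Psi> \<mu> (\<lambda>R x. uR R x * complex_of_real (\<eta> R x))"
    and \<nu>: "\<And>l. bloch_measure_of \<epsilon> K \<eta> \<Psi> l uR (\<nu> l)"
  shows "(\<forall>l\<ge>1. \<nu> l = null_measure (restrict_space borel Z_cell)) \<and>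
    meas_supp (\<nu> 0) \<subseteq> {j \<in> Z_cell. \<mu> j 0 = \<omega>\<^sup>2 \<and> (\<exists>n::int. snd j = of_int n / real K)} \<inter> J_zero \<epsilon> b \<Psi> 0"
proof (intro conjI allI impI subsetI)
  show "\<nu> l = null_measure (restrict_space borel Z_cell)" if "l \<ge> 1" for l
    using van that unfolding masses_vanish_def by (intro bloch_measure_zero[OF \<nu>]) blast
next
  fix j0 assume j0: "j0 \<in> meas_supp (\<nu> 0)"
  have Z: "j0 \<in> Z_cell" using j0 bloch_measure_space(1)[OF \<nu>[of 0]] by (simp add: meas_supp_def)
  have smu: "((\<lambda>j. sqrt (\<mu> j 0)) \<longlongrightarrow> sqrt (\<mu> j0 0)) (at j0 within Z_cell)"
    unfolding LIM_zero_iff[of _ "sqrt (\<mu> j0 0)", symmetric]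
  proof (rule Lim_null_comparison)
    show "\<forall>\<^sub>F j in at j0 within Z_cell. norm (sqrt (\<mu> j 0) - sqrt (\<mu> j0 0)) \<le> lip * norm (j - j0)"
      unfolding eventually_at_filter by (rule always_eventually) (use sqrt_mu_Lipschitz[OF Z] in simp)
    show "((\<lambda>j. lip * norm (j - j0)) \<longlongrightarrow> 0) (at j0 within Z_cell)" by (auto intro!: tendsto_eq_intros)
  qed
  have mu: "((\<lambda>j. \<mu> j 0) \<longlongrightarrow> \<mu> j0 0) (at j0 within Z_cell)"
  proof (rule Lim_transform_eventually[rotated])
    have "(sqrt (\<mu> j0 0))\<^sup>2 = \<mu> j0 0" using mu_nonneg[OF Z] by simp
    then show "((\<lambda>j. (sqrt (\<mu> j 0))\<^sup>2) \<longlongrightarrow> \<mu> j0 0) (at j0 within Z_cell)" using tendsto_power[OF smu, of 2] by simp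
    show "\<forall>\<^sub>F j in at j0 within Z_cell. (sqrt (\<mu> j 0))\<^sup>2 = \<mu> j 0"
      unfolding eventually_at_filter by (rule always_eventually) (use mu_nonneg in auto)
  qed
  have "(\<mu> j0 0 - \<omega>\<^sup>2)\<^sup>2 = 0"
  proof (rule bloch_measure_support[OF \<nu> _ _ _ j0])
    show "((\<lambda>j. (\<mu> j 0 - \<omega>\<^sup>2)\<^sup>2) \<longlongrightarrow> (\<mu> j0 0 - \<omega>\<^sup>2)\<^sup>2) (at j0 within Z_cell)" by (intro tendsto_intros mu)
  qed (use van in \<open>auto simp: masses_vanish_def\<close>)
  then have m0: "\<mu> j0 0 = \<omega>\<^sup>2" by simp
  have gr: "\<exists>n::int. snd j0 = of_int n / real K"
  proof (rule ccontr)
    assume n: "\<not> ?thesis"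
    have nI: "real K * snd j0 \<notin> \<int>"
    proof
      assume "real K * snd j0 \<in> \<int>"
      then obtain n :: int where "real K * snd j0 = of_int n" by (auto elim: Ints_cases)
      then have "snd j0 = of_int n / real K" using K by (simp add: field_simps)
      with n show False by blast
    qed
    have QI: "snd j \<notin> Q_grid K" if "real K * snd j \<notin> \<int>" for j :: plane
      using that K by (auto simp: Q_grid_def)
    have "open (- (\<int> :: real set))" by (intro open_Compl closed_Ints)
    moreover have "((\<lambda>j. real K * snd j) \<longlongrightarrow> real K * snd j0) (at j0 within Z_cell)" by (intro tendsto_intros)
    ultimately have "\<forall>\<^sub>F j in at j0 within Z_cell. real K * snd j \<in> - \<int>"
      using nI by (auto dest!: topological_tendstoD)
    then have "((\<lambda>j. if snd j \<in> Q_grid K then 0 else 1 :: real) \<longlongrightarrow> (if snd j0 \<in> Q_grid K then 0 else 1)) (at j0 within Z_cell)"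
      using QI[OF nI] by (intro tendsto_eventually) (auto elim!: eventually_mono dest: QI)
    then have "(if snd j0 \<in> Q_grid K then 0 else 1 :: real) = 0"
      by (intro bloch_measure_support[OF \<nu> _ _ _ j0]) (use van in \<open>auto simp: masses_vanish_def\<close>)
    then show False using QI[OF nI] by simp
  qed
  have "\<bar>poynting \<epsilon> b \<Psi> (j0, 0)\<bar> = 0"
  proof (rule bloch_measure_support[OF \<nu> _ _ _ j0])
    have "((\<lambda>j. flux (\<Psi> j 0) (\<Gamma> j 0)) \<longlongrightarrow> flux (\<Psi> j0 0) (\<Gamma> j0 0)) (at j0 within Z_cell)"
      using flux_continuous[OF Z \<Lambda>[OF Z]] w m0 by simp
    then have "((\<lambda>j. poynting \<epsilon> b \<Psi> (j, 0)) \<longlongrightarrow> poynting \<epsilon> b \<Psi> (j0, 0)) (at j0 within Z_cell)"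
      unfolding poynting_eq_flux[OF Z bumps]
      by (rule Lim_transform_eventually)
        (auto simp: eventually_at_filter poynting_eq_flux[OF _ bumps])
    then show "((\<lambda>j. \<bar>poynting \<epsilon> b \<Psi> (j, 0)\<bar>) \<longlongrightarrow> \<bar>poynting \<epsilon> b \<Psi> (j0, 0)\<bar>) (at j0 within Z_cell)"
      by (rule tendsto_rabs)
  qed (use van in \<open>auto simp: masses_vanish_def\<close>)
  then show "j0 \<in> {j \<in> Z_cell. \<mu> j 0 = \<omega>\<^sup>2 \<and> (\<exists>n::int. snd j = of_int n / real K)} \<inter> J_zero \<epsilon> b \<Psi> 0"
    using Z m0 gr by (simp add: J_zero_def)
qed

section \<open>The outgoing wave conditions\<close>

context strip_problem
begin

lemma u_right_eq: "u_right \<epsilon> h f R = vper f (real R * \<epsilon>)"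
  and u_left_eq: "u_left \<epsilon> h f R = vper f (- 2 * real R * \<epsilon>)"
  by (simp_all add: fun_eq_iff u_right_def u_left_def vper_def)

text \<open>The outgoing wave condition passes to differences in terms of the coefficients of the excluded waves,
  which depend linearly on the function.\<close>

lemma outgoing_coefficients:
  assumes bc: "bloch_cell \<epsilon> b \<Psi> \<mu> a_lo a_hi \<kappa>" and f: "L2_loc_strip h f" and g: "L2_loc_strip h g"
    and f0: "(\<lambda>n. mean_sq (W_box \<epsilon> (n * K)) (bloch_proj \<epsilon> (n * K) (bloch_wave \<epsilon> \<Psi>) A (vper f (t (n * K))))) \<longlonglongrightarrow> 0"
    and g0: "(\<lambda>n. mean_sq (W_box \<epsilon> (n * K)) (bloch_proj \<epsilon> (n * K) (bloch_wave \<epsilon> \<Psi>) A (vper g (t (n * K))))) \<longlonglongrightarrow> 0"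
  shows "(\<lambda>n. \<Sum>j\<in>{j \<in> Q_grid (n * K) \<times> Q_grid (n * K). (j, 0) \<in> A}.
      (norm (mean_ip (W_box \<epsilon> (n * K)) (vper (\<lambda>x. f x - g x) (t (n * K))) (bloch_wave \<epsilon> \<Psi> (j, 0))))\<^sup>2) \<longlonglongrightarrow> 0"
proof (rule tendsto_sandwich[OF _ _ tendsto_const])
  interpret bc: bloch_cell \<epsilon> b \<Psi> \<mu> a_lo a_hi \<kappa> by (rule bc)
  let ?M = "\<lambda>f n. mean_sq (W_box \<epsilon> (n * K)) (bloch_proj \<epsilon> (n * K) (bloch_wave \<epsilon> \<Psi>) A (vper f (t (n * K))))"
  show "(\<lambda>n. 2 * ?M f n + 2 * ?M g n) \<longlonglongrightarrow> 0"
    using tendsto_add[OF tendsto_mult[OF tendsto_const f0] tendsto_mult[OF tendsto_const g0], of 2 2] by simp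
  show "\<forall>\<^sub>F n in sequentially. (\<Sum>j\<in>{j \<in> Q_grid (n * K) \<times> Q_grid (n * K). (j, 0) \<in> A}.
      (norm (mean_ip (W_box \<epsilon> (n * K)) (vper (\<lambda>x. f x - g x) (t (n * K))) (bloch_wave \<epsilon> \<Psi> (j, 0))))\<^sup>2) \<le> 2 * ?M f n + 2 * ?M g n"
  proof (rule eventually_sequentiallyI[of 1])
    fix n :: nat assume n: "1 \<le> n"
    define R where "R = n * K"
    have R: "R > 0" using n K by (simp add: R_def)
    let ?S = "{j \<in> Q_grid R \<times> Q_grid R. (j, 0::nat) \<in> A}" and ?D = "W_box \<epsilon> R" and ?U = "\<lambda>j. bloch_wave \<epsilon> \<Psi> (j, 0)"
    have L: "L2_on ?D (vper f (t R))" "L2_on ?D (vper g (t R))"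
      using vper_L2[OF f R_def R] vper_L2[OF g R_def R] by auto
    have U: "L2_on ?D (?U j)" if "j \<in> ?S" for j
      unfolding W_box_eq using that Q_grid_Z by (intro bc.bloch_wave_L2) auto
    have P: "(\<Sum>j\<in>?S. (norm (mean_ip ?D w (?U j)))\<^sup>2) \<le> mean_sq ?D (bloch_proj \<epsilon> R (bloch_wave \<epsilon> \<Psi>) A w)" if w: "L2_on ?D w" for w
    proof -
      have "(\<Sum>j\<in>?S. (norm (mean_ip ?D w (?U j)))\<^sup>2) = (\<Sum>\<xi>\<in>?S \<times> {0}. (norm (mean_ip ?D w (bloch_wave \<epsilon> \<Psi> \<xi>)))\<^sup>2)"
        by (rule sum.reindex_bij_witness[where i=fst and j="\<lambda>j. (j, 0)"]) auto
      also have "\<dots> \<le> mean_sq ?D (bloch_proj \<epsilon> R (bloch_wave \<epsilon> \<Psi>) A w)"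
        by (rule bc.bloch_proj_bound[OF R w]) (auto simp: I_index_def)
      finally show ?thesis .
    qed
    have "(\<Sum>j\<in>?S. (norm (mean_ip ?D (vper (\<lambda>x. f x - g x) (t R)) (?U j)))\<^sup>2) \<le>
       (\<Sum>j\<in>?S. 2 * (norm (mean_ip ?D (vper f (t R)) (?U j)))\<^sup>2 + 2 * (norm (mean_ip ?D (vper g (t R)) (?U j)))\<^sup>2)"
    proof (rule sum_mono)
      fix j assume j: "j \<in> ?S"
      have "mean_ip ?D (vper (\<lambda>x. f x - g x) (t R)) (?U j) = mean_ip ?D (\<lambda>x. vper f (t R) x - vper g (t R) x) (?U j)"
        by (simp add: vper_def[abs_def] per_ext_def)
      also have "\<dots> = mean_ip ?D (vper f (t R)) (?U j) + - mean_ip ?D (vper g (t R)) (?U j)"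
        using mean_ip_diff_left[OF _ L U[OF j]] by (simp add: W_box_eq)
      finally show "(norm (mean_ip ?D (vper (\<lambda>x. f x - g x) (t R)) (?U j)))\<^sup>2 \<le>
          2 * (norm (mean_ip ?D (vper f (t R)) (?U j)))\<^sup>2 + 2 * (norm (mean_ip ?D (vper g (t R)) (?U j)))\<^sup>2"
        using norm_add_sq_le[of "mean_ip ?D (vper f (t R)) (?U j)" "- mean_ip ?D (vper g (t R)) (?U j)"] by simp
    qed
    also have "\<dots> \<le> 2 * mean_sq ?D (bloch_proj \<epsilon> R (bloch_wave \<epsilon> \<Psi>) A (vper f (t R))) + 2 * mean_sq ?D (bloch_proj \<epsilon> R (bloch_wave \<epsilon> \<Psi>) A (vper g (t R)))"
      unfolding sum.distrib sum_distrib_left[symmetric] by (intro add_mono mult_left_mono P L) auto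
    finally show "(\<Sum>j\<in>{j \<in> Q_grid (n * K) \<times> Q_grid (n * K). (j, 0) \<in> A}.
      (norm (mean_ip (W_box \<epsilon> (n * K)) (vper (\<lambda>x. f x - g x) (t (n * K))) (bloch_wave \<epsilon> \<Psi> (j, 0))))\<^sup>2) \<le> 2 * ?M f n + 2 * ?M g n"
      unfolding R_def .
  qed
qed (auto intro!: always_eventually sum_nonneg)

lemma window_eq_shifted_cell:
  assumes f: "L2_loc_strip h f"
  shows "(LINT x:cell l h|lborel. (norm (f (x + (L, 0))))\<^sup>2) = (LINT x:{L<..<L+l} \<times> {0<..<h}|lborel. (norm (f x))\<^sup>2)"
proof -
  have [measurable]: "f \<in> borel_measurable borel" using f by (auto simp: L2_loc_strip_def L2_on_def)
  have B: "{L<..<L+l} \<times> {0<..<h} \<in> sets borel" by (intro borel_open open_Times) auto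
  then have m: "(\<lambda>x. indicat_real ({L<..<L+l} \<times> {0<..<h}) x *\<^sub>R (norm (f x))\<^sup>2) \<in> borel_measurable borel" by measurable
  have "indicat_real ({L<..<L+l} \<times> {0<..<h}) (x + (L, 0)) = indicat_real (cell l h) x" for x
    by (cases x) (auto simp: indicator_def mem_cell)
  then show ?thesis
    unfolding set_lebesgue_integral_def using plane_integral_translate(1)[OF m, of "(L, 0)"] by simp
qed

text \<open>On each side the bound comes from a different pair of functions with the same difference, since the
  incoming wave has to be subtracted on the left. A window that meets the interface is covered by
  one from each side.\<close>

lemma window_bound:
  assumes f: "L2_loc_strip h f" "L2_loc_strip h g" and f': "L2_loc_strip h f'" "L2_loc_strip h g'"
    and v: "v = (\<lambda>x. f x - g x)" "v = (\<lambda>x. f' x - g' x)"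
    and r: "\<And>L. L \<ge> 0 \<Longrightarrow> (LINT x:{L<..<L+1} \<times> {0<..<h}|lborel. (norm (f x))\<^sup>2) \<le> C1"
       "\<And>L. L \<ge> 0 \<Longrightarrow> (LINT x:{L<..<L+1} \<times> {0<..<h}|lborel. (norm (g x))\<^sup>2) \<le> C2"
    and l: "\<And>L. L \<le> 0 \<Longrightarrow> (LINT x:{L-1<..<L} \<times> {0<..<h}|lborel. (norm (f' x))\<^sup>2) \<le> C3"
       "\<And>L. L \<le> 0 \<Longrightarrow> (LINT x:{L-1<..<L} \<times> {0<..<h}|lborel. (norm (g' x))\<^sup>2) \<le> C4"
  shows "(LINT x:cell 1 h|lborel. (norm (v (x + (L, 0))))\<^sup>2) \<le> (2 * C1 + 2 * C2) + (2 * C3 + 2 * C4)"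
proof -
  let ?I = "\<lambda>l f L. (LINT x:cell l h|lborel. (norm (f (x + (L, 0))))\<^sup>2)"
  have d: "?I 1 (\<lambda>x. f x - g x) L \<le> 2 * ?I 1 f L + 2 * ?I 1 g L" if "L2_loc_strip h f" "L2_loc_strip h g" for f g L
  proof -
    have "mean_sq (cell 1 h) (\<lambda>x. f (x + (L, 0)) - g (x + (L, 0))) \<le> 2 * mean_sq (cell 1 h) (\<lambda>x. f (x + (L, 0))) + 2 * mean_sq (cell 1 h) (\<lambda>x. g (x + (L, 0)))"
      using that by (intro mean_sq_diff_le L2_loc_strip_cell) auto
    then show ?thesis using h_pos unfolding mean_sq_def by (simp add: field_simps)
  qed
  have R: "?I 1 v L \<le> 2 * C1 + 2 * C2" if "L \<ge> 0" for L
    using d[OF f, of L] r[OF that] unfolding v(1) window_eq_shifted_cell[OF f(1)] window_eq_shifted_cell[OF f(2)] by linarith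
  have Lf: "?I 1 v L \<le> 2 * C3 + 2 * C4" if "L \<le> -1" for L
    using d[OF f', of L] l[of "L + 1"] that unfolding v(2) window_eq_shifted_cell[OF f'(1)] window_eq_shifted_cell[OF f'(2)] by simp
  have vL: "L2_loc_strip h v" unfolding v(1) by (rule L2_loc_strip_diff[OF f])
  have nn: "0 \<le> ?I 1 v L" for L
    unfolding set_lebesgue_integral_def by (intro Bochner_Integration.integral_nonneg) auto
  have pos: "0 \<le> 2 * C1 + 2 * C2" "0 \<le> 2 * C3 + 2 * C4"     using order_trans[OF nn R[of 0]] order_trans[OF nn Lf[of "-1"]] by simp_all
  consider "L \<ge> 0" | "L \<le> -1" | "-1 < L" "L < 0" by linarith
  then show ?thesis
  proof cases
    case 1 then show ?thesis using R[of L] pos by simp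
  next
    case 2 then show ?thesis using Lf[of L] pos by simp
  next
    case 3
    have [measurable]: "v \<in> borel_measurable borel" using vL by (auto simp: L2_loc_strip_def L2_on_def)
    have m: "(\<lambda>x. (norm (v (x + (-1, 0))))\<^sup>2) \<in> borel_measurable borel" by measurable
    have i: "set_integrable lborel (cell s h) (\<lambda>x. (norm (v (x + (L, 0))))\<^sup>2)" for s L
      by (rule L2_onD(2)[OF L2_loc_strip_cell[OF vL]])
    have i2: "set_integrable lborel ({-1<..<1} \<times> {0<..<h}) (\<lambda>x. (norm (v x))\<^sup>2)"
      using vL by (auto simp: L2_loc_strip_def L2_on_def)
    have "?I 1 v L \<le> ?I 2 v (-1)"
      unfolding window_eq_shifted_cell[OF vL]
      unfolding set_lebesgue_integral_def
    proof (rule integral_mono)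
      show "integrable lborel (\<lambda>x. indicat_real ({L<..<L + 1} \<times> {0<..<h}) x *\<^sub>R (norm (v x))\<^sup>2)"
        using set_integrable_subset[OF i2, of "{L<..<L + 1} \<times> {0<..<h}"] 3 unfolding set_integrable_def
        by (force intro: borel_open open_Times)
      show "integrable lborel (\<lambda>x. indicat_real ({-1<..<-1 + 2} \<times> {0<..<h}) x *\<^sub>R (norm (v x))\<^sup>2)"
        using i2 by (simp add: set_integrable_def)
    qed (use 3 in \<open>auto simp: indicator_def\<close>)
    also have "\<dots> = (\<Sum>c\<in>{..<2::nat} \<times> {..<1::nat}. LINT x:cell 1 h|lborel. (norm (v (x + tile 1 h c + (-1, 0))))\<^sup>2)"
      using set_integrable_tile(2)[OF m zero_less_one h_pos(1), of 2 1] i[of 2 "-1"] by simp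
    also have "\<dots> = ?I 1 v (-1) + ?I 1 v 0"
    proof -
      have "{..<2::nat} \<times> {..<1::nat} = {(0, 0), (1, 0)}" by auto
      then show ?thesis by (simp add: tile_def add.assoc)
    qed
    finally show ?thesis using R[of 0] Lf[of "-1"] by simp
  qed
qed

end

context strip_solution
begin

text \<open>The flux that enters on the left leaves on the right. On the right nearly all waves carry energy to
  the right, so \<open>\<Sum>|P||\<alpha>|\<^sup>2\<close> is bounded by twice the flux up to small terms; on the left nearly all
  carry it to the left and the bound is minus twice the same flux. Adding the bounds, the flux
  cancels.\<close>

lemma masses_vanish_both_sides:
  assumes bR: "bloch_cell \<epsilon> b \<Psi> \<mu> a_lo a_hi \<kappa>" and per: "periodic2 \<epsilon> b"
    and \<Lambda>R: "\<And>j m. j \<in> Z_cell \<Longrightarrow> m \<ge> 1 \<Longrightarrow> \<Lambda> \<le> \<mu> j m" "\<omega>\<^sup>2 < \<Lambda>"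
    and bL: "bloch_cell \<epsilon> (\<lambda>_. 1) \<Psi>' \<mu>' a_lo a_hi \<kappa>"
    and \<Lambda>L: "\<And>j m. j \<in> Z_cell \<Longrightarrow> m \<ge> 1 \<Longrightarrow> \<Lambda>' \<le> \<mu>' j m" "\<omega>\<^sup>2 < \<Lambda>'"
    and right: "\<And>R x. x \<in> cell (real R * \<epsilon>) h \<Longrightarrow> a (x + (real R * \<epsilon>, 0)) = b x"
    and left: "\<And>R x. x \<in> cell (real R * \<epsilon>) h \<Longrightarrow> a (x + (- 2 * real R * \<epsilon>, 0)) = 1"
    and outR: "(\<lambda>n. \<Sum>j\<in>{j \<in> Q_grid (n * K) \<times> Q_grid (n * K). poynting \<epsilon> b \<Psi> (j, 0) < 0}.
      (norm (mean_ip (W_box \<epsilon> (n * K)) (vper v (real (n * K) * \<epsilon>)) (bloch_wave \<epsilon> \<Psi> (j, 0))))\<^sup>2) \<longlonglongrightarrow> 0"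
    and outL: "(\<lambda>n. \<Sum>j\<in>{j \<in> Q_grid (n * K) \<times> Q_grid (n * K). poynting \<epsilon> (\<lambda>_. 1) \<Psi>' (j, 0) > 0}.
      (norm (mean_ip (W_box \<epsilon> (n * K)) (vper v (- 2 * real (n * K) * \<epsilon>)) (bloch_wave \<epsilon> \<Psi>' (j, 0))))\<^sup>2) \<longlonglongrightarrow> 0"
  shows "masses_vanish \<epsilon> K \<omega> b \<Psi> \<mu> (\<lambda>R x. u_right \<epsilon> h v R x * complex_of_real (\<eta> R x))"
    and "masses_vanish \<epsilon> K \<omega> (\<lambda>_. 1) \<Psi>' \<mu>' (\<lambda>R x. u_left \<epsilon> h v R x * complex_of_real (\<eta> R x))"
proof -
  define mR where "mR l q n = bloch_mass \<epsilon> \<Psi> l (n * K) (\<lambda>x. vper v (real (n * K) * \<epsilon>) x * complex_of_real (\<eta> (n * K) x)) q" for l q n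
  define mL where "mL l q n = bloch_mass \<epsilon> \<Psi>' l (n * K) (\<lambda>x. vper v (- 2 * real (n * K) * \<epsilon>) x * complex_of_real (\<eta> (n * K) x)) q" for l q n
  define oR where "oR n = (\<Sum>j\<in>{j \<in> Q_grid (n * K) \<times> Q_grid (n * K). poynting \<epsilon> b \<Psi> (j, 0) < 0}.
      (norm (mean_ip (W_box \<epsilon> (n * K)) (vper v (real (n * K) * \<epsilon>)) (bloch_wave \<epsilon> \<Psi> (j, 0))))\<^sup>2)" for n
  define oL where "oL n = (\<Sum>j\<in>{j \<in> Q_grid (n * K) \<times> Q_grid (n * K). poynting \<epsilon> (\<lambda>_. 1) \<Psi>' (j, 0) > 0}.
      (norm (mean_ip (W_box \<epsilon> (n * K)) (vper v (- 2 * real (n * K) * \<epsilon>)) (bloch_wave \<epsilon> \<Psi>' (j, 0))))\<^sup>2)" for n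
  define f where "f n = flux_cell (n * K) (real (n * K) * \<epsilon>)" for n
  have "periodic2 \<epsilon> (\<lambda>_. 1 :: real)" by (simp add: periodic2_def)
  note sR = side_bounds[OF bR per \<Lambda>R] and sL = side_bounds[OF bL this \<Lambda>L]
  have n6: "n * K > 5" if "n \<ge> 6" for n using that K mult_le_mono[of 6 n 1 K] by simp
  obtain C where C0: "C \<ge> 0" and C: "\<And>n. n \<ge> 6 \<Longrightarrow>
      (\<forall>l\<ge>1. mR l (\<lambda>_. 1) n \<le> C / real (n * K)) \<and> mR 0 (\<lambda>j. (\<mu> j 0 - \<omega>\<^sup>2)\<^sup>2) n \<le> C / real (n * K) \<and>
      mR 0 (\<lambda>j. if snd j \<in> Q_grid K then 0 else 1) n \<le> C / real (n * K) \<and>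
      mR 0 (\<lambda>j. \<bar>poynting \<epsilon> b \<Psi> (j, 0)\<bar>) n \<le> 2 * f n + C / sqrt (real (n * K)) + C * oR n"
  proof (rule sR, goal_cases)
    case (3 C)
    show ?case
    proof (rule that[OF 3(2)])
      fix n :: nat assume "n \<ge> 6"
      from 3(3)[where t="real (n * K) * \<epsilon>", OF refl n6[OF this] right refl refl refl]
      show "(\<forall>l\<ge>1. mR l (\<lambda>_. 1) n \<le> C / real (n * K)) \<and> mR 0 (\<lambda>j. (\<mu> j 0 - \<omega>\<^sup>2)\<^sup>2) n \<le> C / real (n * K) \<and>
          mR 0 (\<lambda>j. if snd j \<in> Q_grid K then 0 else 1) n \<le> C / real (n * K) \<and>
          mR 0 (\<lambda>j. \<bar>poynting \<epsilon> b \<Psi> (j, 0)\<bar>) n \<le> 2 * f n + C / sqrt (real (n * K)) + C * oR n"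
        unfolding mR_def bloch_mass_def oR_def f_def by simp
    qed
  qed
  obtain C' where C'0: "C' \<ge> 0" and C': "\<And>n. n \<ge> 6 \<Longrightarrow>
      (\<forall>l\<ge>1. mL l (\<lambda>_. 1) n \<le> C' / real (n * K)) \<and> mL 0 (\<lambda>j. (\<mu>' j 0 - \<omega>\<^sup>2)\<^sup>2) n \<le> C' / real (n * K) \<and>
      mL 0 (\<lambda>j. if snd j \<in> Q_grid K then 0 else 1) n \<le> C' / real (n * K) \<and>
      mL 0 (\<lambda>j. \<bar>poynting \<epsilon> (\<lambda>_. 1) \<Psi>' (j, 0)\<bar>) n \<le> - (2 * f n) + C' / sqrt (real (n * K)) + C' * oL n"
  proof (rule sL, goal_cases)
    case (3 C)
    show ?case
    proof (rule that[OF 3(2)])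
      fix n :: nat assume n: "n \<ge> 6"
      from 3(3)[where t="- 2 * real (n * K) * \<epsilon>", OF refl n6[OF n] left refl refl refl] flux_conservation[OF n6[OF n] dvd_triv_right]
      show "(\<forall>l\<ge>1. mL l (\<lambda>_. 1) n \<le> C / real (n * K)) \<and> mL 0 (\<lambda>j. (\<mu>' j 0 - \<omega>\<^sup>2)\<^sup>2) n \<le> C / real (n * K) \<and>
          mL 0 (\<lambda>j. if snd j \<in> Q_grid K then 0 else 1) n \<le> C / real (n * K) \<and>
          mL 0 (\<lambda>j. \<bar>poynting \<epsilon> (\<lambda>_. 1) \<Psi>' (j, 0)\<bar>) n \<le> - (2 * f n) + C / sqrt (real (n * K)) + C * oL n"
        unfolding mL_def bloch_mass_def oL_def f_def by simp
    qed
  qed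
  have null: "(\<lambda>n. c / real (n * K)) \<longlonglongrightarrow> 0" for c
    using lim_const_over_n[of "c / real K"] by (simp add: mult.commute)
  have null_sqrt: "(\<lambda>n. c / sqrt (real (n * K))) \<longlonglongrightarrow> 0" for c
    using tendsto_mult[OF tendsto_const[of c] tendsto_real_sqrt[OF null[of 1]]] by (simp add: real_sqrt_divide)
  have lim0: "g \<longlonglongrightarrow> 0" if "\<And>n. 0 \<le> g n" "\<And>n. n \<ge> 6 \<Longrightarrow> g n \<le> e n" "e \<longlonglongrightarrow> 0" for g e :: "nat \<Rightarrow> real"
    by (rule tendsto_sandwich[OF _ _ tendsto_const that(3)])
      (use that in \<open>auto intro: eventually_sequentiallyI[of 6]\<close>)
  have nnR: "0 \<le> mR l q n" "0 \<le> mL l q n" if "\<And>j. 0 \<le> q j" for l q n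
    using that by (auto simp: mR_def mL_def intro: bloch_mass_nonneg)
  define e where "e n = (C + C') / sqrt (real (n * K)) + (C * oR n + C' * oL n)" for n
  have e0: "e \<longlonglongrightarrow> 0"
  proof -
    have "(\<lambda>n. C * oR n + C' * oL n) \<longlonglongrightarrow> C * 0 + C' * 0"
      using outR outL unfolding oR_def oL_def by (intro tendsto_intros)
    from tendsto_add[OF null_sqrt[of "C + C'"] this] show ?thesis by (simp add: e_def[abs_def])
  qed
  let ?PR = "\<lambda>j. \<bar>poynting \<epsilon> b \<Psi> (j, 0)\<bar>" and ?PL = "\<lambda>j. \<bar>poynting \<epsilon> (\<lambda>_. 1) \<Psi>' (j, 0)\<bar>"
  have both: "mR 0 ?PR n + mL 0 ?PL n \<le> e n" if "n \<ge> 6" for n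
    using C[OF that] C'[OF that] unfolding e_def add_divide_distrib by linarith
  have le: "mR 0 ?PR n \<le> e n" "mL 0 ?PL n \<le> e n" if "n \<ge> 6" for n
    using both[OF that] nnR(1)[of ?PR 0 n, OF abs_ge_zero] nnR(2)[of ?PL 0 n, OF abs_ge_zero] by linarith+
  have PR: "mR 0 ?PR \<longlonglongrightarrow> 0" by (rule lim0[OF nnR(1)[OF abs_ge_zero] le(1) e0])
  have PL: "mL 0 ?PL \<longlonglongrightarrow> 0" by (rule lim0[OF nnR(2)[OF abs_ge_zero] le(2) e0])
  have "mR l (\<lambda>_. 1) \<longlonglongrightarrow> 0" if "l \<ge> 1" for l
    by (rule lim0[OF nnR(1) _ null[of C]], simp) (use C that in blast)
  moreover have "mL l (\<lambda>_. 1) \<longlonglongrightarrow> 0" if "l \<ge> 1" for l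
    by (rule lim0[OF nnR(2) _ null[of C']], simp) (use C' that in blast)
  moreover have "mR 0 (\<lambda>j. (\<mu> j 0 - \<omega>\<^sup>2)\<^sup>2) \<longlonglongrightarrow> 0"
    by (rule lim0[OF nnR(1) _ null[of C]], simp) (use C in blast)
  moreover have "mL 0 (\<lambda>j. (\<mu>' j 0 - \<omega>\<^sup>2)\<^sup>2) \<longlonglongrightarrow> 0"
    by (rule lim0[OF nnR(2) _ null[of C']], simp) (use C' in blast)
  moreover have "mR 0 (\<lambda>j. if snd j \<in> Q_grid K then 0 else 1) \<longlonglongrightarrow> 0"
    by (rule lim0[OF nnR(1) _ null[of C]], simp) (use C in blast)
  moreover have "mL 0 (\<lambda>j. if snd j \<in> Q_grid K then 0 else 1) \<longlonglongrightarrow> 0"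
    by (rule lim0[OF nnR(2) _ null[of C']], simp) (use C' in blast)
  ultimately show "masses_vanish \<epsilon> K \<omega> b \<Psi> \<mu> (\<lambda>R x. u_right \<epsilon> h v R x * complex_of_real (\<eta> R x))"
    and "masses_vanish \<epsilon> K \<omega> (\<lambda>_. 1) \<Psi>' \<mu>' (\<lambda>R x. u_left \<epsilon> h v R x * complex_of_real (\<eta> R x))"
    using PR PL unfolding masses_vanish_def u_right_eq u_left_eq mR_def[abs_def] mL_def[abs_def] by blast+
qed

end

theorem theorem1p3:
  fixes \<epsilon> \<omega> a_lo a_hi h :: real and K :: nat and k :: plane
    and a_per :: "plane \<Rightarrow> real"
    and \<Psi>p \<Psi>m :: "plane \<Rightarrow> nat \<Rightarrow> plane \<Rightarrow> complex"
    and \<mu>p \<mu>m :: "plane \<Rightarrow> nat \<Rightarrow> real"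
    and \<eta> :: "nat \<Rightarrow> plane \<Rightarrow> real"
    and u u' v :: "plane \<Rightarrow> complex"
    and \<nu>p \<nu>m :: "nat \<Rightarrow> plane measure"
  assumes "\<epsilon> > 0" and "K \<ge> 1" and h_def: "h = \<epsilon> * real K" and "\<omega> > 0"
    and "Ck 1 a_per" and "periodic2 \<epsilon> a_per"
    and "0 < a_lo" and "\<forall>x\<in>strip h. a_lo \<le> a_coeff a_per x \<and> a_coeff a_per x \<le> a_hi"
    and "fst k > 0" and "\<exists>n::int. snd k * h = \<epsilon> * of_int n"
    and "4 * pi\<^sup>2 * (norm k)\<^sup>2 / \<epsilon>\<^sup>2 = \<omega>\<^sup>2"
    and "bloch_family \<epsilon> a_per \<Psi>p \<mu>p"
    and "bloch_family \<epsilon> (\<lambda>_. 1) \<Psi>m \<mu>m"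
    and "\<forall>j\<in>Z_cell. \<forall>m. \<exists>\<kappa>1 \<kappa>2::int. \<forall>x.
           \<Psi>m j m x = cis (2 * pi * ((of_int \<kappa>1, of_int \<kappa>2) \<bullet> x) / \<epsilon>)"
    and "cutoff_family \<epsilon> K \<eta>"
    and "\<omega>\<^sup>2 < Inf {\<mu>p j m |j m. j \<in> Z_cell \<and> m \<ge> 1}"
    and "\<omega>\<^sup>2 < Inf {\<mu>m j m |j m. j \<in> Z_cell \<and> m \<ge> 1}"
    and "transmission_solution \<epsilon> K \<omega> a_per \<Psi>p \<Psi>m k u"
    and "transmission_solution \<epsilon> K \<omega> a_per \<Psi>p \<Psi>m k u'"
    and v_def: "v = (\<lambda>x. u x - u' x)"
    and "\<forall>l. bloch_measure_right \<epsilon> K \<eta> \<Psi>p l v (\<nu>p l)"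
    and "\<forall>l. bloch_measure_left \<epsilon> K \<eta> \<Psi>m l v (\<nu>m l)"
  shows "(\<forall>l\<ge>1. \<nu>p l = null_measure (restrict_space borel Z_cell)) \<and>
         (\<forall>l\<ge>1. \<nu>m l = null_measure (restrict_space borel Z_cell)) \<and>
         meas_supp (\<nu>p 0) \<subseteq>
           {j \<in> Z_cell. \<mu>p j 0 = \<omega>\<^sup>2 \<and> (\<exists>n::int. snd j = of_int n / real K)} \<inter> J_zero \<epsilon> a_per \<Psi>p 0 \<and>
         meas_supp (\<nu>m 0) \<subseteq>
           {j \<in> Z_cell. \<mu>m j 0 = \<omega>\<^sup>2 \<and> (\<exists>n::int. snd j = of_int n / real K)} \<inter> J_zero \<epsilon> (\<lambda>_. 1) \<Psi>m 0"
proof -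
  note \<epsilon> = assms(1) and K = assms(2)
  have hp: "h > 0" "\<epsilon> \<le> h" using \<epsilon> K by (simp_all add: h_def)
  obtain \<kappa> where fourier: "fourier_complete \<kappa>"
    using fourier_complete_if_free_bloch_family[OF \<epsilon> assms(13,14)] by blast
  obtain C0 where \<eta>: "\<And>R. R > 0 \<Longrightarrow> K dvd R \<Longrightarrow> Cinf (\<eta> R) \<and>
     (\<forall>x. \<eta> R (x + (0, real R * \<epsilon>)) = \<eta> R x) \<and>
     (\<exists>\<delta>>0. \<forall>x. fst x < \<delta> \<or> fst x > real R * \<epsilon> - \<delta> \<longrightarrow> \<eta> R x = 0) \<and>
     (\<forall>x \<in> {\<epsilon><..<(real R - 1) * \<epsilon>} \<times> {\<epsilon><..<(real R - 1) * \<epsilon>}. \<eta> R x = 1) \<and>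
     (\<forall>x. norm (grad (\<eta> R) x) \<le> C0 \<and> norm (grad (grad (\<eta> R)) x) \<le> C0)"
    using assms(15)[unfolded cutoff_family_def]
    by (elim exE) (rule that, drule spec, drule mp, assumption, drule mp, assumption, assumption)
  define a where "a = a_coeff a_per"
  have "continuous_on UNIV a_per"
    using assms(5) unfolding One_nat_def Ck.simps
    by (intro continuous_at_imp_continuous_on ballI differentiable_imp_continuous_within) blast
  then have ap [measurable]: "a_per \<in> borel_measurable borel" by (rule borel_measurable_continuous_onI)
  have am [measurable]: "a \<in> borel_measurable borel"
  proof -
    have "open {x :: plane. fst x < 0}" by (intro open_Collect_less continuous_intros)
    then have [measurable]: "{x :: plane. fst x < 0} \<in> sets borel" by (rule borel_open)
    have "a = (\<lambda>x. if x \<in> {x. fst x < 0} then 1 else a_per x)" by (simp add: a_def a_coeff_def fun_eq_iff)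
    then show ?thesis by (simp only:) measurable
  qed
  have bounds: "a_lo \<le> a x \<and> a x \<le> a_hi" if "x \<in> strip h" for x using assms(8) that by (auto simp: a_def)
  interpret strip_problem \<epsilon> \<omega> h a_lo a_hi C0 K a \<kappa> \<eta>
    by unfold_locales (use \<epsilon> K h_def am assms(7) bounds fourier \<eta> in auto)
  have one: "a_lo \<le> 1 \<and> 1 \<le> a_hi"
    using bounds[of "(-1, h / 2)"] hp by (simp add: a_def a_coeff_def mem_strip)
  have per_b: "a_lo \<le> a_per x \<and> a_per x \<le> a_hi" if "x \<in> cell \<epsilon> \<epsilon>" for x
    using bounds[of x] that hp by (auto simp: a_def a_coeff_def mem_strip mem_cell)
  have bp: "bloch_cell \<epsilon> a_per \<Psi>p \<mu>p a_lo a_hi \<kappa>"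
    by unfold_locales (use \<epsilon> ap assms(7) per_b fourier assms(12) in auto)
  have bm: "bloch_cell \<epsilon> (\<lambda>_. 1) \<Psi>m \<mu>m a_lo a_hi \<kappa>"
    by unfold_locales (use \<epsilon> assms(7) one fourier assms(13) in auto)
  have gap: "Inf {\<mu> j m |j m. j \<in> Z_cell \<and> m \<ge> 1} \<le> \<mu> j m"
    if "bloch_cell \<epsilon> b \<Psi> \<mu> a_lo a_hi \<kappa>" "j \<in> Z_cell" "m \<ge> 1" for b \<Psi> \<mu> j m
    using that bloch_cell.mu_nonneg[OF that(1)] by (intro cInf_lower) (auto intro!: bdd_belowI[of _ 0])
  note T = assms(18,19)[unfolded transmission_solution_def outgoing_right_def outgoing_left_def Let_def, folded h_def a_def]
  obtain f1 f2 where f: "local_solution h \<omega> a u f1 f2"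
    using helmholtz_local_solution[OF conjunct1[OF T(1)] am a_abs] by blast
  obtain g1 g2 where g: "local_solution h \<omega> a u' g1 g2"
    using helmholtz_local_solution[OF conjunct1[OF T(2)] am a_abs] by blast
  have sol: "local_solution h \<omega> a v (\<lambda>x. f1 x - g1 x) (\<lambda>x. f2 x - g2 x)"
    unfolding v_def by (rule local_solution_diff[OF f g am a_abs])
  let ?w = "\<lambda>x. u x - U_inc \<epsilon> k x" and ?w' = "\<lambda>x. u' x - U_inc \<epsilon> k x"
  have L: "L2_loc_strip h u" "L2_loc_strip h u'" "L2_loc_strip h ?w" "L2_loc_strip h ?w'" using T by auto
  have vw: "v = (\<lambda>x. ?w x - ?w' x)" by (simp add: v_def)
  obtain C1 where C1: "\<And>L. L \<ge> 0 \<Longrightarrow> (LINT x:{L<..<L+1} \<times> {0<..<h}|lborel. (norm (u x))\<^sup>2) \<le> C1" using T(1) by blast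
  obtain C2 where C2: "\<And>L. L \<ge> 0 \<Longrightarrow> (LINT x:{L<..<L+1} \<times> {0<..<h}|lborel. (norm (u' x))\<^sup>2) \<le> C2" using T(2) by blast
  obtain C3 where C3: "\<And>L. L \<le> 0 \<Longrightarrow> (LINT x:{L-1<..<L} \<times> {0<..<h}|lborel. (norm (?w x))\<^sup>2) \<le> C3" using T(1) by blast
  obtain C4 where C4: "\<And>L. L \<le> 0 \<Longrightarrow> (LINT x:{L-1<..<L} \<times> {0<..<h}|lborel. (norm (?w' x))\<^sup>2) \<le> C4" using T(2) by blast
  define Cv where "Cv = (2 * C1 + 2 * C2) + (2 * C3 + 2 * C4)"
  have win: "(LINT x:cell 1 h|lborel. (norm (v (x + (L, 0))))\<^sup>2) \<le> Cv" for L
    unfolding Cv_def by (rule window_bound[OF L v_def vw C1 C2 C3 C4])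
  interpret strip_solution \<epsilon> \<omega> h a_lo a_hi C0 K a \<kappa> \<eta> v "\<lambda>x. f1 x - g1 x" "\<lambda>x. f2 x - g2 x" Cv
    by unfold_locales (use sol win in auto)
  have right: "a (x + (real R * \<epsilon>, 0)) = a_per x" if "x \<in> cell (real R * \<epsilon>) h" for R x
  proof -
    have "a (x + (real R * \<epsilon>, 0)) = a_per (x + tile \<epsilon> \<epsilon> (R, 0))"
      using that \<epsilon> add_nonneg_nonneg[of "fst x" "real R * \<epsilon>"] by (simp add: a_def a_coeff_def tile_def mem_cell not_less)
    then show ?thesis using periodic2_tile[OF assms(6)] by simp
  qed
  have left: "a (x + (- 2 * real R * \<epsilon>, 0)) = 1" if "x \<in> cell (real R * \<epsilon>) h" for R x
  proof -
    have "fst x < 2 * (real R * \<epsilon>)" using that by (simp add: mem_cell)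
    then show ?thesis by (simp add: a_def a_coeff_def)
  qed
  have outR: "(\<lambda>n. \<Sum>j\<in>{j \<in> Q_grid (n * K) \<times> Q_grid (n * K). poynting \<epsilon> a_per \<Psi>p (j, 0) < 0}.
      (norm (mean_ip (W_box \<epsilon> (n * K)) (vper v (real (n * K) * \<epsilon>)) (bloch_wave \<epsilon> \<Psi>p (j, 0))))\<^sup>2) \<longlonglongrightarrow> 0"
    using outgoing_coefficients[OF bp L(1,2), where t="\<lambda>R. real R * \<epsilon>" and A="{\<xi>. poynting \<epsilon> a_per \<Psi>p \<xi> < 0}"] T
    unfolding Pi_neg_def u_right_eq v_def mem_Collect_eq by blast
  have outL: "(\<lambda>n. \<Sum>j\<in>{j \<in> Q_grid (n * K) \<times> Q_grid (n * K). poynting \<epsilon> (\<lambda>_. 1) \<Psi>m (j, 0) > 0}.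
      (norm (mean_ip (W_box \<epsilon> (n * K)) (vper v (- 2 * real (n * K) * \<epsilon>)) (bloch_wave \<epsilon> \<Psi>m (j, 0))))\<^sup>2) \<longlonglongrightarrow> 0"
    using outgoing_coefficients[OF bm L(3,4), where t="\<lambda>R. - 2 * real R * \<epsilon>" and A="{\<xi>. poynting \<epsilon> (\<lambda>_. 1) \<Psi>m \<xi> > 0}"] T
    unfolding Pi_pos_def u_left_eq vw mem_Collect_eq by blast
  note van = masses_vanish_both_sides[OF bp assms(6) gap[OF bp] assms(16) bm gap[OF bm] assms(17) right left outR outL]
  have "\<And>l. bloch_measure_of \<epsilon> K \<eta> \<Psi>p l (u_right \<epsilon> h v) (\<nu>p l)" "\<And>l. bloch_measure_of \<epsilon> K \<eta> \<Psi>m l (u_left \<epsilon> h v) (\<nu>m l)"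
    using assms(21,22) unfolding bloch_measure_right_def bloch_measure_left_def h_def by auto
  then show ?thesis
    using bloch_cell.bloch_measures_supported[OF bp smooth_bumps K gap[OF bp] assms(16) van(1)]
      bloch_cell.bloch_measures_supported[OF bm smooth_bumps K gap[OF bm] assms(17) van(2)] by blast
qed

end
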